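(* Let $(M,\{\cdot,\cdot\})$ be a Poisson manifold and let $\star$ be a Hermitian star product on $M$. Then $(C^\infty(M)[[\lambda]],\star)$ is a completely positive deformation of the $^*$-algebra $C^\infty(M)$.
   Context: $M$ is a smooth manifold, and $C^\infty(M)$ is the algebra of complex-valued smooth functions on $M$, a $^*$-algebra over $\mathbb{C}$ with involution $f\mapsto\overline{f}$ (pointwise complex conjugation). Star products. A star product on a Poisson manifold $(M,\{\cdot,\cdot\})$ is an associative $\mathbb{C}[[\lambda]]$-bilinear product $\star$ on $C^\infty(M)[[\lambda]]$ (a formal associative deformation of $C^\infty(M)$ in the sense of Gerstenhaber) of the form $$f\star g = f\cdot g+\sum_{r=1}^\infty \lambda^r C_r(f,g),\qquad f,g\in C^\infty(M),$$ where each $C_r$ is a bidifferential operator on $M$ and $C_1(f,g)-C_1(g,f)=\mathrm{i}\{f,g\}$. It is called Hermitian if $\overline{f\star g}=\overline{g}\star\overline{f}$ for all $f,g$, where complex conjugation is extended $\lambda$-linearly to $C^\infty(M)[[\lambda]]$, i.e. $\lambda$ is treated as real. Order. $\mathbb{R}[[\lambda]]$ is an ordered ring: a nonzero $a=\sum_{r\ge 0}\lambda^r a_r\in\mathbb{R}[[\lambda]]$ satisfies $a>0$ if and only if its first nonzero coefficient $a_{r_0}$ satisfies $a_{r_0}>0$. One has $\mathbb{C}[[\lambda]]=\mathbb{R}[[\lambda]](\mathrm{i})$. For $z\in\mathbb{C}[[\lambda]]$, "$z\ge 0$" means $z\in\mathbb{R}[[\lambda]]$ and $z\geq 0$ in this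 order (and similarly for $z\in\mathbb{C}$). Positive functionals. Let $\mathsf{C}$ be $\mathbb{C}$ or $\mathbb{C}[[\lambda]]$ and let $\mathcal{A}$ be a $^*$-algebra over $\mathsf{C}$. A $\mathsf{C}$-linear functional $\omega:\mathcal{A}\to\mathsf{C}$ is positive if $\omega(a^*a)\ge 0$ for all $a\in\mathcal{A}$. Positive and completely positive deformations. Let $\mathcal{A}$ be a $^*$-algebra over $\mathbb{C}$ and let $\boldsymbol{\mathcal{A}}=(\mathcal{A}[[\lambda]],\star)$ be a formal associative deformation that is Hermitian, i.e. $(a_1\star a_2)^*=a_2^*\star a_1^*$; then $\boldsymbol{\mathcal{A}}$ is a $^*$-algebra over $\mathbb{C}[[\lambda]]$ with the $\lambda$-linearly extended involution. It is a positive deformation if for every positive linear functional $\omega_0:\mathcal{A}\to\mathbb{C}$ there exist $\mathbb{C}$-linear functionals $\omega_r:\mathcal{A}\to\mathbb{C}$, $r=1,2,\dots$, such that $\omega_0+\sum_{r=1}^\infty\lambda^r\omega_r$ (extended $\mathbb{C}[[\lambda]]$-linearly to $\mathcal{A}[[\lambda]]$) is a positive linear functional on $\boldsymbol{\mathcal{A}}$. It is a completely positive deformation if for each $n\in\mathbb{N}$ the $^*$-algebra $M_n(\boldsymbol{\mathcal{A}})$ is a positive deformation of $M_n(\mathcal{A})$. Here matrix algebras carry the involution $(a_{ij})^*=(a_{ji}^* )$, the matrix product of $M_n(\boldsymbol{\mathcal{A}})$ is built from $\star$, and $M_n(\boldsymbol{\mathcal{A}})$ is identified with $M_n(\mathcal{A})[[\lambda]]$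 as a $\mathbb{C}[[\lambda]]$-module. *)

theory Defs
  imports
    "HOL-Analysis.Analysis"
    "HOL-Computational_Algebra.Formal_Power_Series"
    "HOL-Library.Function_Algebras"
begin

section \<open>Smooth functions on open subsets of \<open>n\<close>-space\<close>

text \<open>Points of \<open>n\<close>-space are functions \<open>nat \<Rightarrow> real\<close> vanishing at all indices \<open>\<ge> n\<close>, as in
  \<^const>\<open>Euclidean_space\<close>. This allows every dimension, including \<open>0\<close>.\<close>

definition partial_deriv ::
    "nat \<Rightarrow> ((nat \<Rightarrow> real) \<Rightarrow> 'b::real_normed_vector) \<Rightarrow> (nat \<Rightarrow> real) \<Rightarrow> 'b" where
  "partial_deriv i f x = vector_derivative (\<lambda>t. f (x(i := t))) (at (x i))"

primrec C_k_on ::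
    "nat \<Rightarrow> nat \<Rightarrow> (nat \<Rightarrow> real) set \<Rightarrow> ((nat \<Rightarrow> real) \<Rightarrow> 'b::real_normed_vector) \<Rightarrow> bool" where
  "C_k_on n 0 U f \<longleftrightarrow> continuous_map (subtopology (Euclidean_space n) U) euclidean f"
| "C_k_on n (Suc k) U f \<longleftrightarrow>
     continuous_map (subtopology (Euclidean_space n) U) euclidean f \<and>
     (\<forall>i<n. (\<forall>x\<in>U. (\<lambda>t. f (x(i := t))) differentiable (at (x i))) \<and>
            C_k_on n k U (partial_deriv i f))"

definition C_inf_on ::
    "nat \<Rightarrow> (nat \<Rightarrow> real) set \<Rightarrow> ((nat \<Rightarrow> real) \<Rightarrow> 'b::real_normed_vector) \<Rightarrow> bool" where
  "C_inf_on n U f \<longleftrightarrow> (\<forall>k. C_k_on n k U f)"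

definition multi_indices :: "nat \<Rightarrow> nat \<Rightarrow> (nat \<Rightarrow> nat) set" where
  "multi_indices n N = {\<alpha>. (\<forall>i\<ge>n. \<alpha> i = 0) \<and> (\<Sum>i<n. \<alpha> i) \<le> N}"

definition multi_deriv ::
    "nat \<Rightarrow> (nat \<Rightarrow> nat) \<Rightarrow> ((nat \<Rightarrow> real) \<Rightarrow> 'b::real_normed_vector) \<Rightarrow> (nat \<Rightarrow> real) \<Rightarrow> 'b" where
  "multi_deriv n \<alpha> f = foldr (\<lambda>i. partial_deriv i ^^ \<alpha> i) [0..<n] f"


section \<open>Smooth manifolds and Poisson manifolds\<close>

text \<open>A chart is a pair of a domain and a coordinate map.\<close>

record 'a manifold =
  mdim :: nat
  mtop :: "'a topology"
  matlas :: "('a set \<times> ('a \<Rightarrow> nat \<Rightarrow> real)) set"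

definition is_chart :: "nat \<Rightarrow> 'a topology \<Rightarrow> 'a set \<Rightarrow> ('a \<Rightarrow> nat \<Rightarrow> real) \<Rightarrow> bool" where
  "is_chart n X U \<phi> \<longleftrightarrow>
     openin X U \<and> openin (Euclidean_space n) (\<phi> ` U) \<and>
     homeomorphic_map (subtopology X U) (subtopology (Euclidean_space n) (\<phi> ` U)) \<phi>"

locale smooth_manifold =
  fixes M :: "'a manifold"
  assumes hausdorff: "Hausdorff_space (mtop M)"
    and second_countable: "second_countable (mtop M)"
    and charts: "\<And>U \<phi>. (U, \<phi>) \<in> matlas M \<Longrightarrow> is_chart (mdim M) (mtop M) U \<phi>"
    and charts_cover: "(\<Union>(U, \<phi>)\<in>matlas M. U) = topspace (mtop M)"
    and transition_smooth: "\<And>U \<phi> V \<psi> i. (U, \<phi>) \<in> matlas M \<Longrightarrow> (V, \<psi>) \<in> matlas M \<Longrightarrow> i < mdim M \<Longrightarrow>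
          C_inf_on (mdim M) (\<phi> ` (U \<inter> V)) (\<lambda>x. \<psi> (inv_into U \<phi> x) i)"

text \<open>The value \<open>0\<close> outside the carrier of the manifold makes functions on \<open>M\<close> correspond to
  unique HOL functions on the whole type.\<close>

definition smooth_functions :: "'a manifold \<Rightarrow> ('a \<Rightarrow> complex) set" where
  "smooth_functions M =
     {f. (\<forall>x. x \<notin> topspace (mtop M) \<longrightarrow> f x = 0) \<and>
         (\<forall>(U, \<phi>)\<in>matlas M. C_inf_on (mdim M) (\<phi> ` U) (f \<circ> inv_into U \<phi>))}"

text \<open>The bracket is the complex bilinear extension of a Poisson bracket on the real-valued smooth
  functions; this is what \<open>bracket_real\<close> expresses.\<close>

locale poisson_manifold = smooth_manifold M
  for M :: "'a manifold" +
  fixes bracket :: "('a \<Rightarrow> complex) \<Rightarrow> ('a \<Rightarrow> complex) \<Rightarrow> ('a \<Rightarrow> complex)"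
  assumes bracket_closed: "\<And>f g. f \<in> smooth_functions M \<Longrightarrow> g \<in> smooth_functions M \<Longrightarrow>
          bracket f g \<in> smooth_functions M"
    and bracket_add: "\<And>f g h. f \<in> smooth_functions M \<Longrightarrow> g \<in> smooth_functions M \<Longrightarrow>
          h \<in> smooth_functions M \<Longrightarrow> bracket (f + g) h = bracket f h + bracket g h"
    and bracket_scale: "\<And>c f g. f \<in> smooth_functions M \<Longrightarrow> g \<in> smooth_functions M \<Longrightarrow>
          bracket (\<lambda>x. c * f x) g = (\<lambda>x. c * bracket f g x)"
    and bracket_antisym: "\<And>f g. f \<in> smooth_functions M \<Longrightarrow> g \<in> smooth_functions M \<Longrightarrow>
          bracket f g = - bracket g f"
    and bracket_leibniz: "\<And>f g h. f \<in> smooth_functions M \<Longrightarrow> g \<in> smooth_functions M \<Longrightarrow>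
          h \<in> smooth_functions M \<Longrightarrow> bracket f (g * h) = bracket f g * h + g * bracket f h"
    and bracket_jacobi: "\<And>f g h. f \<in> smooth_functions M \<Longrightarrow> g \<in> smooth_functions M \<Longrightarrow>
          h \<in> smooth_functions M \<Longrightarrow>
          bracket f (bracket g h) + bracket g (bracket h f) + bracket h (bracket f g) = 0"
    and bracket_real: "\<And>f g. f \<in> smooth_functions M \<Longrightarrow> g \<in> smooth_functions M \<Longrightarrow>
          bracket (cnj \<circ> f) (cnj \<circ> g) = cnj \<circ> bracket f g"

text \<open>Bidifferential operators of some finite order \<open>N\<close>: in each chart they are given by partial
  derivatives of the arguments with smooth coefficients. Bilinearity follows.\<close>

definition bidifferential_operator ::
    "'a manifold \<Rightarrow> (('a \<Rightarrow> complex) \<Rightarrow> ('a \<Rightarrow> complex) \<Rightarrow> ('a \<Rightarrow> complex)) \<Rightarrow> bool" where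
  "bidifferential_operator M B \<longleftrightarrow>
     (\<forall>f\<in>smooth_functions M. \<forall>g\<in>smooth_functions M. B f g \<in> smooth_functions M) \<and>
     (\<exists>N. \<forall>(U, \<phi>)\<in>matlas M. \<exists>c.
        (\<forall>\<alpha>\<in>multi_indices (mdim M) N. \<forall>\<beta>\<in>multi_indices (mdim M) N.
            C_inf_on (mdim M) (\<phi> ` U) (c \<alpha> \<beta> :: (nat \<Rightarrow> real) \<Rightarrow> complex)) \<and>
        (\<forall>f\<in>smooth_functions M. \<forall>g\<in>smooth_functions M. \<forall>x\<in>U.
            B f g x =
              (\<Sum>\<alpha>\<in>multi_indices (mdim M) N. \<Sum>\<beta>\<in>multi_indices (mdim M) N.
                 c \<alpha> \<beta> (\<phi> x) * multi_deriv (mdim M) \<alpha> (f \<circ> inv_into U \<phi>) (\<phi> x)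
                             * multi_deriv (mdim M) \<beta> (g \<circ> inv_into U \<phi>) (\<phi> x))))"


section \<open>Associative algebras and *-algebras\<close>

text \<open>Not necessarily unital. Addition is the one of the ambient type, of which the carrier is an
  additive subgroup.\<close>

record ('k, 'a) algebra_data =
  carr :: "'a set"
  scal :: "'k \<Rightarrow> 'a \<Rightarrow> 'a"
  mul :: "'a \<Rightarrow> 'a \<Rightarrow> 'a"
  adj :: "'a \<Rightarrow> 'a"

locale assoc_algebra =
  fixes A :: "('k::comm_ring_1, 'a::ab_group_add) algebra_data"
  assumes zero_closed: "0 \<in> carr A"
    and add_closed: "\<And>a b. a \<in> carr A \<Longrightarrow> b \<in> carr A \<Longrightarrow> a + b \<in> carr A"
    and scal_closed: "\<And>c a. a \<in> carr A \<Longrightarrow> scal A c a \<in> carr A"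
    and mul_closed: "\<And>a b. a \<in> carr A \<Longrightarrow> b \<in> carr A \<Longrightarrow> mul A a b \<in> carr A"
    and scal_one: "\<And>a. a \<in> carr A \<Longrightarrow> scal A 1 a = a"
    and scal_scal: "\<And>c d a. a \<in> carr A \<Longrightarrow> scal A c (scal A d a) = scal A (c * d) a"
    and scal_add_left: "\<And>c d a. a \<in> carr A \<Longrightarrow> scal A (c + d) a = scal A c a + scal A d a"
    and scal_add_right: "\<And>c a b. a \<in> carr A \<Longrightarrow> b \<in> carr A \<Longrightarrow>
          scal A c (a + b) = scal A c a + scal A c b"
    and mul_assoc: "\<And>a b c. a \<in> carr A \<Longrightarrow> b \<in> carr A \<Longrightarrow> c \<in> carr A \<Longrightarrow>
          mul A (mul A a b) c = mul A a (mul A b c)"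
    and mul_add_left: "\<And>a b c. a \<in> carr A \<Longrightarrow> b \<in> carr A \<Longrightarrow> c \<in> carr A \<Longrightarrow>
          mul A (a + b) c = mul A a c + mul A b c"
    and mul_add_right: "\<And>a b c. a \<in> carr A \<Longrightarrow> b \<in> carr A \<Longrightarrow> c \<in> carr A \<Longrightarrow>
          mul A a (b + c) = mul A a b + mul A a c"
    and mul_scal_left: "\<And>k a b. a \<in> carr A \<Longrightarrow> b \<in> carr A \<Longrightarrow>
          mul A (scal A k a) b = scal A k (mul A a b)"
    and mul_scal_right: "\<And>k a b. a \<in> carr A \<Longrightarrow> b \<in> carr A \<Longrightarrow>
          mul A a (scal A k b) = scal A k (mul A a b)"

locale star_algebra = assoc_algebra A
  for A :: "('k::comm_ring_1, 'a::ab_group_add) algebra_data" +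
  fixes conjugate :: "'k \<Rightarrow> 'k"
  assumes adj_closed: "\<And>a. a \<in> carr A \<Longrightarrow> adj A a \<in> carr A"
    and adj_adj: "\<And>a. a \<in> carr A \<Longrightarrow> adj A (adj A a) = a"
    and adj_add: "\<And>a b. a \<in> carr A \<Longrightarrow> b \<in> carr A \<Longrightarrow> adj A (a + b) = adj A a + adj A b"
    and adj_scal: "\<And>c a. a \<in> carr A \<Longrightarrow> adj A (scal A c a) = scal A (conjugate c) (adj A a)"
    and adj_mul: "\<And>a b. a \<in> carr A \<Longrightarrow> b \<in> carr A \<Longrightarrow>
          adj A (mul A a b) = mul A (adj A b) (adj A a)"

definition function_algebra :: "'a manifold \<Rightarrow> (complex, 'a \<Rightarrow> complex) algebra_data" where
  "function_algebra M =
     \<lparr>carr = smooth_functions M, scal = (\<lambda>c f x. c * f x), mul = (\<lambda>f g x. f x * g x),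
      adj = (\<lambda>f x. cnj (f x))\<rparr>"

definition matrix_algebra ::
    "nat \<Rightarrow> ('k, 'a::ab_group_add) algebra_data \<Rightarrow> ('k, nat \<Rightarrow> nat \<Rightarrow> 'a) algebra_data" where
  "matrix_algebra n A =
     \<lparr>carr = {a. \<forall>i j. if i < n \<and> j < n then a i j \<in> carr A else a i j = 0},
      scal = (\<lambda>c a i j. if i < n \<and> j < n then scal A c (a i j) else 0),
      mul = (\<lambda>a b i j. if i < n \<and> j < n then (\<Sum>l<n. mul A (a i l) (b l j)) else 0),
      adj = (\<lambda>a i j. if i < n \<and> j < n then adj A (a j i) else 0)\<rparr>"


section \<open>Positivity\<close>

definition linear_functional :: "('k::comm_ring_1, 'a::ab_group_add) algebra_data \<Rightarrow> ('a \<Rightarrow> 'k) \<Rightarrow> bool" where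
  "linear_functional A \<omega> \<longleftrightarrow>
     (\<forall>a\<in>carr A. \<forall>b\<in>carr A. \<omega> (a + b) = \<omega> a + \<omega> b) \<and>
     (\<forall>c. \<forall>a\<in>carr A. \<omega> (scal A c a) = c * \<omega> a)"

definition complex_nonneg :: "complex \<Rightarrow> bool" where
  "complex_nonneg z \<longleftrightarrow> z \<in> \<real> \<and> 0 \<le> Re z"

definition real_fps_pos :: "real fps \<Rightarrow> bool" where
  "real_fps_pos a \<longleftrightarrow> a \<noteq> 0 \<and> 0 < fps_nth a (subdegree a)"

definition complex_fps_nonneg :: "complex fps \<Rightarrow> bool" where
  "complex_fps_nonneg z \<longleftrightarrow>
     (\<exists>a. z = Abs_fps (\<lambda>k. complex_of_real (fps_nth a k)) \<and> (a = 0 \<or> real_fps_pos a))"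

text \<open>The predicate \<open>nonneg\<close> is \<^const>\<open>complex_nonneg\<close> or \<^const>\<open>complex_fps_nonneg\<close>, depending on
  the scalars.\<close>

definition positive_functional ::
    "('k \<Rightarrow> bool) \<Rightarrow> ('k::comm_ring_1, 'a::ab_group_add) algebra_data \<Rightarrow> ('a \<Rightarrow> 'k) \<Rightarrow> bool" where
  "positive_functional nonneg A \<omega> \<longleftrightarrow>
     linear_functional A \<omega> \<and> (\<forall>a\<in>carr A. nonneg (\<omega> (mul A (adj A a) a)))"


section \<open>Formal deformations\<close>

definition fps_cnj :: "complex fps \<Rightarrow> complex fps" where
  "fps_cnj z = Abs_fps (\<lambda>k. cnj (fps_nth z k))"

text \<open>\<open>A[[\<lambda>]]\<close> with the \<open>\<lambda>\<close>-linearly extended involution and a given product.\<close>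

definition deformed_algebra ::
    "(complex, 'a::ab_group_add) algebra_data \<Rightarrow> ('a fps \<Rightarrow> 'a fps \<Rightarrow> 'a fps) \<Rightarrow>
     (complex fps, 'a fps) algebra_data" where
  "deformed_algebra A star =
     \<lparr>carr = {F. \<forall>k. fps_nth F k \<in> carr A},
      scal = (\<lambda>c F. Abs_fps (\<lambda>k. \<Sum>j\<le>k. scal A (fps_nth c j) (fps_nth F (k - j)))),
      mul = star,
      adj = (\<lambda>F. Abs_fps (\<lambda>k. adj A (fps_nth F k)))\<rparr>"

text \<open>By \<open>\<complex>[[\<lambda>]]\<close>-bilinearity, \<open>star\<close> is determined by the maps \<open>star_coeff star r\<close> on \<open>A\<close>: for
  \<open>a\<close>, \<open>b\<close> in \<open>A\<close>, the product of \<open>a\<close> and \<open>b\<close> is the series \<open>\<Sum>r. \<lambda>^r star_coeff star r a b\<close>.\<close>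

definition star_coeff :: "('a::zero fps \<Rightarrow> 'a fps \<Rightarrow> 'a fps) \<Rightarrow> nat \<Rightarrow> 'a \<Rightarrow> 'a \<Rightarrow> 'a" where
  "star_coeff star r a b = fps_nth (star (fps_const a) (fps_const b)) r"

definition formal_deformation ::
    "(complex, 'a::ab_group_add) algebra_data \<Rightarrow> ('a fps \<Rightarrow> 'a fps \<Rightarrow> 'a fps) \<Rightarrow> bool" where
  "formal_deformation A star \<longleftrightarrow>
     assoc_algebra A \<and> assoc_algebra (deformed_algebra A star) \<and>
     (\<forall>a\<in>carr A. \<forall>b\<in>carr A. star_coeff star 0 a b = mul A a b)"

definition hermitian_product ::
    "(complex, 'a::ab_group_add) algebra_data \<Rightarrow> ('a fps \<Rightarrow> 'a fps \<Rightarrow> 'a fps) \<Rightarrow> bool" where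
  "hermitian_product A star \<longleftrightarrow>
     (let D = deformed_algebra A star in
      \<forall>F\<in>carr D. \<forall>G\<in>carr D. adj D (star F G) = star (adj D G) (adj D F))"

definition hermitian_deformation ::
    "(complex, 'a::ab_group_add) algebra_data \<Rightarrow> ('a fps \<Rightarrow> 'a fps \<Rightarrow> 'a fps) \<Rightarrow> bool" where
  "hermitian_deformation A star \<longleftrightarrow>
     star_algebra A cnj \<and> formal_deformation A star \<and> hermitian_product A star \<and>
     star_algebra (deformed_algebra A star) fps_cnj"

text \<open>The \<open>\<complex>[[\<lambda>]]\<close>-linear extension to \<open>A[[\<lambda>]]\<close> of \<open>\<Sum>r. \<lambda>^r \<omega> r\<close>.\<close>

definition formal_functional :: "(nat \<Rightarrow> 'a \<Rightarrow> complex) \<Rightarrow> 'a fps \<Rightarrow> complex fps" where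
  "formal_functional \<omega> F = Abs_fps (\<lambda>k. \<Sum>r\<le>k. \<omega> r (fps_nth F (k - r)))"

definition positive_deformation ::
    "(complex, 'a::ab_group_add) algebra_data \<Rightarrow> ('a fps \<Rightarrow> 'a fps \<Rightarrow> 'a fps) \<Rightarrow> bool" where
  "positive_deformation A star \<longleftrightarrow>
     hermitian_deformation A star \<and>
     (\<forall>\<omega>\<^sub>0. positive_functional complex_nonneg A \<omega>\<^sub>0 \<longrightarrow>
        (\<exists>\<omega>. \<omega> 0 = \<omega>\<^sub>0 \<and> (\<forall>r\<ge>1. linear_functional A (\<omega> r)) \<and>
             positive_functional complex_fps_nonneg (deformed_algebra A star)
               (formal_functional \<omega>)))"

text \<open>The identification of \<open>M\<^sub>n(A)[[\<lambda>]]\<close> with \<open>M\<^sub>n(A[[\<lambda>]])\<close>, and the product on the former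
  corresponding to the matrix product over \<open>(A[[\<lambda>]], star)\<close>.\<close>

definition matrix_of_series :: "(nat \<Rightarrow> nat \<Rightarrow> 'a) fps \<Rightarrow> nat \<Rightarrow> nat \<Rightarrow> 'a fps" where
  "matrix_of_series F = (\<lambda>i j. Abs_fps (\<lambda>k. fps_nth F k i j))"

definition series_of_matrix :: "(nat \<Rightarrow> nat \<Rightarrow> 'a fps) \<Rightarrow> (nat \<Rightarrow> nat \<Rightarrow> 'a) fps" where
  "series_of_matrix m = Abs_fps (\<lambda>k i j. fps_nth (m i j) k)"

definition matrix_star ::
    "nat \<Rightarrow> (complex, 'a::ab_group_add) algebra_data \<Rightarrow> ('a fps \<Rightarrow> 'a fps \<Rightarrow> 'a fps) \<Rightarrow>
     (nat \<Rightarrow> nat \<Rightarrow> 'a) fps \<Rightarrow> (nat \<Rightarrow> nat \<Rightarrow> 'a) fps \<Rightarrow> (nat \<Rightarrow> nat \<Rightarrow> 'a) fps" where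
  "matrix_star n A star F G =
     series_of_matrix (mul (matrix_algebra n (deformed_algebra A star))
       (matrix_of_series F) (matrix_of_series G))"

definition completely_positive_deformation ::
    "(complex, 'a::ab_group_add) algebra_data \<Rightarrow> ('a fps \<Rightarrow> 'a fps \<Rightarrow> 'a fps) \<Rightarrow> bool" where
  "completely_positive_deformation A star \<longleftrightarrow>
     hermitian_deformation A star \<and>
     (\<forall>n\<ge>1. positive_deformation (matrix_algebra n A) (matrix_star n A star))"


section \<open>Star products\<close>

locale star_product = poisson_manifold M bracket
  for M :: "'a manifold"
    and bracket :: "('a \<Rightarrow> complex) \<Rightarrow> ('a \<Rightarrow> complex) \<Rightarrow> ('a \<Rightarrow> complex)" +
  fixes star :: "('a \<Rightarrow> complex) fps \<Rightarrow> ('a \<Rightarrow> complex) fps \<Rightarrow> ('a \<Rightarrow> complex) fps"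
  assumes star_deformation: "formal_deformation (function_algebra M) star"
    and star_bidifferential: "\<And>r. r \<ge> 1 \<Longrightarrow> bidifferential_operator M (star_coeff star r)"
    and star_poisson: "\<And>f g x. f \<in> smooth_functions M \<Longrightarrow> g \<in> smooth_functions M \<Longrightarrow>
          star_coeff star 1 f g x - star_coeff star 1 g f x = \<i> * bracket f g x"

end

theory Submission
  imports Defs
begin

text \<open>In a chart, a gauge transformation \<open>\<tau> = id + \<lambda> \<tau>\<^sub>1 + \<dots>\<close> makes the star product natural, which means that
  its \<open>r\<close>-th coefficient has order at most \<open>r\<close> in each argument, and a large multiple of the Laplacian
  in \<open>\<tau>\<^sub>1\<close> makes the symbol of the first coefficient larger than the identity matrix. By associativity,
  the symbol of the \<open>r\<close>-th coefficient is then \<open>1 / r!\<close> times the \<open>r\<close>-th power of the symbol of the first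
  one. If derivatives are given weight \<open>1\<close> and \<open>\<lambda>\<close> is given weight \<open>2\<close>, it follows for a positive
  functional \<open>\<omega>\<close> that the leading coefficient of \<open>\<omega> (\<tau> (f\<^sup>* \<star> f))\<close> is positive; the same argument works for
  matrices. Globally, a positive functional \<open>\<omega>\<^sub>0\<close> is a finite sum of functionals
  \<open>a \<mapsto> \<omega>\<^sub>0 (\<kappa>\<^sub>i\<^sup>2 a)\<close> for a quadratic partition of unity \<open>\<kappa>\<close> subordinate to charts, since otherwise some
  smooth function would have infinite expectation. Each summand is deformed by the gauge
  transformation of its chart.\<close>


section \<open>Differential operators over an algebra with coordinates\<close>

text \<open>A positive functional enters only through linearity and positivity, without a
  representing measure or any continuity, so positivity on the deformed algebra has to come from the
  Cauchy-Schwarz inequality. The order on formal series asks for reality of all coefficients, which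
  the Hermitian property supplies, and for the sign of the first nonzero one. Hence only jets of
  lowest weight matter for the sign: all correction terms pair them with null vectors and vanish.
  What survives is a Wick-like form \<open>exp (\<lambda> p)\<close>; since the functional knows no
  pointwise order, positivity of the symbol \<open>p\<close> is replaced by diagonal dominance
  written as an algebraic identity. The local part lives in an abstract algebra with commuting
  derivations and coordinates, where orders of operators are controlled by commutators with
  coordinates and no Taylor expansion is used. Squares of cut-offs localize because
  \<open>\<kappa>\<^sup>2 a\<^sup>* a\<close> is again of the form \<open>b\<^sup>* b\<close>;
  finiteness of the decomposition must be derived, because the functional need not respect infinite
  sums.\<close>

locale diff_algebra =
  fixes B :: "'b::comm_ring_1 set"
    and sc :: "complex \<Rightarrow> 'b"
    and st :: "'b \<Rightarrow> 'b"
    and n :: nat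
    and d :: "nat \<Rightarrow> 'b \<Rightarrow> 'b"
    and x :: "nat \<Rightarrow> 'b"
  assumes add_B [simp]: "\<And>a b. a \<in> B \<Longrightarrow> b \<in> B \<Longrightarrow> a + b \<in> B"
    and mult_B [simp]: "\<And>a b. a \<in> B \<Longrightarrow> b \<in> B \<Longrightarrow> a * b \<in> B"
    and sc_B [simp]: "\<And>c. sc c \<in> B"
    and st_B [simp]: "\<And>a. a \<in> B \<Longrightarrow> st a \<in> B"
    and d_B [simp]: "\<And>i a. i < n \<Longrightarrow> a \<in> B \<Longrightarrow> d i a \<in> B"
    and x_B [simp]: "\<And>i. i < n \<Longrightarrow> x i \<in> B"
    and sc_add: "\<And>a b. sc (a + b) = sc a + sc b"
    and sc_mult: "\<And>a b. sc (a * b) = sc a * sc b"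
    and sc_one [simp]: "sc 1 = 1"
    and st_st [simp]: "\<And>a. st (st a) = a"
    and st_add [simp]: "\<And>a b. st (a + b) = st a + st b"
    and st_mult [simp]: "\<And>a b. st (a * b) = st a * st b"
    and st_sc [simp]: "\<And>c. st (sc c) = sc (cnj c)"
    and st_d: "\<And>i a. i < n \<Longrightarrow> a \<in> B \<Longrightarrow> st (d i a) = d i (st a)"
    and st_x [simp]: "\<And>i. i < n \<Longrightarrow> st (x i) = x i"
    and d_add: "\<And>i a b. i < n \<Longrightarrow> a \<in> B \<Longrightarrow> b \<in> B \<Longrightarrow> d i (a + b) = d i a + d i b"
    and d_mult: "\<And>i a b. i < n \<Longrightarrow> a \<in> B \<Longrightarrow> b \<in> B \<Longrightarrow> d i (a * b) = d i a * b + a * d i b"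
    and d_sc [simp]: "\<And>i c. i < n \<Longrightarrow> d i (sc c) = 0"
    and d_comm: "\<And>i j a. i < n \<Longrightarrow> j < n \<Longrightarrow> a \<in> B \<Longrightarrow> d i (d j a) = d j (d i a)"
    and d_x: "\<And>i j. i < n \<Longrightarrow> j < n \<Longrightarrow> d i (x j) = (if i = j then 1 else 0)"
begin

lemma sc_zero [simp]: "sc 0 = 0"
  using sc_add[of 0 0] by simp

lemma sc_minus: "sc (- c) = - sc c"
  using sc_add[of c "- c"] by (simp add: eq_neg_iff_add_eq_0 add.commute)

lemma sc_of_nat: "sc (of_nat k) = of_nat k"
  by (induction k) (simp_all add: sc_add)

lemma zero_B [simp]: "0 \<in> B" and one_B [simp]: "1 \<in> B"
  using sc_B[of 0] sc_B[of 1] by simp_all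

lemma minus_B [simp]: "- a \<in> B" if "a \<in> B"
  using mult_B[OF sc_B[of "-1"] that] by (simp add: sc_minus)

lemma diff_B [simp]: "a - b \<in> B" if "a \<in> B" "b \<in> B"
  using add_B[OF that(1) minus_B[OF that(2)]] by simp

lemma of_nat_B [simp]: "of_nat k \<in> B"
  using sc_B[of "of_nat k"] by (simp add: sc_of_nat)

lemma sum_B [simp]: "(\<And>i. i \<in> I \<Longrightarrow> h i \<in> B) \<Longrightarrow> (\<Sum>i\<in>I. h i) \<in> B"
  by (induction I rule: infinite_finite_induct) auto

lemma st_zero [simp]: "st 0 = 0" and st_one [simp]: "st 1 = 1"
  using st_sc[of 0] st_sc[of 1] by simp_all

lemma st_minus [simp]: "st (- a) = - st a"
proof -
  have "st (- a) + st a = 0" using st_add[of "- a" a] by (simp del: st_add)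
  then show ?thesis by (simp add: eq_neg_iff_add_eq_0)
qed

lemma st_diff [simp]: "st (a - b) = st a - st b"
  using st_add[of a "- b"] by simp

lemma st_sum [simp]: "st (\<Sum>i\<in>I. h i) = (\<Sum>i\<in>I. st (h i))"
  by (induction I rule: infinite_finite_induct) auto

lemma st_of_nat [simp]: "st (of_nat k) = of_nat k"
  by (induction k) auto

lemma d_zero [simp]: "i < n \<Longrightarrow> d i 0 = 0" and d_one [simp]: "i < n \<Longrightarrow> d i 1 = 0"
  using d_sc[of i 0] d_sc[of i 1] by simp_all

lemma d_sc_mult: "i < n \<Longrightarrow> a \<in> B \<Longrightarrow> d i (sc c * a) = sc c * d i a"
  by (simp add: d_mult)

lemma d_sum: "i < n \<Longrightarrow> (\<And>j. j \<in> I \<Longrightarrow> h j \<in> B) \<Longrightarrow> d i (\<Sum>j\<in>I. h j) = (\<Sum>j\<in>I. d i (h j))"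
  by (induction I rule: infinite_finite_induct) (auto simp: d_add)

lemma inverse_Suc: "sc (1 / of_nat (Suc k)) * of_nat (Suc k) = 1"
  by (metis nonzero_eq_divide_eq of_nat_Suc of_nat_neq_0 sc_mult sc_of_nat sc_one)

text \<open>\<open>diffop m\<close>: differential operators of order less than \<open>m\<close>.\<close>

primrec diffop :: "nat \<Rightarrow> ('b \<Rightarrow> 'b) \<Rightarrow> bool" where
  "diffop 0 P \<longleftrightarrow> (\<forall>f\<in>B. P f = 0)"
| "diffop (Suc m) P \<longleftrightarrow> (\<exists>b\<in>B. \<exists>Q. (\<forall>i<n. diffop m (Q i)) \<and>
     (\<forall>f\<in>B. P f = b * f + (\<Sum>i<n. Q i (d i f))))"

lemma diffop_SucI:
  assumes "b \<in> B" "\<And>i. i < n \<Longrightarrow> diffop m (Q i)"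
    "\<And>f. f \<in> B \<Longrightarrow> P f = b * f + (\<Sum>i<n. Q i (d i f))"
  shows "diffop (Suc m) P"
  using assms by auto

lemma diffop_SucE:
  assumes "diffop (Suc m) P"
  obtains b Q where "b \<in> B" "\<And>i. i < n \<Longrightarrow> diffop m (Q i)"
    "\<And>f. f \<in> B \<Longrightarrow> P f = b * f + (\<Sum>i<n. Q i (d i f))"
  using assms by auto

lemma diffop_cong: "(\<And>f. f \<in> B \<Longrightarrow> P f = Q f) \<Longrightarrow> diffop m P \<longleftrightarrow> diffop m Q"
  by (cases m) auto

declare diffop.simps(2) [simp del]

lemma diffop_B: "diffop m P \<Longrightarrow> f \<in> B \<Longrightarrow> P f \<in> B"
proof (induction m arbitrary: P f)
  case (Suc m)
  then obtain b Q where "b \<in> B" "\<And>i. i < n \<Longrightarrow> diffop m (Q i)"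
    "\<And>f. f \<in> B \<Longrightarrow> P f = b * f + (\<Sum>i<n. Q i (d i f))" by (elim diffop_SucE) auto
  with Suc show ?case by (auto intro!: add_B mult_B sum_B)
qed auto

lemma diffop_zero [simp]: "diffop m (\<lambda>f. 0)"
proof (induction m)
  case (Suc m)
  then show ?case by (intro diffop_SucI[where b = 0 and Q = "\<lambda>i f. 0"]) auto
qed auto

lemma diffop_mult: "b \<in> B \<Longrightarrow> diffop (Suc m) (\<lambda>f. b * f)"
  by (rule diffop_SucI[where Q = "\<lambda>i f. 0"]) auto

lemma diffop_add: "diffop m P \<Longrightarrow> diffop m Q \<Longrightarrow> diffop m (\<lambda>f. P f + Q f)"
proof (induction m arbitrary: P Q)
  case (Suc m)
  obtain b P' where P: "b \<in> B" "\<And>i. i < n \<Longrightarrow> diffop m (P' i)"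
    "\<And>f. f \<in> B \<Longrightarrow> P f = b * f + (\<Sum>i<n. P' i (d i f))" using Suc.prems(1) by (elim diffop_SucE) auto
  obtain c Q' where Q: "c \<in> B" "\<And>i. i < n \<Longrightarrow> diffop m (Q' i)"
    "\<And>f. f \<in> B \<Longrightarrow> Q f = c * f + (\<Sum>i<n. Q' i (d i f))" using Suc.prems(2) by (elim diffop_SucE) auto
  show ?case
    by (rule diffop_SucI[where b = "b + c" and Q = "\<lambda>i f. P' i f + Q' i f"])
      (use P Q Suc.IH in \<open>auto simp: algebra_simps sum.distrib\<close>)
qed auto

lemma diffop_lmult: "b \<in> B \<Longrightarrow> diffop m P \<Longrightarrow> diffop m (\<lambda>f. b * P f)"
proof (induction m arbitrary: P)
  case (Suc m)
  obtain c P' where P: "c \<in> B" "\<And>i. i < n \<Longrightarrow> diffop m (P' i)"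
    "\<And>f. f \<in> B \<Longrightarrow> P f = c * f + (\<Sum>i<n. P' i (d i f))" using Suc.prems(2) by (elim diffop_SucE) auto
  show ?case
    by (rule diffop_SucI[where b = "b * c" and Q = "\<lambda>i f. b * P' i f"])
      (use P Suc in \<open>auto simp: algebra_simps sum_distrib_left\<close>)
qed auto

lemma diffop_minus: "diffop m P \<Longrightarrow> diffop m (\<lambda>f. - P f)"
  using diffop_lmult[of "- 1" m P] by simp

lemma diffop_diff: "diffop m P \<Longrightarrow> diffop m Q \<Longrightarrow> diffop m (\<lambda>f. P f - Q f)"
  using diffop_add[OF _ diffop_minus, of m P Q] by simp

lemma diffop_sum: "(\<And>i. i \<in> I \<Longrightarrow> diffop m (P i)) \<Longrightarrow> diffop m (\<lambda>f. \<Sum>i\<in>I. P i f)"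
  by (induction I rule: infinite_finite_induct) (auto intro: diffop_add)

lemma diffop_Suc: "diffop m P \<Longrightarrow> diffop (Suc m) P"
proof (induction m arbitrary: P)
  case 0
  then have "diffop (Suc 0) P \<longleftrightarrow> diffop (Suc 0) (\<lambda>f. 0)" by (intro diffop_cong) auto
  then show ?case by (simp del: diffop.simps(1))
next
  case (Suc m)
  then show ?case by (elim diffop_SucE) (rule diffop_SucI, auto simp del: diffop.simps(1))
qed

lemma diffop_mono: "diffop m P \<Longrightarrow> m \<le> k \<Longrightarrow> diffop k P"
  by (rule lift_Suc_mono_le[of "\<lambda>m. diffop m P" m k, unfolded le_bool_def, rule_format])
    (auto simp: le_bool_def diffop_Suc simp del: diffop.simps(1))

lemma diffop_d: "i < n \<Longrightarrow> diffop m P \<Longrightarrow> diffop (Suc m) (\<lambda>f. P (d i f))"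
  by (rule diffop_SucI[where b = 0 and Q = "\<lambda>j. if j = i then P else (\<lambda>f. 0)"])
    (auto simp: if_distribR cong: if_cong)

lemma diffop_additive: "diffop m P \<Longrightarrow> f \<in> B \<Longrightarrow> g \<in> B \<Longrightarrow> P (f + g) = P f + P g"
proof (induction m arbitrary: P f g)
  case (Suc m)
  obtain c P' where P: "c \<in> B" "\<And>i. i < n \<Longrightarrow> diffop m (P' i)"
    "\<And>f. f \<in> B \<Longrightarrow> P f = c * f + (\<Sum>i<n. P' i (d i f))" using Suc.prems(1) by (elim diffop_SucE) auto
  have "(\<Sum>i<n. P' i (d i (f + g))) = (\<Sum>i<n. P' i (d i f)) + (\<Sum>i<n. P' i (d i g))"
    unfolding sum.distrib[symmetric]
    by (rule sum.cong) (use Suc P in \<open>auto simp: d_add\<close>)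
  with P Suc.prems show ?case by (simp add: algebra_simps)
qed auto

lemma diffop_sc: "diffop m P \<Longrightarrow> f \<in> B \<Longrightarrow> P (sc c * f) = sc c * P f"
proof (induction m arbitrary: P f)
  case (Suc m)
  obtain b P' where P: "b \<in> B" "\<And>i. i < n \<Longrightarrow> diffop m (P' i)"
    "\<And>f. f \<in> B \<Longrightarrow> P f = b * f + (\<Sum>i<n. P' i (d i f))" using Suc.prems(1) by (elim diffop_SucE) auto
  have "(\<Sum>i<n. P' i (d i (sc c * f))) = sc c * (\<Sum>i<n. P' i (d i f))"
    unfolding sum_distrib_left
    by (rule sum.cong) (use Suc P in \<open>auto simp: d_sc_mult\<close>)
  with P Suc.prems show ?case by (simp add: algebra_simps)
qed auto

lemma diffop_0: "diffop m P \<Longrightarrow> P 0 = 0"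
  using diffop_additive[of m P 0 0] by simp

lemma diffop_neg: "diffop m P \<Longrightarrow> f \<in> B \<Longrightarrow> P (- f) = - P f"
  using diffop_additive[of m P f "- f"] diffop_0[of m P]
  by (simp add: eq_neg_iff_add_eq_0 add.commute)

lemma diffop_subtract: "diffop m P \<Longrightarrow> f \<in> B \<Longrightarrow> g \<in> B \<Longrightarrow> P (f - g) = P f - P g"
  using diffop_additive[of m P f "- g"] diffop_neg[of m P g] by simp

lemma diffop_sum_arg: "diffop m P \<Longrightarrow> (\<And>i. i \<in> I \<Longrightarrow> h i \<in> B) \<Longrightarrow> P (\<Sum>i\<in>I. h i) = (\<Sum>i\<in>I. P (h i))"
  by (induction I rule: infinite_finite_induct) (auto simp: diffop_additive diffop_0)

text \<open>The two halves need each other: by the Leibniz rule the commutator consists of the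
  operators \<open>P' i (d i b * f)\<close>, whose order the first half bounds, and of the
  commutators of the \<open>P' i\<close>. Truncated subtraction keeps \<open>m = 0\<close> inside
  the induction.\<close>

lemma diffop_rmult_commute:
  "diffop m P \<Longrightarrow> b \<in> B \<Longrightarrow>
    diffop m (\<lambda>f. P (b * f)) \<and> diffop (m - 1) (\<lambda>f. P (b * f) - b * P f)"
proof (induction m arbitrary: P b)
  case (Suc m)
  obtain c P' where P: "c \<in> B" "\<And>i. i < n \<Longrightarrow> diffop m (P' i)"
    "\<And>f. f \<in> B \<Longrightarrow> P f = c * f + (\<Sum>i<n. P' i (d i f))" using Suc.prems(1) by (elim diffop_SucE) auto
  have *: "P (b * f) - b * P f = (\<Sum>i<n. P' i (d i b * f)) + (\<Sum>i<n. P' i (b * d i f) - b * P' i (d i f))"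
    if "f \<in> B" for f
  proof -
    have "(\<Sum>i<n. P' i (d i (b * f))) = (\<Sum>i<n. P' i (d i b * f)) + (\<Sum>i<n. P' i (b * d i f))"
      unfolding sum.distrib[symmetric]
      by (rule sum.cong) (use P Suc.prems that in \<open>auto simp: d_mult diffop_additive[OF P(2)]\<close>)
    then show ?thesis using P(3) that Suc.prems
      by (simp add: sum_subtractf sum_distrib_left algebra_simps)
  qed
  have 1: "diffop m (\<lambda>f. \<Sum>i<n. P' i (d i b * f))"
    by (rule diffop_sum) (use Suc P in auto)
  have 2: "diffop m (\<lambda>f. \<Sum>i<n. P' i (b * d i f) - b * P' i (d i f))"
  proof (cases m)
    case 0
    then show ?thesis using P(2) Suc.prems by auto
  next
    case (Suc k)
    have "diffop (Suc k) (\<lambda>f. P' i (b * d i f) - b * P' i (d i f))" if "i < n" for i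
      using diffop_d[OF that, of k "\<lambda>f. P' i (b * f) - b * P' i f"] Suc.IH[OF P(2)[OF that] Suc.prems(2)]
      by (simp add: \<open>m = Suc k\<close> del: diffop.simps(1))
    then show ?thesis unfolding \<open>m = Suc k\<close> by (intro diffop_sum) auto
  qed
  have C: "diffop m (\<lambda>f. P (b * f) - b * P f)"
    using diffop_add[OF 1 2] by (subst diffop_cong[OF *]) auto
  moreover have "diffop (Suc m) (\<lambda>f. P (b * f) - b * P f + b * P f)"
    using diffop_Suc[OF C] diffop_lmult[OF Suc.prems(2,1)] by (rule diffop_add)
  ultimately show ?case by (simp del: diffop.simps(1))
qed auto

lemma diffop_commute_mult: "diffop (Suc m) P \<Longrightarrow> b \<in> B \<Longrightarrow> diffop m (\<lambda>f. P (b * f) - b * P f)"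
  using diffop_rmult_commute[of "Suc m"] by auto

text \<open>The commutator with \<open>d i\<close> only differentiates the coefficients, because the
  derivations commute with each other; so the order does not grow.\<close>

lemma diffop_commute_d:
  "diffop m P \<Longrightarrow> i < n \<Longrightarrow> diffop m (\<lambda>f. d i (P f) - P (d i f))"
proof (induction m arbitrary: P)
  case (Suc m)
  obtain c P' where P: "c \<in> B" "\<And>i. i < n \<Longrightarrow> diffop m (P' i)"
    "\<And>f. f \<in> B \<Longrightarrow> P f = c * f + (\<Sum>i<n. P' i (d i f))" using Suc.prems(1) by (elim diffop_SucE) auto
  show ?case
  proof (rule diffop_SucI[where b = "d i c" and Q = "\<lambda>j f. d i (P' j f) - P' j (d i f)"])
    fix f assume f: "f \<in> B"
    have "d i (\<Sum>j<n. P' j (d j f)) = (\<Sum>j<n. d i (P' j (d j f)))"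
      by (rule d_sum) (use Suc P f in \<open>auto intro: diffop_B[OF P(2)]\<close>)
    moreover have "(\<Sum>j<n. P' j (d j (d i f))) = (\<Sum>j<n. P' j (d i (d j f)))"
      using Suc.prems f by (auto simp: d_comm)
    moreover have "(\<Sum>j<n. P' j (d j f)) \<in> B" using f by (intro sum_B diffop_B[OF P(2)]) auto
    ultimately show "d i (P f) - P (d i f) = d i c * f + (\<Sum>j<n. d i (P' j (d j f)) - P' j (d i (d j f)))"
      using P(1,3) f Suc.prems by (simp add: sum_subtractf d_add d_mult algebra_simps)
  qed (use P Suc in auto)
qed auto

lemma diffop_post_d: "diffop m P \<Longrightarrow> i < n \<Longrightarrow> diffop (Suc m) (\<lambda>f. d i (P f))"
  using diffop_add[OF diffop_Suc[OF diffop_commute_d[of m P i]] diffop_d[of i m P]]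
  by (simp del: diffop.simps(1))

lemma diffop_comp: "diffop (Suc a) P \<Longrightarrow> diffop b Q \<Longrightarrow> diffop (a + b) (\<lambda>f. P (Q f))"
proof (induction a arbitrary: P Q b)
  case 0
  obtain c P' where P: "c \<in> B" "\<And>i. i < n \<Longrightarrow> diffop 0 (P' i)"
    "\<And>f. f \<in> B \<Longrightarrow> P f = c * f + (\<Sum>i<n. P' i (d i f))" using 0(1) by (elim diffop_SucE) auto
  have "P (Q f) = c * Q f" if "f \<in> B" for f
    using P diffop_B[OF 0(2) that] by simp
  then show ?case using diffop_lmult[OF P(1) 0(2)] by (subst diffop_cong[of _ "\<lambda>f. c * Q f"]) auto
next
  case (Suc a)
  obtain c P' where P: "c \<in> B" "\<And>i. i < n \<Longrightarrow> diffop (Suc a) (P' i)"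
    "\<And>f. f \<in> B \<Longrightarrow> P f = c * f + (\<Sum>i<n. P' i (d i f))" using Suc.prems(1) by (elim diffop_SucE) auto
  have *: "P (Q f) = c * Q f + (\<Sum>i<n. P' i (d i (Q f)))" if "f \<in> B" for f
    using P diffop_B[OF Suc.prems(2) that] by simp
  have "diffop (a + Suc b) (\<lambda>f. \<Sum>i<n. P' i (d i (Q f)))"
    by (intro diffop_sum Suc.IH P diffop_post_d Suc.prems) auto
  moreover have "diffop (a + Suc b) (\<lambda>f. c * Q f)"
    by (rule diffop_mono[OF diffop_lmult[OF P(1) Suc.prems(2)]]) simp
  ultimately have "diffop (a + Suc b) (\<lambda>f. c * Q f + (\<Sum>i<n. P' i (d i (Q f))))"
    by (intro diffop_add)
  then show ?case by (subst diffop_cong[OF *]) simp_all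
qed

text \<open>Principal symbols commute, so one order is gained over \<open>diffop_comp\<close>. The
  induction expands \<open>[P' d, Q] = P' [d, Q] + [P', Q] d\<close>; in the first term
  \<open>P'\<close> has lower order than \<open>P\<close> and \<open>[d, Q]\<close> no higher order
  than \<open>Q\<close>, in the second the induction hypothesis applies.\<close>

lemma diffop_commutator:
  "diffop (Suc a) P \<Longrightarrow> diffop (Suc b) Q \<Longrightarrow> diffop (a + b) (\<lambda>f. P (Q f) - Q (P f))"
proof (induction a arbitrary: P)
  case 0
  obtain c P' where P: "c \<in> B" "\<And>i. i < n \<Longrightarrow> diffop 0 (P' i)"
    "\<And>f. f \<in> B \<Longrightarrow> P f = c * f + (\<Sum>i<n. P' i (d i f))" using 0(1) by (elim diffop_SucE) auto
  have "P (Q f) - Q (P f) = - (Q (c * f) - c * Q f)" if "f \<in> B" for f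
    using P diffop_B[OF 0(2) that] that by simp
  then show ?case using diffop_minus[OF diffop_commute_mult[OF 0(2) P(1)]]
    by (subst diffop_cong[of _ "\<lambda>f. - (Q (c * f) - c * Q f)"]) auto
next
  case (Suc a)
  obtain c P' where P: "c \<in> B" "\<And>i. i < n \<Longrightarrow> diffop (Suc a) (P' i)"
    "\<And>f. f \<in> B \<Longrightarrow> P f = c * f + (\<Sum>i<n. P' i (d i f))" using Suc.prems(1) by (elim diffop_SucE) auto
  let ?D = "\<lambda>i f. d i (Q f) - Q (d i f)"
  let ?K = "\<lambda>i f. P' i (Q f) - Q (P' i f)"
  have *: "P (Q f) - Q (P f) = - (Q (c * f) - c * Q f) + ((\<Sum>i<n. P' i (?D i f)) + (\<Sum>i<n. ?K i (d i f)))"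
    if f: "f \<in> B" for f
  proof -
    have "(\<Sum>i<n. P' i (?D i f)) = (\<Sum>i<n. P' i (d i (Q f))) - (\<Sum>i<n. P' i (Q (d i f)))"
      unfolding sum_subtractf[symmetric]
      by (rule sum.cong) (use f Suc.prems in \<open>auto simp: diffop_subtract[OF P(2)] diffop_B\<close>)
    moreover have "Q (\<Sum>i<n. P' i (d i f)) = (\<Sum>i<n. Q (P' i (d i f)))"
      using f Suc.prems by (intro diffop_sum_arg) (auto intro: diffop_B[OF P(2)])
    moreover have "(\<Sum>i<n. P' i (d i f)) \<in> B" using f by (intro sum_B diffop_B[OF P(2)]) auto
    ultimately show ?thesis
      using P(1,3) f Suc.prems by (simp add: diffop_B diffop_additive sum_subtractf del: diffop.simps(1))
  qed
  have 1: "diffop (Suc a + b) (\<lambda>f. - (Q (c * f) - c * Q f))"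
    by (rule diffop_mono[OF diffop_minus[OF diffop_commute_mult[OF Suc.prems(2) P(1)]]]) simp
  have 2: "diffop (Suc a + b) (\<lambda>f. \<Sum>i<n. P' i (?D i f))"
    using diffop_comp[OF P(2) diffop_commute_d[OF Suc.prems(2)]]
    by (intro diffop_sum) (simp del: diffop.simps(1))
  have 3: "diffop (Suc a + b) (\<lambda>f. \<Sum>i<n. ?K i (d i f))"
    using diffop_d[OF _ Suc.IH[OF P(2) Suc.prems(2)]] by (intro diffop_sum) (simp del: diffop.simps(1))
  show ?case
    using diffop_add[OF 1 diffop_add[OF 2 3]] by (simp only: * cong: diffop_cong)
qed

text \<open>On principal symbols the commutator with \<open>x i\<close> is the derivative in the
  \<open>i\<close>-th dual variable, so this is Euler's identity for a homogeneous polynomial of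
  degree \<open>m\<close>, up to lower order.\<close>

lemma diffop_Euler:
  "diffop (Suc m) P \<Longrightarrow>
    diffop m (\<lambda>f. (\<Sum>i<n. P (x i * d i f) - x i * P (d i f)) - of_nat m * P f)"
proof (induction m arbitrary: P)
  case 0
  then obtain c P' where P: "c \<in> B" "\<And>i. i < n \<Longrightarrow> diffop 0 (P' i)"
    "\<And>f. f \<in> B \<Longrightarrow> P f = c * f + (\<Sum>i<n. P' i (d i f))" by (elim diffop_SucE) auto
  then show ?case by (auto simp: algebra_simps)
next
  case (Suc m)
  obtain c P' where P: "c \<in> B" "\<And>i. i < n \<Longrightarrow> diffop (Suc m) (P' i)"
    "\<And>f. f \<in> B \<Longrightarrow> P f = c * f + (\<Sum>i<n. P' i (d i f))" using Suc.prems(1) by (elim diffop_SucE) auto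
  let ?U = "\<lambda>P f. (\<Sum>i<n. P (x i * d i f) - x i * P (d i f)) - of_nat m * P f"
  show ?case
  proof (rule diffop_SucI[where b = "- (of_nat (Suc m) * c)" and Q = "\<lambda>j. ?U (P' j)"])
    fix f assume f: "f \<in> B"
    \<comment> \<open>Differentiating the coordinate leaves the one term \<open>i = j\<close>; this
      term raises the Euler factor from \<open>m\<close> to \<open>Suc m\<close>.\<close>
    have 1: "P' j (d j (x i * d i f)) = (if i = j then P' j (d j f) else 0) + P' j (x i * d i (d j f))"
      if "i < n" "j < n" for i j
      using that P(2) f by (auto simp: d_mult d_x d_comm diffop_additive[OF P(2)] diffop_0[OF P(2)])
    have "(\<Sum>i<n. P (x i * d i f) - x i * P (d i f)) =
        (\<Sum>i<n. \<Sum>j<n. P' j (d j (x i * d i f)) - x i * P' j (d j (d i f)))"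
      using P(3) f by (intro sum.cong) (auto simp: sum_subtractf sum_distrib_left algebra_simps)
    also have "\<dots> = (\<Sum>j<n. \<Sum>i<n. P' j (d j (x i * d i f)) - x i * P' j (d j (d i f)))"
      by (rule sum.swap)
    also have "\<dots> = (\<Sum>j<n. P' j (d j f) + (\<Sum>i<n. P' j (x i * d i (d j f)) - x i * P' j (d i (d j f))))"
      by (rule sum.cong) (use f in \<open>auto simp: 1 sum.distrib sum_subtractf d_comm\<close>)
    finally show "(\<Sum>i<n. P (x i * d i f) - x i * P (d i f)) - of_nat (Suc m) * P f =
        - (of_nat (Suc m) * c) * f + (\<Sum>j<n. ?U (P' j) (d j f))"
      using P(3)[OF f] by (simp add: sum.distrib sum_subtractf sum_distrib_left algebra_simps)
  qed (use P Suc in auto)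
qed

text \<open>The a priori order is lowered step by step: as long as it exceeds \<open>m\<close>, the
  commutators have lower order than expected, and Euler's identity then gives the same for
  \<open>of_nat k * P\<close> and hence for \<open>P\<close>. All later bounds on orders are
  obtained from commutators with coordinates in this way.\<close>

lemma diffop_descend:
  assumes "\<And>i. i < n \<Longrightarrow> diffop m (\<lambda>f. P (x i * f) - x i * P f)"
  shows "diffop k P \<Longrightarrow> diffop (Suc m) P"
proof (induction k)
  case 0
  then show ?case by (rule diffop_mono) simp
next
  case (Suc k)
  show ?case
  proof (cases "k \<le> m")
    case True
    then show ?thesis using Suc.prems diffop_mono by blast
  next
    case False
    then obtain l where k: "k = Suc l" by (cases k) auto
    have "diffop k (\<lambda>f. \<Sum>i<n. P (x i * d i f) - x i * P (d i f))"
      using False diffop_mono[OF diffop_d[OF _ assms]] by (intro diffop_sum) auto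
    from diffop_diff[OF this diffop_Euler[OF Suc.prems]]
    have "diffop k (\<lambda>f. of_nat k * P f)" by simp
    from diffop_lmult[OF sc_B[of "1 / of_nat k"] this]
    have "diffop k P" unfolding mult.assoc[symmetric] k inverse_Suc by simp
    then show ?thesis by (rule Suc.IH)
  qed
qed


text \<open>\<open>bidiffop w\<close>: bidifferential operators of total order less than \<open>w\<close>.\<close>

primrec bidiffop :: "nat \<Rightarrow> ('b \<Rightarrow> 'b \<Rightarrow> 'b) \<Rightarrow> bool" where
  "bidiffop 0 Z \<longleftrightarrow> (\<forall>f\<in>B. \<forall>g\<in>B. Z f g = 0)"
| "bidiffop (Suc w) Z \<longleftrightarrow> (\<exists>b\<in>B. \<exists>X Y. (\<forall>i<n. bidiffop w (X i)) \<and> (\<forall>i<n. bidiffop w (Y i)) \<and>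
     (\<forall>f\<in>B. \<forall>g\<in>B. Z f g = b * f * g + (\<Sum>i<n. X i (d i f) g) + (\<Sum>i<n. Y i f (d i g))))"

lemma bidiffop_SucI:
  assumes "b \<in> B" "\<And>i. i < n \<Longrightarrow> bidiffop w (X i)" "\<And>i. i < n \<Longrightarrow> bidiffop w (Y i)"
    "\<And>f g. f \<in> B \<Longrightarrow> g \<in> B \<Longrightarrow>
      Z f g = b * f * g + (\<Sum>i<n. X i (d i f) g) + (\<Sum>i<n. Y i f (d i g))"
  shows "bidiffop (Suc w) Z"
  using assms by auto

lemma bidiffop_SucE:
  assumes "bidiffop (Suc w) Z"
  obtains b X Y where "b \<in> B" "\<And>i. i < n \<Longrightarrow> bidiffop w (X i)" "\<And>i. i < n \<Longrightarrow> bidiffop w (Y i)"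
    "\<And>f g. f \<in> B \<Longrightarrow> g \<in> B \<Longrightarrow>
      Z f g = b * f * g + (\<Sum>i<n. X i (d i f) g) + (\<Sum>i<n. Y i f (d i g))"
  using assms unfolding bidiffop.simps by blast

lemma bidiffop_cong:
  "(\<And>f g. f \<in> B \<Longrightarrow> g \<in> B \<Longrightarrow> Z f g = Z' f g) \<Longrightarrow> bidiffop w Z \<longleftrightarrow> bidiffop w Z'"
  by (cases w) auto

declare bidiffop.simps(2) [simp del]

lemma bidiffop_B: "bidiffop w Z \<Longrightarrow> f \<in> B \<Longrightarrow> g \<in> B \<Longrightarrow> Z f g \<in> B"
proof (induction w arbitrary: Z f g)
  case (Suc w)
  obtain b X Y where Z: "b \<in> B" "\<And>i. i < n \<Longrightarrow> bidiffop w (X i)" "\<And>i. i < n \<Longrightarrow> bidiffop w (Y i)"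
    "\<And>f g. f \<in> B \<Longrightarrow> g \<in> B \<Longrightarrow>
      Z f g = b * f * g + (\<Sum>i<n. X i (d i f) g) + (\<Sum>i<n. Y i f (d i g))"
    using Suc.prems(1) by (rule bidiffop_SucE) blast
  show ?case unfolding Z(4)[OF Suc.prems(2,3)]
    by (intro add_B mult_B sum_B Suc.IH[OF Z(2)] Suc.IH[OF Z(3)]) (use Z Suc.prems in auto)
qed auto

lemma bidiffop_zero [simp]: "bidiffop w (\<lambda>f g. 0)"
proof (induction w)
  case (Suc w)
  then show ?case by (intro bidiffop_SucI[where b = 0 and X = "\<lambda>i f g. 0" and Y = "\<lambda>i f g. 0"]) auto
qed auto

lemma bidiffop_times: "bidiffop (Suc w) (\<lambda>f g. f * g)"
  by (rule bidiffop_SucI[where b = 1 and X = "\<lambda>i f g. 0" and Y = "\<lambda>i f g. 0"]) auto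

lemma bidiffop_flip: "bidiffop w Z \<Longrightarrow> bidiffop w (\<lambda>f g. Z g f)"
proof (induction w arbitrary: Z)
  case (Suc w)
  obtain b X Y where Z: "b \<in> B" "\<And>i. i < n \<Longrightarrow> bidiffop w (X i)" "\<And>i. i < n \<Longrightarrow> bidiffop w (Y i)"
    "\<And>f g. f \<in> B \<Longrightarrow> g \<in> B \<Longrightarrow>
      Z f g = b * f * g + (\<Sum>i<n. X i (d i f) g) + (\<Sum>i<n. Y i f (d i g))"
    using Suc.prems(1) by (rule bidiffop_SucE) blast
  show ?case
    by (rule bidiffop_SucI[where b = b and X = "\<lambda>i f g. Y i g f" and Y = "\<lambda>i f g. X i g f"])
      (use Z Suc.IH in \<open>auto simp: algebra_simps\<close>)
qed auto

lemma bidiffop_add: "bidiffop w Z \<Longrightarrow> bidiffop w Z' \<Longrightarrow> bidiffop w (\<lambda>f g. Z f g + Z' f g)"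
proof (induction w arbitrary: Z Z')
  case (Suc w)
  obtain b X Y where Z: "b \<in> B" "\<And>i. i < n \<Longrightarrow> bidiffop w (X i)" "\<And>i. i < n \<Longrightarrow> bidiffop w (Y i)"
    "\<And>f g. f \<in> B \<Longrightarrow> g \<in> B \<Longrightarrow>
      Z f g = b * f * g + (\<Sum>i<n. X i (d i f) g) + (\<Sum>i<n. Y i f (d i g))"
    using Suc.prems(1) by (rule bidiffop_SucE) blast
  obtain b' X' Y' where Z': "b' \<in> B" "\<And>i. i < n \<Longrightarrow> bidiffop w (X' i)"
    "\<And>i. i < n \<Longrightarrow> bidiffop w (Y' i)"
    "\<And>f g. f \<in> B \<Longrightarrow> g \<in> B \<Longrightarrow>
      Z' f g = b' * f * g + (\<Sum>i<n. X' i (d i f) g) + (\<Sum>i<n. Y' i f (d i g))"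
    using Suc.prems(2) by (rule bidiffop_SucE) blast
  show ?case
    by (rule bidiffop_SucI[where b = "b + b'" and X = "\<lambda>i f g. X i f g + X' i f g"
          and Y = "\<lambda>i f g. Y i f g + Y' i f g"])
      (use Z(1-3) Z'(1-3) Suc.IH in \<open>auto simp: Z(4) Z'(4) algebra_simps sum.distrib\<close>)
qed auto

lemma bidiffop_lmult: "c \<in> B \<Longrightarrow> bidiffop w Z \<Longrightarrow> bidiffop w (\<lambda>f g. c * Z f g)"
proof (induction w arbitrary: Z)
  case (Suc w)
  obtain b X Y where Z: "b \<in> B" "\<And>i. i < n \<Longrightarrow> bidiffop w (X i)" "\<And>i. i < n \<Longrightarrow> bidiffop w (Y i)"
    "\<And>f g. f \<in> B \<Longrightarrow> g \<in> B \<Longrightarrow>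
      Z f g = b * f * g + (\<Sum>i<n. X i (d i f) g) + (\<Sum>i<n. Y i f (d i g))"
    using Suc.prems(2) by (rule bidiffop_SucE) blast
  show ?case
    by (rule bidiffop_SucI[where b = "c * b" and X = "\<lambda>i f g. c * X i f g" and Y = "\<lambda>i f g. c * Y i f g"])
      (use Z(1-3) Suc in \<open>auto simp: Z(4) algebra_simps sum_distrib_left\<close>)
qed auto

lemma bidiffop_minus: "bidiffop w Z \<Longrightarrow> bidiffop w (\<lambda>f g. - Z f g)"
  using bidiffop_lmult[of "- 1" w Z] by simp

lemma bidiffop_diff: "bidiffop w Z \<Longrightarrow> bidiffop w Z' \<Longrightarrow> bidiffop w (\<lambda>f g. Z f g - Z' f g)"
  using bidiffop_add[OF _ bidiffop_minus, of w Z Z'] by simp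

lemma bidiffop_sum: "(\<And>i. i \<in> I \<Longrightarrow> bidiffop w (Z i)) \<Longrightarrow> bidiffop w (\<lambda>f g. \<Sum>i\<in>I. Z i f g)"
  by (induction I rule: infinite_finite_induct) (auto intro: bidiffop_add)

lemma bidiffop_Suc: "bidiffop w Z \<Longrightarrow> bidiffop (Suc w) Z"
proof (induction w arbitrary: Z)
  case 0
  then show ?case
    by (intro bidiffop_SucI[where b = 0 and X = "\<lambda>i f g. 0" and Y = "\<lambda>i f g. 0"]) auto
next
  case (Suc w)
  then show ?case by (elim bidiffop_SucE) (rule bidiffop_SucI, auto)
qed

lemma bidiffop_mono: "bidiffop w Z \<Longrightarrow> w \<le> k \<Longrightarrow> bidiffop k Z"
  by (rule lift_Suc_mono_le[of "\<lambda>w. bidiffop w Z" w k, unfolded le_bool_def, rule_format])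
    (auto simp: le_bool_def bidiffop_Suc simp del: bidiffop.simps(1))

lemma bidiffop_d1: "i < n \<Longrightarrow> bidiffop w Z \<Longrightarrow> bidiffop (Suc w) (\<lambda>f g. Z (d i f) g)"
  by (rule bidiffop_SucI[where b = 0 and X = "\<lambda>j. if j = i then Z else (\<lambda>f g. 0)" and Y = "\<lambda>i f g. 0"])
    (auto simp: if_distribR cong: if_cong)

lemma bidiffop_d2: "i < n \<Longrightarrow> bidiffop w Z \<Longrightarrow> bidiffop (Suc w) (\<lambda>f g. Z f (d i g))"
  using bidiffop_flip[OF bidiffop_d1[of i w "\<lambda>f g. Z g f"]] bidiffop_flip[of w Z] by simp

lemma diffop_bidiffop: "bidiffop w Z \<Longrightarrow> f \<in> B \<Longrightarrow> diffop w (Z f)"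
proof (induction w arbitrary: Z f)
  case (Suc w)
  obtain b X Y where Z: "b \<in> B" "\<And>i. i < n \<Longrightarrow> bidiffop w (X i)" "\<And>i. i < n \<Longrightarrow> bidiffop w (Y i)"
    "\<And>f g. f \<in> B \<Longrightarrow> g \<in> B \<Longrightarrow>
      Z f g = b * f * g + (\<Sum>i<n. X i (d i f) g) + (\<Sum>i<n. Y i f (d i g))"
    using Suc.prems(1) by (rule bidiffop_SucE) blast
  have "diffop (Suc w) (\<lambda>g. b * f * g)" using Z Suc.prems by (intro diffop_mult) auto
  moreover have "diffop (Suc w) (\<lambda>g. \<Sum>i<n. X i (d i f) g)"
    by (intro diffop_sum diffop_Suc Suc.IH[OF Z(2)]) (use Suc.prems in auto)
  moreover have "diffop (Suc w) (\<lambda>g. \<Sum>i<n. Y i f (d i g))"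
    by (intro diffop_sum diffop_d Suc.IH[OF Z(3)]) (use Suc.prems in auto)
  ultimately have "diffop (Suc w) (\<lambda>g. b * f * g + (\<Sum>i<n. X i (d i f) g) + (\<Sum>i<n. Y i f (d i g)))"
    by (intro diffop_add)
  then show ?case by (subst diffop_cong[OF Z(4)[OF Suc.prems(2)]])
qed auto

lemma diffop_bidiffop': "bidiffop w Z \<Longrightarrow> g \<in> B \<Longrightarrow> diffop w (\<lambda>f. Z f g)"
  by (rule diffop_bidiffop[OF bidiffop_flip])

lemmas bidiffop_add1 = diffop_additive[OF diffop_bidiffop']
lemmas bidiffop_add2 = diffop_additive[OF diffop_bidiffop]
lemmas bidiffop_sum1 = diffop_sum_arg[OF diffop_bidiffop']
lemmas bidiffop_0_1 = diffop_0[OF diffop_bidiffop']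
lemmas bidiffop_0_2 = diffop_0[OF diffop_bidiffop]

lemma bidiffop_mult1_commute1:
  "bidiffop w Z \<Longrightarrow> c \<in> B \<Longrightarrow>
    bidiffop w (\<lambda>f g. Z (c * f) g) \<and> bidiffop (w - 1) (\<lambda>f g. Z (c * f) g - c * Z f g)"
proof (induction w arbitrary: Z c)
  case (Suc w)
  obtain b X Y where Z: "b \<in> B" "\<And>i. i < n \<Longrightarrow> bidiffop w (X i)" "\<And>i. i < n \<Longrightarrow> bidiffop w (Y i)"
    "\<And>f g. f \<in> B \<Longrightarrow> g \<in> B \<Longrightarrow>
      Z f g = b * f * g + (\<Sum>i<n. X i (d i f) g) + (\<Sum>i<n. Y i f (d i g))"
    using Suc.prems(1) by (rule bidiffop_SucE) blast
  have *: "Z (c * f) g - c * Z f g = (\<Sum>i<n. X i (d i c * f) g) +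
      ((\<Sum>i<n. X i (c * d i f) g - c * X i (d i f) g) + (\<Sum>i<n. Y i (c * f) (d i g) - c * Y i f (d i g)))"
    if "f \<in> B" "g \<in> B" for f g
  proof -
    have "(\<Sum>i<n. X i (d i (c * f)) g) = (\<Sum>i<n. X i (d i c * f) g) + (\<Sum>i<n. X i (c * d i f) g)"
      unfolding sum.distrib[symmetric]
      by (rule sum.cong) (use Suc.prems that in \<open>auto simp: d_mult bidiffop_add1[OF Z(2)]\<close>)
    then show ?thesis using Z(4) that Suc.prems
      by (simp add: sum_subtractf sum_distrib_left algebra_simps)
  qed
  have 1: "bidiffop w (\<lambda>f g. \<Sum>i<n. X i (d i c * f) g)"
    by (rule bidiffop_sum) (use Suc.prems Suc.IH[OF Z(2)] in auto)
  have 2: "bidiffop w (\<lambda>f g. \<Sum>i<n. X i (c * d i f) g - c * X i (d i f) g)"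
  proof (cases w)
    case 0
    then show ?thesis using Z(2) Suc.prems by auto
  next
    case (Suc k)
    have "bidiffop (Suc k) (\<lambda>f g. X i (c * d i f) g - c * X i (d i f) g)" if "i < n" for i
      using bidiffop_d1[OF that, of k "\<lambda>f g. X i (c * f) g - c * X i f g"] Suc.IH[OF Z(2)[OF that] Suc.prems(2)]
      by (simp add: Suc)
    then show ?thesis unfolding Suc by (intro bidiffop_sum) auto
  qed
  have 3: "bidiffop w (\<lambda>f g. \<Sum>i<n. Y i (c * f) (d i g) - c * Y i f (d i g))"
  proof (cases w)
    case 0
    then show ?thesis using Z(3) Suc.prems by auto
  next
    case (Suc k)
    have "bidiffop (Suc k) (\<lambda>f g. Y i (c * f) (d i g) - c * Y i f (d i g))" if "i < n" for i
      using bidiffop_d2[OF that, of k "\<lambda>f g. Y i (c * f) g - c * Y i f g"] Suc.IH[OF Z(3)[OF that] Suc.prems(2)]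
      by (simp add: Suc)
    then show ?thesis unfolding Suc by (intro bidiffop_sum) auto
  qed
  have C: "bidiffop w (\<lambda>f g. Z (c * f) g - c * Z f g)"
    using bidiffop_add[OF 1 bidiffop_add[OF 2 3]] by (subst bidiffop_cong[OF *]) auto
  moreover have "bidiffop (Suc w) (\<lambda>f g. Z (c * f) g - c * Z f g + c * Z f g)"
    using bidiffop_Suc[OF C] bidiffop_lmult[OF Suc.prems(2,1)] by (rule bidiffop_add)
  ultimately show ?case by simp
qed auto

lemma bidiffop_mult1: "bidiffop w Z \<Longrightarrow> c \<in> B \<Longrightarrow> bidiffop w (\<lambda>f g. Z (c * f) g)"
  using bidiffop_mult1_commute1 by blast

lemma bidiffop_commute1:
  "bidiffop (Suc w) Z \<Longrightarrow> c \<in> B \<Longrightarrow> bidiffop w (\<lambda>f g. Z (c * f) g - c * Z f g)"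
  using bidiffop_mult1_commute1[of "Suc w"] by auto

lemma bidiffop_sub1: "diffop (Suc a) P \<Longrightarrow> bidiffop w Z \<Longrightarrow> bidiffop (a + w) (\<lambda>f g. Z (P f) g)"
proof (induction a arbitrary: P)
  case 0
  obtain c P' where P: "c \<in> B" "\<And>i. i < n \<Longrightarrow> diffop 0 (P' i)"
    "\<And>f. f \<in> B \<Longrightarrow> P f = c * f + (\<Sum>i<n. P' i (d i f))" using 0(1) by (elim diffop_SucE) auto
  have "P f = c * f" if "f \<in> B" for f using P that by simp
  then show ?case using bidiffop_mult1[OF 0(2) P(1)]
    by (subst bidiffop_cong[of _ "\<lambda>f g. Z (c * f) g"]) auto
next
  case (Suc a)
  obtain c P' where P: "c \<in> B" "\<And>i. i < n \<Longrightarrow> diffop (Suc a) (P' i)"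
    "\<And>f. f \<in> B \<Longrightarrow> P f = c * f + (\<Sum>i<n. P' i (d i f))" using Suc.prems(1) by (elim diffop_SucE) auto
  have *: "Z (P f) g = Z (c * f) g + (\<Sum>i<n. Z (P' i (d i f)) g)" if "f \<in> B" "g \<in> B" for f g
  proof -
    have B: "P' i (d i f) \<in> B" if "i < n" for i using \<open>f \<in> B\<close> that by (intro diffop_B[OF P(2)]) auto
    have "Z (P f) g = Z (c * f) g + Z (\<Sum>i<n. P' i (d i f)) g"
      unfolding P(3)[OF that(1)] using that P(1) B
      by (intro bidiffop_add1[OF Suc.prems(2)] sum_B) auto
    also have "Z (\<Sum>i<n. P' i (d i f)) g = (\<Sum>i<n. Z (P' i (d i f)) g)"
      using that B by (intro bidiffop_sum1[OF Suc.prems(2)]) auto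
    finally show ?thesis .
  qed
  have "bidiffop (Suc (a + w)) (\<lambda>f g. \<Sum>i<n. Z (P' i (d i f)) g)"
    using bidiffop_d1[OF _ Suc.IH[OF P(2) Suc.prems(2)]] by (intro bidiffop_sum) auto
  moreover have "bidiffop (Suc (a + w)) (\<lambda>f g. Z (c * f) g)"
    by (rule bidiffop_mono[OF bidiffop_mult1[OF Suc.prems(2) P(1)]]) simp
  ultimately have "bidiffop (Suc (a + w)) (\<lambda>f g. Z (c * f) g + (\<Sum>i<n. Z (P' i (d i f)) g))"
    by (intro bidiffop_add)
  then show ?case by (subst bidiffop_cong[OF *]) auto
qed

lemma bidiffop_sub2: "diffop (Suc a) P \<Longrightarrow> bidiffop w Z \<Longrightarrow> bidiffop (a + w) (\<lambda>f g. Z f (P g))"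
  using bidiffop_flip[OF bidiffop_sub1[of a P w "\<lambda>f g. Z g f"]] bidiffop_flip[of w Z] by simp

text \<open>The defect in the Leibniz rule only differentiates the coefficients of \<open>Z\<close>,
  so its total order is no higher than that of \<open>Z\<close>, although each of its three terms
  may have one order more.\<close>

lemma bidiffop_Leibniz:
  "bidiffop w Z \<Longrightarrow> i < n \<Longrightarrow> bidiffop w (\<lambda>f g. d i (Z f g) - Z (d i f) g - Z f (d i g))"
proof (induction w arbitrary: Z)
  case (Suc w)
  obtain b X Y where Z: "b \<in> B" "\<And>i. i < n \<Longrightarrow> bidiffop w (X i)" "\<And>i. i < n \<Longrightarrow> bidiffop w (Y i)"
    "\<And>f g. f \<in> B \<Longrightarrow> g \<in> B \<Longrightarrow>
      Z f g = b * f * g + (\<Sum>i<n. X i (d i f) g) + (\<Sum>i<n. Y i f (d i g))"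
    using Suc.prems(1) by (rule bidiffop_SucE) blast
  let ?L = "\<lambda>Z f g. d i (Z f g) - Z (d i f) g - Z f (d i g)"
  show ?case
  proof (rule bidiffop_SucI[where b = "d i b" and X = "\<lambda>j. ?L (X j)" and Y = "\<lambda>j. ?L (Y j)"])
    fix f g assume f: "f \<in> B" and g: "g \<in> B"
    have B: "X j (d j f) g \<in> B" "Y j f (d j g) \<in> B" if "j < n" for j
      using f g that by (auto intro: bidiffop_B[OF Z(2)] bidiffop_B[OF Z(3)])
    have "d i (\<Sum>j<n. X j (d j f) g) = (\<Sum>j<n. d i (X j (d j f) g))"
      and "d i (\<Sum>j<n. Y j f (d j g)) = (\<Sum>j<n. d i (Y j f (d j g)))"
      using B Suc.prems by (auto intro!: d_sum)
    moreover have "(\<Sum>j<n. X j (d j (d i f)) g) = (\<Sum>j<n. X j (d i (d j f)) g)"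
      "(\<Sum>j<n. Y j f (d j (d i g))) = (\<Sum>j<n. Y j f (d i (d j g)))"
      using Suc.prems f g by (auto simp: d_comm)
    moreover have "(\<Sum>j<n. X j (d j f) g) \<in> B" "(\<Sum>j<n. Y j f (d j g)) \<in> B"
      using B by (auto intro!: sum_B)
    ultimately show "?L Z f g = d i b * f * g + (\<Sum>j<n. ?L (X j) (d j f) g) + (\<Sum>j<n. ?L (Y j) f (d j g))"
      using Z(1) f g Suc.prems by (simp add: Z(4) sum_subtractf sum.distrib d_add d_mult algebra_simps)
  qed (use Z Suc in auto)
qed auto

lemma bidiffop_post_d:
  assumes "bidiffop w Z" "i < n"
  shows "bidiffop (Suc w) (\<lambda>f g. d i (Z f g))"
proof -
  have "bidiffop (Suc w) (\<lambda>f g. (d i (Z f g) - Z (d i f) g - Z f (d i g)) + Z (d i f) g + Z f (d i g))"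
    by (intro bidiffop_add bidiffop_d1 bidiffop_d2 bidiffop_Suc[OF bidiffop_Leibniz] assms)
  then show ?thesis by simp
qed

lemma bidiffop_post: "diffop (Suc a) P \<Longrightarrow> bidiffop w Z \<Longrightarrow> bidiffop (a + w) (\<lambda>f g. P (Z f g))"
proof (induction a arbitrary: P Z w)
  case 0
  obtain c P' where P: "c \<in> B" "\<And>i. i < n \<Longrightarrow> diffop 0 (P' i)"
    "\<And>f. f \<in> B \<Longrightarrow> P f = c * f + (\<Sum>i<n. P' i (d i f))" using 0(1) by (elim diffop_SucE) auto
  have "P f = c * f" if "f \<in> B" for f using P that by simp
  then show ?case using bidiffop_lmult[OF P(1) 0(2)] bidiffop_B[OF 0(2)]
    by (subst bidiffop_cong[of _ "\<lambda>f g. c * Z f g"]) auto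
next
  case (Suc a)
  obtain c P' where P: "c \<in> B" "\<And>i. i < n \<Longrightarrow> diffop (Suc a) (P' i)"
    "\<And>f. f \<in> B \<Longrightarrow> P f = c * f + (\<Sum>i<n. P' i (d i f))" using Suc.prems(1) by (elim diffop_SucE) auto
  have *: "P (Z f g) = c * Z f g + (\<Sum>i<n. P' i (d i (Z f g)))" if "f \<in> B" "g \<in> B" for f g
    using P(3) bidiffop_B[OF Suc.prems(2) that] by simp
  have "bidiffop (Suc (a + w)) (\<lambda>f g. \<Sum>i<n. P' i (d i (Z f g)))"
    using Suc.IH[OF P(2) bidiffop_post_d[OF Suc.prems(2)]] by (intro bidiffop_sum) auto
  moreover have "bidiffop (Suc (a + w)) (\<lambda>f g. c * Z f g)"
    by (rule bidiffop_mono[OF bidiffop_lmult[OF P(1) Suc.prems(2)]]) simp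
  ultimately have "bidiffop (Suc (a + w)) (\<lambda>f g. c * Z f g + (\<Sum>i<n. P' i (d i (Z f g))))"
    by (intro bidiffop_add)
  then show ?case by (subst bidiffop_cong[OF *]) auto
qed

text \<open>Euler's identity in both sets of dual variables at once: commutators in the first and in
  the second argument together count the total degree.\<close>

lemma bidiffop_Euler:
  "bidiffop (Suc w) Z \<Longrightarrow>
    bidiffop w (\<lambda>f g. (\<Sum>i<n. Z (x i * d i f) g - x i * Z (d i f) g)
      + (\<Sum>i<n. Z f (x i * d i g) - x i * Z f (d i g)) - of_nat w * Z f g)"
proof (induction w arbitrary: Z)
  case 0
  then obtain b X Y where Z: "b \<in> B" "\<And>i. i < n \<Longrightarrow> bidiffop 0 (X i)" "\<And>i. i < n \<Longrightarrow> bidiffop 0 (Y i)"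
    "\<And>f g. f \<in> B \<Longrightarrow> g \<in> B \<Longrightarrow>
      Z f g = b * f * g + (\<Sum>i<n. X i (d i f) g) + (\<Sum>i<n. Y i f (d i g))"
    by (rule bidiffop_SucE) blast
  then show ?case by (auto simp: algebra_simps)
next
  case (Suc w)
  obtain b X Y where Z: "b \<in> B" "\<And>i. i < n \<Longrightarrow> bidiffop (Suc w) (X i)"
    "\<And>i. i < n \<Longrightarrow> bidiffop (Suc w) (Y i)"
    "\<And>f g. f \<in> B \<Longrightarrow> g \<in> B \<Longrightarrow>
      Z f g = b * f * g + (\<Sum>i<n. X i (d i f) g) + (\<Sum>i<n. Y i f (d i g))"
    using Suc.prems(1) by (rule bidiffop_SucE) blast
  let ?V = "\<lambda>Z f g. \<Sum>i<n. Z (x i * d i f) g - x i * Z (d i f) g"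
  let ?W = "\<lambda>Z f g. \<Sum>i<n. Z f (x i * d i g) - x i * Z f (d i g)"
  let ?U = "\<lambda>Z f g. ?V Z f g + ?W Z f g - of_nat w * Z f g"
  show ?case
  proof (rule bidiffop_SucI[where b = "- (of_nat (Suc w) * b)" and X = "\<lambda>j. ?U (X j)" and Y = "\<lambda>j. ?U (Y j)"])
    fix f g assume f: "f \<in> B" and g: "g \<in> B"
    have 1: "X j (d j (x i * d i f)) g = (if i = j then X j (d j f) g else 0) + X j (x i * d i (d j f)) g"
      if "i < n" "j < n" for i j
      using that f g by (auto simp: d_mult d_x d_comm bidiffop_add1[OF Z(2)] bidiffop_0_1[OF Z(2)])
    have 2: "Y j f (d j (x i * d i g)) = (if i = j then Y j f (d j g) else 0) + Y j f (x i * d i (d j g))"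
      if "i < n" "j < n" for i j
      using that f g by (auto simp: d_mult d_x d_comm bidiffop_add2[OF Z(3)] bidiffop_0_2[OF Z(3)])
    have "?V Z f g = (\<Sum>i<n. (\<Sum>j<n. X j (d j (x i * d i f)) g - x i * X j (d j (d i f)) g)
         + (\<Sum>j<n. Y j (x i * d i f) (d j g) - x i * Y j (d i f) (d j g)))"
      using f g by (intro sum.cong) (auto simp: Z(4) Z(1) sum_subtractf sum_distrib_left algebra_simps)
    also have "\<dots> = (\<Sum>j<n. (\<Sum>i<n. X j (d j (x i * d i f)) g - x i * X j (d j (d i f)) g)
         + (\<Sum>i<n. Y j (x i * d i f) (d j g) - x i * Y j (d i f) (d j g)))"
      unfolding sum.distrib by (intro arg_cong2[of _ _ _ _ "(+)"] sum.swap)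
    also have "\<dots> = (\<Sum>j<n. X j (d j f) g + ?V (X j) (d j f) g + ?V (Y j) f (d j g))"
      by (rule sum.cong) (use f in \<open>auto simp: 1 sum.distrib sum_subtractf d_comm\<close>)
    finally have V: "?V Z f g = (\<Sum>j<n. X j (d j f) g + ?V (X j) (d j f) g + ?V (Y j) f (d j g))" .
    have "?W Z f g = (\<Sum>i<n. (\<Sum>j<n. Y j f (d j (x i * d i g)) - x i * Y j f (d j (d i g)))
         + (\<Sum>j<n. X j (d j f) (x i * d i g) - x i * X j (d j f) (d i g)))"
      using f g by (intro sum.cong) (auto simp: Z(4) Z(1) sum_subtractf sum_distrib_left algebra_simps)
    also have "\<dots> = (\<Sum>j<n. (\<Sum>i<n. Y j f (d j (x i * d i g)) - x i * Y j f (d j (d i g)))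
         + (\<Sum>i<n. X j (d j f) (x i * d i g) - x i * X j (d j f) (d i g)))"
      unfolding sum.distrib by (intro arg_cong2[of _ _ _ _ "(+)"] sum.swap)
    also have "\<dots> = (\<Sum>j<n. Y j f (d j g) + ?W (Y j) f (d j g) + ?W (X j) (d j f) g)"
      by (rule sum.cong) (use g in \<open>auto simp: 2 sum.distrib sum_subtractf d_comm\<close>)
    finally have W: "?W Z f g = (\<Sum>j<n. Y j f (d j g) + ?W (Y j) f (d j g) + ?W (X j) (d j f) g)" .
    show "?V Z f g + ?W Z f g - of_nat (Suc w) * Z f g =
        - (of_nat (Suc w) * b) * f * g + (\<Sum>j<n. ?U (X j) (d j f) g) + (\<Sum>j<n. ?U (Y j) f (d j g))"
      unfolding V W Z(4)[OF f g]
      by (simp add: sum.distrib sum_subtractf sum_distrib_left[symmetric] algebra_simps)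
  qed (use Z Suc in auto)
qed

lemma bidiffop_descend:
  assumes 1: "\<And>i. i < n \<Longrightarrow> bidiffop m (\<lambda>f g. Z (x i * f) g - x i * Z f g)"
    and 2: "\<And>i. i < n \<Longrightarrow> bidiffop m (\<lambda>f g. Z f (x i * g) - x i * Z f g)"
  shows "bidiffop k Z \<Longrightarrow> bidiffop (Suc m) Z"
proof (induction k)
  case 0
  then show ?case by (rule bidiffop_mono) simp
next
  case (Suc k)
  show ?case
  proof (cases "k \<le> m")
    case True
    then show ?thesis using Suc.prems bidiffop_mono by blast
  next
    case False
    then obtain l where k: "k = Suc l" by (cases k) auto
    have "bidiffop k (\<lambda>f g. \<Sum>i<n. Z (x i * d i f) g - x i * Z (d i f) g)"
      using False bidiffop_mono[OF bidiffop_d1[OF _ 1]] by (intro bidiffop_sum) auto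
    moreover have "bidiffop k (\<lambda>f g. \<Sum>i<n. Z f (x i * d i g) - x i * Z f (d i g))"
      using False bidiffop_mono[OF bidiffop_d2[OF _ 2]] by (intro bidiffop_sum) auto
    ultimately have "bidiffop k (\<lambda>f g. of_nat k * Z f g)"
      using bidiffop_diff[OF bidiffop_add bidiffop_Euler[OF Suc.prems],
          of "\<lambda>f g. \<Sum>i<n. Z (x i * d i f) g - x i * Z (d i f) g"
             "\<lambda>f g. \<Sum>i<n. Z f (x i * d i g) - x i * Z f (d i g)"] by simp
    from bidiffop_lmult[OF sc_B[of "1 / of_nat k"] this]
    have "bidiffop k Z" unfolding mult.assoc[symmetric] k inverse_Suc by simp
    then show ?thesis by (rule Suc.IH)
  qed
qed

text \<open>Induction on \<open>a + b\<close>: a commutator with a coordinate in one argument lowers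
  the order there and keeps the order in the other, so \<open>bidiffop_descend\<close> applies,
  starting from the a priori order \<open>k\<close>. Orders at most \<open>a - 1\<close> and
  \<open>b - 1\<close> add up to something less than \<open>a + b - 1\<close>.\<close>

lemma bidiffop_separate:
  "bidiffop k Z \<Longrightarrow> (\<And>f. f \<in> B \<Longrightarrow> diffop a (Z f)) \<Longrightarrow> (\<And>g. g \<in> B \<Longrightarrow> diffop b (\<lambda>f. Z f g)) \<Longrightarrow>
    bidiffop (a + b - 1) Z"
proof (induction "a + b" arbitrary: a b k Z rule: less_induct)
  case less
  show ?case
  proof (cases "a = 0 \<or> b = 0")
    case True
    then have "bidiffop 0 Z" using less.prems(2,3) by auto
    then show ?thesis by (rule bidiffop_mono) simp
  next
    case False
    then obtain a' b' where ab: "a = Suc a'" "b = Suc b'" by (cases a; cases b) auto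
    have "bidiffop (Suc (a' + b')) Z"
    proof (rule bidiffop_descend[OF _ _ less.prems(1)])
      fix i assume i: "i < n"
      have "bidiffop (a + b' - 1) (\<lambda>f g. Z (x i * f) g - x i * Z f g)"
      proof (rule less.hyps)
        show "bidiffop k (\<lambda>f g. Z (x i * f) g - x i * Z f g)"
          using i less.prems(1) by (intro bidiffop_diff bidiffop_mult1 bidiffop_lmult) auto
        show "diffop a (\<lambda>g. Z (x i * f) g - x i * Z f g)" if "f \<in> B" for f
          using i that less.prems(2) by (intro diffop_diff diffop_lmult) auto
        show "diffop b' (\<lambda>f. Z (x i * f) g - x i * Z f g)" if "g \<in> B" for g
          using i less.prems(3)[OF that] unfolding ab by (intro diffop_commute_mult) auto
      qed (simp add: ab)
      then show "bidiffop (a' + b') (\<lambda>f g. Z (x i * f) g - x i * Z f g)" by (simp add: ab)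
      have "bidiffop (a' + b - 1) (\<lambda>f g. Z f (x i * g) - x i * Z f g)"
      proof (rule less.hyps)
        show "bidiffop k (\<lambda>f g. Z f (x i * g) - x i * Z f g)"
          using i bidiffop_flip[OF bidiffop_mult1[OF bidiffop_flip[OF less.prems(1)], of "x i"]] less.prems(1)
          by (intro bidiffop_diff bidiffop_lmult) auto
        show "diffop a' (\<lambda>g. Z f (x i * g) - x i * Z f g)" if "f \<in> B" for f
          using i less.prems(2)[OF that] unfolding ab by (intro diffop_commute_mult) auto
        show "diffop b (\<lambda>f. Z f (x i * g) - x i * Z f g)" if "g \<in> B" for g
          using i that less.prems(3) by (intro diffop_diff diffop_lmult) auto
      qed (simp add: ab)
      then show "bidiffop (a' + b') (\<lambda>f g. Z f (x i * g) - x i * Z f g)" by (simp add: ab)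
    qed
    then show ?thesis by (simp add: ab)
  qed
qed

end

section \<open>Formal series of operators\<close>

definition series :: "'b set \<Rightarrow> 'b fps set" where
  "series B = {F. \<forall>k. fps_nth F k \<in> B}"

text \<open>Compatibility with \<open>fps_X\<close> already encodes continuity: together with
  additivity it makes each coefficient of \<open>G F\<close> depend on finitely many coefficients of
  \<open>F\<close>.\<close>

definition series_linear :: "'b::comm_ring_1 set \<Rightarrow> ('b fps \<Rightarrow> 'b fps) \<Rightarrow> bool" where
  "series_linear B G \<longleftrightarrow> (\<forall>F\<in>series B. G F \<in> series B) \<and>
     (\<forall>F\<in>series B. \<forall>F'\<in>series B. G (F + F') = G F + G F') \<and>
     (\<forall>F\<in>series B. G (fps_X * F) = fps_X * G F)"

definition app :: "(nat \<Rightarrow> 'b \<Rightarrow> 'b) \<Rightarrow> 'b::comm_ring_1 fps \<Rightarrow> 'b fps" where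
  "app \<tau> F = Abs_fps (\<lambda>k. \<Sum>i\<le>k. \<tau> i (fps_nth F (k - i)))"

definition star_of :: "(nat \<Rightarrow> 'b \<Rightarrow> 'b \<Rightarrow> 'b) \<Rightarrow> 'b::comm_ring_1 fps \<Rightarrow> 'b fps \<Rightarrow> 'b fps" where
  "star_of C F G = Abs_fps (\<lambda>k. \<Sum>i\<le>k. \<Sum>j\<le>k - i. C (k - i - j) (fps_nth F i) (fps_nth G j))"

lemma series_nth: "F \<in> series B \<Longrightarrow> fps_nth F k \<in> B"
  by (simp add: series_def)

lemma seriesI: "(\<And>k. fps_nth F k \<in> B) \<Longrightarrow> F \<in> series B"
  by (simp add: series_def)

locale additive_set =
  fixes B :: "'b::comm_ring_1 set"
  assumes zero_mem [simp]: "0 \<in> B" and add_mem [simp]: "\<And>a b. a \<in> B \<Longrightarrow> b \<in> B \<Longrightarrow> a + b \<in> B"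
begin

lemma sum_mem [simp]: "(\<And>i. i \<in> I \<Longrightarrow> h i \<in> B) \<Longrightarrow> (\<Sum>i\<in>I. h i) \<in> B"
  by (induction I rule: infinite_finite_induct) auto

lemma series_const [simp]: "f \<in> B \<Longrightarrow> fps_const f \<in> series B"
  by (simp add: series_def)

lemma series_add [simp]: "F \<in> series B \<Longrightarrow> G \<in> series B \<Longrightarrow> F + G \<in> series B"
  by (simp add: series_def)

lemma series_X [simp]: "F \<in> series B \<Longrightarrow> fps_X * F \<in> series B"
  by (simp add: series_def)

lemma series_shift [simp]: "F \<in> series B \<Longrightarrow> fps_shift k F \<in> series B"
  by (simp add: series_def)

lemma fps_decompose: "F = fps_const (fps_nth F 0) + fps_X * fps_shift 1 F"
  for F :: "'b fps"
  by (rule fps_ext) auto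

text \<open>Splitting off the constant coefficient pushes the rest of the series one power up, so
  induction on \<open>k\<close> determines \<open>G\<close> by its values on constant
  series.\<close>

lemma series_linear_nth:
  assumes "series_linear B G" "F \<in> series B"
  shows "fps_nth (G F) k = (\<Sum>i\<le>k. fps_nth (G (fps_const (fps_nth F i))) (k - i))"
  using assms(2)
proof (induction k arbitrary: F)
  case (0 F)
  have "G F = G (fps_const (fps_nth F 0)) + fps_X * G (fps_shift 1 F)"
    using assms(1) 0 unfolding series_linear_def
    by (metis fps_decompose series_X series_const series_nth series_shift)
  then show ?case by simp
next
  case (Suc k F)
  have "G F = G (fps_const (fps_nth F 0)) + fps_X * G (fps_shift 1 F)"
    using assms(1) Suc.prems unfolding series_linear_def
    by (metis fps_decompose series_X series_const series_nth series_shift)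
  then have "fps_nth (G F) (Suc k) = fps_nth (G (fps_const (fps_nth F 0))) (Suc k) + fps_nth (G (fps_shift 1 F)) k"
    by simp
  also have "fps_nth (G (fps_shift 1 F)) k = (\<Sum>i\<le>k. fps_nth (G (fps_const (fps_nth F (Suc i)))) (k - i))"
    using Suc.IH[of "fps_shift 1 F"] Suc.prems by simp
  finally show ?case by (simp only: sum.atMost_Suc_shift) simp
qed

lemma series_linear_eqI:
  assumes "series_linear B G" "series_linear B H" "\<And>f. f \<in> B \<Longrightarrow> G (fps_const f) = H (fps_const f)"
    "F \<in> series B"
  shows "G F = H F"
proof (rule fps_ext)
  show "fps_nth (G F) k = fps_nth (H F) k" for k
    unfolding series_linear_nth[OF assms(1,4)] series_linear_nth[OF assms(2,4)]
    using assms(3) series_nth[OF assms(4)] by simp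
qed

lemma series_linear_compose:
  "series_linear B G \<Longrightarrow> series_linear B H \<Longrightarrow> series_linear B (\<lambda>F. G (H F))"
  by (simp add: series_linear_def)

lemma app_const: "(\<And>i. \<tau> i 0 = 0) \<Longrightarrow> fps_nth (app \<tau> (fps_const f)) k = \<tau> k f"
  by (simp add: app_def) (subst sum.cong[OF refl, of _ _ "\<lambda>i. if i = k then \<tau> i f else 0"], auto)

lemma series_linear_app:
  assumes "\<And>i f. f \<in> B \<Longrightarrow> \<tau> i f \<in> B" "\<And>i f g. f \<in> B \<Longrightarrow> g \<in> B \<Longrightarrow> \<tau> i (f + g) = \<tau> i f + \<tau> i g"
  shows "series_linear B (app \<tau>)"
proof -
  have z: "\<tau> i 0 = 0" for i using assms(2)[of 0 0 i] by simp
  have X: "app \<tau> (fps_X * F) = fps_X * app \<tau> F" for F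
  proof (rule fps_ext)
    fix k
    show "fps_nth (app \<tau> (fps_X * F)) k = fps_nth (fps_X * app \<tau> F) k"
    proof (cases k)
      case (Suc l)
      have "(\<Sum>i\<le>Suc l. \<tau> i (fps_nth (fps_X * F) (Suc l - i))) =
          (\<Sum>i\<le>l. \<tau> i (fps_nth (fps_X * F) (Suc l - i)))" by (simp add: z)
      also have "\<dots> = (\<Sum>i\<le>l. \<tau> i (fps_nth F (l - i)))"
        by (rule sum.cong) (auto simp: Suc_diff_le)
      finally show ?thesis by (simp add: Suc app_def)
    qed (simp add: app_def z)
  qed
  have "app \<tau> (F + G) = app \<tau> F + app \<tau> G" if "F \<in> series B" "G \<in> series B" for F G
    by (rule fps_ext) (use that assms in \<open>simp add: app_def series_nth sum.distrib\<close>)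
  moreover have "app \<tau> F \<in> series B" if "F \<in> series B" for F
    using assms(1) that by (auto simp: app_def series_nth intro!: seriesI sum_mem)
  ultimately show ?thesis using X by (simp add: series_linear_def)
qed

lemma star_of_eq_app1: "star_of C F G = Abs_fps (\<lambda>k. \<Sum>i\<le>k. fps_nth (app (\<lambda>j. C j (fps_nth F i)) G) (k - i))"
proof -
  have "(\<Sum>j\<le>m. C (m - j) a (fps_nth G j)) = (\<Sum>i\<le>m. C i a (fps_nth G (m - i)))" for m a
    by (rule sum.reindex_bij_witness[of _ "\<lambda>i. m - i" "\<lambda>i. m - i"]) auto
  then show ?thesis unfolding star_of_def app_def fps_nth_Abs_fps by (simp only:)
qed

lemma star_of_flip: "star_of C F G = star_of (\<lambda>r f g. C r g f) G F"
proof (rule fps_ext)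
  fix k
  have "(\<Sum>i\<le>k. \<Sum>j\<le>k - i. C (k - i - j) (fps_nth F i) (fps_nth G j)) =
    (\<Sum>(i, j)\<in>(SIGMA i:{..k}. {..k - i}). C (k - i - j) (fps_nth F i) (fps_nth G j))"
    by (subst sum.Sigma) auto
  also have "\<dots> = (\<Sum>(i, j)\<in>(SIGMA i:{..k}. {..k - i}). C (k - i - j) (fps_nth F j) (fps_nth G i))"
    by (rule sum.reindex_bij_witness[of _ prod.swap prod.swap]) (auto simp: add.commute)
  also have "\<dots> = (\<Sum>i\<le>k. \<Sum>j\<le>k - i. C (k - i - j) (fps_nth F j) (fps_nth G i))"
    by (subst sum.Sigma) auto
  finally show "fps_nth (star_of C F G) k = fps_nth (star_of (\<lambda>r f g. C r g f) G F) k"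
    by (simp add: star_of_def)
qed

definition biadditive :: "(nat \<Rightarrow> 'b \<Rightarrow> 'b \<Rightarrow> 'b) \<Rightarrow> bool" where
  "biadditive C \<longleftrightarrow> (\<forall>r. \<forall>f\<in>B. \<forall>g\<in>B. C r f g \<in> B \<and>
     (\<forall>h\<in>B. C r (f + g) h = C r f h + C r g h \<and> C r h (f + g) = C r h f + C r h g))"

lemma biadditive_flip: "biadditive C \<Longrightarrow> biadditive (\<lambda>r f g. C r g f)"
  by (simp add: biadditive_def)

lemma biadditive_0: "biadditive C \<Longrightarrow> f \<in> B \<Longrightarrow> C r 0 f = 0 \<and> C r f 0 = 0"
  unfolding biadditive_def using zero_mem by (metis add.right_neutral add_cancel_right_right)

lemma series_linear_star2:
  assumes C: "biadditive C" and F: "F \<in> series B"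
  shows "series_linear B (star_of C F)"
proof -
  have L: "series_linear B (app (\<lambda>j. C j f))" if "f \<in> B" for f
    using C that by (intro series_linear_app) (auto simp: biadditive_def)
  have X: "star_of C F (fps_X * G) = fps_X * star_of C F G" if G: "G \<in> series B" for G
  proof (rule fps_ext)
    fix k
    have A: "app (\<lambda>j. C j (fps_nth F i)) (fps_X * G) = fps_X * app (\<lambda>j. C j (fps_nth F i)) G" for i
      using L[OF series_nth[OF F]] G by (simp add: series_linear_def)
    show "fps_nth (star_of C F (fps_X * G)) k = fps_nth (fps_X * star_of C F G) k"
    proof (cases k)
      case (Suc l)
      have "(\<Sum>i\<le>Suc l. fps_nth (fps_X * app (\<lambda>j. C j (fps_nth F i)) G) (Suc l - i)) =
         (\<Sum>i\<le>l. fps_nth (fps_X * app (\<lambda>j. C j (fps_nth F i)) G) (Suc l - i))" by simp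
      also have "\<dots> = (\<Sum>i\<le>l. fps_nth (app (\<lambda>j. C j (fps_nth F i)) G) (l - i))"
        by (rule sum.cong) (auto simp: Suc_diff_le)
      finally show ?thesis by (simp add: Suc star_of_eq_app1 A)
    qed (simp add: star_of_eq_app1 A)
  qed
  have "star_of C F (G + H) = star_of C F G + star_of C F H" if "G \<in> series B" "H \<in> series B" for G H
    using that L[OF series_nth[OF F]] unfolding star_of_eq_app1 series_linear_def
    by (intro fps_ext) (simp add: sum.distrib)
  moreover have "star_of C F G \<in> series B" if "G \<in> series B" for G
    using L[OF series_nth[OF F]] that
    unfolding star_of_eq_app1 series_linear_def by (intro seriesI) (simp add: series_nth)
  ultimately show ?thesis using X by (simp add: series_linear_def)
qed

lemma series_linear_star1:
  "biadditive C \<Longrightarrow> G \<in> series B \<Longrightarrow> series_linear B (\<lambda>F. star_of C F G)"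
  using series_linear_star2[OF biadditive_flip] by (subst star_of_flip)

lemma star_of_series: "biadditive C \<Longrightarrow> F \<in> series B \<Longrightarrow> G \<in> series B \<Longrightarrow> star_of C F G \<in> series B"
  using series_linear_star2 unfolding series_linear_def by blast

lemma star_of_const2:
  assumes "biadditive C" "F \<in> series B" "g \<in> B"
  shows "fps_nth (star_of C F (fps_const g)) k = (\<Sum>i\<le>k. C (k - i) (fps_nth F i) g)"
proof -
  have "fps_nth (app (\<lambda>j. C j a) (fps_const g)) k = C k a g" if "a \<in> B" for a k
    by (rule app_const) (use biadditive_0[OF assms(1) that] in auto)
  then show ?thesis using series_nth[OF assms(2)] by (simp add: star_of_eq_app1)
qed

lemma star_of_const1:
  assumes "biadditive C" "F \<in> series B" "g \<in> B"
  shows "fps_nth (star_of C (fps_const g) F) k = (\<Sum>i\<le>k. C (k - i) g (fps_nth F i))"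
  using star_of_const2[OF biadditive_flip[OF assms(1)] assms(2,3)] by (subst star_of_flip)

lemma star_of_const:
  assumes "biadditive C" "f \<in> B" "g \<in> B"
  shows "fps_nth (star_of C (fps_const f) (fps_const g)) k = C k f g"
proof -
  have "(\<Sum>i\<le>k. C (k - i) (if i = 0 then f else 0) g) = (\<Sum>i\<le>k. if i = 0 then C k f g else 0)"
    by (rule sum.cong) (use biadditive_0[OF assms(1,3)] in auto)
  then show ?thesis using assms by (simp add: star_of_const2)
qed

lemma bilinear_eqI:
  assumes "\<And>F. F \<in> series B \<Longrightarrow> series_linear B (P F)" "\<And>G. G \<in> series B \<Longrightarrow> series_linear B (\<lambda>F. P F G)"
    and "\<And>F. F \<in> series B \<Longrightarrow> series_linear B (Q F)" "\<And>G. G \<in> series B \<Longrightarrow> series_linear B (\<lambda>F. Q F G)"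
    and "\<And>f g. f \<in> B \<Longrightarrow> g \<in> B \<Longrightarrow> P (fps_const f) (fps_const g) = Q (fps_const f) (fps_const g)"
    and "F \<in> series B" "G \<in> series B"
  shows "P F G = Q F G"
proof (rule series_linear_eqI[OF assms(1,3)[OF assms(6)] _ assms(7)])
  fix g assume g: "g \<in> B"
  show "P F (fps_const g) = Q F (fps_const g)"
    by (rule series_linear_eqI[OF assms(2,4) assms(5) assms(6)]) (use g in auto)
qed

text \<open>The sums are the coefficients of the two bracketings of constant series. Both
  bracketings are additive and compatible with the formal variable in each argument, so equality on
  constants spreads to all series: first in two arguments together, then in the third.\<close>

lemma star_of_assoc_iff:
  assumes C: "biadditive C"
  shows "(\<forall>F\<in>series B. \<forall>G\<in>series B. \<forall>H\<in>series B.
      star_of C (star_of C F G) H = star_of C F (star_of C G H)) \<longleftrightarrow>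
    (\<forall>r. \<forall>f\<in>B. \<forall>g\<in>B. \<forall>h\<in>B. (\<Sum>i\<le>r. C i (C (r - i) f g) h) = (\<Sum>i\<le>r. C i f (C (r - i) g h)))"
  (is "?L \<longleftrightarrow> ?R")
proof -
  have 1: "fps_nth (star_of C (star_of C (fps_const f) (fps_const g)) (fps_const h)) r = (\<Sum>i\<le>r. C i (C (r - i) f g) h)"
    if "f \<in> B" "g \<in> B" "h \<in> B" for f g h r
  proof -
    have "(\<Sum>i\<le>r. C (r - i) (C i f g) h) = (\<Sum>i\<le>r. C i (C (r - i) f g) h)"
      by (rule sum.reindex_bij_witness[of _ "\<lambda>i. r - i" "\<lambda>i. r - i"]) auto
    then show ?thesis
      using that by (simp only: star_of_const2[OF C star_of_series[OF C]] star_of_const[OF C] series_const)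
  qed
  have 2: "fps_nth (star_of C (fps_const f) (star_of C (fps_const g) (fps_const h))) r = (\<Sum>i\<le>r. C i f (C (r - i) g h))"
    if "f \<in> B" "g \<in> B" "h \<in> B" for f g h r
  proof -
    have "(\<Sum>i\<le>r. C (r - i) f (C i g h)) = (\<Sum>i\<le>r. C i f (C (r - i) g h))"
      by (rule sum.reindex_bij_witness[of _ "\<lambda>i. r - i" "\<lambda>i. r - i"]) auto
    then show ?thesis
      using that by (simp only: star_of_const1[OF C star_of_series[OF C]] star_of_const[OF C] series_const)
  qed
  show ?thesis
  proof
    assume L: ?L
    show ?R
    proof (intro allI ballI)
      fix r f g h assume f: "f \<in> B" "g \<in> B" "h \<in> B"
      then have "star_of C (star_of C (fps_const f) (fps_const g)) (fps_const h) =
          star_of C (fps_const f) (star_of C (fps_const g) (fps_const h))" using L by simp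
      then show "(\<Sum>i\<le>r. C i (C (r - i) f g) h) = (\<Sum>i\<le>r. C i f (C (r - i) g h))"
        using 1[OF f, of r] 2[OF f, of r] by simp
    qed
  next
    assume R: ?R
    have cc: "star_of C (star_of C (fps_const f) (fps_const g)) (fps_const h) =
        star_of C (fps_const f) (star_of C (fps_const g) (fps_const h))"
      if "f \<in> B" "g \<in> B" "h \<in> B" for f g h
      by (rule fps_ext) (use R that in \<open>simp add: 1 2\<close>)
    note sl = series_linear_star1[OF C] series_linear_star2[OF C] star_of_series[OF C]
    have c: "star_of C (star_of C F G) (fps_const h) = star_of C F (star_of C G (fps_const h))"
      if "F \<in> series B" "G \<in> series B" "h \<in> B" for F G h
    proof (rule bilinear_eqI[where P = "\<lambda>F G. star_of C (star_of C F G) (fps_const h)"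
          and Q = "\<lambda>F G. star_of C F (star_of C G (fps_const h))"])
      fix F assume F: "F \<in> series B"
      show "series_linear B (\<lambda>G. star_of C (star_of C F G) (fps_const h))"
        by (rule series_linear_compose[where G = "\<lambda>K. star_of C K (fps_const h)"]) (use F that sl in auto)
      show "series_linear B (\<lambda>G. star_of C F (star_of C G (fps_const h)))"
        by (rule series_linear_compose[where G = "star_of C F" and H = "\<lambda>G. star_of C G (fps_const h)"]) (use F that sl in auto)
      show "series_linear B (\<lambda>G. star_of C (star_of C G F) (fps_const h))"
        by (rule series_linear_compose[where G = "\<lambda>K. star_of C K (fps_const h)" and H = "\<lambda>G. star_of C G F"]) (use F that sl in auto)
      show "series_linear B (\<lambda>G. star_of C G (star_of C F (fps_const h)))"
        using F that sl by auto
    qed (use that cc in auto)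
    show ?L
    proof (intro ballI)
      fix F G H assume F: "F \<in> series B" "G \<in> series B" "H \<in> series B"
      show "star_of C (star_of C F G) H = star_of C F (star_of C G H)"
        by (rule series_linear_eqI[OF sl(2) series_linear_compose[OF sl(2) sl(2)] c F(3)])
          (use F sl in auto)
    qed
  qed
qed

end

context diff_algebra begin

sublocale additive_set B
  by unfold_locales auto

section \<open>Operators of some finite order\<close>

definition is_diffop :: "('b \<Rightarrow> 'b) \<Rightarrow> bool" where
  "is_diffop P \<longleftrightarrow> (\<exists>m. diffop m P)"

definition is_bidiffop :: "('b \<Rightarrow> 'b \<Rightarrow> 'b) \<Rightarrow> bool" where
  "is_bidiffop Z \<longleftrightarrow> (\<exists>w. bidiffop w Z)"

lemma is_diffop_cong: "(\<And>f. f \<in> B \<Longrightarrow> P f = Q f) \<Longrightarrow> is_diffop P \<longleftrightarrow> is_diffop Q"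
  unfolding is_diffop_def using diffop_cong by blast

lemma is_bidiffop_cong:
  "(\<And>f g. f \<in> B \<Longrightarrow> g \<in> B \<Longrightarrow> Z f g = Z' f g) \<Longrightarrow> is_bidiffop Z \<longleftrightarrow> is_bidiffop Z'"
  unfolding is_bidiffop_def using bidiffop_cong by blast

lemma is_diffop_B: "is_diffop P \<Longrightarrow> f \<in> B \<Longrightarrow> P f \<in> B"
  unfolding is_diffop_def using diffop_B by blast

lemma is_diffop_zero [simp]: "is_diffop (\<lambda>f. 0)"
  unfolding is_diffop_def using diffop_zero by blast

lemma is_diffop_id [simp]: "is_diffop (\<lambda>f. f)"
  unfolding is_diffop_def using diffop_mult[of 1] by auto

lemma is_diffop_add: "is_diffop P \<Longrightarrow> is_diffop Q \<Longrightarrow> is_diffop (\<lambda>f. P f + Q f)"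
  unfolding is_diffop_def using diffop_add diffop_mono by (meson max.cobounded1 max.cobounded2)

lemma is_diffop_minus: "is_diffop P \<Longrightarrow> is_diffop (\<lambda>f. - P f)"
  unfolding is_diffop_def using diffop_minus by blast

lemma is_diffop_lmult: "b \<in> B \<Longrightarrow> is_diffop P \<Longrightarrow> is_diffop (\<lambda>f. b * P f)"
  unfolding is_diffop_def using diffop_lmult by blast

lemma is_diffop_d: "i < n \<Longrightarrow> is_diffop P \<Longrightarrow> is_diffop (\<lambda>f. P (d i f))"
  unfolding is_diffop_def using diffop_d by blast

lemma is_diffop_sum: "(\<And>i. i \<in> I \<Longrightarrow> is_diffop (P i)) \<Longrightarrow> is_diffop (\<lambda>f. \<Sum>i\<in>I. P i f)"
  by (induction I rule: infinite_finite_induct) (auto intro: is_diffop_add)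

lemma is_diffop_comp: "is_diffop P \<Longrightarrow> is_diffop Q \<Longrightarrow> is_diffop (\<lambda>f. P (Q f))"
  unfolding is_diffop_def using diffop_comp diffop_Suc by meson

lemma is_diffop_additive: "is_diffop P \<Longrightarrow> f \<in> B \<Longrightarrow> g \<in> B \<Longrightarrow> P (f + g) = P f + P g"
  unfolding is_diffop_def using diffop_additive by blast

lemma is_bidiffop_B: "is_bidiffop Z \<Longrightarrow> f \<in> B \<Longrightarrow> g \<in> B \<Longrightarrow> Z f g \<in> B"
  unfolding is_bidiffop_def using bidiffop_B by blast

lemma is_bidiffop_times: "is_bidiffop (\<lambda>f g. f * g)"
  unfolding is_bidiffop_def using bidiffop_times by blast

lemma is_bidiffop_zero [simp]: "is_bidiffop (\<lambda>f g. 0)"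
  unfolding is_bidiffop_def using bidiffop_zero by blast

lemma is_bidiffop_add: "is_bidiffop Z \<Longrightarrow> is_bidiffop Z' \<Longrightarrow> is_bidiffop (\<lambda>f g. Z f g + Z' f g)"
  unfolding is_bidiffop_def using bidiffop_add bidiffop_mono by (meson max.cobounded1 max.cobounded2)

lemma is_bidiffop_lmult: "b \<in> B \<Longrightarrow> is_bidiffop Z \<Longrightarrow> is_bidiffop (\<lambda>f g. b * Z f g)"
  unfolding is_bidiffop_def using bidiffop_lmult by blast

lemma is_bidiffop_sum: "(\<And>i. i \<in> I \<Longrightarrow> is_bidiffop (Z i)) \<Longrightarrow> is_bidiffop (\<lambda>f g. \<Sum>i\<in>I. Z i f g)"
  by (induction I rule: infinite_finite_induct) (auto intro: is_bidiffop_add)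

lemma is_bidiffop_sub:
  "is_diffop P \<Longrightarrow> is_diffop Q \<Longrightarrow> is_bidiffop Z \<Longrightarrow> is_bidiffop (\<lambda>f g. Z (P f) (Q g))"
  unfolding is_diffop_def is_bidiffop_def
  using bidiffop_sub2[OF diffop_Suc bidiffop_sub1[OF diffop_Suc]] by blast

lemma is_bidiffop_post: "is_diffop P \<Longrightarrow> is_bidiffop Z \<Longrightarrow> is_bidiffop (\<lambda>f g. P (Z f g))"
  unfolding is_diffop_def is_bidiffop_def using bidiffop_post[OF diffop_Suc] by blast

lemma diffop_st: "diffop m P \<Longrightarrow> diffop m (\<lambda>f. st (P (st f)))"
proof (induction m arbitrary: P)
  case 0
  then show ?case by simp
next
  case (Suc m)
  obtain c P' where P: "c \<in> B" "\<And>i. i < n \<Longrightarrow> diffop m (P' i)"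
    "\<And>f. f \<in> B \<Longrightarrow> P f = c * f + (\<Sum>i<n. P' i (d i f))" using Suc.prems(1) by (elim diffop_SucE) auto
  show ?case
    by (rule diffop_SucI[where b = "st c" and Q = "\<lambda>i f. st (P' i (st f))"])
      (use P Suc.IH in \<open>auto simp: st_d\<close>)
qed

definition hermitian_op :: "('b \<Rightarrow> 'b) \<Rightarrow> bool" where
  "hermitian_op P \<longleftrightarrow> (\<forall>f\<in>B. P (st f) = st (P f))"

section \<open>Star products and gauge transformations\<close>

definition star_coeffs :: "(nat \<Rightarrow> 'b \<Rightarrow> 'b \<Rightarrow> 'b) \<Rightarrow> bool" where
  "star_coeffs C \<longleftrightarrow>
     (\<forall>f\<in>B. \<forall>g\<in>B. C 0 f g = f * g) \<and> (\<forall>r. is_bidiffop (C r)) \<and>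
     (\<forall>r. \<forall>f\<in>B. \<forall>g\<in>B. \<forall>h\<in>B. (\<Sum>i\<le>r. C i (C (r - i) f g) h) = (\<Sum>i\<le>r. C i f (C (r - i) g h))) \<and>
     (\<forall>r. \<forall>f\<in>B. \<forall>g\<in>B. st (C r f g) = C r (st g) (st f))"

definition natural_at :: "(nat \<Rightarrow> 'b \<Rightarrow> 'b \<Rightarrow> 'b) \<Rightarrow> nat \<Rightarrow> bool" where
  "natural_at C r \<longleftrightarrow> (\<forall>f\<in>B. diffop (Suc r) (C r f) \<and> diffop (Suc r) (\<lambda>g. C r g f))"

context
  fixes C assumes C: "star_coeffs C"
begin

lemma star_0: "f \<in> B \<Longrightarrow> g \<in> B \<Longrightarrow> C 0 f g = f * g"
  and star_bidiffop: "is_bidiffop (C r)"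
  and star_assoc: "f \<in> B \<Longrightarrow> g \<in> B \<Longrightarrow> h \<in> B \<Longrightarrow>
    (\<Sum>i\<le>r. C i (C (r - i) f g) h) = (\<Sum>i\<le>r. C i f (C (r - i) g h))"
  and star_herm: "f \<in> B \<Longrightarrow> g \<in> B \<Longrightarrow> st (C r f g) = C r (st g) (st f)"
  using C unfolding star_coeffs_def by auto

lemma star_B [simp]: "f \<in> B \<Longrightarrow> g \<in> B \<Longrightarrow> C r f g \<in> B"
  by (rule is_bidiffop_B[OF star_bidiffop])

lemma star_left: "\<exists>m. diffop m (C r f)" and star_right: "\<exists>m. diffop m (\<lambda>g. C r g f)" if "f \<in> B"
proof -
  obtain w where w: "bidiffop w (C r)" using star_bidiffop[of r] by (auto simp: is_bidiffop_def)
  show "\<exists>m. diffop m (C r f)" by (rule exI, rule diffop_bidiffop[OF w that])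
  show "\<exists>m. diffop m (\<lambda>g. C r g f)" by (rule exI, rule diffop_bidiffop'[OF w that])
qed

lemma star_add2: "f \<in> B \<Longrightarrow> g \<in> B \<Longrightarrow> h \<in> B \<Longrightarrow> C r f (g + h) = C r f g + C r f h"
  using star_left[of f r] diffop_additive by blast

lemma star_add1: "f \<in> B \<Longrightarrow> g \<in> B \<Longrightarrow> h \<in> B \<Longrightarrow> C r (f + g) h = C r f h + C r g h"
  using star_right[of h r] diffop_additive by blast

lemma star_diff1: "f \<in> B \<Longrightarrow> g \<in> B \<Longrightarrow> h \<in> B \<Longrightarrow> C r (f - g) h = C r f h - C r g h"
  using star_right[of h r] diffop_subtract by blast

lemma star_biadditive: "biadditive C"
  unfolding biadditive_def by (simp add: star_add1 star_add2)

lemma sum_atMost_ends: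
  fixes h :: "nat \<Rightarrow> 'b"
  assumes "r \<ge> 1"
  shows "(\<Sum>i\<le>r. h i) = h 0 + h r + (\<Sum>i\<in>{0<..<r}. h i)"
proof -
  have "{..r} = insert 0 (insert r {0<..<r})" using assms by auto
  then show ?thesis using assms by (simp add: add.assoc)
qed

text \<open>By associativity, the commutator of left multiplications is a left multiplication.\<close>

lemma left_left_commutator:
  assumes nat: "\<And>j. j < r \<Longrightarrow> natural_at C j" and r: "r \<ge> 1" and f: "f \<in> B" and g: "g \<in> B"
  shows "diffop r (\<lambda>h. (C r f (g * h) - g * C r f h) - (C r g (f * h) - f * C r g h))"
proof -
  have eq: "(C r f (g * h) - g * C r f h) - (C r g (f * h) - f * C r g h) =
      (\<Sum>i<r. C i (C (r - i) f g - C (r - i) g f) h)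
      - (\<Sum>i\<in>{0<..<r}. C i f (C (r - i) g h) - C (r - i) g (C i f h))" if h: "h \<in> B" for h
  proof -
    have 1: "(\<Sum>i\<le>r. C i f (C (r - i) g h)) - (\<Sum>i\<le>r. C i g (C (r - i) f h)) =
        (\<Sum>i\<le>r. C i (C (r - i) f g - C (r - i) g f) h)"
      using star_assoc[OF f g h, of r] star_assoc[OF g f h, of r]
      by (simp add: star_diff1 f g h sum_subtractf)
    have 2: "(\<Sum>i\<in>{0<..<r}. C i g (C (r - i) f h)) = (\<Sum>i\<in>{0<..<r}. C (r - i) g (C i f h))"
      by (rule sum.reindex_bij_witness[of _ "\<lambda>i. r - i" "\<lambda>i. r - i"]) auto
    \<comment> \<open>The term \<open>i = r\<close> vanishes because \<open>C 0\<close> is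
      commutative, so on this side only coefficients below \<open>r\<close> act on \<open>h\<close>,
      and these are natural.\<close>
    have 3: "(\<Sum>i\<le>r. C i (C (r - i) f g - C (r - i) g f) h) = (\<Sum>i<r. C i (C (r - i) f g - C (r - i) g f) h)"
    proof -
      have "C r 0 h = 0" using star_right[OF h] diffop_0 by blast
      moreover have "{..r} = insert r {..<r}" by auto
      ultimately show ?thesis using f g by (simp add: star_0 mult.commute)
    qed
    show ?thesis
      using 1 unfolding 3 sum_atMost_ends[OF r] 2 using f g h
      by (simp add: star_0 sum_subtractf algebra_simps)
  qed
  have A: "diffop r (C i c)" if "i < r" "c \<in> B" for i c
    using nat[OF that(1)] that diffop_mono[of "Suc i" "C i c" r] by (auto simp: natural_at_def)
  have "diffop r (\<lambda>h. \<Sum>i<r. C i (C (r - i) f g - C (r - i) g f) h)"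
    using f g by (intro diffop_sum A) auto
  \<comment> \<open>The two operators have orders at most \<open>i\<close> and \<open>r - i\<close>,
    so their commutator has order less than \<open>r\<close>.\<close>
  moreover have "diffop r (\<lambda>h. C i f (C (r - i) g h) - C (r - i) g (C i f h))" if "i \<in> {0<..<r}" for i
    using diffop_commutator[of i "C i f" "r - i" "C (r - i) g"] nat[of i] nat[of "r - i"] that f g
    by (auto simp: natural_at_def)
  ultimately have "diffop r (\<lambda>h. (\<Sum>i<r. C i (C (r - i) f g - C (r - i) g f) h)
      - (\<Sum>i\<in>{0<..<r}. C i f (C (r - i) g h) - C (r - i) g (C i f h)))"
    by (intro diffop_diff[OF _ diffop_sum])
  then show ?thesis by (subst diffop_cong[OF eq])
qed

text \<open>By associativity, left multiplications commute with right multiplications.\<close>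

lemma left_right_commutator:
  assumes nat: "\<And>j. j < r \<Longrightarrow> natural_at C j" and r: "r \<ge> 1" and f: "f \<in> B" and g: "g \<in> B"
  shows "diffop r (\<lambda>h. (C r (f * h) g - f * C r h g) - (C r f (g * h) - g * C r f h))"
proof -
  have eq: "(C r (f * h) g - f * C r h g) - (C r f (g * h) - g * C r f h) =
      (\<Sum>i\<in>{0<..<r}. C i f (C (r - i) h g) - C (r - i) (C i f h) g)" if h: "h \<in> B" for h
  proof -
    have 2: "(\<Sum>i\<in>{0<..<r}. C i (C (r - i) f h) g) = (\<Sum>i\<in>{0<..<r}. C (r - i) (C i f h) g)"
      by (rule sum.reindex_bij_witness[of _ "\<lambda>i. r - i" "\<lambda>i. r - i"]) auto
    show ?thesis
      using star_assoc[OF f h g, of r] unfolding sum_atMost_ends[OF r] 2 using f g h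
      by (simp add: star_0 sum_subtractf algebra_simps)
  qed
  have "diffop r (\<lambda>h. C i f (C (r - i) h g) - C (r - i) (C i f h) g)" if "i \<in> {0<..<r}" for i
    using diffop_commutator[of i "C i f" "r - i" "\<lambda>h. C (r - i) h g"] nat[of i] nat[of "r - i"] that f g
    by (auto simp: natural_at_def)
  then have "diffop r (\<lambda>h. \<Sum>i\<in>{0<..<r}. C i f (C (r - i) h g) - C (r - i) (C i f h) g)"
    by (intro diffop_sum)
  then show ?thesis by (subst diffop_cong[OF eq])
qed

text \<open>Up to order less than \<open>r\<close>, commuting \<open>C r f\<close> with
  \<open>x i\<close> is the same as commuting \<open>C r (x i)\<close> with \<open>f\<close>, which
  loses one order; the descent then bounds the order of \<open>C r f\<close>. Right multiplications
  by \<open>f\<close> are compared with left multiplications by \<open>x i\<close> in the same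
  way.\<close>

lemma natural_at_from_coordinates:
  assumes nat: "\<And>j. j < r \<Longrightarrow> natural_at C j" and r: "r \<ge> 1"
    and x: "\<And>i. i < n \<Longrightarrow> diffop (Suc r) (C r (x i))"
  shows "natural_at C r"
  unfolding natural_at_def
proof (intro ballI conjI)
  fix f assume f: "f \<in> B"
  show L: "diffop (Suc r) (C r f)"
  proof -
    obtain k where k: "diffop k (C r f)" using star_left[OF f] by blast
    have "diffop r (\<lambda>h. C r f (x i * h) - x i * C r f h)" if i: "i < n" for i
      using diffop_add[OF left_left_commutator[OF nat r f x_B[OF i]] diffop_commute_mult[OF x[OF i] f]]
      by simp
    then show ?thesis by (rule diffop_descend[OF _ k])
  qed
  obtain k where k: "diffop k (\<lambda>g. C r g f)" using star_right[OF f] by blast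
  have "diffop r (\<lambda>h. C r (x i * h) f - x i * C r h f)" if i: "i < n" for i
    using diffop_add[OF left_right_commutator[OF nat r x_B[OF i] f] diffop_commute_mult[OF x[OF i] f]]
    by simp
  then show "diffop (Suc r) (\<lambda>g. C r g f)" by (rule diffop_descend[OF _ k])
qed

end

text \<open>A Koszul-type argument: the primitive is, order by order, a multiple of the contraction of \<open>D\<close> with
  the derivations \<open>d\<close>.\<close>

lemma commutator_primitive:
  assumes "\<And>k. k < n \<Longrightarrow> diffop (Suc (r + s)) (D k)"
    "\<And>j k. j < n \<Longrightarrow> k < n \<Longrightarrow>
      diffop r (\<lambda>h. (D k (x j * h) - x j * D k h) - (D j (x k * h) - x k * D j h))"
  shows "\<exists>T. is_diffop T \<and> (\<forall>k<n. diffop (Suc r) (\<lambda>h. D k h - (T (x k * h) - x k * T h)))"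
  using assms
proof (induction s arbitrary: D)
  case 0
  then show ?case by (intro exI[of _ "\<lambda>h. 0"]) auto
next
  case (Suc s)
  define m where "m = r + s + 1"
  \<comment> \<open>The commutator of \<open>\<Sum>j. D j (d j h)\<close> with \<open>x k\<close> is
    \<open>D k\<close> plus the commutators of the \<open>D j\<close> with \<open>x k\<close>,
    applied to \<open>d j h\<close>. Exchanging \<open>j\<close> and \<open>k\<close> by the
    compatibility assumption and then using Euler's identity, these add up to \<open>m\<close> times
    \<open>D k\<close> modulo lower order; hence the normalization by \<open>m + 1\<close>.\<close>
  define c where "c = sc (1 / of_nat (Suc m))"
  have c: "c \<in> B" "c * of_nat (Suc m) = 1" by (simp_all add: c_def inverse_Suc del: of_nat_Suc)
  have D: "diffop (Suc m) (D k)" if "k < n" for k using Suc.prems(1)[OF that] by (simp add: m_def)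
  define T where "T = (\<lambda>h. c * (\<Sum>j<n. D j (d j h)))"
  have T: "is_diffop T"
    unfolding T_def using D by (intro is_diffop_lmult c is_diffop_sum is_diffop_d) (auto simp: is_diffop_def)
  then obtain t where t: "diffop t T" by (auto simp: is_diffop_def)
  let ?ad = "\<lambda>P k h. P (x k * h) - x k * P h"
  define D' where "D' = (\<lambda>k h. D k h - ?ad T k h)"
  have "diffop (Suc (r + s)) (D' k)" if k: "k < n" for k
  proof -
    have eq: "D' k h = - (c * ((\<Sum>j<n. D k (x j * d j h) - x j * D k (d j h)) - of_nat m * D k h))
        + c * (\<Sum>j<n. ?ad (D k) j (d j h) - ?ad (D j) k (d j h))" if h: "h \<in> B" for h
    proof -
      have 1: "D j (d j (x k * h)) = (if j = k then D k h else 0) + D j (x k * d j h)" if "j < n" for j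
        using that k h by (auto simp: d_mult d_x diffop_additive[OF D] diffop_0[OF D])
      have "?ad T k h = c * (D k h + (\<Sum>j<n. ?ad (D j) k (d j h)))"
      proof -
        have "(\<Sum>j<n. D j (d j (x k * h))) = D k h + (\<Sum>j<n. D j (x k * d j h))"
          using 1 k by (simp add: sum.distrib)
        then show ?thesis unfolding T_def by (simp add: sum_subtractf sum_distrib_left algebra_simps)
      qed
      moreover have "D k h = c * (of_nat (Suc m) * D k h)"
        using c(2) by (simp add: mult.assoc[symmetric] del: of_nat_Suc)
      moreover have "- (c * (a - of_nat m * y)) + c * (a - b) = y - c * (y + b)"
        if "y = c * (of_nat (Suc m) * y)" for a b y
        using that by (simp add: algebra_simps)
      ultimately show ?thesis unfolding D'_def sum_subtractf[of "\<lambda>j. ?ad (D k) j (d j h)"]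
        by simp
    qed
    have "diffop m (\<lambda>h. - (c * ((\<Sum>j<n. D k (x j * d j h) - x j * D k (d j h)) - of_nat m * D k h)))"
      by (intro diffop_minus diffop_lmult c diffop_Euler D k)
    moreover have "diffop m (\<lambda>h. c * (\<Sum>j<n. ?ad (D k) j (d j h) - ?ad (D j) k (d j h)))"
    proof (intro diffop_lmult c diffop_sum)
      fix j assume "j \<in> {..<n}"
      then have "diffop (Suc r) (\<lambda>h. ?ad (D k) j (d j h) - ?ad (D j) k (d j h))"
        using diffop_d[OF _ Suc.prems(2)[of j k]] k by simp
      then show "diffop m (\<lambda>h. ?ad (D k) j (d j h) - ?ad (D j) k (d j h))"
        by (rule diffop_mono) (simp add: m_def)
    qed
    ultimately have "diffop m (\<lambda>h. - (c * ((\<Sum>j<n. D k (x j * d j h) - x j * D k (d j h)) - of_nat m * D k h))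
        + c * (\<Sum>j<n. ?ad (D k) j (d j h) - ?ad (D j) k (d j h)))"
      by (rule diffop_add)
    then show ?thesis by (subst diffop_cong[OF eq]) (auto simp: m_def)
  qed
  \<comment> \<open>The corrections are commutators of a single operator \<open>T\<close> with
    multiplications that commute, so they satisfy the compatibility exactly and \<open>D'\<close>
    inherits it from \<open>D\<close>.\<close>
  moreover have "diffop r (\<lambda>h. ?ad (D' k) j h - ?ad (D' j) k h)" if jk: "j < n" "k < n" for j k
  proof -
    have "?ad (D' k) j h - ?ad (D' j) k h = ?ad (D k) j h - ?ad (D j) k h" if "h \<in> B" for h
      unfolding D'_def by (simp add: algebra_simps)
    with Suc.prems(2)[OF jk] show ?thesis by (simp cong: diffop_cong)
  qed
  ultimately obtain T' where T': "is_diffop T'"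
    "\<And>k. k < n \<Longrightarrow> diffop (Suc r) (\<lambda>h. D' k h - (T' (x k * h) - x k * T' h))"
    using Suc.IH[of D'] by blast
  show ?case
  proof (intro exI[of _ "\<lambda>h. T h + T' h"] conjI allI impI)
    show "is_diffop (\<lambda>h. T h + T' h)" using T T' by (intro is_diffop_add)
    show "diffop (Suc r) (\<lambda>h. D k h - (T (x k * h) + T' (x k * h) - x k * (T h + T' h)))" if "k < n" for k
      using T'(2)[OF that] by (simp add: D'_def algebra_simps)
  qed
qed

text \<open>The operators \<open>C r (x k)\<close> satisfy the compatibility of
  \<open>commutator_primitive\<close> by \<open>left_left_commutator\<close>, so they are
  commutators with one operator \<open>T\<close> up to the natural order. Averaging \<open>T\<close>
  with its conjugate makes it Hermitian; that the conjugate does equally well is a comparison of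
  left and right multiplications.\<close>

lemma naturalizing_operator:
  assumes C: "star_coeffs C" and nat: "\<And>j. j < r \<Longrightarrow> natural_at C j" and r: "r \<ge> 1"
  shows "\<exists>T. is_diffop T \<and> hermitian_op T \<and>
    (\<forall>k<n. diffop (Suc r) (\<lambda>h. C r (x k) h - (T (x k * h) - x k * T h)))"
proof -
  obtain w where w: "bidiffop w (C r)" using star_bidiffop[OF C, of r] by (auto simp: is_bidiffop_def)
  have "diffop (Suc (r + w)) (C r (x k))" if "k < n" for k
    by (rule diffop_mono[OF diffop_bidiffop[OF w]]) (use that in auto)
  moreover have LL: "diffop r (\<lambda>h. (C r (x k) (x j * h) - x j * C r (x k) h) - (C r (x j) (x k * h) - x k * C r (x j) h))"
    if "j < n" "k < n" for j k
    by (rule left_left_commutator[OF C nat r]) (use that in auto)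
  ultimately obtain T where T: "is_diffop T"
    "\<And>k. k < n \<Longrightarrow> diffop (Suc r) (\<lambda>h. C r (x k) h - (T (x k * h) - x k * T h))"
    using commutator_primitive[of r w "\<lambda>k. C r (x k)"] by blast
  obtain t where t: "diffop t T" using T by (auto simp: is_diffop_def)
  define T' where "T' = (\<lambda>h. st (T (st h)))"
  have T': "diffop t T'" unfolding T'_def by (rule diffop_st[OF t])
  have "diffop (Suc r) (\<lambda>h. C r (x k) h - (T' (x k * h) - x k * T' h))" if k: "k < n" for k
  proof -
    have "diffop (Suc r) (\<lambda>h. st (C r (x k) (st h) - (T (x k * st h) - x k * T (st h))))"
      by (rule diffop_st[OF T(2)[OF k]])
    moreover have "st (C r (x k) (st h) - (T (x k * st h) - x k * T (st h))) =
        C r h (x k) - (T' (x k * h) - x k * T' h)" if "h \<in> B" for h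
      using that k unfolding T'_def by (simp add: star_herm[OF C])
    ultimately have R: "diffop (Suc r) (\<lambda>h. C r h (x k) - (T' (x k * h) - x k * T' h))"
      by (simp cong: diffop_cong)
    \<comment> \<open>Conjugation has turned the left multiplication by \<open>x k\<close> into the
      right one. The two differ by order at most \<open>r\<close>, because their commutators with
      every \<open>x i\<close> agree up to order less than \<open>r\<close>.\<close>
    have RL: "diffop (Suc r) (\<lambda>h. C r (x k) h - C r h (x k))"
    proof (rule diffop_descend)
      show "diffop w (\<lambda>h. C r (x k) h - C r h (x k))"
        by (intro diffop_diff diffop_bidiffop[OF w] diffop_bidiffop'[OF w]) (use k in auto)
      fix i assume i: "i < n"
      have "diffop r (\<lambda>h. - ((C r (x i * h) (x k) - x i * C r h (x k)) - (C r (x i) (x k * h) - x k * C r (x i) h)))"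
        by (intro diffop_minus left_right_commutator[OF C nat r]) (use i k in auto)
      from diffop_add[OF LL[OF i k] this]
      show "diffop r (\<lambda>h. C r (x k) (x i * h) - C r (x i * h) (x k) - x i * (C r (x k) h - C r h (x k)))"
        by (simp add: algebra_simps)
    qed
    show ?thesis using diffop_add[OF RL R] by (simp only: add_diff_eq diff_add_cancel)
  qed
  note T'2 = this
  let ?T = "\<lambda>h. sc (1/2) * (T h + T' h)"
  have half: "sc (1/2) * a + sc (1/2) * a = a" for a
    by (simp add: distrib_right[symmetric] sc_add[symmetric])
  show ?thesis
  proof (intro exI[of _ ?T] conjI allI impI)
    show "is_diffop ?T" using T T' by (intro is_diffop_lmult is_diffop_add) (auto simp: is_diffop_def)
    show "hermitian_op ?T" by (simp add: hermitian_op_def T'_def add.commute)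
    fix k assume k: "k < n"
    have "diffop (Suc r) (\<lambda>h. sc (1/2) * (C r (x k) h - (T (x k * h) - x k * T h))
        + sc (1/2) * (C r (x k) h - (T' (x k * h) - x k * T' h)))"
      by (intro diffop_add diffop_lmult T(2) T'2 k) auto
    moreover have "sc (1/2) * (C r (x k) h - (T (x k * h) - x k * T h))
        + sc (1/2) * (C r (x k) h - (T' (x k * h) - x k * T' h)) =
        C r (x k) h - (?T (x k * h) - x k * ?T h)" for h
    proof -
      have "sc (1/2) * (C r (x k) h - (T (x k * h) - x k * T h))
        + sc (1/2) * (C r (x k) h - (T' (x k * h) - x k * T' h)) =
        (sc (1/2) * C r (x k) h + sc (1/2) * C r (x k) h) - (?T (x k * h) - x k * ?T h)"
        by (simp add: algebra_simps)
      then show ?thesis by (simp only: half)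
    qed
    ultimately show "diffop (Suc r) (\<lambda>h. C r (x k) h - (?T (x k * h) - x k * ?T h))"
      by (simp only:)
  qed
qed


section \<open>Inverse series of operators and transport of the product\<close>

function inverse_ops :: "(nat \<Rightarrow> 'b \<Rightarrow> 'b) \<Rightarrow> nat \<Rightarrow> 'b \<Rightarrow> 'b" where
  "inverse_ops \<tau> k f = (if k = 0 then f else - (\<Sum>i<k. \<tau> (k - i) (inverse_ops \<tau> i f)))"
  by auto
termination by (relation "Wellfounded.measure (\<lambda>(\<tau>, k, f). k)") auto

declare inverse_ops.simps [simp del]

text \<open>The \<open>r\<close>-th coefficient of the transported product: apply the inverse of
  \<open>\<tau>\<close> to both arguments, multiply, apply \<open>\<tau>\<close>. The
  \<open>inverse_ops\<close> are the coefficients of the inverse series, obtained by solving for it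
  order by order from \<open>\<tau> 0 = id\<close>.\<close>

definition gauge :: "(nat \<Rightarrow> 'b \<Rightarrow> 'b) \<Rightarrow> (nat \<Rightarrow> 'b \<Rightarrow> 'b \<Rightarrow> 'b) \<Rightarrow> nat \<Rightarrow> 'b \<Rightarrow> 'b \<Rightarrow> 'b" where
  "gauge \<tau> C r f g = (\<Sum>i\<le>r. \<tau> i (\<Sum>a\<le>r - i. \<Sum>b\<le>r - i - a.
     C (r - i - a - b) (inverse_ops \<tau> a f) (inverse_ops \<tau> b g)))"

lemma inverse_ops_cong:
  "(\<And>i. i \<le> k \<Longrightarrow> \<tau> i = \<tau>' i) \<Longrightarrow> inverse_ops \<tau> k f = inverse_ops \<tau>' k f"
proof (induction k rule: less_induct)
  case (less k)
  have "\<tau> (k - i) (inverse_ops \<tau> i f) = \<tau>' (k - i) (inverse_ops \<tau>' i f)" if "i < k" for i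
    using less.IH[OF that] less.prems that by simp
  then show ?case by (subst (1 2) inverse_ops.simps) auto
qed

text \<open>Coefficient \<open>r\<close> of the transported product sees only \<open>\<tau>\<close>
  up to index \<open>r\<close>; this is what allows a gauge transformation to be chosen order by
  order.\<close>

lemma gauge_cong:
  assumes "\<And>i. i \<le> r \<Longrightarrow> \<tau> i = \<tau>' i"
  shows "gauge \<tau> C r = gauge \<tau>' C r"
proof -
  have "inverse_ops \<tau> a f = inverse_ops \<tau>' a f" if "a \<le> r" for a f
    using assms that by (intro inverse_ops_cong) auto
  with assms show ?thesis unfolding gauge_def by (intro ext sum.cong) auto
qed

definition gauge_transformation :: "(nat \<Rightarrow> 'b \<Rightarrow> 'b) \<Rightarrow> bool" where
  "gauge_transformation \<tau> \<longleftrightarrow> \<tau> 0 = (\<lambda>f. f) \<and> (\<forall>i. is_diffop (\<tau> i) \<and> hermitian_op (\<tau> i))"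

context
  fixes \<tau> assumes gt: "gauge_transformation \<tau>"
begin

lemma gt_0: "\<tau> 0 f = f" and gt_diffop: "is_diffop (\<tau> i)"
  and gt_st: "f \<in> B \<Longrightarrow> \<tau> i (st f) = st (\<tau> i f)"
  using gt by (auto simp: gauge_transformation_def hermitian_op_def)

lemma gt_zero: "\<tau> i 0 = 0"
  using is_diffop_additive[OF gt_diffop, of 0 0 i] by simp

lemma inverse_diffop: "is_diffop (inverse_ops \<tau> k)"
proof (induction k rule: less_induct)
  case (less k)
  have "is_diffop (\<lambda>f. - (\<Sum>i<k. \<tau> (k - i) (inverse_ops \<tau> i f)))"
    by (intro is_diffop_minus is_diffop_sum is_diffop_comp[OF gt_diffop] less) auto
  then have "is_diffop (\<lambda>f. if k = 0 then f else - (\<Sum>i<k. \<tau> (k - i) (inverse_ops \<tau> i f)))"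
    by (cases "k = 0") auto
  then show ?case by (subst is_diffop_cong[OF inverse_ops.simps])
qed

lemma inverse_st: "f \<in> B \<Longrightarrow> inverse_ops \<tau> k (st f) = st (inverse_ops \<tau> k f)"
proof (induction k rule: less_induct)
  case (less k)
  have "\<tau> (k - i) (inverse_ops \<tau> i (st f)) = st (\<tau> (k - i) (inverse_ops \<tau> i f))" if "i < k" for i
    using less.IH[OF that less.prems] less.prems by (simp add: gt_st is_diffop_B[OF inverse_diffop])
  then show ?case by (subst (1 2) inverse_ops.simps) auto
qed

lemma inverse_zero: "inverse_ops \<tau> i 0 = 0"
  using is_diffop_additive[OF inverse_diffop, of 0 0 i] by simp

lemma linear_app_gt: "series_linear B (app \<tau>)"
  by (intro series_linear_app is_diffop_B[OF gt_diffop] is_diffop_additive[OF gt_diffop])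

lemma linear_app_inverse: "series_linear B (app (inverse_ops \<tau>))"
  by (intro series_linear_app is_diffop_B[OF inverse_diffop] is_diffop_additive[OF inverse_diffop])

lemma app_gt_series: "F \<in> series B \<Longrightarrow> app \<tau> F \<in> series B"
  and app_inverse_series: "F \<in> series B \<Longrightarrow> app (inverse_ops \<tau>) F \<in> series B"
  using linear_app_gt linear_app_inverse by (simp_all add: series_linear_def)

lemma app_gt_inverse:
  assumes "F \<in> series B"
  shows "app \<tau> (app (inverse_ops \<tau>) F) = F"
proof (rule series_linear_eqI[OF series_linear_compose[OF linear_app_gt linear_app_inverse] _ _ assms])
  show "series_linear B (\<lambda>F. F)" by (simp add: series_linear_def)
  fix f assume f: "f \<in> B"
  show "app \<tau> (app (inverse_ops \<tau>) (fps_const f)) = fps_const f"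
  proof (rule fps_ext)
    fix k
    have "fps_nth (app \<tau> (app (inverse_ops \<tau>) (fps_const f))) k = (\<Sum>i\<le>k. \<tau> i (inverse_ops \<tau> (k - i) f))"
      using app_const[of "inverse_ops \<tau>", OF inverse_zero] by (simp add: app_def[of \<tau>])
    also have "\<dots> = (\<Sum>i\<le>k. \<tau> (k - i) (inverse_ops \<tau> i f))"
      by (rule sum.reindex_bij_witness[of _ "\<lambda>i. k - i" "\<lambda>i. k - i"]) auto
    also have "\<dots> = (if k = 0 then f else 0)"
    proof (cases k)
      case 0
      then show ?thesis by (simp add: inverse_ops.simps[of \<tau> 0] gt_0)
    next
      case (Suc l)
      then have "{..k} = insert k {..<k}" by auto
      then show ?thesis using Suc by (simp add: gt_0) (subst inverse_ops.simps, simp)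
    qed
    finally show "fps_nth (app \<tau> (app (inverse_ops \<tau>) (fps_const f))) k = fps_nth (fps_const f) k" by simp
  qed
qed

lemma app_gt_injective:
  assumes F: "F \<in> series B" and 0: "app \<tau> F = 0"
  shows "F = 0"
proof -
  have "fps_nth F k = 0" for k
  proof (induction k rule: less_induct)
    case (less k)
    have "fps_nth (app \<tau> F) k = (\<Sum>i\<le>k. if i = 0 then fps_nth F k else 0)"
      unfolding app_def fps_nth_Abs_fps
      by (rule sum.cong) (use less in \<open>auto simp: gt_0 gt_zero\<close>)
    with 0 show ?case by simp
  qed
  then show ?thesis by (simp add: fps_ext)
qed

text \<open>A right inverse of an injective additive map is also a left inverse, so the recursion
  for \<open>inverse_ops\<close> is checked on one side only.\<close>

lemma app_inverse_gt:
  assumes F: "F \<in> series B"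
  shows "app (inverse_ops \<tau>) (app \<tau> F) = F"
proof -
  let ?G = "app (inverse_ops \<tau>) (app \<tau> F)"
  have G: "?G \<in> series B" and mF: "- F \<in> series B"
    using F app_gt_series app_inverse_series by (auto simp: series_def)
  have add: "app \<tau> (P + Q) = app \<tau> P + app \<tau> Q" if "P \<in> series B" "Q \<in> series B" for P Q
    using linear_app_gt that by (simp add: series_linear_def)
  have "app \<tau> (?G + - F) = app \<tau> F + app \<tau> (- F)"
    using add[OF G mF] app_gt_inverse[OF app_gt_series[OF F]] by simp
  also have "\<dots> = app \<tau> 0" using add[OF F mF] by simp
  also have "\<dots> = 0" by (rule fps_ext) (simp add: app_def gt_zero)
  finally have "?G + - F = 0" by (rule app_gt_injective[OF series_add[OF G mF]])
  then show ?thesis by simp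
qed

context
  fixes C assumes C: "star_coeffs C"
begin

lemma gauge_nth:
  assumes "f \<in> B" "g \<in> B"
  shows "fps_nth (app \<tau> (star_of C (app (inverse_ops \<tau>) (fps_const f)) (app (inverse_ops \<tau>) (fps_const g)))) r
    = gauge \<tau> C r f g"
  unfolding app_def[of \<tau>] gauge_def star_of_def
  by (simp add: app_const[of "inverse_ops \<tau>", OF inverse_zero] add.assoc)

lemma gauge_bidiffop: "is_bidiffop (gauge \<tau> C r)"
  unfolding gauge_def
  by (rule is_bidiffop_sum, rule is_bidiffop_post[OF gt_diffop], (rule is_bidiffop_sum)+,
      rule is_bidiffop_sub[OF inverse_diffop inverse_diffop star_bidiffop[OF C]])

lemma gauge_biadditive: "biadditive (gauge \<tau> C)"
  unfolding biadditive_def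
proof (intro allI ballI conjI)
  fix r f g h assume B: "f \<in> B" "g \<in> B" "h \<in> B"
  obtain w where w: "bidiffop w (gauge \<tau> C r)" using gauge_bidiffop by (auto simp: is_bidiffop_def)
  show "gauge \<tau> C r (f + g) h = gauge \<tau> C r f h + gauge \<tau> C r g h"
    "gauge \<tau> C r h (f + g) = gauge \<tau> C r h f + gauge \<tau> C r h g"
    using bidiffop_add1[OF w] bidiffop_add2[OF w] B by auto
qed (rule is_bidiffop_B[OF gauge_bidiffop])

lemma gauge_star:
  assumes "F \<in> series B" "G \<in> series B"
  shows "star_of (gauge \<tau> C) F G = app \<tau> (star_of C (app (inverse_ops \<tau>) F) (app (inverse_ops \<tau>) G))"
proof (rule bilinear_eqI[where P = "star_of (gauge \<tau> C)"
      and Q = "\<lambda>F G. app \<tau> (star_of C (app (inverse_ops \<tau>) F) (app (inverse_ops \<tau>) G))"])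
  note b = star_biadditive[OF C]
  show "series_linear B (star_of (gauge \<tau> C) F)" if "F \<in> series B" for F
    by (rule series_linear_star2[OF gauge_biadditive that])
  show "series_linear B (\<lambda>F. star_of (gauge \<tau> C) F G)" if "G \<in> series B" for G
    by (rule series_linear_star1[OF gauge_biadditive that])
  show "series_linear B (\<lambda>G. app \<tau> (star_of C (app (inverse_ops \<tau>) F) (app (inverse_ops \<tau>) G)))"
    if "F \<in> series B" for F
    by (rule series_linear_compose[OF linear_app_gt
        series_linear_compose[OF series_linear_star2[OF b app_inverse_series[OF that]] linear_app_inverse]])
  show "series_linear B (\<lambda>F. app \<tau> (star_of C (app (inverse_ops \<tau>) F) (app (inverse_ops \<tau>) G)))"
    if "G \<in> series B" for G
    by (rule series_linear_compose[OF linear_app_gt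
        series_linear_compose[OF series_linear_star1[OF b app_inverse_series[OF that]] linear_app_inverse]])
  show "star_of (gauge \<tau> C) (fps_const f) (fps_const g) =
      app \<tau> (star_of C (app (inverse_ops \<tau>) (fps_const f)) (app (inverse_ops \<tau>) (fps_const g)))"
    if "f \<in> B" "g \<in> B" for f g
    by (rule fps_ext) (use that in \<open>simp add: gauge_nth star_of_const[OF gauge_biadditive]\<close>)
qed (use assms in auto)

lemma gauge_st:
  assumes "f \<in> B" "g \<in> B"
  shows "st (gauge \<tau> C r f g) = gauge \<tau> C r (st g) (st f)"
proof -
  have B: "inverse_ops \<tau> a f \<in> B" "inverse_ops \<tau> a g \<in> B" for a
    using assms by (auto intro: is_diffop_B[OF inverse_diffop])
  have "st (gauge \<tau> C r f g) = (\<Sum>i\<le>r. \<tau> i (\<Sum>a\<le>r - i. \<Sum>b\<le>r - i - a.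
     C (r - i - a - b) (inverse_ops \<tau> b (st g)) (inverse_ops \<tau> a (st f))))"
    unfolding gauge_def st_sum using assms B
    by (intro sum.cong refl) (simp add: gt_st[symmetric] star_herm[OF C] inverse_st star_B[OF C])
  also have "\<dots> = gauge \<tau> C r (st g) (st f)"
  proof -
    have "(\<Sum>a\<le>m. \<Sum>b\<le>m - a. C (m - a - b) (inverse_ops \<tau> b (st g)) (inverse_ops \<tau> a (st f))) =
        (\<Sum>a\<le>m. \<Sum>b\<le>m - a. C (m - a - b) (inverse_ops \<tau> a (st g)) (inverse_ops \<tau> b (st f)))" for m
    proof -
      let ?F = "app (inverse_ops \<tau>) (fps_const (st f))" and ?G = "app (inverse_ops \<tau>) (fps_const (st g))"
      have "fps_nth (star_of (\<lambda>r f g. C r g f) ?F ?G) m = fps_nth (star_of C ?G ?F) m"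
        by (subst star_of_flip) simp
      then show ?thesis
        unfolding star_of_def fps_nth_Abs_fps app_const[of "inverse_ops \<tau>", OF inverse_zero] .
    qed
    then show ?thesis unfolding gauge_def by (simp only:)
  qed
  finally show ?thesis .
qed

text \<open>Associativity is transported between the extended products, where
  \<open>app \<tau>\<close> is an isomorphism, and read back coefficientwise by
  \<open>star_of_assoc_iff\<close>.\<close>

lemma gauge_star_coeffs: "star_coeffs (gauge \<tau> C)"
  unfolding star_coeffs_def
proof (intro conjI)
  show "\<forall>f\<in>B. \<forall>g\<in>B. gauge \<tau> C 0 f g = f * g"
    by (simp add: gauge_def gt_0 inverse_ops.simps[of \<tau> 0] star_0[OF C])
  have "star_of (gauge \<tau> C) (star_of (gauge \<tau> C) F G) H = star_of (gauge \<tau> C) F (star_of (gauge \<tau> C) G H)"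
    if "F \<in> series B" "G \<in> series B" "H \<in> series B" for F G H
  proof -
    note s = app_inverse_series[OF that(1)] app_inverse_series[OF that(2)] app_inverse_series[OF that(3)]
    note b = star_biadditive[OF C]
    have a: "star_of C (star_of C (app (inverse_ops \<tau>) F) (app (inverse_ops \<tau>) G)) (app (inverse_ops \<tau>) H) =
        star_of C (app (inverse_ops \<tau>) F) (star_of C (app (inverse_ops \<tau>) G) (app (inverse_ops \<tau>) H))"
      using star_of_assoc_iff[OF b] star_assoc[OF C] s by simp
    show ?thesis
      using that s a star_of_series[OF b]
      by (simp add: gauge_star app_gt_series app_inverse_gt)
  qed
  then show "\<forall>r. \<forall>f\<in>B. \<forall>g\<in>B. \<forall>h\<in>B. (\<Sum>i\<le>r. gauge \<tau> C i (gauge \<tau> C (r - i) f g) h) =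
      (\<Sum>i\<le>r. gauge \<tau> C i f (gauge \<tau> C (r - i) g h))"
    using star_of_assoc_iff[OF gauge_biadditive] by blast
qed (auto simp: gauge_bidiffop gauge_st)

end
end

text \<open>In order \<open>r\<close> the new coefficient can only meet terms of order
  \<open>0\<close>, where \<open>\<tau>\<close> is the identity and \<open>C 0\<close> the
  undeformed product. So \<open>C r\<close> changes by minus the Hochschild coboundary of
  \<open>t\<close>.\<close>

lemma gauge_update:
  assumes gt: "gauge_transformation \<tau>" and C: "star_coeffs C" and r: "r \<ge> 1"
    and 0: "\<tau> r = (\<lambda>f. 0)" and t: "is_diffop t"
    and f: "f \<in> B" and g: "g \<in> B"
  shows "gauge (\<tau>(r := t)) C r f g = gauge \<tau> C r f g + t (f * g) - t f * g - f * t g"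
proof -
  let ?\<tau> = "\<tau>(r := t)"
  let ?s = "inverse_ops \<tau>" and ?s' = "inverse_ops ?\<tau>"
  have s0: "?s 0 h = h" "?s' 0 h = h" for h by (simp_all add: inverse_ops.simps[of _ 0])
  have less: "?s' a h = ?s a h" if "a < r" for a h
    using that by (intro inverse_ops_cong) auto
  \<comment> \<open>The inverse series first notices the change in order \<open>r\<close>, and there
    with the opposite sign.\<close>
  have sr: "?s' r h = ?s r h - t h" for h
  proof -
    have "(\<Sum>i<r. ?\<tau> (r - i) (?s' i h)) = t h + (\<Sum>i\<in>{0<..<r}. \<tau> (r - i) (?s i h))"
    proof -
      have e: "{..<r} = insert 0 {0<..<r}" using r by auto
      have "(\<Sum>i\<in>{0<..<r}. ?\<tau> (r - i) (?s' i h)) = (\<Sum>i\<in>{0<..<r}. \<tau> (r - i) (?s i h))"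
        by (rule sum.cong) (auto simp: less)
      then show ?thesis unfolding e using r by (simp add: s0)
    qed
    moreover have "(\<Sum>i<r. \<tau> (r - i) (?s i h)) = (\<Sum>i\<in>{0<..<r}. \<tau> (r - i) (?s i h))"
    proof -
      have e: "{..<r} = insert 0 {0<..<r}" using r by auto
      show ?thesis unfolding e using r by (simp add: s0 0)
    qed
    ultimately show ?thesis
      using r by (subst (1 2) inverse_ops.simps) simp
  qed
  have t_B: "t h \<in> B" if "h \<in> B" for h using is_diffop_B[OF t that] .
  have s_B: "?s a h \<in> B" if "h \<in> B" for a h using is_diffop_B[OF inverse_diffop[OF gt] that] .
  let ?W = "\<lambda>s m. \<Sum>a\<le>m. \<Sum>b\<le>m - a. C (m - a - b) (s a f) (s b g)"
  have W_less: "?W ?s' m = ?W ?s m" if "m < r" for m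
    by (intro sum.cong refl) (use that less in auto)
  have W_r: "?W ?s' r = ?W ?s r - t f * g - f * t g"
  proof -
    have "C (r - a - b) (?s' a f) (?s' b g) = C (r - a - b) (?s a f) (?s b g)
        - (if a = r then (if b = 0 then t f * g else 0) else 0) - (if a = 0 then (if b = r then f * t g else 0) else 0)"
      if "a \<le> r" "b \<le> r - a" for a b
    proof -
      consider "a = r" "b = 0" | "a = 0" "b = r" | "a < r" "b < r" using \<open>a \<le> r\<close> \<open>b \<le> r - a\<close> by linarith
      then show ?thesis
      proof cases
        case 1
        then show ?thesis using r f g t_B s_B by (simp add: sr s0 star_0[OF C] algebra_simps)
      next
        case 2
        then show ?thesis using r f g t_B s_B by (simp add: sr s0 star_0[OF C] algebra_simps)
      qed (simp add: less)
    qed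
    then have "?W ?s' r = (\<Sum>a\<le>r. \<Sum>b\<le>r - a. C (r - a - b) (?s a f) (?s b g)
        - (if a = r then (if b = 0 then t f * g else 0) else 0) - (if a = 0 then (if b = r then f * t g else 0) else 0))"
      by (intro sum.cong refl) auto
    also have "\<dots> = ?W ?s r - (\<Sum>a\<le>r. \<Sum>b\<le>r - a. if a = r then (if b = 0 then t f * g else 0) else 0)
        - (\<Sum>a\<le>r. \<Sum>b\<le>r - a. if a = 0 then (if b = r then f * t g else 0) else 0)"
      by (simp only: sum_subtractf)
    also have "(\<Sum>a\<le>r. \<Sum>b\<le>r - a. if a = r then (if b = 0 then t f * g else 0) else 0) =
        (\<Sum>a\<le>r. if a = r then t f * g else 0)"
      by (intro sum.cong refl) auto
    also have "(\<Sum>a\<le>r. \<Sum>b\<le>r - a. if a = 0 then (if b = r then f * t g else 0) else 0) =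
        (\<Sum>a\<le>r. if a = 0 then f * t g else 0)"
      by (intro sum.cong refl) auto
    finally show ?thesis by (simp add: fun_upd_def)
  qed
  have "gauge ?\<tau> C r f g = (\<Sum>i\<le>r. ?\<tau> i (?W ?s' (r - i)))" unfolding gauge_def ..
  also have "\<dots> = ?\<tau> 0 (?W ?s' r) + ?\<tau> r (?W ?s' 0) + (\<Sum>i\<in>{0<..<r}. ?\<tau> i (?W ?s' (r - i)))"
    by (subst sum_atMost_ends[OF C r]) simp
  also have "(\<Sum>i\<in>{0<..<r}. ?\<tau> i (?W ?s' (r - i))) = (\<Sum>i\<in>{0<..<r}. \<tau> i (?W ?s (r - i)))"
    by (rule sum.cong) (simp_all add: W_less del: diff_diff_left)
  also have "?\<tau> 0 (?W ?s' r) + ?\<tau> r (?W ?s' 0) + (\<Sum>i\<in>{0<..<r}. \<tau> i (?W ?s (r - i))) =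
      (\<tau> 0 (?W ?s r) + \<tau> r (?W ?s 0) + (\<Sum>i\<in>{0<..<r}. \<tau> i (?W ?s (r - i)))) + t (f * g) - t f * g - f * t g"
    unfolding W_r using r f g by (simp add: gt_0[OF gt] 0 s0 star_0[OF C] del: diff_diff_left)
  also have "\<tau> 0 (?W ?s r) + \<tau> r (?W ?s 0) + (\<Sum>i\<in>{0<..<r}. \<tau> i (?W ?s (r - i))) =
      (\<Sum>i\<le>r. \<tau> i (?W ?s (r - i)))"
    by (subst sum_atMost_ends[OF C r]) simp
  finally show ?thesis unfolding gauge_def .
qed


section \<open>Symbol of the first coefficient and choice of the natural gauge\<close>

definition symbol1 :: "(nat \<Rightarrow> 'b \<Rightarrow> 'b \<Rightarrow> 'b) \<Rightarrow> nat \<Rightarrow> nat \<Rightarrow> 'b" where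
  "symbol1 C k j = C 1 (x k) (x j) - x k * x j * C 1 1 1"

text \<open>Large enough to complete squares against a Hermitian matrix: \<open>of_nat n\<close> and
  the squares of the entries absorb the two kinds of error in \<open>dominant_form_bound\<close>,
  and the summand \<open>1\<close> remains as a margin.\<close>

definition large_scalar :: "(nat \<Rightarrow> nat \<Rightarrow> 'b) \<Rightarrow> 'b" where
  "large_scalar p = 1 + of_nat n + (\<Sum>a<n. \<Sum>b<n. st (p a b) * p a b)"

text \<open>Says that \<open>p\<close> is larger than the identity matrix in a form that makes sense
  without a pointwise order on \<open>B\<close>: the shape of \<open>p\<close> itself forces the
  lower bound for every positive form.\<close>

definition dominant :: "(nat \<Rightarrow> nat \<Rightarrow> 'b) \<Rightarrow> bool" where
  "dominant p \<longleftrightarrow> (\<exists>p\<^sub>0. (\<forall>k<n. \<forall>j<n. p\<^sub>0 k j \<in> B \<and> st (p\<^sub>0 k j) = p\<^sub>0 j k) \<and>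
     (\<forall>k<n. \<forall>j<n. p k j = p\<^sub>0 k j + (if k = j then large_scalar p\<^sub>0 else 0)))"

lemma large_scalar_B:
  "(\<And>k j. k < n \<Longrightarrow> j < n \<Longrightarrow> p k j \<in> B) \<Longrightarrow> large_scalar p \<in> B"
  unfolding large_scalar_def by (intro add_B sum_B mult_B st_B) auto

lemma st_large_scalar: "st (large_scalar p) = large_scalar p"
  by (simp add: large_scalar_def mult.commute)

lemma natural_at_0: "star_coeffs C \<Longrightarrow> natural_at C 0"
  unfolding natural_at_def
proof (intro ballI conjI)
  fix f assume C: "star_coeffs C" and f: "f \<in> B"
  show "diffop (Suc 0) (C 0 f)"
    using diffop_mult[OF f, of 0] by (subst diffop_cong[of _ "\<lambda>g. f * g"]) (simp_all add: star_0[OF C] f)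
  show "diffop (Suc 0) (\<lambda>g. C 0 g f)"
    using diffop_mult[OF f, of 0]
    by (subst diffop_cong[of _ "\<lambda>g. f * g"]) (simp_all only: star_0[OF C] f mult.commute[of _ f])
qed

lemma natural_at_cong: "C r = C' r \<Longrightarrow> natural_at C r = natural_at C' r"
  by (simp add: natural_at_def)

text \<open>Adding a multiple of the Laplacian to the gauge transformation in first order makes the symbol
  of the first coefficient dominant.\<close>

lemma natural_gauge_step:
  assumes C: "star_coeffs C" and gt: "gauge_transformation \<tau>" and r: "r \<ge> 1" and 0: "\<tau> r = (\<lambda>f. 0)"
    and nat: "\<And>j. j < r \<Longrightarrow> natural_at (gauge \<tau> C) j"
  shows "\<exists>t. is_diffop t \<and> hermitian_op t \<and> natural_at (gauge (\<tau>(r := t)) C) r \<and>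
    (r = 1 \<longrightarrow> dominant (symbol1 (gauge (\<tau>(r := t)) C)))"
proof -
  note C0 = gauge_star_coeffs[OF gt C]
  obtain T where T: "is_diffop T" "hermitian_op T"
    "\<And>k. k < n \<Longrightarrow> diffop (Suc r) (\<lambda>h. gauge \<tau> C r (x k) h - (T (x k * h) - x k * T h))"
    using naturalizing_operator[OF C0 nat r] by blast
  have gt_upd: "gauge_transformation (\<tau>(r := t))" if "is_diffop t" "hermitian_op t" for t
    using gt that r by (auto simp: gauge_transformation_def)
  have nT: "is_diffop (\<lambda>f. - T f)" "hermitian_op (\<lambda>f. - T f)"
    using T by (auto intro: is_diffop_minus simp: hermitian_op_def)
  note C1 = gauge_star_coeffs[OF gt_upd[OF nT] C]
  \<comment> \<open>The symbol after naturalization and before the Laplacian is added; its size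
    determines the multiple of the Laplacian.\<close>
  define p where "p = symbol1 (gauge (\<tau>(r := (\<lambda>f. - T f))) C)"
  have p: "p k j \<in> B" "st (p k j) = p j k" if "k < n" "j < n" for k j
    using that unfolding p_def symbol1_def
    by (auto simp: star_B[OF C1] star_herm[OF C1] mult.commute)
  define \<kappa> where "\<kappa> = large_scalar p"
  have \<kappa>: "\<kappa> \<in> B" "st \<kappa> = \<kappa>" unfolding \<kappa>_def using p by (auto intro: large_scalar_B simp: st_large_scalar)
  \<comment> \<open>The factor \<open>1/2\<close> compensates that the Leibniz defect of a second
    derivative is twice the product of the first derivatives.\<close>
  define V where "V = (\<lambda>f. sc (1/2) * (\<kappa> * (\<Sum>i<n. d i (d i f))))"
  have V: "is_diffop V" unfolding V_def
    by (rule is_diffop_lmult[OF sc_B], rule is_diffop_lmult[OF \<kappa>(1)], rule is_diffop_sum,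
        rule is_diffop_d, simp, rule is_diffop_d[where P = "\<lambda>f. f"]) auto
  have V_st: "hermitian_op V" unfolding hermitian_op_def V_def by (auto simp: \<kappa> st_d)
  have V_mult: "V (f * g) - V f * g - f * V g = \<kappa> * (\<Sum>i<n. d i f * d i g)"
    if f: "f \<in> B" and g: "g \<in> B" for f g
  proof -
    have half: "sc (1/2) * (a + a) = a" for a
    proof -
      have "sc (1/2) * (a + a) = (sc (1/2) + sc (1/2)) * a" by (simp add: algebra_simps)
      then show ?thesis by (simp add: sc_add[symmetric])
    qed
    have "d i (d i (f * g)) = d i (d i f) * g + (d i f * d i g + d i f * d i g) + f * d i (d i g)" if "i < n" for i
      using that f g by (simp add: d_mult d_add)
    then have "(\<Sum>i<n. d i (d i (f * g))) = (\<Sum>i<n. d i (d i f)) * g +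
        ((\<Sum>i<n. d i f * d i g) + (\<Sum>i<n. d i f * d i g)) + f * (\<Sum>i<n. d i (d i g))"
      by (simp add: sum.distrib sum_distrib_left sum_distrib_right)
    then have "V (f * g) - V f * g - f * V g =
        sc (1/2) * (\<kappa> * (\<Sum>i<n. d i f * d i g) + \<kappa> * (\<Sum>i<n. d i f * d i g))"
      unfolding V_def by (simp add: algebra_simps)
    then show ?thesis by (simp only: half)
  qed
  \<comment> \<open>\<open>- T\<close> cancels the part of \<open>C r (x k)\<close> of order above
    \<open>r\<close>. In order one \<open>V\<close> adds only \<open>\<kappa> * d k\<close> to
    \<open>C 1 (x k)\<close>, which is still of the natural order.\<close>
  define t where "t = (\<lambda>f. (if r = 1 then V f else 0) - T f)"
  have t: "is_diffop t" "hermitian_op t"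
    using is_diffop_add[OF V nT(1)] nT V_st T(2) unfolding t_def
    by (cases "r = 1"; auto simp: hermitian_op_def)+
  have C2: "star_coeffs (gauge (\<tau>(r := t)) C)" by (rule gauge_star_coeffs[OF gt_upd[OF t] C])
  have upd: "gauge (\<tau>(r := t)) C r f g = gauge (\<tau>(r := (\<lambda>f. - T f))) C r f g
      + (if r = 1 then \<kappa> * (\<Sum>i<n. d i f * d i g) else 0)" if "f \<in> B" "g \<in> B" for f g
    unfolding gauge_update[OF gt C r 0 t(1) that] gauge_update[OF gt C r 0 nT(1) that]
    using V_mult[OF that] by (auto simp: t_def algebra_simps)
  have "natural_at (gauge (\<tau>(r := t)) C) r"
  proof (rule natural_at_from_coordinates[OF C2 _ r])
    show "natural_at (gauge (\<tau>(r := t)) C) j" if "j < r" for j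
    proof -
      have "gauge (\<tau>(r := t)) C j = gauge \<tau> C j" using that by (intro gauge_cong) auto
      with nat[OF that] show ?thesis by (simp cong: natural_at_cong)
    qed
    fix k assume k: "k < n"
    have eq: "gauge (\<tau>(r := t)) C r (x k) h = (gauge \<tau> C r (x k) h - (T (x k * h) - x k * T h)) + T (x k) * h
        + (if r = 1 then \<kappa> * d k h else 0)" if h: "h \<in> B" for h
    proof -
      have "(\<Sum>i<n. d i (x k) * d i h) = (\<Sum>i<n. if i = k then d k h else 0)"
        using k by (intro sum.cong) (auto simp: d_x)
      then have "(\<Sum>i<n. d i (x k) * d i h) = d k h" using k by simp
      then show ?thesis
        unfolding upd[OF x_B[OF k] h] gauge_update[OF gt C r 0 nT(1) x_B[OF k] h] by (simp add: algebra_simps)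
    qed
    have "diffop (Suc r) (\<lambda>h. T (x k) * h)"
      using is_diffop_B[OF T(1) x_B[OF k]] by (rule diffop_mult)
    moreover have "diffop (Suc r) (\<lambda>h. if r = 1 then \<kappa> * d k h else 0)"
    proof (cases "r = 1")
      case True
      have "diffop (Suc 1) (\<lambda>h. \<kappa> * d k h)"
        using diffop_d[OF k diffop_mult[OF \<kappa>(1), of 0]] by simp
      then show ?thesis using True by simp
    qed (simp add: diffop_zero)
    ultimately have "diffop (Suc r) (\<lambda>h. (gauge \<tau> C r (x k) h - (T (x k * h) - x k * T h)) + T (x k) * h
        + (if r = 1 then \<kappa> * d k h else 0))"
      by (intro diffop_add T(3)[OF k])
    then show "diffop (Suc r) (gauge (\<tau>(r := t)) C r (x k))" by (subst diffop_cong[OF eq])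
  qed
  moreover have "dominant (symbol1 (gauge (\<tau>(r := t)) C))" if r1: "r = 1"
    unfolding dominant_def
  proof (intro exI[of _ p] conjI allI impI)
    fix k j assume kj: "k < n" "j < n"
    show "p k j \<in> B" "st (p k j) = p j k" using p kj by auto
    have "(\<Sum>i<n. d i (x k) * d i (x j)) = (\<Sum>i<n. if i = k then (if k = j then 1 else 0) else 0)"
      using kj by (intro sum.cong) (auto simp: d_x)
    then have s: "(\<Sum>i<n. d i (x k) * d i (x j)) = (if k = j then 1 else 0)" using kj by simp
    have "(\<Sum>i<n. d i 1 * d i 1) = 0" by simp
    then have "symbol1 (gauge (\<tau>(r := t)) C) k j =
        symbol1 (gauge (\<tau>(r := (\<lambda>f. - T f))) C) k j + \<kappa> * (if k = j then 1 else 0)"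
      unfolding symbol1_def
      using upd[OF x_B[OF kj(1)] x_B[OF kj(2)]] upd[OF one_B one_B] s
      by (simp add: r1)
    then show "symbol1 (gauge (\<tau>(r := t)) C) k j = p k j + (if k = j then large_scalar p else 0)"
      unfolding p_def[symmetric] \<kappa>_def by simp
  qed
  ultimately show ?thesis using t by blast
qed

text \<open>Well-founded choice of each coefficient from its predecessors; by
  \<open>gauge_cong\<close> the condition \<open>P\<close> on the coefficient at \<open>r\<close>
  involves \<tau> only below \<open>r\<close>.\<close>

theorem natural_gauge:
  assumes C: "star_coeffs C"
  shows "\<exists>\<tau>. gauge_transformation \<tau> \<and> (\<forall>r. natural_at (gauge \<tau> C) r) \<and> dominant (symbol1 (gauge \<tau> C))"
proof -
  define P where "P = (\<lambda>\<tau> r t. if r = 0 then t = (\<lambda>f. f) else is_diffop t \<and> hermitian_op t \<and>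
     natural_at (gauge (\<tau>(r := t)) C) r \<and> (r = 1 \<longrightarrow> dominant (symbol1 (gauge (\<tau>(r := t)) C))))"
  have "\<exists>\<tau>. \<forall>r. P \<tau> r (\<tau> r)"
  proof (rule dependent_wf_choice[OF wf_less])
    fix \<tau> \<tau>' :: "nat \<Rightarrow> 'b \<Rightarrow> 'b" and r :: nat and t assume "\<And>z. (z, r) \<in> {(a, b). a < b} \<Longrightarrow> \<tau> z = \<tau>' z"
    then have "gauge (\<tau>(r := t)) C r = gauge (\<tau>'(r := t)) C r"
      by (intro gauge_cong) auto
    then show "P \<tau> r t = P \<tau>' r t"
      unfolding P_def symbol1_def natural_at_def by auto
  next
    fix r :: nat and \<tau> :: "nat \<Rightarrow> 'b \<Rightarrow> 'b" assume IH: "\<And>y. (y, r) \<in> {(a, b). a < b} \<Longrightarrow> P \<tau> y (\<tau> y)"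
    show "\<exists>t. P \<tau> r t"
    proof (cases "r = 0")
      case False
      \<comment> \<open>The entries from \<open>r\<close> on are not fixed yet. Setting them to
        \<open>0\<close> yields a gauge transformation to which \<open>natural_gauge_step\<close>
        applies, and leaves the transported coefficients below \<open>r\<close> unchanged.\<close>
      define \<tau>' where "\<tau>' = (\<lambda>i. if i < r then \<tau> i else (\<lambda>f. 0))"
      have gt: "gauge_transformation \<tau>'"
        unfolding gauge_transformation_def
      proof (intro conjI allI)
        show "\<tau>' 0 = (\<lambda>f. f)" using IH[of 0] False by (simp add: P_def \<tau>'_def)
        have "is_diffop (\<tau> i) \<and> hermitian_op (\<tau> i)" if "i < r" for i
          using IH[of i] that by (cases "i = 0") (auto simp: P_def hermitian_op_def)
        then show "is_diffop (\<tau>' i)" "hermitian_op (\<tau>' i)" for i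
          by (auto simp: \<tau>'_def hermitian_op_def)
      qed
      have "natural_at (gauge \<tau>' C) j" if j: "j < r" for j
      proof (cases "j = 0")
        case True
        then show ?thesis using natural_at_0[OF gauge_star_coeffs[OF gt C]] by simp
      next
        case False
        have "gauge \<tau>' C j = gauge \<tau> C j" using j by (intro gauge_cong) (auto simp: \<tau>'_def)
        moreover have "natural_at (gauge \<tau> C) j" using IH[of j] j False by (simp add: P_def)
        ultimately show ?thesis by (simp cong: natural_at_cong)
      qed
      then obtain t where t: "is_diffop t" "hermitian_op t" "natural_at (gauge (\<tau>'(r := t)) C) r"
        "r = 1 \<longrightarrow> dominant (symbol1 (gauge (\<tau>'(r := t)) C))"
        using natural_gauge_step[OF C gt, of r] False by (auto simp: \<tau>'_def)
      have "gauge (\<tau>'(r := t)) C r = gauge (\<tau>(r := t)) C r"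
        by (intro gauge_cong) (auto simp: \<tau>'_def)
      with t False have "P \<tau> r t" unfolding P_def symbol1_def natural_at_def by auto
      then show ?thesis by blast
    qed (auto simp: P_def)
  qed
  then obtain \<tau> where \<tau>: "\<And>r. P \<tau> r (\<tau> r)" by blast
  have gt: "gauge_transformation \<tau>"
    unfolding gauge_transformation_def
  proof (intro conjI allI)
    show "\<tau> 0 = (\<lambda>f. f)" using \<tau>[of 0] by (simp add: P_def)
    fix i show "is_diffop (\<tau> i)" "hermitian_op (\<tau> i)"
      using \<tau>[of i] by (auto simp: P_def hermitian_op_def split: if_splits)
  qed
  moreover have "natural_at (gauge \<tau> C) r" for r
    using \<tau>[of r] natural_at_0[OF gauge_star_coeffs[OF gt C]]
    by (cases "r = 0") (auto simp: P_def)
  moreover have "dominant (symbol1 (gauge \<tau> C))"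
    using \<tau>[of 1] by (simp add: P_def)
  ultimately show ?thesis by blast
qed

section \<open>The leading symbols of a natural star product\<close>

text \<open>The bidifferential operator with symbol \<open>p ^ r / r!\<close>: the coefficients
  \<open>p k j\<close> are kept outside and never differentiated.\<close>

primrec leading :: "(nat \<Rightarrow> nat \<Rightarrow> 'b) \<Rightarrow> nat \<Rightarrow> 'b \<Rightarrow> 'b \<Rightarrow> 'b" where
  "leading p 0 f g = f * g"
| "leading p (Suc r) f g =
     sc (1 / of_nat (Suc r)) * (\<Sum>k<n. \<Sum>j<n. p k j * leading p r (d k f) (d j g))"

lemma leading_flip: "leading p r f g = leading (\<lambda>k j. p j k) r g f"
proof (induction r arbitrary: f g)
  case (Suc r)
  show ?case unfolding leading.simps by (subst sum.swap) (simp add: Suc.IH[symmetric])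
qed (simp add: mult.commute)

context
  fixes p assumes p: "\<And>k j. k < n \<Longrightarrow> j < n \<Longrightarrow> p k j \<in> B"
begin

lemma leading_is_bidiffop: "is_bidiffop (leading p r)"
proof (induction r)
  case 0
  then show ?case using is_bidiffop_times by (subst is_bidiffop_cong[of _ "\<lambda>f g. f * g"]) auto
next
  case (Suc r)
  have dd: "is_diffop (d k)" if "k < n" for k
    using is_diffop_d[OF that is_diffop_id] by simp
  have "is_bidiffop (\<lambda>f g. sc (1 / of_nat (Suc r)) * (\<Sum>k<n. \<Sum>j<n. p k j * leading p r (d k f) (d j g)))"
    by (rule is_bidiffop_lmult[OF sc_B], (rule is_bidiffop_sum)+, rule is_bidiffop_lmult)
      (use p in \<open>auto intro: is_bidiffop_sub[OF dd dd Suc]\<close>)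
  then show ?case by (subst is_bidiffop_cong) auto
qed

lemma leading_B: "f \<in> B \<Longrightarrow> g \<in> B \<Longrightarrow> leading p r f g \<in> B"
  by (rule is_bidiffop_B[OF leading_is_bidiffop])

lemma leading_add1: "f \<in> B \<Longrightarrow> g \<in> B \<Longrightarrow> h \<in> B \<Longrightarrow> leading p r (f + g) h = leading p r f h + leading p r g h"
  using leading_is_bidiffop[of r] bidiffop_add1 unfolding is_bidiffop_def by blast

text \<open>Commuting with \<open>x k\<close> differentiates the symbol in the \<open>k\<close>-th
  dual variable of the first argument, and the derivative of \<open>p ^ (r + 1) / (r + 1)!\<close>
  is the derivative of \<open>p\<close> times \<open>p ^ r / r!\<close>.\<close>

lemma leading_commute1:
  "k < n \<Longrightarrow> f \<in> B \<Longrightarrow> g \<in> B \<Longrightarrow>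
    leading p (Suc r) (x k * f) g - x k * leading p (Suc r) f g = (\<Sum>j<n. p k j * leading p r f (d j g))"
proof (induction r arbitrary: f g)
  case 0
  have "(\<Sum>l<n. \<Sum>j<n. p l j * (d l (x k * f) * d j g)) =
      (\<Sum>l<n. if l = k then \<Sum>j<n. p k j * (f * d j g) else 0) + (\<Sum>l<n. \<Sum>j<n. p l j * (x k * d l f * d j g))"
    unfolding sum.distrib[symmetric] using 0
    by (intro sum.cong) (auto simp: d_mult d_x algebra_simps sum.distrib)
  then show ?case using 0 by (simp add: sum_distrib_left algebra_simps)
next
  case (Suc r)
  define c where "c = sc (1 / of_nat (Suc (Suc r)))"
  have c: "c * of_nat (Suc (Suc r)) = 1" unfolding c_def by (rule inverse_Suc)
  let ?Z = "leading p (Suc r)"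
  have 1: "(\<Sum>l<n. \<Sum>j<n. p l j * ?Z (d l (x k * f)) (d j g)) =
      (\<Sum>j<n. p k j * ?Z f (d j g)) + (\<Sum>l<n. \<Sum>j<n. p l j * ?Z (x k * d l f) (d j g))"
  proof -
    have "p l j * ?Z (d l (x k * f)) (d j g) = (if l = k then p k j * ?Z f (d j g) else 0) + p l j * ?Z (x k * d l f) (d j g)"
      if "l < n" "j < n" for l j
    proof -
      have "?Z (d l (x k * f)) (d j g) = ?Z ((if l = k then f else 0) + x k * d l f) (d j g)"
        using that Suc.prems by (simp add: d_mult d_x)
      also have "\<dots> = (if l = k then ?Z f (d j g) else 0) + ?Z (x k * d l f) (d j g)"
        using that Suc.prems leading_add1[of 0 0 "d j g" "Suc r"]
        by (simp add: leading_add1 del: leading.simps)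
      finally show ?thesis by (simp add: algebra_simps del: leading.simps)
    qed
    then have "(\<Sum>l<n. \<Sum>j<n. p l j * ?Z (d l (x k * f)) (d j g)) =
       (\<Sum>l<n. \<Sum>j<n. (if l = k then p k j * ?Z f (d j g) else 0) + p l j * ?Z (x k * d l f) (d j g))"
      by (intro sum.cong) auto
    also have "\<dots> = (\<Sum>l<n. \<Sum>j<n. if l = k then p k j * ?Z f (d j g) else 0) + (\<Sum>l<n. \<Sum>j<n. p l j * ?Z (x k * d l f) (d j g))"
      by (simp only: sum.distrib)
    also have "(\<Sum>l<n. \<Sum>j<n. if l = k then p k j * ?Z f (d j g) else 0) =
        (\<Sum>l<n. if l = k then \<Sum>j<n. p k j * ?Z f (d j g) else 0)"
      by (rule sum.cong) auto
    finally show ?thesis using Suc.prems(1) by (simp del: leading.simps)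
  qed
  \<comment> \<open>The induction hypothesis is applied inside the double sum, and commuting
    derivations reassemble the outcome into \<open>r + 1\<close> copies of the wanted sum. With the
    single copy in \<open>1\<close> these are \<open>r + 2\<close>, which \<open>c\<close>
    normalizes.\<close>
  have 2: "(\<Sum>l<n. \<Sum>j<n. p l j * ?Z (x k * d l f) (d j g)) - x k * (\<Sum>l<n. \<Sum>j<n. p l j * ?Z (d l f) (d j g)) =
      of_nat (Suc r) * (\<Sum>m<n. p k m * ?Z f (d m g))"
  proof -
    have "(\<Sum>l<n. \<Sum>j<n. p l j * ?Z (x k * d l f) (d j g)) - x k * (\<Sum>l<n. \<Sum>j<n. p l j * ?Z (d l f) (d j g)) =
        (\<Sum>l<n. \<Sum>j<n. p l j * (?Z (x k * d l f) (d j g) - x k * ?Z (d l f) (d j g)))"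
      by (simp add: sum_distrib_left sum_subtractf algebra_simps del: leading.simps)
    also have "\<dots> = (\<Sum>l<n. \<Sum>j<n. p l j * (\<Sum>m<n. p k m * leading p r (d l f) (d m (d j g))))"
      by (intro sum.cong refl) (use Suc in \<open>auto simp del: leading.simps\<close>)
    also have "\<dots> = (\<Sum>l<n. \<Sum>j<n. \<Sum>m<n. p k m * (p l j * leading p r (d l f) (d j (d m g))))"
      using Suc.prems by (intro sum.cong refl) (simp add: sum_distrib_left d_comm algebra_simps)
    also have "\<dots> = (\<Sum>l<n. \<Sum>m<n. \<Sum>j<n. p k m * (p l j * leading p r (d l f) (d j (d m g))))"
      by (intro sum.cong refl sum.swap)
    also have "\<dots> = (\<Sum>m<n. \<Sum>l<n. \<Sum>j<n. p k m * (p l j * leading p r (d l f) (d j (d m g))))"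
      by (rule sum.swap)
    also have "\<dots> = (\<Sum>m<n. p k m * (of_nat (Suc r) * ?Z f (d m g)))"
    proof (intro sum.cong refl)
      fix m
      have "of_nat (Suc r) * ?Z f (d m g) = sc (1 / of_nat (Suc r)) * of_nat (Suc r) *
          (\<Sum>l<n. \<Sum>j<n. p l j * leading p r (d l f) (d j (d m g)))"
        by (simp add: algebra_simps del: of_nat_Suc)
      then show "(\<Sum>l<n. \<Sum>j<n. p k m * (p l j * leading p r (d l f) (d j (d m g)))) = p k m * (of_nat (Suc r) * ?Z f (d m g))"
        unfolding inverse_Suc by (simp add: sum_distrib_left)
    qed
    finally show ?thesis by (simp add: sum_distrib_left algebra_simps del: leading.simps)
  qed
  have "leading p (Suc (Suc r)) (x k * f) g - x k * leading p (Suc (Suc r)) f g =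
     c * ((\<Sum>l<n. \<Sum>j<n. p l j * ?Z (d l (x k * f)) (d j g)) - x k * (\<Sum>l<n. \<Sum>j<n. p l j * ?Z (d l f) (d j g)))"
    unfolding leading.simps(2)[of p "Suc r"] c_def by (simp add: algebra_simps del: leading.simps of_nat_Suc)
  also have "\<dots> = c * of_nat (Suc (Suc r)) * (\<Sum>m<n. p k m * ?Z f (d m g))"
    using 2 unfolding 1 by (simp add: algebra_simps del: leading.simps)
  finally show ?case unfolding c by (simp del: leading.simps)
qed

end

context
  fixes C assumes C: "star_coeffs C" and nat: "\<And>r. natural_at C r"
begin

lemma symbol1_B: "k < n \<Longrightarrow> j < n \<Longrightarrow> symbol1 C k j \<in> B"
  by (simp add: symbol1_def star_B[OF C])

text \<open>Naturality makes \<open>C 1 (x k)\<close> an operator of first order. Its zeroth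
  coefficient is fixed by associativity, which gives \<open>C 1 f 1 = f * C 1 1 1\<close>, and the
  others are read off at the coordinates; this explains the correction term in
  \<open>symbol1\<close>.\<close>

lemma first_coefficient:
  assumes k: "k < n" and g: "g \<in> B"
  shows "C 1 (x k) g = (\<Sum>j<n. symbol1 C k j * d j g) + x k * C 1 1 1 * g"
proof -
  have u: "C 1 f 1 = f * C 1 1 1" if "f \<in> B" for f
    using star_assoc[OF C that one_B one_B, of 1] that by (simp add: star_0[OF C] star_B[OF C])
  obtain b Q where Q: "b \<in> B" "\<And>i. i < n \<Longrightarrow> diffop (Suc 0) (Q i)"
    "\<And>g. g \<in> B \<Longrightarrow> C 1 (x k) g = b * g + (\<Sum>i<n. Q i (d i g))"
  proof -
    have "diffop (Suc 1) (C 1 (x k))" using nat[of 1] x_B[OF k] unfolding natural_at_def by blast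
    then show ?thesis using that unfolding One_nat_def by (rule diffop_SucE) blast
  qed
  have "\<exists>c. \<forall>f\<in>B. Q i f = c * f" if i: "i < n" for i
  proof -
    obtain c Q' where "c \<in> B" "\<And>j. j < n \<Longrightarrow> diffop 0 (Q' j)" "\<And>f. f \<in> B \<Longrightarrow> Q i f = c * f + (\<Sum>j<n. Q' j (d j f))"
      using Q(2)[OF i] by (rule diffop_SucE) blast
    then show ?thesis by (intro exI[of _ c]) auto
  qed
  then obtain c where c: "\<And>i f. i < n \<Longrightarrow> f \<in> B \<Longrightarrow> Q i f = c i * f" by metis
  have L: "C 1 (x k) g = b * g + (\<Sum>i<n. c i * d i g)" if "g \<in> B" for g
    using Q(3)[OF that] c that by simp
  have b: "b = x k * C 1 1 1" using L[OF one_B] u[OF x_B[OF k]] by simp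
  have "c j = symbol1 C k j" if j: "j < n" for j
  proof -
    have "(\<Sum>i<n. c i * d i (x j)) = (\<Sum>i<n. if i = j then c j else 0)"
      using j by (intro sum.cong) (auto simp: d_x)
    then have "C 1 (x k) (x j) = b * x j + c j" using L[OF x_B[OF j]] j by simp
    then show ?thesis unfolding symbol1_def b by (simp add: algebra_simps)
  qed
  then show ?thesis using L[OF g] b by simp
qed

lemma natural_bidiffop: "bidiffop (Suc (2 * r)) (C r)"
proof -
  obtain w where "bidiffop w (C r)" using star_bidiffop[OF C, of r] by (auto simp: is_bidiffop_def)
  from bidiffop_separate[OF this, of "Suc r" "Suc r"] nat[of r]
  show ?thesis by (simp add: natural_at_def mult_2)
qed

text \<open>Associativity for \<open>x k\<close>, \<open>f\<close>, \<open>g\<close> in order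
  \<open>r + 1\<close>. Composites of \<open>C (r + 1 - i) (x k)\<close> with \<open>C i\<close> for
  \<open>i < r\<close> have total order at most \<open>r + 1 + i\<close>, hence at most
  \<open>2 * r\<close>. Only the composites with \<open>C 1 (x k)\<close> reach the top order, and
  there the Leibniz rule cancels the derivatives that fall on \<open>f\<close>.\<close>

lemma leading_recursion:
  assumes k: "k < n"
  shows "bidiffop (Suc (2 * r)) (\<lambda>f g. C (Suc r) (x k * f) g - x k * C (Suc r) f g
    - (\<Sum>j<n. symbol1 C k j * C r f (d j g)))"
proof -
  let ?c = "x k * C 1 1 1"
  let ?p = "symbol1 C k"
  have cB: "?c \<in> B" using k by (simp add: star_B[OF C])
  have pB: "?p j \<in> B" if "j < n" for j using symbol1_B k that by auto
  have split: "(\<Sum>i\<le>Suc r. h i) = h (Suc r) + h r + (\<Sum>i<r. h i)" for h :: "nat \<Rightarrow> 'b"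
    by (simp add: lessThan_Suc_atMost[symmetric])
  have eq: "C (Suc r) (x k * f) g - x k * C (Suc r) f g - (\<Sum>j<n. ?p j * C r f (d j g)) =
    (\<Sum>i<r. C (Suc r - i) (x k) (C i f g)) - (\<Sum>i<r. C i (C (Suc r - i) (x k) f) g)
    + (\<Sum>j<n. ?p j * (d j (C r f g) - C r (d j f) g - C r f (d j g)))
    - (\<Sum>j<n. C r (?p j * d j f) g - ?p j * C r (d j f) g)
    + (?c * C r f g - C r (?c * f) g)" if f: "f \<in> B" and g: "g \<in> B" for f g
  proof -
    have "C (Suc r) (C 0 (x k) f) g + C r (C 1 (x k) f) g + (\<Sum>i<r. C i (C (Suc r - i) (x k) f) g) =
       (\<Sum>i\<le>Suc r. C (Suc r - i) (x k) (C i f g))"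
    proof -
      have "(\<Sum>i\<le>Suc r. C i (C (Suc r - i) (x k) f) g) = (\<Sum>i\<le>Suc r. C i (x k) (C (Suc r - i) f g))"
        by (rule star_assoc[OF C]) (use f g k in auto)
      also have "\<dots> = (\<Sum>i\<le>Suc r. C (Suc r - i) (x k) (C i f g))"
        by (rule sum.reindex_bij_witness[of _ "\<lambda>i. Suc r - i" "\<lambda>i. Suc r - i"]) auto
      finally show ?thesis unfolding split[of "\<lambda>i. C i (C (Suc r - i) (x k) f) g"] by simp
    qed
    also have "(\<Sum>i\<le>Suc r. C (Suc r - i) (x k) (C i f g)) =
       C 0 (x k) (C (Suc r) f g) + C 1 (x k) (C r f g) + (\<Sum>i<r. C (Suc r - i) (x k) (C i f g))"
      unfolding split[of "\<lambda>i. C (Suc r - i) (x k) (C i f g)"] by simp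
    finally have main: "C (Suc r) (x k * f) g - x k * C (Suc r) f g =
       C 1 (x k) (C r f g) - C r (C 1 (x k) f) g
       + (\<Sum>i<r. C (Suc r - i) (x k) (C i f g)) - (\<Sum>i<r. C i (C (Suc r - i) (x k) f) g)"
      using f g k by (simp add: star_0[OF C] star_B[OF C] algebra_simps)
    have "C r (C 1 (x k) f) g = (\<Sum>j<n. C r (?p j * d j f) g) + C r (?c * f) g"
    proof -
      have "C r ((\<Sum>j<n. ?p j * d j f) + ?c * f) g = C r (\<Sum>j<n. ?p j * d j f) g + C r (?c * f) g"
        by (intro star_add1[OF C] sum_B mult_B pB cB) (use f g in auto)
      also have "C r (\<Sum>j<n. ?p j * d j f) g = (\<Sum>j<n. C r (?p j * d j f) g)"
        by (rule bidiffop_sum1[OF natural_bidiffop g]) (use pB f in auto)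
      finally show ?thesis unfolding first_coefficient[OF k f] .
    qed
    moreover have "C 1 (x k) (C r f g) = (\<Sum>j<n. ?p j * d j (C r f g)) + ?c * C r f g"
      by (rule first_coefficient[OF k]) (simp add: star_B[OF C] f g)
    ultimately show ?thesis unfolding main
      by (simp add: sum_subtractf sum.distrib algebra_simps)
  qed
  have A: "bidiffop (Suc (2 * r)) (\<lambda>f g. C (Suc r - i) (x k) (C i f g))" if "i < r" for i
  proof -
    have "diffop (Suc (Suc r - i)) (C (Suc r - i) (x k))" using nat k by (simp add: natural_at_def)
    from bidiffop_post[OF this natural_bidiffop] show ?thesis
      by (rule bidiffop_mono) (use that in simp)
  qed
  have A': "bidiffop (Suc (2 * r)) (\<lambda>f g. C i (C (Suc r - i) (x k) f) g)" if "i < r" for i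
  proof -
    have "diffop (Suc (Suc r - i)) (C (Suc r - i) (x k))" using nat k by (simp add: natural_at_def)
    from bidiffop_sub1[OF this natural_bidiffop] show ?thesis
      by (rule bidiffop_mono) (use that in simp)
  qed
  have Bd: "bidiffop (Suc (2 * r)) (\<lambda>f g. C r (?p j * d j f) g - ?p j * C r (d j f) g)" if "j < n" for j
    using bidiffop_d1[OF that bidiffop_commute1[OF natural_bidiffop pB[OF that]]] by simp
  have "bidiffop (Suc (2 * r)) (\<lambda>f g. (\<Sum>i<r. C (Suc r - i) (x k) (C i f g)) - (\<Sum>i<r. C i (C (Suc r - i) (x k) f) g)
    + (\<Sum>j<n. ?p j * (d j (C r f g) - C r (d j f) g - C r f (d j g)))
    - (\<Sum>j<n. C r (?p j * d j f) g - ?p j * C r (d j f) g)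
    + (?c * C r f g - C r (?c * f) g))"
    by (rule bidiffop_add[OF bidiffop_diff[OF bidiffop_add[OF bidiffop_diff[OF bidiffop_sum bidiffop_sum]
         bidiffop_sum[OF bidiffop_lmult]] bidiffop_sum] bidiffop_diff])
      (use A A' Bd bidiffop_Leibniz[OF natural_bidiffop] bidiffop_lmult[OF cB natural_bidiffop]
        bidiffop_mult1[OF natural_bidiffop cB] pB in auto)
  then show ?thesis by (subst bidiffop_cong[OF eq])
qed

end

lemma is_bidiffop_flip: "is_bidiffop Z \<Longrightarrow> is_bidiffop (\<lambda>f g. Z g f)"
  unfolding is_bidiffop_def by (elim exE, rule exI, rule bidiffop_flip)

lemma star_coeffs_flip: "star_coeffs C \<Longrightarrow> star_coeffs (\<lambda>r f g. C r g f)"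
  unfolding star_coeffs_def by (auto simp: mult.commute intro: is_bidiffop_flip)

text \<open>The symbol of bidegree \<open>(r, r)\<close> of the \<open>r\<close>-th coefficient is \<open>1 / r!\<close> times the \<open>r\<close>-th power of the
  symbol of the first one.\<close>

lemma leading_symbol:
  assumes C: "star_coeffs C" and nat: "\<And>r. natural_at C r"
  shows "bidiffop (2 * r) (\<lambda>f g. C r f g - leading (symbol1 C) r f g)"
proof (induction r)
  case 0
  then show ?case by (simp add: star_0[OF C])
next
  case (Suc r)
  let ?p = "symbol1 C"
  \<comment> \<open>The opposite product is again a star product in this sense, with the transposed
    symbol; it yields the commutators in the second argument.\<close>
  let ?C = "\<lambda>r f g. C r g f"
  have C': "star_coeffs ?C" by (rule star_coeffs_flip[OF C])
  have nat': "natural_at ?C r" for r using nat[of r] by (simp add: natural_at_def)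
  have p': "symbol1 ?C k j = ?p j k" for k j by (simp add: symbol1_def mult.commute)
  note pB = symbol1_B[OF C nat]
  let ?D = "\<lambda>f g. C (Suc r) f g - leading ?p (Suc r) f g"
  obtain w where w: "bidiffop w ?D"
  proof -
    have "is_bidiffop (\<lambda>f g. C (Suc r) f g + (- 1) * leading ?p (Suc r) f g)"
      by (intro is_bidiffop_add star_bidiffop[OF C] is_bidiffop_lmult leading_is_bidiffop pB minus_B one_B)
    then show ?thesis using that by (auto simp: is_bidiffop_def)
  qed
  \<comment> \<open>In either argument \<open>C\<close> and \<open>leading\<close> obey the same
    recursion up to total order \<open>2 * r\<close>, so the commutators of the difference are
    controlled by the induction hypothesis and the descent applies.\<close>
  have "bidiffop (Suc (Suc (2 * r))) ?D"
  proof (rule bidiffop_descend[OF _ _ w])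
    fix k assume k: "k < n"
    have e1: "?D (x k * f) g - x k * ?D f g = (C (Suc r) (x k * f) g - x k * C (Suc r) f g
        - (\<Sum>j<n. ?p k j * C r f (d j g))) + (\<Sum>j<n. ?p k j * (C r f (d j g) - leading ?p r f (d j g)))"
      if "f \<in> B" "g \<in> B" for f g
      using leading_commute1[OF pB k that, where r = r]
      by (simp add: algebra_simps sum_subtractf del: leading.simps)
    have "bidiffop (Suc (2 * r)) (\<lambda>f g. \<Sum>j<n. ?p k j * (C r f (d j g) - leading ?p r f (d j g)))"
      by (intro bidiffop_sum bidiffop_lmult bidiffop_d2[OF _ Suc]) (use pB k in auto)
    from bidiffop_add[OF leading_recursion[OF C nat k] this]
    show "bidiffop (Suc (2 * r)) (\<lambda>f g. ?D (x k * f) g - x k * ?D f g)"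
      by (subst bidiffop_cong[OF e1])
    have e2: "?D f (x k * g) - x k * ?D f g = (C (Suc r) f (x k * g) - x k * C (Suc r) f g
        - (\<Sum>j<n. ?p j k * C r (d j f) g)) + (\<Sum>j<n. ?p j k * (C r (d j f) g - leading ?p r (d j f) g))"
      if f: "f \<in> B" and g: "g \<in> B" for f g
      using leading_commute1[of "\<lambda>k j. ?p j k", OF _ k g f, where r = r] pB
      by (simp add: algebra_simps sum_subtractf leading_flip[of "\<lambda>k j. ?p j k"] del: leading.simps)
    have "bidiffop (Suc (2 * r)) (\<lambda>f g. \<Sum>j<n. ?p j k * (C r (d j f) g - leading ?p r (d j f) g))"
      by (intro bidiffop_sum bidiffop_lmult bidiffop_d1[OF _ Suc]) (use pB k in auto)
    moreover have "bidiffop (Suc (2 * r)) (\<lambda>f g. C (Suc r) f (x k * g) - x k * C (Suc r) f g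
        - (\<Sum>j<n. ?p j k * C r (d j f) g))"
      using bidiffop_flip[OF leading_recursion[OF C' nat' k, where r = r]] by (simp add: p')
    ultimately show "bidiffop (Suc (2 * r)) (\<lambda>f g. ?D f (x k * g) - x k * ?D f g)"
      by (subst bidiffop_cong[OF e2]) (auto intro: bidiffop_add)
  qed
  then show ?case by simp
qed

end

section \<open>Positivity\<close>

lemma complex_fps_nonnegI:
  assumes "\<And>k. Im (fps_nth z k) = 0" "z = 0 \<or> (\<exists>m. (\<forall>k<m. fps_nth z k = 0) \<and> Re (fps_nth z m) > 0)"
  shows "complex_fps_nonneg z"
proof -
  let ?a = "Abs_fps (\<lambda>k. Re (fps_nth z k))"
  have z: "z = Abs_fps (\<lambda>k. complex_of_real (fps_nth ?a k))"
    by (rule fps_ext) (simp add: complex_eq_iff assms(1))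
  have "?a = 0 \<or> real_fps_pos ?a"
  proof (rule disjE[OF assms(2)])
    assume "\<exists>m. (\<forall>k<m. fps_nth z k = 0) \<and> Re (fps_nth z m) > 0"
    then obtain m where m: "\<forall>k<m. fps_nth z k = 0" "Re (fps_nth z m) > 0" by blast
    have "subdegree ?a = m" by (rule subdegreeI) (use m in auto)
    moreover have "?a \<noteq> 0" using m(2) by (metis fps_nth_Abs_fps fps_zero_nth less_irrefl)
    ultimately show ?thesis using m by (simp add: real_fps_pos_def)
  qed (simp add: fps_eq_iff)
  then show ?thesis unfolding complex_fps_nonneg_def using z by blast
qed

lemma complex_nonneg_iff: "complex_nonneg z \<longleftrightarrow> Im z = 0 \<and> Re z \<ge> 0"
  by (simp add: complex_nonneg_def complex_is_Real_iff)

section \<open>Positive sesquilinear forms and diagonal dominance\<close>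

context diff_algebra begin

text \<open>Abstracts pairings such as \<open>u, v \<mapsto> \<omega> (u\<^sup>* v)\<close> on
  families. The index type is a parameter because the construction of \<open>tensor_form\<close>
  passes from families to families indexed by words as well.\<close>

definition positive_form :: "(('i \<Rightarrow> 'b) \<Rightarrow> ('i \<Rightarrow> 'b) \<Rightarrow> complex) \<Rightarrow> bool" where
  "positive_form \<phi> \<longleftrightarrow>
     (\<forall>u v w. range u \<subseteq> B \<longrightarrow> range v \<subseteq> B \<longrightarrow> range w \<subseteq> B \<longrightarrow>
        \<phi> u (\<lambda>i. v i + w i) = \<phi> u v + \<phi> u w \<and> cnj (\<phi> u v) = \<phi> v u \<and>
        complex_nonneg (\<phi> u u) \<and>
        (\<forall>b\<in>B. \<phi> (\<lambda>i. b * u i) v = \<phi> u (\<lambda>i. st b * v i)) \<and>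
        (\<forall>c. \<phi> u (\<lambda>i. sc c * v i) = c * \<phi> u v))"

context
  fixes \<phi> :: "('i \<Rightarrow> 'b) \<Rightarrow> ('i \<Rightarrow> 'b) \<Rightarrow> complex"
  assumes form: "positive_form \<phi>"
begin

lemma form_add2: "range u \<subseteq> B \<Longrightarrow> range v \<subseteq> B \<Longrightarrow> range w \<subseteq> B \<Longrightarrow> \<phi> u (\<lambda>i. v i + w i) = \<phi> u v + \<phi> u w"
  and form_cnj: "range u \<subseteq> B \<Longrightarrow> range v \<subseteq> B \<Longrightarrow> cnj (\<phi> u v) = \<phi> v u"
  and form_nonneg: "range u \<subseteq> B \<Longrightarrow> complex_nonneg (\<phi> u u)"
  and form_mult: "range u \<subseteq> B \<Longrightarrow> range v \<subseteq> B \<Longrightarrow> b \<in> B \<Longrightarrow> \<phi> (\<lambda>i. b * u i) v = \<phi> u (\<lambda>i. st b * v i)"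
  and form_sc: "range u \<subseteq> B \<Longrightarrow> range v \<subseteq> B \<Longrightarrow> \<phi> u (\<lambda>i. sc c * v i) = c * \<phi> u v"
  using form unfolding positive_form_def by blast+

lemma form_add1:
  assumes "range u \<subseteq> B" "range v \<subseteq> B" "range w \<subseteq> B"
  shows "\<phi> (\<lambda>i. v i + w i) u = \<phi> v u + \<phi> w u"
proof -
  have vw: "range (\<lambda>i. v i + w i) \<subseteq> B" using assms by (auto intro!: add_B)
  have "\<phi> (\<lambda>i. v i + w i) u = cnj (\<phi> u (\<lambda>i. v i + w i))" using form_cnj[OF assms(1) vw] by simp
  then show ?thesis using assms by (simp add: form_add2 form_cnj)
qed

lemma form_mult':
  assumes "range u \<subseteq> B" "range v \<subseteq> B" "b \<in> B"
  shows "\<phi> u (\<lambda>i. b * v i) = \<phi> (\<lambda>i. st b * u i) v"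
  using form_mult[OF assms(1,2), of "st b"] assms by simp

lemma form_sum2:
  assumes "range u \<subseteq> B" "\<And>k. k \<in> K \<Longrightarrow> range (v k) \<subseteq> B" "finite K"
  shows "\<phi> u (\<lambda>i. \<Sum>k\<in>K. v k i) = (\<Sum>k\<in>K. \<phi> u (v k))"
  using assms(3,2)
proof (induction K)
  case empty
  have "\<phi> u (\<lambda>i. sc 0 * 0) = 0 * \<phi> u (\<lambda>i. 0)" using assms(1) by (intro form_sc) auto
  then show ?case by simp
next
  case (insert k K)
  have "range (\<lambda>i. \<Sum>k\<in>K. v k i) \<subseteq> B" using insert by (auto intro!: sum_B)
  then show ?case using insert assms(1) by (simp add: form_add2)
qed

lemma form_Im: "range u \<subseteq> B \<Longrightarrow> Im (\<phi> u u) = 0" and form_Re: "range u \<subseteq> B \<Longrightarrow> Re (\<phi> u u) \<ge> 0"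
  using form_nonneg by (auto simp: complex_nonneg_iff)

lemma form_polar:
  assumes u: "range u \<subseteq> B" and v: "range v \<subseteq> B"
  shows "Re (\<phi> (\<lambda>i. u i + v i) (\<lambda>i. u i + v i)) = Re (\<phi> u u) + 2 * Re (\<phi> u v) + Re (\<phi> v v)"
proof -
  have uv: "range (\<lambda>i. u i + v i) \<subseteq> B" using u v by (auto intro!: add_B)
  have "\<phi> (\<lambda>i. u i + v i) (\<lambda>i. u i + v i) = \<phi> u u + \<phi> u v + (\<phi> v u + \<phi> v v)"
    using u v uv by (simp add: form_add1 form_add2)
  moreover have "Re (\<phi> v u) = Re (\<phi> u v)" using form_cnj[OF u v, symmetric] by simp
  ultimately show ?thesis by simp
qed

lemma form_lower_bound:
  assumes u: "range u \<subseteq> B" and v: "range v \<subseteq> B"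
  shows "2 * Re (\<phi> u v) \<ge> - Re (\<phi> u u) - Re (\<phi> v v)"
proof -
  have "range (\<lambda>i. u i + v i) \<subseteq> B" using u v by (auto intro!: add_B)
  from form_Re[OF this] form_polar[OF u v] show ?thesis by linarith
qed

text \<open>The degenerate case of the Cauchy-Schwarz inequality: when multiples of a null vector
  are added to another vector, the value of the form is affine in the multiplier, and an affine
  function bounded below is constant.\<close>

lemma form_null:
  assumes u: "range u \<subseteq> B" and v: "range v \<subseteq> B" and 0: "\<phi> u u = 0"
  shows "\<phi> u v = 0" "\<phi> v u = 0"
proof -
  have *: "Re (c * \<phi> u v) = 0" for c
  proof (rule ccontr)
    assume nz: "Re (c * \<phi> u v) \<noteq> 0"
    define a where "a = Re (c * \<phi> u v)"
    \<comment> \<open>Chosen so that \<open>2 * (s * a)\<close> falls below the bound that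
      \<open>form_lower_bound\<close> imposes on it.\<close>
    define s where "s = - (Re (\<phi> (\<lambda>i. sc c * v i) (\<lambda>i. sc c * v i)) + 1) / a"
    have cv: "range (\<lambda>i. sc c * v i) \<subseteq> B" using v by (auto intro!: mult_B)
    have su: "range (\<lambda>i. sc (of_real s) * u i) \<subseteq> B" using u by (auto intro!: mult_B)
    have 1: "\<phi> (\<lambda>i. sc (of_real s) * u i) (\<lambda>i. sc c * v i) = of_real s * (c * \<phi> u v)"
    proof -
      have "\<phi> (\<lambda>i. sc (of_real s) * u i) (\<lambda>i. sc c * v i) = \<phi> u (\<lambda>i. sc (of_real s) * (sc c * v i))"
        using form_mult[OF u cv sc_B[of "of_real s"]] by simp
      then show ?thesis using form_sc[OF u cv] form_sc[OF u v] by simp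
    qed
    have 2: "\<phi> (\<lambda>i. sc (of_real s) * u i) (\<lambda>i. sc (of_real s) * u i) = 0"
    proof -
      have "\<phi> (\<lambda>i. sc (of_real s) * u i) (\<lambda>i. sc (of_real s) * u i) = \<phi> u (\<lambda>i. sc (of_real s) * (sc (of_real s) * u i))"
        using form_mult[OF u su sc_B[of "of_real s"]] by simp
      then show ?thesis using form_sc[OF u su] form_sc[OF u u] 0 by simp
    qed
    have "2 * (s * a) \<ge> - Re (\<phi> (\<lambda>i. sc c * v i) (\<lambda>i. sc c * v i))"
      using form_lower_bound[OF su cv] unfolding 1 2 by (simp add: a_def)
    moreover have "s * a = - (Re (\<phi> (\<lambda>i. sc c * v i) (\<lambda>i. sc c * v i)) + 1)"
      using nz by (simp add: s_def a_def)
    ultimately show False using form_Re[OF cv] by linarith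
  qed
  show "\<phi> u v = 0" using *[of 1] *[of "\<i>"] by (simp add: complex_eq_iff)
  then show "\<phi> v u = 0" using form_cnj[OF u v] by simp
qed

text \<open>An entry of \<open>p0\<close> costs at most the square of \<open>G k\<close> plus the
  square of \<open>p0 k j * G j\<close>. Over all entries the first kind adds up to \<open>n\<close>
  times the squares of the \<open>G k\<close>, and the second is contained in the squares that
  \<open>large_scalar\<close> provides; the diagonal pays for both, and its summand \<open>1\<close>
  is left.\<close>

lemma dominant_form_bound:
  assumes p: "dominant p" and G: "\<And>k. range (G k) \<subseteq> B"
  shows "Im (\<Sum>k<n. \<Sum>j<n. \<phi> (G k) (\<lambda>i. p k j * G j i)) = 0"
    and "Re (\<Sum>k<n. \<Sum>j<n. \<phi> (G k) (\<lambda>i. p k j * G j i)) \<ge> (\<Sum>k<n. Re (\<phi> (G k) (G k)))"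
proof -
  obtain p0 where p0: "\<And>k j. k < n \<Longrightarrow> j < n \<Longrightarrow> p0 k j \<in> B" "\<And>k j. k < n \<Longrightarrow> j < n \<Longrightarrow> st (p0 k j) = p0 j k"
    and pp: "\<And>k j. k < n \<Longrightarrow> j < n \<Longrightarrow> p k j = p0 k j + (if k = j then large_scalar p0 else 0)"
    using p unfolding dominant_def by blast
  have L: "large_scalar p0 \<in> B" by (rule large_scalar_B[OF p0(1)])
  have pB: "p k j \<in> B" "st (p k j) = p j k" if "k < n" "j < n" for k j
    using that L by (auto simp: pp p0 st_large_scalar)
  have R: "range (\<lambda>i. b * G k i) \<subseteq> B" if "b \<in> B" for b k using that G[of k] by (auto intro!: mult_B)
  have "cnj (\<Sum>k<n. \<Sum>j<n. \<phi> (G k) (\<lambda>i. p k j * G j i)) = (\<Sum>k<n. \<Sum>j<n. \<phi> (\<lambda>i. p k j * G j i) (G k))"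
    by (simp add: form_cnj[OF G R[OF pB(1)]])
  also have "\<dots> = (\<Sum>k<n. \<Sum>j<n. \<phi> (G j) (\<lambda>i. p j k * G k i))"
    by (intro sum.cong refl) (simp add: form_mult[OF G G pB(1)] pB(2))
  also have "\<dots> = (\<Sum>k<n. \<Sum>j<n. \<phi> (G k) (\<lambda>i. p k j * G j i))" by (rule sum.swap)
  finally show "Im (\<Sum>k<n. \<Sum>j<n. \<phi> (G k) (\<lambda>i. p k j * G j i)) = 0"
    by (simp only: Reals_cnj_iff[symmetric] complex_is_Real_iff[symmetric])
  have split: "\<phi> (G k) (\<lambda>i. p k j * G j i) = \<phi> (G k) (\<lambda>i. p0 k j * G j i)
      + (if k = j then \<phi> (G k) (\<lambda>i. large_scalar p0 * G k i) else 0)" if "k < n" "j < n" for k j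
  proof (cases "k = j")
    case True
    have "\<phi> (G k) (\<lambda>i. p0 k k * G k i + large_scalar p0 * G k i) =
        \<phi> (G k) (\<lambda>i. p0 k k * G k i) + \<phi> (G k) (\<lambda>i. large_scalar p0 * G k i)"
      by (rule form_add2[OF G R R]) (use that L p0 True in auto)
    then show ?thesis using True that by (simp add: pp algebra_simps)
  qed (use that in \<open>simp add: pp\<close>)
  let ?N = "\<lambda>k. Re (\<phi> (G k) (G k))"
  let ?M = "\<lambda>a b k. Re (\<phi> (\<lambda>i. p0 a b * G k i) (\<lambda>i. p0 a b * G k i))"
  have M0: "?M a b k \<ge> 0" if "a < n" "b < n" for a b k
    by (rule form_Re[OF R]) (use p0 that in auto)
  have N0: "?N k \<ge> 0" for k by (rule form_Re[OF G])
  have large: "Re (\<phi> (G k) (\<lambda>i. large_scalar p0 * G k i)) = (1 + real n) * ?N k + (\<Sum>a<n. \<Sum>b<n. ?M a b k)" for k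
  proof -
    have "(\<lambda>i. large_scalar p0 * G k i) = (\<lambda>i. sc (1 + of_nat n) * G k i + (\<Sum>a<n. \<Sum>b<n. st (p0 a b) * (p0 a b * G k i)))"
      by (simp add: large_scalar_def sc_add sc_of_nat algebra_simps sum_distrib_right sum_distrib_left)
    moreover have "\<phi> (G k) (\<lambda>i. sc (1 + of_nat n) * G k i + (\<Sum>a<n. \<Sum>b<n. st (p0 a b) * (p0 a b * G k i))) =
       \<phi> (G k) (\<lambda>i. sc (1 + of_nat n) * G k i) + \<phi> (G k) (\<lambda>i. \<Sum>a<n. \<Sum>b<n. st (p0 a b) * (p0 a b * G k i))"
      by (rule form_add2[OF G R]) (use G[of k] p0 in \<open>auto intro!: sum_B mult_B\<close>)
    moreover have "\<phi> (G k) (\<lambda>i. sc (1 + of_nat n) * G k i) = (1 + of_nat n) * \<phi> (G k) (G k)"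
      by (rule form_sc[OF G G])
    moreover have "\<phi> (G k) (\<lambda>i. \<Sum>a<n. \<Sum>b<n. st (p0 a b) * (p0 a b * G k i)) =
       (\<Sum>a<n. \<phi> (G k) (\<lambda>i. \<Sum>b<n. st (p0 a b) * (p0 a b * G k i)))"
      by (rule form_sum2[OF G]) (use G[of k] p0 in \<open>auto intro!: sum_B mult_B\<close>)
    moreover have "\<phi> (G k) (\<lambda>i. \<Sum>b<n. st (p0 a b) * (p0 a b * G k i)) =
       (\<Sum>b<n. \<phi> (G k) (\<lambda>i. st (p0 a b) * (p0 a b * G k i)))" if "a < n" for a
      by (rule form_sum2[OF G]) (use G[of k] p0 that in \<open>auto intro!: sum_B mult_B\<close>)
    moreover have "\<phi> (G k) (\<lambda>i. st (p0 a b) * (p0 a b * G k i)) = \<phi> (\<lambda>i. p0 a b * G k i) (\<lambda>i. p0 a b * G k i)"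
      if "a < n" "b < n" for a b
      using form_mult[OF G[of k] R p0(1)[OF that], of "p0 a b" k] p0(1)[OF that] by simp
    ultimately show ?thesis by simp
  qed
  have low: "2 * Re (\<phi> (G k) (\<lambda>i. p0 k j * G j i)) \<ge> - ?N k - ?M k j j" if "k < n" "j < n" for k j
    by (rule form_lower_bound[OF G R]) (use p0 that in auto)
  have "(\<Sum>k<n. \<Sum>j<n. Re (\<phi> (G k) (\<lambda>i. p0 k j * G j i))) \<ge> (\<Sum>k<n. \<Sum>j<n. - ?N k - ?M k j j)"
  proof (intro sum_mono)
    fix k j assume kj: "k \<in> {..<n}" "j \<in> {..<n}"
    then show "- ?N k - ?M k j j \<le> Re (\<phi> (G k) (\<lambda>i. p0 k j * G j i))"
      using low[of k j] N0[of k] M0[of k j j] by auto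
  qed
  moreover have "(\<Sum>k<n. \<Sum>j<n. - ?N k - ?M k j j) = - (real n * (\<Sum>k<n. ?N k)) - (\<Sum>j<n. \<Sum>k<n. ?M k j j)"
    by (subst sum.swap[of "\<lambda>j k. ?M k j j"]) (simp add: sum_subtractf sum_negf sum_distrib_left)
  moreover have "(\<Sum>j<n. \<Sum>k<n. ?M k j j) \<le> (\<Sum>j<n. \<Sum>a<n. \<Sum>b<n. ?M a b j)"
  proof (intro sum_mono)
    fix j a assume "j \<in> {..<n}" "a \<in> {..<n}"
    then show "?M a j j \<le> (\<Sum>b<n. ?M a b j)"
      using M0 by (intro member_le_sum[of j "{..<n}" "\<lambda>b. ?M a b j"]) auto
  qed
  moreover have "Re (\<Sum>k<n. \<Sum>j<n. \<phi> (G k) (\<lambda>i. p k j * G j i)) =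
      (\<Sum>k<n. \<Sum>j<n. Re (\<phi> (G k) (\<lambda>i. p0 k j * G j i))) + (\<Sum>k<n. Re (\<phi> (G k) (\<lambda>i. large_scalar p0 * G k i)))"
    by (simp add: split sum.distrib if_distrib[of Re])
  moreover have "(\<Sum>k<n. Re (\<phi> (G k) (\<lambda>i. large_scalar p0 * G k i))) =
      (\<Sum>k<n. ?N k) + real n * (\<Sum>k<n. ?N k) + (\<Sum>k<n. \<Sum>a<n. \<Sum>b<n. ?M a b k)"
    by (simp only: large sum.distrib sum_distrib_left distrib_right mult_1_left)
  ultimately show "Re (\<Sum>k<n. \<Sum>j<n. \<phi> (G k) (\<lambda>i. p k j * G j i)) \<ge> (\<Sum>k<n. ?N k)"
    by linarith
qed

end

text \<open>The form induced by \<open>\<phi>\<close> and the \<open>r\<close>-th tensor power of \<open>p\<close> on families indexed by multi-indices.\<close>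

primrec tensor_form :: "(nat \<Rightarrow> nat \<Rightarrow> 'b) \<Rightarrow> (('i \<Rightarrow> 'b) \<Rightarrow> ('i \<Rightarrow> 'b) \<Rightarrow> complex) \<Rightarrow> nat \<Rightarrow>
    (nat list \<times> 'i \<Rightarrow> 'b) \<Rightarrow> (nat list \<times> 'i \<Rightarrow> 'b) \<Rightarrow> complex" where
  "tensor_form p \<phi> 0 F G = \<phi> (\<lambda>i. F ([], i)) (\<lambda>i. G ([], i))"
| "tensor_form p \<phi> (Suc r) F G = (\<Sum>k<n. \<Sum>j<n. tensor_form p \<phi> r
     (\<lambda>(I, i). F (k # I, i)) (\<lambda>(I, i). p k j * G (j # I, i)))"

text \<open>Only the slices at words of length \<open>r\<close> with letters below \<open>n\<close>
  enter \<open>tensor_form\<close>, so it is enough that these annihilate everything.\<close>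

lemma tensor_form_null:
  assumes "\<And>I v. length I = r \<Longrightarrow> set I \<subseteq> {..<n} \<Longrightarrow> range v \<subseteq> B \<Longrightarrow> \<phi> (\<lambda>i. F (I, i)) v = 0" "range G \<subseteq> B"
    and p: "\<And>k j. k < n \<Longrightarrow> j < n \<Longrightarrow> p k j \<in> B"
  shows "tensor_form p \<phi> r F G = 0"
  using assms(1,2)
proof (induction r arbitrary: F G)
  case 0
  have "\<phi> (\<lambda>i. F ([], i)) (\<lambda>i. G ([], i)) = 0" by (rule 0(1)) (use 0(2) in auto)
  then show ?case by simp
next
  case (Suc r)
  have "tensor_form p \<phi> r (\<lambda>(I, i). F (k # I, i)) (\<lambda>(I, i). p k j * G (j # I, i)) = 0"
    if "k < n" "j < n" for k j
    by (rule Suc.IH) (use Suc.prems p that in \<open>auto intro!: mult_B\<close>)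
  then show ?case by simp
qed

text \<open>One use of \<open>dominant_form_bound\<close> for each tensor factor: the form for
  \<open>r\<close> factors plays the role of \<phi>, and the slices of \<open>F\<close> by their
  first letter are the vectors. The margin in that bound is what yields the estimate by a single
  word.\<close>

lemma positive_tensor_form:
  assumes p: "dominant p" and \<phi>: "positive_form \<phi>"
  shows "positive_form (tensor_form p \<phi> r) \<and> (\<forall>F. range F \<subseteq> B \<longrightarrow> (\<forall>I. length I = r \<longrightarrow> set I \<subseteq> {..<n} \<longrightarrow>
    Re (tensor_form p \<phi> r F F) \<ge> Re (\<phi> (\<lambda>i. F (I, i)) (\<lambda>i. F (I, i)))))"
proof (induction r)
  case 0
  have "positive_form (tensor_form p \<phi> 0)"
    unfolding positive_form_def tensor_form.simps
  proof (intro allI impI conjI ballI)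
    fix F G H :: "nat list \<times> 'a \<Rightarrow> 'b" and b c
    assume "range F \<subseteq> B" "range G \<subseteq> B" "range H \<subseteq> B"
    then have R: "range (\<lambda>i. F ([], i)) \<subseteq> B" "range (\<lambda>i. G ([], i)) \<subseteq> B" "range (\<lambda>i. H ([], i)) \<subseteq> B" by auto
    note form_add2[OF \<phi> R] form_cnj[OF \<phi> R(1,2)] form_nonneg[OF \<phi> R(1)] form_mult[OF \<phi> R(1,2)] form_sc[OF \<phi> R(1,2)]
    then show "\<phi> (\<lambda>i. F ([], i)) (\<lambda>i. G ([], i) + H ([], i)) =
        \<phi> (\<lambda>i. F ([], i)) (\<lambda>i. G ([], i)) + \<phi> (\<lambda>i. F ([], i)) (\<lambda>i. H ([], i))"
      "cnj (\<phi> (\<lambda>i. F ([], i)) (\<lambda>i. G ([], i))) = \<phi> (\<lambda>i. G ([], i)) (\<lambda>i. F ([], i))"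
      "complex_nonneg (\<phi> (\<lambda>i. F ([], i)) (\<lambda>i. F ([], i)))"
      "b \<in> B \<Longrightarrow> \<phi> (\<lambda>i. b * F ([], i)) (\<lambda>i. G ([], i)) = \<phi> (\<lambda>i. F ([], i)) (\<lambda>i. st b * G ([], i))"
      "\<phi> (\<lambda>i. F ([], i)) (\<lambda>i. sc c * G ([], i)) = c * \<phi> (\<lambda>i. F ([], i)) (\<lambda>i. G ([], i))"
      by blast+
  qed
  then show ?case by (intro conjI, assumption) simp
next
  case (Suc r)
  let ?T = "tensor_form p \<phi> r"
  have pf: "positive_form ?T" using Suc by blast
  obtain p0 where p0: "\<And>k j. k < n \<Longrightarrow> j < n \<Longrightarrow> p0 k j \<in> B" "\<And>k j. k < n \<Longrightarrow> j < n \<Longrightarrow> st (p0 k j) = p0 j k"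
    and pp: "\<And>k j. k < n \<Longrightarrow> j < n \<Longrightarrow> p k j = p0 k j + (if k = j then large_scalar p0 else 0)"
    using p unfolding dominant_def by blast
  have pB: "p k j \<in> B" "st (p k j) = p j k" if "k < n" "j < n" for k j
    using that large_scalar_B[OF p0(1)] by (auto simp: pp p0 st_large_scalar)
  let ?c = "\<lambda>k F (I, i). F (k # I, i)"
  have eq: "tensor_form p \<phi> (Suc r) F G = (\<Sum>k<n. \<Sum>j<n. ?T (?c k F) (\<lambda>i. p k j * ?c j G i))" for F G
    by (simp add: case_prod_beta')
  have cB: "range (?c k F) \<subseteq> B" if "range F \<subseteq> B" for F k using that by auto
  have mB: "range (\<lambda>i. b * F i) \<subseteq> B" if "range F \<subseteq> B" "b \<in> B" for b and F :: "'c \<Rightarrow> 'b"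
    using that by (auto intro!: mult_B)
  have bound: "Im (tensor_form p \<phi> (Suc r) F F) = 0"
    "Re (tensor_form p \<phi> (Suc r) F F) \<ge> (\<Sum>k<n. Re (?T (?c k F) (?c k F)))" if "range F \<subseteq> B" for F
    using dominant_form_bound[OF pf p, of "\<lambda>k. ?c k F"] cB[OF that] unfolding eq by auto
  have "positive_form (tensor_form p \<phi> (Suc r))"
    unfolding positive_form_def
  proof (intro allI impI conjI ballI)
    fix F G H :: "nat list \<times> 'a \<Rightarrow> 'b"
    assume F: "range F \<subseteq> B" and G: "range G \<subseteq> B" and H: "range H \<subseteq> B"
    have "?T (?c k F) (\<lambda>i. p k j * ?c j (\<lambda>i. G i + H i) i) =
        ?T (?c k F) (\<lambda>i. p k j * ?c j G i) + ?T (?c k F) (\<lambda>i. p k j * ?c j H i)" if "k < n" "j < n" for k j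
      using form_add2[OF pf cB[OF F] mB[OF cB[OF G] pB(1)[OF that]] mB[OF cB[OF H] pB(1)[OF that]]]
      by (simp add: case_prod_beta' algebra_simps)
    then show "tensor_form p \<phi> (Suc r) F (\<lambda>i. G i + H i) = tensor_form p \<phi> (Suc r) F G + tensor_form p \<phi> (Suc r) F H"
      unfolding eq by (simp add: sum.distrib)
    have "cnj (?T (?c k F) (\<lambda>i. p k j * ?c j G i)) = ?T (?c j G) (\<lambda>i. p j k * ?c k F i)" if "k < n" "j < n" for k j
      using form_cnj[OF pf cB[OF F] mB[OF cB[OF G] pB(1)[OF that]]]
        form_mult[OF pf cB[OF G] cB[OF F] pB(1)[OF that]] by (simp add: pB(2)[OF that])
    then have "cnj (tensor_form p \<phi> (Suc r) F G) = (\<Sum>k<n. \<Sum>j<n. ?T (?c j G) (\<lambda>i. p j k * ?c k F i))"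
      unfolding eq by simp
    then show "cnj (tensor_form p \<phi> (Suc r) F G) = tensor_form p \<phi> (Suc r) G F"
      unfolding eq by (subst sum.swap) simp
    have "(\<Sum>k<n. Re (?T (?c k F) (?c k F))) \<ge> 0" by (intro sum_nonneg form_Re[OF pf cB[OF F]])
    then show "complex_nonneg (tensor_form p \<phi> (Suc r) F F)"
      using bound[OF F] by (simp add: complex_nonneg_iff del: tensor_form.simps)
    show "tensor_form p \<phi> (Suc r) (\<lambda>i. b * F i) G = tensor_form p \<phi> (Suc r) F (\<lambda>i. st b * G i)" if b: "b \<in> B" for b
    proof -
      have "?T (?c k (\<lambda>i. b * F i)) (\<lambda>i. p k j * ?c j G i) = ?T (?c k F) (\<lambda>i. p k j * ?c j (\<lambda>i. st b * G i) i)"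
        if "k < n" "j < n" for k j
        using form_mult[OF pf cB[OF F] mB[OF cB[OF G] pB(1)[OF that]] b]
        by (simp add: case_prod_beta' mult.left_commute)
      then show ?thesis unfolding eq by simp
    qed
    show "tensor_form p \<phi> (Suc r) F (\<lambda>i. sc c * G i) = c * tensor_form p \<phi> (Suc r) F G" for c
    proof -
      have "?T (?c k F) (\<lambda>i. p k j * ?c j (\<lambda>i. sc c * G i) i) = c * ?T (?c k F) (\<lambda>i. p k j * ?c j G i)"
        if "k < n" "j < n" for k j
        using form_sc[OF pf cB[OF F] mB[OF cB[OF G] pB(1)[OF that]], where c = c]
        by (simp add: case_prod_beta' mult.left_commute)
      then show ?thesis unfolding eq by (simp add: sum_distrib_left)
    qed
  qed
  moreover have "Re (tensor_form p \<phi> (Suc r) F F) \<ge> Re (\<phi> (\<lambda>i. F (I, i)) (\<lambda>i. F (I, i)))"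
    if F: "range F \<subseteq> B" and I: "length I = Suc r" "set I \<subseteq> {..<n}" for F I
  proof -
    obtain k J where J: "I = k # J" "length J = r" "set J \<subseteq> {..<n}" "k < n" using I by (cases I) auto
    have "Re (\<phi> (\<lambda>i. F (I, i)) (\<lambda>i. F (I, i))) \<le> Re (?T (?c k F) (?c k F))"
      using conjunct2[OF Suc, rule_format, OF cB[OF F, of k] J(2,3)] J(1) by simp
    also have "\<dots> \<le> (\<Sum>k<n. Re (?T (?c k F) (?c k F)))"
      using J form_Re[OF pf cB[OF F]] by (intro member_le_sum[of k]) auto
    also have "\<dots> \<le> Re (tensor_form p \<phi> (Suc r) F F)" by (rule bound[OF F])
    finally show ?thesis .
  qed
  ultimately show ?case by blast
qed

section \<open>Jets paired by a positive matrix functional\<close>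

primrec list_deriv :: "nat list \<Rightarrow> 'b \<Rightarrow> 'b" where
  "list_deriv [] u = u"
| "list_deriv (k # I) u = list_deriv I (d k u)"

lemma list_deriv_append: "list_deriv (I @ [k]) u = d k (list_deriv I u)"
  by (induction I arbitrary: u) auto

lemma list_deriv_B: "set I \<subseteq> {..<n} \<Longrightarrow> u \<in> B \<Longrightarrow> list_deriv I u \<in> B"
  by (induction I arbitrary: u) auto

definition st_series :: "'b fps \<Rightarrow> 'b fps" where
  "st_series F = Abs_fps (\<lambda>k. st (fps_nth F k))"

text \<open>The entries of a functional on matrices over \<open>B\<close>. It is tested on matrices
  \<open>st (u i) * u j\<close> built from a single row \<open>u\<close>, since
  \<open>a\<^sup>* a\<close> is the sum of such matrices over the rows of \<open>a\<close>.\<close>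

definition positive_matrix_functional :: "nat \<Rightarrow> (nat \<Rightarrow> nat \<Rightarrow> 'b \<Rightarrow> complex) \<Rightarrow> bool" where
  "positive_matrix_functional N \<Lambda> \<longleftrightarrow>
     (\<forall>i<N. \<forall>j<N. \<forall>u\<in>B. \<forall>v\<in>B. \<Lambda> i j (u + v) = \<Lambda> i j u + \<Lambda> i j v) \<and>
     (\<forall>i<N. \<forall>j<N. \<forall>u\<in>B. \<forall>c. \<Lambda> i j (sc c * u) = c * \<Lambda> i j u) \<and>
     (\<forall>u. range u \<subseteq> B \<longrightarrow> complex_nonneg (\<Sum>i<N. \<Sum>j<N. \<Lambda> i j (st (u i) * u j)))"

context
  fixes N \<Lambda> assumes \<Lambda>: "positive_matrix_functional N \<Lambda>"
begin

lemma \<Lambda>_add: "i < N \<Longrightarrow> j < N \<Longrightarrow> u \<in> B \<Longrightarrow> v \<in> B \<Longrightarrow> \<Lambda> i j (u + v) = \<Lambda> i j u + \<Lambda> i j v"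
  and \<Lambda>_sc: "i < N \<Longrightarrow> j < N \<Longrightarrow> u \<in> B \<Longrightarrow> \<Lambda> i j (sc c * u) = c * \<Lambda> i j u"
  using \<Lambda> unfolding positive_matrix_functional_def by blast+

lemma \<Lambda>_pos: "range u \<subseteq> B \<Longrightarrow> complex_nonneg (\<Sum>i<N. \<Sum>j<N. \<Lambda> i j (st (u i) * u j))"
  using \<Lambda> unfolding positive_matrix_functional_def by blast

lemma \<Lambda>_0: "i < N \<Longrightarrow> j < N \<Longrightarrow> \<Lambda> i j 0 = 0"
  using \<Lambda>_add[of i j 0 0] by simp

lemma \<Lambda>_sum: "i < N \<Longrightarrow> j < N \<Longrightarrow> (\<And>k. k \<in> K \<Longrightarrow> h k \<in> B) \<Longrightarrow> \<Lambda> i j (\<Sum>k\<in>K. h k) = (\<Sum>k\<in>K. \<Lambda> i j (h k))"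
  by (induction K rule: infinite_finite_induct) (auto simp: \<Lambda>_add \<Lambda>_0)

definition pair :: "(nat \<Rightarrow> 'b) \<Rightarrow> (nat \<Rightarrow> 'b) \<Rightarrow> complex" where
  "pair u v = (\<Sum>i<N. \<Sum>j<N. \<Lambda> i j (st (u i) * v j))"

lemma positive_form_pair: "positive_form pair"
proof -
  have add: "pair u (\<lambda>i. v i + w i) = pair u v + pair u w" "pair (\<lambda>i. v i + w i) u = pair v u + pair w u"
    if "range u \<subseteq> B" "range v \<subseteq> B" "range w \<subseteq> B" for u v w
    using that unfolding pair_def by (simp_all add: algebra_simps \<Lambda>_add sum.distrib image_subset_iff)
  have sc: "pair u (\<lambda>i. sc c * v i) = c * pair u v" "pair (\<lambda>i. sc c * u i) v = cnj c * pair u v"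
    if "range u \<subseteq> B" "range v \<subseteq> B" for u v c
    using that unfolding pair_def
    by (simp_all add: mult.left_commute[of _ "sc c"] mult.assoc \<Lambda>_sc sum_distrib_left image_subset_iff)
  have herm: "cnj (pair u v) = pair v u" if u: "range u \<subseteq> B" and v: "range v \<subseteq> B" for u v
  proof -
    \<comment> \<open>Polarization: Hermitian symmetry of the pairing follows from the reality of
      its values on \<open>u + c v\<close> with \<open>c = 1\<close> and
      \<open>c = \<i>\<close>.\<close>
    have *: "Im (c * pair u v + cnj c * pair v u) = 0" for c
    proof -
      have cv: "range (\<lambda>i. sc c * v i) \<subseteq> B" using v by (auto intro!: mult_B)
      have "range (\<lambda>i. u i + sc c * v i) \<subseteq> B" using u v by (auto intro!: mult_B add_B)
      then have "Im (pair (\<lambda>i. u i + sc c * v i) (\<lambda>i. u i + sc c * v i)) = 0" "Im (pair u u) = 0" "Im (pair v v) = 0"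
        using \<Lambda>_pos u v unfolding complex_nonneg_iff pair_def by blast+
      moreover have "pair (\<lambda>i. u i + sc c * v i) (\<lambda>i. u i + sc c * v i) =
          pair u u + c * pair u v + (cnj c * pair v u + cnj c * (c * pair v v))"
        using \<open>range (\<lambda>i. u i + sc c * v i) \<subseteq> B\<close> u v cv by (simp add: add sc)
      moreover have "Im (cnj c * (c * z)) = 0" if "Im z = 0" for z using that by (simp add: algebra_simps)
      ultimately show ?thesis by simp
    qed
    show ?thesis using *[of 1] *[of "\<i>"] by (simp add: complex_eq_iff)
  qed
  have mult: "pair (\<lambda>i. b * u i) v = pair u (\<lambda>i. st b * v i)" for b u v
    unfolding pair_def by (simp add: mult.assoc mult.left_commute)
  show ?thesis unfolding positive_form_def
    by (intro allI impI conjI ballI add(1) sc(1) herm mult) (auto simp: pair_def intro: \<Lambda>_pos)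
qed

lemma cnj_\<Lambda>:
  assumes i: "i < N" and j: "j < N" and b: "b \<in> B"
  shows "cnj (\<Lambda> i j b) = \<Lambda> j i (st b)"
proof -
  have single: "pair (\<lambda>k. if k = i then 1 else 0) (\<lambda>k. if k = j then b else 0) = \<Lambda> i j b"
    if "i < N" "j < N" "b \<in> B" for i j b
  proof -
    have "pair (\<lambda>k. if k = i then 1 else 0) (\<lambda>k. if k = j then b else 0) =
        (\<Sum>k<N. \<Sum>l<N. if k = i \<and> l = j then \<Lambda> i j b else 0)"
      unfolding pair_def by (intro sum.cong refl) (auto simp: \<Lambda>_0)
    also have "\<dots> = (\<Sum>k<N. if k = i then \<Sum>l<N. if l = j then \<Lambda> i j b else 0 else 0)"
      by (intro sum.cong refl) auto
    finally have "pair (\<lambda>k. if k = i then 1 else 0) (\<lambda>k. if k = j then b else 0) =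
        (\<Sum>k<N. if k = i then \<Sum>l<N. if l = j then \<Lambda> i j b else 0 else 0)" .
    then show ?thesis using that by simp
  qed
  have single': "pair (\<lambda>k. if k = j then b else 0) (\<lambda>k. if k = i then 1 else 0) = \<Lambda> j i (st b)"
  proof -
    have "pair (\<lambda>k. if k = j then b else 0) (\<lambda>k. if k = i then 1 else 0) =
        (\<Sum>k<N. \<Sum>l<N. if k = j \<and> l = i then \<Lambda> j i (st b) else 0)"
      unfolding pair_def by (intro sum.cong refl) (auto simp: \<Lambda>_0)
    also have "\<dots> = (\<Sum>k<N. if k = j then \<Sum>l<N. if l = i then \<Lambda> j i (st b) else 0 else 0)"
      by (intro sum.cong refl) auto
    finally have "pair (\<lambda>k. if k = j then b else 0) (\<lambda>k. if k = i then 1 else 0) =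
        (\<Sum>k<N. if k = j then \<Sum>l<N. if l = i then \<Lambda> j i (st b) else 0 else 0)" .
    then show ?thesis using i j by simp
  qed
  have "cnj (pair (\<lambda>k. if k = i then 1 else 0) (\<lambda>k. if k = j then b else 0)) =
      pair (\<lambda>k. if k = j then b else 0) (\<lambda>k. if k = i then 1 else 0)"
    by (rule form_cnj[OF positive_form_pair]) (use b in auto)
  then show ?thesis unfolding single[OF i j b] single' .
qed

text \<open>The factor \<open>b\<close> collects the coefficients \<open>p k l\<close> that the
  recursion of \<open>leading\<close> has already split off; without it the induction would not
  close.\<close>

lemma leading_tensor_form:
  assumes p: "\<And>k j. k < n \<Longrightarrow> j < n \<Longrightarrow> p k j \<in> B"
  shows "range u \<subseteq> B \<Longrightarrow> range v \<subseteq> B \<Longrightarrow> b \<in> B \<Longrightarrow>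
    (\<Sum>i<N. \<Sum>j<N. \<Lambda> i j (b * leading p r (st (u i)) (v j))) =
    1 / fact r * tensor_form p pair r (\<lambda>(I, i). list_deriv I (u i)) (\<lambda>(I, i). b * list_deriv I (v i))"
proof (induction r arbitrary: u v b)
  case 0
  show ?case by (simp add: pair_def mult.left_commute)
next
  case (Suc r)
  let ?c = "1 / of_nat (Suc r) :: complex"
  have uB: "u i \<in> B" "v i \<in> B" for i using Suc.prems by auto
  have "(\<Sum>i<N. \<Sum>j<N. \<Lambda> i j (b * leading p (Suc r) (st (u i)) (v j))) =
      (\<Sum>i<N. \<Sum>j<N. ?c * (\<Sum>k<n. \<Sum>l<n. \<Lambda> i j ((b * p k l) * leading p r (st (d k (u i))) (d l (v j)))))"
  proof (intro sum.cong refl)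
    fix i j assume ij: "i \<in> {..<N}" "j \<in> {..<N}"
    have B: "(b * p k l) * leading p r (st (d k (u i))) (d l (v j)) \<in> B" if "k < n" "l < n" for k l
      using that p uB Suc.prems by (intro mult_B leading_B[OF p]) auto
    have "b * leading p (Suc r) (st (u i)) (v j) = sc ?c * (\<Sum>k<n. \<Sum>l<n. (b * p k l) * leading p r (st (d k (u i))) (d l (v j)))"
      using uB by (simp add: sum_distrib_left st_d mult.assoc mult.left_commute[of b] del: of_nat_Suc)
    moreover have "\<Lambda> i j (sc ?c * (\<Sum>k<n. \<Sum>l<n. (b * p k l) * leading p r (st (d k (u i))) (d l (v j)))) =
        ?c * \<Lambda> i j (\<Sum>k<n. \<Sum>l<n. (b * p k l) * leading p r (st (d k (u i))) (d l (v j)))"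
      using ij by (intro \<Lambda>_sc sum_B B) auto
    moreover have "\<Lambda> i j (\<Sum>k<n. \<Sum>l<n. (b * p k l) * leading p r (st (d k (u i))) (d l (v j))) =
        (\<Sum>k<n. \<Lambda> i j (\<Sum>l<n. (b * p k l) * leading p r (st (d k (u i))) (d l (v j))))"
      using ij by (intro \<Lambda>_sum sum_B B) auto
    moreover have "\<Lambda> i j (\<Sum>l<n. (b * p k l) * leading p r (st (d k (u i))) (d l (v j))) =
        (\<Sum>l<n. \<Lambda> i j ((b * p k l) * leading p r (st (d k (u i))) (d l (v j))))" if "k < n" for k
      using ij that by (intro \<Lambda>_sum B) auto
    ultimately show "\<Lambda> i j (b * leading p (Suc r) (st (u i)) (v j)) =
        ?c * (\<Sum>k<n. \<Sum>l<n. \<Lambda> i j ((b * p k l) * leading p r (st (d k (u i))) (d l (v j))))"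
      by (simp del: leading.simps of_nat_Suc)
  qed
  also have "\<dots> = ?c * (\<Sum>i<N. \<Sum>j<N. \<Sum>k<n. \<Sum>l<n. \<Lambda> i j ((b * p k l) * leading p r (st (d k (u i))) (d l (v j))))"
    by (simp only: sum_distrib_left)
  also have "(\<Sum>i<N. \<Sum>j<N. \<Sum>k<n. \<Sum>l<n. \<Lambda> i j ((b * p k l) * leading p r (st (d k (u i))) (d l (v j)))) =
      (\<Sum>k<n. \<Sum>l<n. \<Sum>i<N. \<Sum>j<N. \<Lambda> i j ((b * p k l) * leading p r (st (d k (u i))) (d l (v j))))"
  proof -
    have "(\<Sum>i<N. \<Sum>j<N. \<Sum>k<n. \<Sum>l<n. h i j k l) = (\<Sum>k<n. \<Sum>l<n. \<Sum>i<N. \<Sum>j<N. h i j k l)"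
      for h :: "nat \<Rightarrow> nat \<Rightarrow> nat \<Rightarrow> nat \<Rightarrow> complex"
      unfolding sum.cartesian_product by (rule sum.reindex_bij_witness[of _
          "\<lambda>(k, l, i, j). (i, j, k, l)" "\<lambda>(i, j, k, l). (k, l, i, j)"]) auto
    then show ?thesis .
  qed
  also have "\<dots> = (\<Sum>k<n. \<Sum>l<n. 1 / fact r * tensor_form p pair r (\<lambda>(I, i). list_deriv I (d k (u i)))
      (\<lambda>(I, i). (b * p k l) * list_deriv I (d l (v i))))"
    by (intro sum.cong refl Suc.IH) (use uB p Suc.prems in auto)
  also have "?c * \<dots> = 1 / fact (Suc r) * tensor_form p pair (Suc r) (\<lambda>(I, i). list_deriv I (u i)) (\<lambda>(I, i). b * list_deriv I (v i))"
    by (simp add: sum_distrib_left[symmetric] sum_divide_distrib mult.assoc mult.left_commute[of _ b] mult.commute[of "fact r"]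
        del: of_nat_Suc)
  finally show ?case .
qed

lemma st_star_of:
  assumes "star_coeffs C" "F \<in> series B" "G \<in> series B"
  shows "st (fps_nth (star_of C F G) k) = fps_nth (star_of C (st_series G) (st_series F)) k"
proof -
  have "st (fps_nth (star_of C F G) k) = fps_nth (star_of (\<lambda>r f g. C r g f) (st_series F) (st_series G)) k"
    using assms(2,3) by (simp add: star_of_def st_series_def star_herm[OF assms(1)] series_nth)
  then show ?thesis by (subst star_of_flip)
qed

text \<open>The number \<open>m\<close> bounds from below the weight \<open>|I| + 2 a\<close> of all derivatives \<open>I\<close> of coefficients of
  order \<open>a\<close> that are not null vectors of the form \<open>pair\<close>.\<close>

definition weight_ge :: "(nat \<Rightarrow> nat \<Rightarrow> 'b) \<Rightarrow> nat \<Rightarrow> bool" where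
  "weight_ge u m \<longleftrightarrow> (\<forall>I a. set I \<subseteq> {..<n} \<longrightarrow> length I + 2 * a < m \<longrightarrow>
     pair (\<lambda>i. list_deriv I (u i a)) (\<lambda>i. list_deriv I (u i a)) = 0)"

context
  fixes u :: "nat \<Rightarrow> nat \<Rightarrow> 'b" assumes u: "\<And>i a. u i a \<in> B"
begin

lemma range_list_deriv: "set I \<subseteq> {..<n} \<Longrightarrow> range (\<lambda>i. list_deriv I (u i a)) \<subseteq> B"
  using u by (auto intro: list_deriv_B)

text \<open>An operator in \<open>bidiffop w\<close> adds at most \<open>w - 1\<close> derivatives,
  so every term has total weight below \<open>2 * m\<close>. One of its two arguments then has
  weight below \<open>m\<close>, hence is a null vector, and the term vanishes by
  \<open>form_null\<close>.\<close>

lemma bidiffop_vanishes: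
  assumes wt: "weight_ge u m"
  shows "bidiffop w Z \<Longrightarrow> set I \<subseteq> {..<n} \<Longrightarrow> set J \<subseteq> {..<n} \<Longrightarrow>
    length I + 2 * a + length J + 2 * b + w \<le> 2 * m \<Longrightarrow>
    (\<Sum>i<N. \<Sum>j<N. \<Lambda> i j (Z (st (list_deriv I (u i a))) (list_deriv J (u j b)))) = 0"
proof (induction w arbitrary: Z I J)
  case 0
  then show ?case using u by (auto simp: list_deriv_B \<Lambda>_0)
next
  case (Suc w)
  obtain c X Y where Z: "c \<in> B" "\<And>i. i < n \<Longrightarrow> bidiffop w (X i)" "\<And>i. i < n \<Longrightarrow> bidiffop w (Y i)"
    "\<And>f g. f \<in> B \<Longrightarrow> g \<in> B \<Longrightarrow>
      Z f g = c * f * g + (\<Sum>i<n. X i (d i f) g) + (\<Sum>i<n. Y i f (d i g))"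
    using Suc.prems(1) by (rule bidiffop_SucE) blast
  let ?f = "\<lambda>i. list_deriv I (u i a)" and ?g = "\<lambda>j. list_deriv J (u j b)"
  have B: "?f i \<in> B" "?g i \<in> B" for i using Suc.prems u by (auto intro: list_deriv_B)
  have R: "range ?f \<subseteq> B" "range ?g \<subseteq> B" "range (\<lambda>j. c * ?g j) \<subseteq> B" using B Z(1) by auto
  have XB: "X k (d k (st (?f i))) (?g j) \<in> B" "Y k (st (?f i)) (d k (?g j)) \<in> B" if "k < n" for i j k
    using B that by (auto intro: bidiffop_B[OF Z(2)] bidiffop_B[OF Z(3)])
  have expand: "\<Lambda> i j (Z (st (?f i)) (?g j)) = \<Lambda> i j (st (?f i) * (c * ?g j)) +
      (\<Sum>k<n. \<Lambda> i j (X k (st (list_deriv (I @ [k]) (u i a))) (?g j))) +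
      (\<Sum>k<n. \<Lambda> i j (Y k (st (?f i)) (list_deriv (J @ [k]) (u j b))))" if "i < N" "j < N" for i j
  proof -
    have "Z (st (?f i)) (?g j) = st (?f i) * (c * ?g j) + (\<Sum>k<n. X k (d k (st (?f i))) (?g j)) + (\<Sum>k<n. Y k (st (?f i)) (d k (?g j)))"
      using Z(4)[OF st_B[OF B(1)] B(2), of i j] by (simp add: algebra_simps)
    moreover have "st (?f i) * (c * ?g j) \<in> B" using B Z(1) by auto
    moreover have "\<Lambda> i j (\<Sum>k<n. X k (d k (st (?f i))) (?g j)) = (\<Sum>k<n. \<Lambda> i j (X k (d k (st (?f i))) (?g j)))"
      "\<Lambda> i j (\<Sum>k<n. Y k (st (?f i)) (d k (?g j))) = (\<Sum>k<n. \<Lambda> i j (Y k (st (?f i)) (d k (?g j))))"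
      using that XB by (auto intro: \<Lambda>_sum)
    moreover have "(\<Sum>k<n. X k (d k (st (?f i))) (?g j)) \<in> B" "(\<Sum>k<n. Y k (st (?f i)) (d k (?g j))) \<in> B"
      using XB by (auto intro!: sum_B)
    ultimately have "\<Lambda> i j (Z (st (?f i)) (?g j)) = \<Lambda> i j (st (?f i) * (c * ?g j)) +
      (\<Sum>k<n. \<Lambda> i j (X k (d k (st (?f i))) (?g j))) + (\<Sum>k<n. \<Lambda> i j (Y k (st (?f i)) (d k (?g j))))"
      using that by (simp only: \<Lambda>_add add_B)
    then show ?thesis using B by (simp add: list_deriv_append st_d)
  qed
  have 1: "(\<Sum>i<N. \<Sum>j<N. \<Lambda> i j (st (?f i) * (c * ?g j))) = 0"
  proof -
    have "length I + 2 * a < m \<or> length J + 2 * b < m" using Suc.prems(4) by linarith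
    then have "pair ?f ?f = 0 \<or> pair ?g ?g = 0" using wt Suc.prems unfolding weight_ge_def by blast
    then have "pair ?f (\<lambda>j. c * ?g j) = 0"
    proof
      assume "pair ?f ?f = 0"
      then show ?thesis by (rule form_null(1)[OF positive_form_pair, OF R(1,3)])
    next
      assume 0: "pair ?g ?g = 0"
      have "pair ?f (\<lambda>j. c * ?g j) = pair (\<lambda>j. st c * ?f j) ?g"
        by (rule form_mult'[OF positive_form_pair, OF R(1,2) Z(1)])
      also have "\<dots> = 0"
      proof -
        have "range (\<lambda>j. st c * ?f j) \<subseteq> B" using B Z(1) by auto
        from form_null(2)[OF positive_form_pair, OF R(2) this 0] show ?thesis .
      qed
      finally show ?thesis .
    qed
    then show ?thesis by (simp add: pair_def)
  qed
  have 2: "(\<Sum>i<N. \<Sum>j<N. \<Lambda> i j (X k (st (list_deriv (I @ [k]) (u i a))) (?g j))) = 0" if "k < n" for k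
    by (rule Suc.IH[OF Z(2)[OF that]]) (use Suc.prems that in auto)
  have 3: "(\<Sum>i<N. \<Sum>j<N. \<Lambda> i j (Y k (st (?f i)) (list_deriv (J @ [k]) (u j b)))) = 0" if "k < n" for k
    by (rule Suc.IH[OF Z(3)[OF that]]) (use Suc.prems that in auto)
  have swap: "(\<Sum>i<N. \<Sum>j<N. \<Sum>k<n. h i j k) = (\<Sum>k<n. \<Sum>i<N. \<Sum>j<N. h i j k)" for h :: "nat \<Rightarrow> nat \<Rightarrow> nat \<Rightarrow> complex"
    unfolding sum.cartesian_product by (rule sum.reindex_bij_witness[of _
        "\<lambda>(k, i, j). (i, j, k)" "\<lambda>(i, j, k). (k, i, j)"]) auto
  have "(\<Sum>i<N. \<Sum>j<N. \<Lambda> i j (Z (st (?f i)) (?g j))) = (\<Sum>i<N. \<Sum>j<N. \<Lambda> i j (st (?f i) * (c * ?g j))) +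
      (\<Sum>k<n. \<Sum>i<N. \<Sum>j<N. \<Lambda> i j (X k (st (list_deriv (I @ [k]) (u i a))) (?g j))) +
      (\<Sum>k<n. \<Sum>i<N. \<Sum>j<N. \<Lambda> i j (Y k (st (?f i)) (list_deriv (J @ [k]) (u j b))))"
    by (simp add: expand sum.distrib swap)
  then show ?case using 1 2 3 by simp
qed

context
  fixes C assumes C: "star_coeffs C" and nat: "\<And>r. natural_at C r" and dom: "dominant (symbol1 C)"
begin

text \<open>The coefficient of degree \<open>m\<close> of the functional on
  \<open>F\<^sup>* \<star> F\<close>, where \<open>u i a\<close> is the coefficient of degree
  \<open>a\<close> of \<open>F i\<close>.\<close>

definition form_coeff :: "nat \<Rightarrow> complex" where
  "form_coeff m = (\<Sum>a\<le>m. \<Sum>b\<le>m - a. \<Sum>i<N. \<Sum>j<N. \<Lambda> i j (C (m - a - b) (st (u i a)) (u j b)))"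

text \<open>A contribution to degree \<open>k\<close> has total weight at most \<open>2 * k\<close>,
  since a natural \<open>C r\<close> carries at most \<open>2 * r\<close> derivatives.\<close>

lemma form_coeff_below:
  assumes "weight_ge u m" "k < m"
  shows "form_coeff k = 0"
proof -
  have "(\<Sum>i<N. \<Sum>j<N. \<Lambda> i j (C (k - a - b) (st (u i a)) (u j b))) = 0" if "a \<le> k" "b \<le> k - a" for a b
    using bidiffop_vanishes[OF assms(1) natural_bidiffop[OF C nat, of "k - a - b"], of "[]" "[]" a b] that assms(2)
    by simp
  then show ?thesis unfolding form_coeff_def by (simp del: diff_diff_left)
qed

text \<open>Cut off at words with letters below \<open>n\<close>, so that all values lie in
  \<open>B\<close>; \<open>tensor_form\<close> never evaluates other words.\<close>

abbreviation "jet a \<equiv> \<lambda>(I, i). if set I \<subseteq> {..<n} then list_deriv I (u i a) else 0"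

lemma tensor_form_cong:
  "(\<And>I i. set I \<subseteq> {..<n} \<Longrightarrow> F (I, i) = F' (I, i)) \<Longrightarrow> (\<And>I i. set I \<subseteq> {..<n} \<Longrightarrow> G (I, i) = G' (I, i)) \<Longrightarrow>
    tensor_form p \<phi> r F G = tensor_form p \<phi> r F' G'"
proof (induction r arbitrary: F F' G G')
  case (Suc r)
  show ?case unfolding tensor_form.simps by (intro sum.cong refl Suc.IH) (use Suc.prems in auto)
qed simp

text \<open>A term that survives in degree \<open>m\<close> has weight exactly \<open>m\<close> in
  both arguments. This leaves only the leading symbols, and of these only \<open>C r\<close> between
  coefficients of the same degree \<open>a\<close>, with \<open>r = m - 2 * a\<close>. Each gives a
  positive tensor form, so nothing cancels and every jet of weight \<open>m\<close> bounds the sum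
  from below.\<close>

lemma form_coeff_lowest:
  assumes wt: "weight_ge u m"
  shows "Im (form_coeff m) = 0"
    and "set I \<subseteq> {..<n} \<Longrightarrow> length I + 2 * a = m \<Longrightarrow>
      Re (form_coeff m) \<ge> 1 / fact (length I) * Re (pair (\<lambda>i. list_deriv I (u i a)) (\<lambda>i. list_deriv I (u i a)))"
proof -
  let ?p = "symbol1 C"
  note pB = symbol1_B[OF C nat]
  let ?T = "\<lambda>r. tensor_form ?p pair r"
  have pf: "positive_form (?T r)" for r using positive_tensor_form[OF dom positive_form_pair] by blast
  have jB: "range (jet a) \<subseteq> B" for a using u by (auto intro!: list_deriv_B)
  \<comment> \<open>The difference from the leading symbol has total order below
    \<open>2 * r\<close>, which is exactly what \<open>bidiffop_vanishes\<close> can absorb at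
    weight \<open>m\<close>.\<close>
  have trm: "(\<Sum>i<N. \<Sum>j<N. \<Lambda> i j (C r (st (u i a)) (u j b))) = 1 / fact r * ?T r (jet a) (jet b)"
    if "r + a + b = m" for r a b
  proof -
    have ub: "range (\<lambda>i. u i a) \<subseteq> B" "range (\<lambda>i. u i b) \<subseteq> B" using u by auto
    have "(\<Sum>i<N. \<Sum>j<N. \<Lambda> i j (C r (st (u i a)) (u j b) - leading ?p r (st (u i a)) (u j b))) = 0"
      using bidiffop_vanishes[OF wt leading_symbol[OF C nat, of r], of "[]" "[]" a b] that by simp
    moreover have "\<Lambda> i j (C r (st (u i a)) (u j b) - leading ?p r (st (u i a)) (u j b)) =
        \<Lambda> i j (C r (st (u i a)) (u j b)) - \<Lambda> i j (leading ?p r (st (u i a)) (u j b))" if "i < N" "j < N" for i j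
    proof -
      have B: "leading ?p r (st (u i a)) (u j b) \<in> B" "C r (st (u i a)) (u j b) \<in> B"
        using u by (auto intro: leading_B[OF pB] star_B[OF C])
      then show ?thesis
        using \<Lambda>_add[OF that, of "C r (st (u i a)) (u j b) - leading ?p r (st (u i a)) (u j b)"
            "leading ?p r (st (u i a)) (u j b)"] by simp
    qed
    ultimately have "(\<Sum>i<N. \<Sum>j<N. \<Lambda> i j (C r (st (u i a)) (u j b))) =
        (\<Sum>i<N. \<Sum>j<N. \<Lambda> i j (1 * leading ?p r (st (u i a)) (u j b)))"
      by (simp add: sum_subtractf)
    also have "\<dots> = 1 / fact r * ?T r (\<lambda>(I, i). list_deriv I (u i a)) (\<lambda>(I, i). 1 * list_deriv I (u i b))"
      by (rule leading_tensor_form[OF pB ub one_B])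
    also have "?T r (\<lambda>(I, i). list_deriv I (u i a)) (\<lambda>(I, i). 1 * list_deriv I (u i b)) = ?T r (jet a) (jet b)"
      by (rule tensor_form_cong) auto
    finally show ?thesis .
  qed
  \<comment> \<open>The numbers \<open>r + 2 * a\<close> and \<open>r + 2 * b\<close> have mean
    \<open>m\<close>; if they differ, one of them is below \<open>m\<close> and the corresponding
    jets are null.\<close>
  have off: "?T r (jet a) (jet b) = 0" if r: "r + a + b = m" and ab: "a \<noteq> b" for r a b
  proof -
    have null: "?T r (jet a) G = 0" if "r + 2 * a < m" "range G \<subseteq> B" for a G
    proof (rule tensor_form_null[OF _ that(2) pB])
      fix I and v :: "nat \<Rightarrow> 'b" assume I: "length I = r" "set I \<subseteq> {..<n}" and v: "range v \<subseteq> B"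
      have "pair (\<lambda>i. list_deriv I (u i a)) (\<lambda>i. list_deriv I (u i a)) = 0"
        using wt I that unfolding weight_ge_def by blast
      from form_null(1)[OF positive_form_pair, OF range_list_deriv[OF I(2)] v this]
      show "pair (\<lambda>i. jet a (I, i)) v = 0" using I by simp
    qed auto
    consider "a < b" | "b < a" using ab by linarith
    then show ?thesis
    proof cases
      case 1
      then show ?thesis using r jB by (intro null) auto
    next
      case 2
      then have "?T r (jet b) (jet a) = 0" using r jB by (intro null) auto
      then show ?thesis using form_cnj[OF pf jB jB, of r b a] by simp
    qed
  qed
  let ?S = "{a. 2 * a \<le> m}"
  have fin: "finite ?S" by (rule finite_subset[of _ "{..m}"]) auto
  have "form_coeff m = (\<Sum>a\<le>m. \<Sum>b\<le>m - a. 1 / fact (m - a - b) * ?T (m - a - b) (jet a) (jet b))"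
    unfolding form_coeff_def by (intro sum.cong refl trm) auto
  also have "\<dots> = (\<Sum>a\<le>m. \<Sum>b\<le>m - a. if b = a then 1 / fact (m - 2 * a) * ?T (m - 2 * a) (jet a) (jet a) else 0)"
  proof (intro sum.cong refl)
    fix a b assume ab: "a \<in> {..m}" "b \<in> {..m - a}"
    show "1 / fact (m - a - b) * ?T (m - a - b) (jet a) (jet b) =
        (if b = a then 1 / fact (m - 2 * a) * ?T (m - 2 * a) (jet a) (jet a) else 0)"
    proof (cases "a = b")
      case True
      then have b: "b = a" by simp
      show ?thesis unfolding b by (simp add: mult_2)
    next
      case False
      with ab off[of "m - a - b" a b] show ?thesis by simp
    qed
  qed
  also have "\<dots> = (\<Sum>a\<le>m. if a \<in> ?S then 1 / fact (m - 2 * a) * ?T (m - 2 * a) (jet a) (jet a) else 0)"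
    by (intro sum.cong refl) (auto simp: sum.delta')
  also have "\<dots> = (\<Sum>a\<in>?S. 1 / fact (m - 2 * a) * ?T (m - 2 * a) (jet a) (jet a))"
    by (rule sum.mono_neutral_cong_right) auto
  finally have eq: "form_coeff m = (\<Sum>a\<in>?S. of_real (1 / fact (m - 2 * a)) * ?T (m - 2 * a) (jet a) (jet a))"
    by simp
  show "Im (form_coeff m) = 0"
    unfolding eq Im_sum by (rule sum.neutral) (simp only: form_Im[OF pf jB] Im_complex_of_real Re_complex_of_real times_complex.sel, simp)
  have Re: "Re (form_coeff m) = (\<Sum>a\<in>?S. 1 / fact (m - 2 * a) * Re (?T (m - 2 * a) (jet a) (jet a)))"
  proof -
    have "Re (of_real r * z) = r * Re z" for r z by simp
    then show ?thesis unfolding eq Re_sum by (simp only:)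
  qed
  assume I: "set I \<subseteq> {..<n}" "length I + 2 * a = m"
  have "Re (pair (\<lambda>i. jet a (I, i)) (\<lambda>i. jet a (I, i))) \<le> Re (?T (length I) (jet a) (jet a))"
    using positive_tensor_form[OF dom positive_form_pair] jB[of a] I by blast
  then have "1 / fact (length I) * Re (pair (\<lambda>i. list_deriv I (u i a)) (\<lambda>i. list_deriv I (u i a))) \<le>
      1 / fact (length I) * Re (?T (length I) (jet a) (jet a))"
    using I by (intro mult_left_mono) auto
  also have "\<dots> \<le> Re (form_coeff m)"
  proof -
    have m: "m - 2 * a = length I" using I by auto
    show ?thesis unfolding Re
      using member_le_sum[of a ?S "\<lambda>a. 1 / fact (m - 2 * a) * Re (?T (m - 2 * a) (jet a) (jet a))"] fin I
        form_Re[OF pf jB] unfolding m by auto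
  qed
  finally show "1 / fact (length I) * Re (pair (\<lambda>i. list_deriv I (u i a)) (\<lambda>i. list_deriv I (u i a))) \<le> Re (form_coeff m)" .
qed

text \<open>If all jets are null, all coefficients vanish. Otherwise a nonnull jet of minimal weight
  \<open>m\<close> makes the coefficient of degree \<open>m\<close> strictly positive, and the
  minimality kills the lower ones.\<close>

lemma form_coeff_zero_or_positive:
  "(\<forall>k. form_coeff k = 0) \<or> (\<exists>m. (\<forall>k<m. form_coeff k = 0) \<and> Re (form_coeff m) > 0)"
proof (cases "\<forall>m. weight_ge u m")
  case True
  then show ?thesis using form_coeff_below by blast
next
  case False
  have 0: "weight_ge u 0" by (simp add: weight_ge_def)
  obtain m where m: "weight_ge u m" "\<not> weight_ge u (Suc m)"
    using False 0 by (metis nat_induct)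
  then obtain I a where I: "set I \<subseteq> {..<n}" "length I + 2 * a < Suc m"
    "pair (\<lambda>i. list_deriv I (u i a)) (\<lambda>i. list_deriv I (u i a)) \<noteq> 0"
    unfolding weight_ge_def by blast
  have "length I + 2 * a = m" using I m(1) unfolding weight_ge_def by (meson less_SucE)
  from form_coeff_lowest(2)[OF m(1) I(1) this]
  have "Re (form_coeff m) \<ge> 1 / fact (length I) * Re (pair (\<lambda>i. list_deriv I (u i a)) (\<lambda>i. list_deriv I (u i a)))" .
  moreover have "Re (pair (\<lambda>i. list_deriv I (u i a)) (\<lambda>i. list_deriv I (u i a))) > 0"
    using I(3) form_Re[OF positive_form_pair range_list_deriv[OF I(1)], of a]
      form_Im[OF positive_form_pair range_list_deriv[OF I(1)], of a]
    by (auto simp: complex_eq_iff less_le)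
  then have "1 / fact (length I) * Re (pair (\<lambda>i. list_deriv I (u i a)) (\<lambda>i. list_deriv I (u i a))) > 0" by simp
  ultimately show ?thesis using form_coeff_below[OF m(1)] by (intro disjI2 exI[of _ m]) auto
qed

end
end

lemma natural_star_positive:
  assumes C: "star_coeffs C" and nat: "\<And>r. natural_at C r" and dom: "dominant (symbol1 C)"
    and F: "\<And>i. i < N \<Longrightarrow> F i \<in> series B"
  shows "complex_fps_nonneg (Abs_fps (\<lambda>m. \<Sum>i<N. \<Sum>j<N. \<Lambda> i j (fps_nth (star_of C (st_series (F i)) (F j)) m)))"
proof -
  \<comment> \<open>Extended by \<open>0\<close> beyond \<open>N\<close>, because the forms are
    stated for families over all natural numbers with values in \<open>B\<close>.\<close>
  define u where "u = (\<lambda>i a. if i < N then fps_nth (F i) a else 0)"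
  have u: "u i a \<in> B" for i a using F by (auto simp: u_def series_nth)
  have stF: "st_series (F i) \<in> series B" if "i < N" for i
    using F[OF that] by (auto simp: st_series_def series_def)
  have swap: "(\<Sum>i<N. \<Sum>j<N. \<Sum>a\<le>m. \<Sum>b\<le>m - a. h i j a b) = (\<Sum>a\<le>m. \<Sum>b\<le>m - a. \<Sum>i<N. \<Sum>j<N. h i j a b)"
    for h :: "nat \<Rightarrow> nat \<Rightarrow> nat \<Rightarrow> nat \<Rightarrow> complex" and m
  proof -
    have "(\<Sum>i<N. \<Sum>j<N. \<Sum>a\<le>m. \<Sum>b\<le>m - a. h i j a b) = (\<Sum>i<N. \<Sum>a\<le>m. \<Sum>j<N. \<Sum>b\<le>m - a. h i j a b)"
      by (intro sum.cong refl sum.swap)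
    also have "\<dots> = (\<Sum>a\<le>m. \<Sum>i<N. \<Sum>j<N. \<Sum>b\<le>m - a. h i j a b)" by (rule sum.swap)
    also have "\<dots> = (\<Sum>a\<le>m. \<Sum>i<N. \<Sum>b\<le>m - a. \<Sum>j<N. h i j a b)"
      by (intro sum.cong refl sum.swap)
    also have "\<dots> = (\<Sum>a\<le>m. \<Sum>b\<le>m - a. \<Sum>i<N. \<Sum>j<N. h i j a b)"
      by (intro sum.cong refl sum.swap)
    finally show ?thesis .
  qed
  have eq: "(\<Sum>i<N. \<Sum>j<N. \<Lambda> i j (fps_nth (star_of C (st_series (F i)) (F j)) m)) = form_coeff u C m" for m
  proof -
    have "\<Lambda> i j (fps_nth (star_of C (st_series (F i)) (F j)) m) =
      (\<Sum>a\<le>m. \<Sum>b\<le>m - a. \<Lambda> i j (C (m - a - b) (st (u i a)) (u j b)))" if ij: "i < N" "j < N" for i j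
    proof -
      have B: "C r (st (u i a)) (u j b) \<in> B" for r a b using u by (intro star_B[OF C]) auto
      have "fps_nth (star_of C (st_series (F i)) (F j)) m = (\<Sum>a\<le>m. \<Sum>b\<le>m - a. C (m - a - b) (st (u i a)) (u j b))"
        using ij by (simp add: star_of_def st_series_def u_def)
      also have "\<Lambda> i j \<dots> = (\<Sum>a\<le>m. \<Lambda> i j (\<Sum>b\<le>m - a. C (m - a - b) (st (u i a)) (u j b)))"
        by (intro \<Lambda>_sum[OF ij] sum_B B)
      also have "\<dots> = (\<Sum>a\<le>m. \<Sum>b\<le>m - a. \<Lambda> i j (C (m - a - b) (st (u i a)) (u j b)))"
        by (intro sum.cong refl \<Lambda>_sum[OF ij] B)
      finally show ?thesis .
    qed
    then show ?thesis unfolding form_coeff_def[OF u C nat dom] swap[symmetric] by simp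
  qed
  \<comment> \<open>Nonnegativity requires all coefficients to be real, also those after the first
    nonzero one. The Hermitian product and \<open>cnj_\<Lambda>\<close> give this without any use of
    weights.\<close>
  have real: "Im (form_coeff u C m) = 0" for m
  proof -
    let ?w = "\<lambda>i j. fps_nth (star_of C (st_series (F i)) (F j)) m"
    have wB: "?w i j \<in> B" if "i < N" "j < N" for i j
      using star_of_series[OF star_biadditive[OF C] stF F] that by (simp add: series_nth)
    have "cnj (\<Sum>i<N. \<Sum>j<N. \<Lambda> i j (?w i j)) = (\<Sum>i<N. \<Sum>j<N. \<Lambda> j i (st (?w i j)))"
      unfolding cnj_sum by (intro sum.cong refl cnj_\<Lambda> wB) auto
    also have "\<dots> = (\<Sum>i<N. \<Sum>j<N. \<Lambda> j i (?w j i))"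
    proof (intro sum.cong refl)
      fix i j assume ij: "i \<in> {..<N}" "j \<in> {..<N}"
      have "st_series (st_series (F i)) = F i" by (rule fps_ext) (simp add: st_series_def)
      then show "\<Lambda> j i (st (?w i j)) = \<Lambda> j i (?w j i)" using st_star_of[OF C stF F] ij by simp
    qed
    also have "\<dots> = (\<Sum>i<N. \<Sum>j<N. \<Lambda> i j (?w i j))" by (rule sum.swap)
    finally show ?thesis unfolding eq by (simp only: Reals_cnj_iff[symmetric] complex_is_Real_iff[symmetric])
  qed
  show ?thesis
    by (rule complex_fps_nonnegI)
      (use real form_coeff_zero_or_positive[OF u C nat dom] in \<open>auto simp: eq fps_eq_iff\<close>)
qed

end

text \<open>Since \<tau> commutes with the involution, it turns \<open>F\<^sup>* \<star> F\<close>
  into the square of \<open>app \<tau> F\<close> for the transported product, which is natural with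
  dominant symbol. One \<tau> serves all functionals and all matrix sizes.\<close>

theorem star_positive:
  assumes C: "star_coeffs C"
  shows "\<exists>\<tau>. gauge_transformation \<tau> \<and> (\<forall>N \<Lambda> F. positive_matrix_functional N \<Lambda> \<longrightarrow> (\<forall>i<N. F i \<in> series B) \<longrightarrow>
    complex_fps_nonneg (Abs_fps (\<lambda>m. \<Sum>i<N. \<Sum>j<N. \<Lambda> i j (fps_nth (app \<tau> (star_of C (st_series (F i)) (F j))) m))))"
proof -
  obtain \<tau> where gt: "gauge_transformation \<tau>" and nat: "\<And>r. natural_at (gauge \<tau> C) r"
    and dom: "dominant (symbol1 (gauge \<tau> C))" using natural_gauge[OF C] by blast
  note G = gauge_star_coeffs[OF gt C]
  have "complex_fps_nonneg (Abs_fps (\<lambda>m. \<Sum>i<N. \<Sum>j<N. \<Lambda> i j (fps_nth (app \<tau> (star_of C (st_series (F i)) (F j))) m)))"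
    if \<Lambda>: "positive_matrix_functional N \<Lambda>" and F: "\<And>i. i < N \<Longrightarrow> F i \<in> series B" for N \<Lambda> F
  proof -
    have stF: "st_series (F i) \<in> series B" if "i < N" for i
      using F[OF that] by (auto simp: st_series_def series_def)
    have "app \<tau> (star_of C (st_series (F i)) (F j)) = star_of (gauge \<tau> C) (st_series (app \<tau> (F i))) (app \<tau> (F j))"
      if "i < N" "j < N" for i j
    proof -
      have "st_series (app \<tau> (F i)) = app \<tau> (st_series (F i))"
        by (rule fps_ext) (use F[OF that(1)] in \<open>simp add: st_series_def app_def gt_st[OF gt] series_nth\<close>)
      then show ?thesis
        using that stF F app_gt_series[OF gt] by (simp add: gauge_star[OF gt C] app_inverse_gt[OF gt])
    qed
    then show ?thesis
      using natural_star_positive[OF \<Lambda> G nat dom, of "\<lambda>i. app \<tau> (F i)"] F app_gt_series[OF gt] by simp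
  qed
  then show ?thesis using gt by blast
qed

end

section \<open>Smooth functions on open sets\<close>

lemma Euclidean_space_top_of_set: "Euclidean_space n = top_of_set {x. \<forall>i\<ge>n. x i = 0}"
  by (simp add: Euclidean_space_def euclidean_product_topology)

text \<open>Basic open sets of the product topology restrict finitely many coordinates, and from
  index \<open>n\<close> on all coordinates are \<open>0\<close>; so a common width for the first
  \<open>n\<close> coordinates describes all neighbourhoods.\<close>

lemma openin_Euclidean_box:
  "openin (Euclidean_space n) U \<longleftrightarrow> U \<subseteq> {x. \<forall>i\<ge>n. x i = 0} \<and>
    (\<forall>x\<in>U. \<exists>e>0. \<forall>y. (\<forall>i\<ge>n. y i = 0) \<longrightarrow> (\<forall>i<n. \<bar>y i - x i\<bar> < e) \<longrightarrow> y \<in> U)" (is "_ \<longleftrightarrow> ?R")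
proof
  assume "openin (Euclidean_space n) U"
  then obtain T where T: "open T" "U = T \<inter> {x. \<forall>i\<ge>n. x i = 0}"
    unfolding Euclidean_space_top_of_set by (auto simp: openin_open)
  have "\<exists>e>0. \<forall>y. (\<forall>i\<ge>n. y i = 0) \<longrightarrow> (\<forall>i<n. \<bar>y i - x i\<bar> < e) \<longrightarrow> y \<in> U" if x: "x \<in> U" for x
  proof -
    have "openin (product_topology (\<lambda>i. euclidean) UNIV) T" "x \<in> T"
      using T x by (auto simp: euclidean_product_topology)
    from product_topology_open_contains_basis[OF this]
    obtain X where X: "x \<in> (\<Pi>\<^sub>E i\<in>UNIV. X i)" "\<And>i. open (X i)" "(\<Pi>\<^sub>E i\<in>UNIV. X i) \<subseteq> T" by auto
    have "\<exists>e>0. \<forall>t. \<bar>t - x i\<bar> < e \<longrightarrow> t \<in> X i" for i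
    proof -
      have "x i \<in> X i" using X(1) by auto
      then obtain e where "e > 0" "ball (x i) e \<subseteq> X i" using X(2)[of i] open_contains_ball by blast
      then show ?thesis by (intro exI[of _ e]) (auto simp: subset_iff dist_real_def abs_minus_commute)
    qed
    then obtain e where e: "\<And>i. e i > 0" "\<And>i t. \<bar>t - x i\<bar> < e i \<Longrightarrow> t \<in> X i" by metis
    \<comment> \<open>\<open>insert 1\<close> keeps the minimum meaningful in dimension
      \<open>0\<close>.\<close>
    define d where "d = Min (insert 1 (e ` {..<n}))"
    have "d > 0" unfolding d_def using e(1) by (subst Min_gr_iff) auto
    moreover have "y \<in> U" if "\<forall>i\<ge>n. y i = 0" "\<forall>i<n. \<bar>y i - x i\<bar> < d" for y
    proof -
      have "y i \<in> X i" for i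
      proof (cases "i < n")
        case True
        then have "d \<le> e i" unfolding d_def by (intro Min_le) auto
        then show ?thesis using True that(2) e(2)[of "y i" i] by force
      next
        case False
        then have "y i = x i" using that(1) x T by auto
        then show ?thesis using X(1) by auto
      qed
      then have "y \<in> T" using X(3) by auto
      then show ?thesis using that T by auto
    qed
    ultimately show ?thesis by blast
  qed
  then show ?R using T by auto
next
  assume R: ?R
  then have "\<forall>x\<in>U. \<exists>e>0. \<forall>y. (\<forall>i\<ge>n. y i = 0) \<longrightarrow> (\<forall>i<n. \<bar>y i - x i\<bar> < e) \<longrightarrow> y \<in> U" by blast
  then obtain e where e: "\<And>x. x \<in> U \<Longrightarrow> e x > 0"
    "\<And>x y. x \<in> U \<Longrightarrow> (\<forall>i\<ge>n. y i = 0) \<Longrightarrow> (\<forall>i<n. \<bar>y i - x i\<bar> < e x) \<Longrightarrow> y \<in> U" by metis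
  define T where "T = (\<Union>x\<in>U. \<Inter>i<n. {y. \<bar>y i - x i\<bar> < e x})"
  have "open {y :: nat \<Rightarrow> real. \<bar>y i - a\<bar> < b}" for i a b
    by (intro open_Collect_less continuous_intros continuous_on_subset[OF continuous_on_product_coordinates]) auto
  then have "open T" unfolding T_def by (intro open_UN ballI open_INT) auto
  moreover have "U = T \<inter> {x. \<forall>i\<ge>n. x i = 0}"
  proof
    show "U \<subseteq> T \<inter> {x. \<forall>i\<ge>n. x i = 0}" using R e(1) unfolding T_def by force
    show "T \<inter> {x. \<forall>i\<ge>n. x i = 0} \<subseteq> U" unfolding T_def using e(2) by blast
  qed
  ultimately show "openin (Euclidean_space n) U"
    unfolding Euclidean_space_top_of_set by (auto simp: openin_open)
qed

text \<open>The mean value inequality for \<open>f t - t *\<^sub>R A\<close>, on a segment so that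
  \<open>b\<close> may lie on either side of \<open>a\<close>.\<close>

lemma vector_increment_bound:
  fixes f :: "real \<Rightarrow> 'b::real_normed_vector"
  assumes "\<And>t. t \<in> closed_segment a b \<Longrightarrow> (f has_vector_derivative f' t) (at t)"
    and "\<And>t. t \<in> closed_segment a b \<Longrightarrow> norm (f' t - A) \<le> B"
  shows "norm (f b - f a - (b - a) *\<^sub>R A) \<le> \<bar>b - a\<bar> * B"
proof -
  let ?g = "\<lambda>t. f t - t *\<^sub>R A"
  have "(?g has_vector_derivative f' t - A) (at t within closed_segment a b)"
    if "t \<in> closed_segment a b" for t
  proof -
    have "((\<lambda>t. t *\<^sub>R A) has_vector_derivative A) (at t)"
      by (auto intro!: derivative_eq_intros simp: has_vector_derivative_def)
    from has_vector_derivative_diff[OF assms(1)[OF that] this]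
    show ?thesis by (rule has_vector_derivative_at_within)
  qed
  then have "norm (?g b - ?g a) \<le> B * norm (b - a)"
    using assms(2)
    by (intro differentiable_bound[of "closed_segment a b" ?g "\<lambda>t h. h *\<^sub>R (f' t - A)"])
      (auto simp: has_vector_derivative_def mult.commute[of B] intro!: onorm_le mult_left_mono)
  then show ?thesis by (simp add: algebra_simps)
qed

definition has_partial ::
    "nat \<Rightarrow> ((nat \<Rightarrow> real) \<Rightarrow> 'b::real_normed_vector) \<Rightarrow> 'b \<Rightarrow> (nat \<Rightarrow> real) \<Rightarrow> bool" where
  "has_partial i f v x \<longleftrightarrow> ((\<lambda>t. f (x(i := t))) has_vector_derivative v) (at (x i))"

lemma has_partial_partial_deriv: "has_partial i f v x \<Longrightarrow> partial_deriv i f x = v"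
  unfolding partial_deriv_def has_partial_def by (rule vector_derivative_at)

lemma has_partial_add:
  "has_partial i f v x \<Longrightarrow> has_partial i g w x \<Longrightarrow> has_partial i (\<lambda>x. f x + g x) (v + w) x"
  unfolding has_partial_def by (rule has_vector_derivative_add)

lemma has_partial_linear:
  "bounded_linear L \<Longrightarrow> has_partial i f v x \<Longrightarrow> has_partial i (\<lambda>x. L (f x)) (L v) x"
  unfolding has_partial_def by (rule bounded_linear.has_vector_derivative)

lemma has_partial_mult:
  fixes f g :: "(nat \<Rightarrow> real) \<Rightarrow> 'b::real_normed_algebra"
  shows "has_partial i f v x \<Longrightarrow> has_partial i g w x \<Longrightarrow>
    has_partial i (\<lambda>x. f x * g x) (f x * w + v * g x) x"
  unfolding has_partial_def
  using has_vector_derivative_mult[of "\<lambda>t. f (x(i := t))" v "x i" UNIV "\<lambda>t. g (x(i := t))" w] by simp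

lemma has_partial_const: "has_partial i (\<lambda>x. c) 0 x"
  unfolding has_partial_def by simp

locale open_region =
  fixes n :: nat and U :: "(nat \<Rightarrow> real) set"
  assumes open_U: "openin (Euclidean_space n) U"
begin

lemma U_zero: "x \<in> U \<Longrightarrow> i \<ge> n \<Longrightarrow> x i = 0"
  using open_U by (auto simp: openin_Euclidean_box)

lemma box:
  assumes "x \<in> U"
  obtains e where "e > 0" "\<And>y. (\<And>i. i \<ge> n \<Longrightarrow> y i = 0) \<Longrightarrow> (\<And>i. i < n \<Longrightarrow> \<bar>y i - x i\<bar> < e) \<Longrightarrow> y \<in> U"
  using open_U assms unfolding openin_Euclidean_box by blast

lemma line_in_U:
  assumes "x \<in> U" "i < n"
  obtains T where "open T" "x i \<in> T" "\<And>t. t \<in> T \<Longrightarrow> x(i := t) \<in> U"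
proof -
  obtain e where e: "e > 0" "\<And>y. (\<And>i. i \<ge> n \<Longrightarrow> y i = 0) \<Longrightarrow> (\<And>i. i < n \<Longrightarrow> \<bar>y i - x i\<bar> < e) \<Longrightarrow> y \<in> U"
    using box[OF assms(1)] by metis
  have "x(i := t) \<in> U" if "t \<in> ball (x i) e" for t
    by (rule e(2)) (use that assms e(1) U_zero in \<open>auto simp: dist_real_def abs_minus_commute\<close>)
  then show ?thesis using that[of "ball (x i) e"] e(1) by auto
qed

lemma C_0_iff: "C_k_on n 0 U f \<longleftrightarrow> continuous_on U f"
proof -
  have "U \<subseteq> {x. \<forall>i\<ge>n. x i = 0}" using U_zero by auto
  then have "subtopology (Euclidean_space n) U = top_of_set U"
    unfolding Euclidean_space_top_of_set by (simp add: subtopology_subtopology Int_absorb1)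
  then show ?thesis by simp
qed

lemma C_Suc_iff: "C_k_on n (Suc k) U f \<longleftrightarrow> continuous_on U f \<and>
    (\<forall>i<n. (\<forall>x\<in>U. (\<lambda>t. f (x(i := t))) differentiable (at (x i))) \<and> C_k_on n k U (partial_deriv i f))"
  using C_0_iff[of f] by simp

declare C_k_on.simps [simp del]

lemma has_partial_cong:
  assumes "x \<in> U" "i < n" "\<And>y. y \<in> U \<Longrightarrow> f y = g y" "has_partial i f v x"
  shows "has_partial i g v x"
proof -
  obtain T where T: "open T" "x i \<in> T" "\<And>t. t \<in> T \<Longrightarrow> x(i := t) \<in> U" using line_in_U[OF assms(1,2)] by metis
  show ?thesis unfolding has_partial_def
    by (rule has_vector_derivative_transform_within_open[OF assms(4)[unfolded has_partial_def] T(1,2)])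
      (use T(3) assms(3) in auto)
qed

lemma has_partial_iff:
  "(\<lambda>t. f (x(i := t))) differentiable (at (x i)) \<longleftrightarrow> has_partial i f (partial_deriv i f x) x"
  unfolding partial_deriv_def has_partial_def by (rule vector_derivative_works)

lemma C_k_cong_imp:
  "(\<And>x. x \<in> U \<Longrightarrow> f x = g x) \<Longrightarrow> C_k_on n k U f \<Longrightarrow> C_k_on n k U g"
proof (induction k arbitrary: f g)
  case 0
  then show ?case unfolding C_0_iff by (metis continuous_on_cong)
next
  case (Suc k)
  have P: "has_partial i g (partial_deriv i f x) x" if "i < n" "x \<in> U" for i x
    by (rule has_partial_cong[OF that(2,1) Suc.prems(1)])
      (use Suc.prems(2) that in \<open>auto simp: C_Suc_iff has_partial_iff\<close>)
  have "C_k_on n k U (partial_deriv i g)" if "i < n" for i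
    by (rule Suc.IH[of "partial_deriv i f"])
      (use has_partial_partial_deriv[OF P] Suc.prems(2) that in \<open>auto simp: C_Suc_iff\<close>)
  moreover have "continuous_on U g" using Suc.prems unfolding C_Suc_iff by (metis continuous_on_cong)
  ultimately show ?case
    unfolding C_Suc_iff has_partial_iff using P has_partial_partial_deriv[OF P] by simp
qed

lemma C_SucI:
  assumes "continuous_on U f" "\<And>i. i < n \<Longrightarrow> C_k_on n k U (g i)"
    "\<And>i x. i < n \<Longrightarrow> x \<in> U \<Longrightarrow> has_partial i f (g i x) x"
  shows "C_k_on n (Suc k) U f"
  unfolding C_Suc_iff
proof (intro conjI allI impI ballI)
  fix i assume i: "i < n"
  show "C_k_on n k U (partial_deriv i f)"
    by (rule C_k_cong_imp[OF _ assms(2)[OF i]]) (use has_partial_partial_deriv[OF assms(3)[OF i]] in simp)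
  show "(\<lambda>t. f (x(i := t))) differentiable (at (x i))" if "x \<in> U" for x
    using assms(3)[OF i that] unfolding has_partial_def by (rule differentiableI_vector)
qed (rule assms(1))

lemma C_Suc_continuous: "C_k_on n (Suc k) U f \<Longrightarrow> continuous_on U f"
  and C_Suc_partial: "C_k_on n (Suc k) U f \<Longrightarrow> i < n \<Longrightarrow> x \<in> U \<Longrightarrow> has_partial i f (partial_deriv i f x) x"
  and C_Suc_deriv: "C_k_on n (Suc k) U f \<Longrightarrow> i < n \<Longrightarrow> C_k_on n k U (partial_deriv i f)"
  unfolding C_Suc_iff has_partial_iff by auto

lemma C_continuous: "C_k_on n k U f \<Longrightarrow> continuous_on U f"
  by (cases k) (auto simp: C_0_iff C_Suc_iff)

lemma C_Suc_mono: "C_k_on n (Suc k) U f \<Longrightarrow> C_k_on n k U f"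
proof (induction k arbitrary: f)
  case 0
  then show ?case by (simp add: C_0_iff C_Suc_iff)
next
  case (Suc k)
  show ?case
    by (rule C_SucI[where g = "\<lambda>i. partial_deriv i f"])
      (use Suc.prems in \<open>auto intro: C_Suc_continuous C_Suc_partial Suc.IH[OF C_Suc_deriv]\<close>)
qed

lemma C_k_const: "C_k_on n k U (\<lambda>x. c)"
proof (induction k arbitrary: c)
  case (Suc k)
  show ?case by (rule C_SucI[where g = "\<lambda>i x. 0"]) (auto intro: Suc has_partial_const)
qed (simp add: C_0_iff)

lemma C_k_linear:
  assumes L: "bounded_linear L"
  shows "C_k_on n k U f \<Longrightarrow> C_k_on n k U (\<lambda>x. L (f x))"
proof (induction k arbitrary: f)
  case 0
  then show ?case using bounded_linear.continuous_on[OF L] by (simp add: C_0_iff)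
next
  case (Suc k)
  show ?case
    by (rule C_SucI[where g = "\<lambda>i x. L (partial_deriv i f x)"])
      (use Suc.prems in \<open>auto intro: bounded_linear.continuous_on[OF L] C_Suc_continuous
        has_partial_linear[OF L] C_Suc_partial Suc.IH C_Suc_deriv\<close>)
qed

lemma C_k_add: "C_k_on n k U f \<Longrightarrow> C_k_on n k U g \<Longrightarrow> C_k_on n k U (\<lambda>x. f x + g x)"
proof (induction k arbitrary: f g)
  case 0
  then show ?case by (simp add: C_0_iff continuous_on_add)
next
  case (Suc k)
  show ?case
    by (rule C_SucI[where g = "\<lambda>i x. partial_deriv i f x + partial_deriv i g x"])
      (use Suc.prems in \<open>auto intro: continuous_on_add C_Suc_continuous
        has_partial_add C_Suc_partial Suc.IH C_Suc_deriv\<close>)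
qed

lemma C_k_mult:
  fixes f g :: "(nat \<Rightarrow> real) \<Rightarrow> 'b::real_normed_algebra"
  shows "C_k_on n k U f \<Longrightarrow> C_k_on n k U g \<Longrightarrow> C_k_on n k U (\<lambda>x. f x * g x)"
proof (induction k arbitrary: f g)
  case 0
  then show ?case by (simp add: C_0_iff continuous_on_mult)
next
  case (Suc k)
  show ?case
  proof (rule C_SucI[where g = "\<lambda>i x. f x * partial_deriv i g x + partial_deriv i f x * g x"])
    show "continuous_on U (\<lambda>x. f x * g x)"
      using Suc.prems by (intro continuous_on_mult C_Suc_continuous)
    show "C_k_on n k U (\<lambda>x. f x * partial_deriv i g x + partial_deriv i f x * g x)" if "i < n" for i
      by (rule C_k_add[OF Suc.IH[OF C_Suc_mono[OF Suc.prems(1)] C_Suc_deriv[OF Suc.prems(2) that]]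
            Suc.IH[OF C_Suc_deriv[OF Suc.prems(1) that] C_Suc_mono[OF Suc.prems(2)]]])
    show "has_partial i (\<lambda>x. f x * g x) (f x * partial_deriv i g x + partial_deriv i f x * g x) x"
      if "i < n" "x \<in> U" for i x
      by (rule has_partial_mult[OF C_Suc_partial[OF Suc.prems(1) that] C_Suc_partial[OF Suc.prems(2) that]])
  qed
qed

lemma C_k_sum: "(\<And>i. i \<in> I \<Longrightarrow> C_k_on n k U (f i)) \<Longrightarrow> C_k_on n k U (\<lambda>x. \<Sum>i\<in>I. f i x)"
  by (induction I rule: infinite_finite_induct) (auto intro: C_k_const C_k_add)

lemma C_k_coordinate:
  assumes "j < n"
  shows "C_k_on n k U (\<lambda>x. x j)"
proof -
  have cont: "continuous_on U (\<lambda>x. x j)"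
    by (rule continuous_on_subset[OF continuous_on_product_coordinates]) simp
  show ?thesis
  proof (cases k)
    case 0
    then show ?thesis using cont by (simp add: C_0_iff)
  next
    case (Suc l)
    have "has_partial i (\<lambda>x. x j) (if i = j then 1 else 0) x" for i x
      unfolding has_partial_def by (cases "i = j") (auto simp: has_vector_derivative_id)
    then show ?thesis unfolding Suc
      by (intro C_SucI[where g = "\<lambda>i x. if i = j then 1 else 0"] cont C_k_const)
  qed
qed

lemma C_k_local:
  fixes f :: "(nat \<Rightarrow> real) \<Rightarrow> 'b::real_normed_vector"
  assumes "\<And>x. x \<in> U \<Longrightarrow> \<exists>V g. x \<in> V \<and> V \<subseteq> U \<and> openin (Euclidean_space n) V \<and> C_k_on n k V g \<and> (\<forall>y\<in>V. f y = g y)"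
  shows "C_k_on n k U f"
proof -
  have "\<exists>V. x \<in> V \<and> V \<subseteq> U \<and> openin (Euclidean_space n) V \<and> C_k_on n k V f" if x: "x \<in> U" for x
  proof -
    obtain V and g :: "(nat \<Rightarrow> real) \<Rightarrow> 'b" where V: "x \<in> V" "V \<subseteq> U"
      "openin (Euclidean_space n) V" "C_k_on n k V g" "\<forall>y\<in>V. f y = g y"
      using assms[OF x] by blast
    interpret V: open_region n V by unfold_locales (rule V)
    have "C_k_on n k V f" by (rule V.C_k_cong_imp[OF _ V(4)]) (use V(5) in auto)
    then show ?thesis using V by blast
  qed
  then show ?thesis
  proof (induction k arbitrary: f)
    case 0
    have *: "\<exists>V. open V \<and> x \<in> V \<and> continuous_on (U \<inter> V) f" if x: "x \<in> U" for x
    proof -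
      obtain V where V: "x \<in> V" "V \<subseteq> U" "openin (Euclidean_space n) V" "C_k_on n 0 V f" using 0 x by blast
      interpret V: open_region n V by unfold_locales (rule V)
      obtain W where W: "open W" "V = W \<inter> {x. \<forall>i\<ge>n. x i = 0}"
        using V(3) unfolding Euclidean_space_top_of_set by (auto simp: openin_open)
      have "U \<inter> W = V" using V(2) W U_zero by auto
      then show ?thesis using W(1) V(1,4) V.C_0_iff \<open>V = W \<inter> _\<close> by (intro exI[of _ W]) auto
    qed
    have "continuous_on U f"
      unfolding continuous_on_eq_continuous_within
    proof
      fix x assume x: "x \<in> U"
      obtain V where V: "open V" "x \<in> V" "continuous_on (U \<inter> V) f" using * x by blast
      then have "continuous (at x within U \<inter> V) f" using x by (auto simp: continuous_on_eq_continuous_within)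
      moreover have "at x within U \<inter> V = at x within U" by (rule at_within_nhd[OF V(2,1)]) auto
      ultimately show "continuous (at x within U) f" by (simp add: continuous_within)
    qed
    then show ?case by (simp add: C_0_iff)
  next
    case (Suc k)
    have c: "continuous_on U f"
    proof -
      have "C_k_on n k U f"
      proof (rule Suc.IH)
        fix x assume "x \<in> U"
        then obtain V where V: "x \<in> V" "V \<subseteq> U" "openin (Euclidean_space n) V" "C_k_on n (Suc k) V f" using Suc.prems by blast
        interpret V: open_region n V by unfold_locales (rule V)
        show "\<exists>V. x \<in> V \<and> V \<subseteq> U \<and> openin (Euclidean_space n) V \<and> C_k_on n k V f"
          using V V.C_Suc_mono by blast
      qed
      then show ?thesis by (rule C_continuous)
    qed
    show ?case
    proof (rule C_SucI[where g = "\<lambda>i. partial_deriv i f", OF c])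
      fix i assume i: "i < n"
      show "C_k_on n k U (partial_deriv i f)"
      proof (rule Suc.IH)
        fix x assume "x \<in> U"
        then obtain V where V: "x \<in> V" "V \<subseteq> U" "openin (Euclidean_space n) V" "C_k_on n (Suc k) V f" using Suc.prems by blast
        interpret V: open_region n V by unfold_locales (rule V)
        show "\<exists>V. x \<in> V \<and> V \<subseteq> U \<and> openin (Euclidean_space n) V \<and> C_k_on n k V (partial_deriv i f)"
          using V V.C_Suc_deriv[OF V(4) i] by blast
      qed
      fix x assume "x \<in> U"
      then obtain V where V: "x \<in> V" "V \<subseteq> U" "openin (Euclidean_space n) V" "C_k_on n (Suc k) V f" using Suc.prems by blast
      interpret V: open_region n V by unfold_locales (rule V)
      show "has_partial i f (partial_deriv i f x) x" by (rule V.C_Suc_partial[OF V(4) i V(1)])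
    qed
  qed
qed

lemma C_k_subset:
  assumes V: "openin (Euclidean_space n) V" "V \<subseteq> U"
  shows "C_k_on n k U f \<Longrightarrow> C_k_on n k V f"
proof (induction k arbitrary: f)
  case 0
  interpret V: open_region n V by unfold_locales (rule V)
  show ?case using 0 V(2) continuous_on_subset by (auto simp: V.C_0_iff C_0_iff)
next
  case (Suc k)
  interpret V: open_region n V by unfold_locales (rule V)
  show ?case
    by (rule V.C_SucI[where g = "\<lambda>i. partial_deriv i f"])
      (use Suc V in \<open>auto intro: C_Suc_deriv C_Suc_partial continuous_on_subset[OF C_Suc_continuous]\<close>)
qed

lemma continuous_box:
  assumes f: "continuous_on U f" and x: "x \<in> U" and e: "e > 0"
  obtains \<delta> where "\<delta> > 0" "\<And>y. (\<And>i. i \<ge> n \<Longrightarrow> y i = 0) \<Longrightarrow> (\<And>i. i < n \<Longrightarrow> \<bar>y i - x i\<bar> < \<delta>) \<Longrightarrow> y \<in> U \<and> norm (f y - f x) < e"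
proof -
  let ?W = "{y \<in> U. f y \<in> ball (f x) e}"
  have "openin (top_of_set U) (U \<inter> f -` ball (f x) e)"
    by (rule continuous_openin_preimage_gen[OF f]) simp
  moreover have "U \<inter> f -` ball (f x) e = ?W" by auto
  ultimately have "openin (top_of_set U) ?W" by simp
  then have "openin (Euclidean_space n) ?W"
    using open_U unfolding Euclidean_space_top_of_set by (rule openin_trans)
  then interpret W: open_region n ?W by unfold_locales
  have "x \<in> ?W" using x e by simp
  then show ?thesis
  proof (rule W.box)
    fix \<delta> :: real assume \<delta>: "\<delta> > 0"
      "\<And>y. (\<And>i. i \<ge> n \<Longrightarrow> y i = 0) \<Longrightarrow> (\<And>i. i < n \<Longrightarrow> \<bar>y i - x i\<bar> < \<delta>) \<Longrightarrow> y \<in> ?W"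
    show ?thesis
      by (rule that[OF \<delta>(1)]) (use \<delta>(2) in \<open>simp add: dist_norm norm_minus_commute\<close>)
  qed
qed

text \<open>The second difference of \<open>f\<close> over a square of side \<open>h\<close>,
  divided by \<open>h * h\<close>, approximates either mixed derivative. The estimate
  \<open>bound\<close> is stated for an arbitrary ordered pair of directions so that it can be used
  in both orders.\<close>

lemma partial_deriv_commute:
  assumes f: "C_k_on n 2 U f" and i: "i < n" and j: "j < n" and x: "x \<in> U"
  shows "partial_deriv i (partial_deriv j f) x = partial_deriv j (partial_deriv i f) x"
proof (cases "i = j")
  case False
  have f': "C_k_on n (Suc (Suc 0)) U f" using f by (simp add: numeral_2_eq_2)
  have bound: "\<exists>\<delta>>0. \<forall>h. 0 < h \<longrightarrow> h < \<delta> \<longrightarrow>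
      norm ((f (x(i := x i + h, j := x j + h)) - f (x(i := x i + h)) - f (x(j := x j + h)) + f x)
        - (h * h) *\<^sub>R partial_deriv j (partial_deriv i f) x) \<le> h * h * e"
    if i: "i < n" and j: "j < n" and ij: "i \<noteq> j" and e: "e > 0" for i j e
  proof -
    have ci: "C_k_on n (Suc 0) U (partial_deriv i f)" by (rule C_Suc_deriv[OF f' i])
    have "continuous_on U (partial_deriv j (partial_deriv i f))"
      using C_Suc_deriv[OF ci j] by (simp add: C_0_iff)
    then obtain \<delta> where \<delta>: "\<delta> > 0" "\<And>y. (\<And>i. i \<ge> n \<Longrightarrow> y i = 0) \<Longrightarrow> (\<And>i. i < n \<Longrightarrow> \<bar>y i - x i\<bar> < \<delta>) \<Longrightarrow>
        y \<in> U \<and> norm (partial_deriv j (partial_deriv i f) y - partial_deriv j (partial_deriv i f) x) < e"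
      using continuous_box[OF _ x e] by metis
    show ?thesis
    proof (intro exI[of _ \<delta>] conjI allI impI \<delta>(1))
      fix h :: real assume h: "0 < h" "h < \<delta>"
      let ?A = "partial_deriv j (partial_deriv i f) x"
      have pt: "x(i := x i + s, j := x j + t) \<in> U"
        "norm (partial_deriv j (partial_deriv i f) (x(i := x i + s, j := x j + t)) - ?A) < e"
        if "0 \<le> s" "s \<le> h" "0 \<le> t" "t \<le> h" for s t
      proof -
        have "x(i := x i + s, j := x j + t) \<in> U \<and>
          norm (partial_deriv j (partial_deriv i f) (x(i := x i + s, j := x j + t)) - ?A) < e"
          by (rule \<delta>(2)) (use that h i j U_zero[OF x] in auto)
        then show "x(i := x i + s, j := x j + t) \<in> U"
          "norm (partial_deriv j (partial_deriv i f) (x(i := x i + s, j := x j + t)) - ?A) < e" by auto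
      qed
      have der: "((\<lambda>t. g (y(k := t))) has_vector_derivative partial_deriv k g (y(k := t0))) (at t0)"
        if "C_k_on n (Suc l) U g" "k < n" "y(k := t0) \<in> U" for g y k t0 and l
        using C_Suc_partial[OF that] unfolding has_partial_def by simp
      let ?\<phi> = "\<lambda>s. f (x(i := s, j := x j + h)) - f (x(i := s))"
      let ?\<phi>' = "\<lambda>s. partial_deriv i f (x(i := s, j := x j + h)) - partial_deriv i f (x(i := s))"
      have seg: "s - x i \<ge> 0" "s - x i \<le> h" if "s \<in> closed_segment (x i) (x i + h)" for s
        using that h by (auto simp: closed_segment_eq_real_ivl)
      have segj: "s - x j \<ge> 0" "s - x j \<le> h" if "s \<in> closed_segment (x j) (x j + h)" for s
        using that h by (auto simp: closed_segment_eq_real_ivl)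
      have 1: "(?\<phi> has_vector_derivative ?\<phi>' s) (at s)" if "s \<in> closed_segment (x i) (x i + h)" for s
      proof -
        have a: "x(i := s, j := x j + h) \<in> U" "x(i := s) \<in> U"
          using pt(1)[of "s - x i" h] pt(1)[of "s - x i" 0] seg[OF that] h ij
            fun_upd_idem[of "x(i := s)" j "x j"] by auto
        have "((\<lambda>t. f ((x(j := x j + h))(i := t))) has_vector_derivative partial_deriv i f ((x(j := x j + h))(i := s))) (at s)"
          by (rule der[OF f' i]) (use a ij in \<open>simp add: fun_upd_twist\<close>)
        moreover have "((\<lambda>t. f (x(i := t))) has_vector_derivative partial_deriv i f (x(i := s))) (at s)"
          by (rule der[OF f' i]) (use a in simp)
        ultimately show ?thesis
          using ij by (simp add: fun_upd_twist[of i j] has_vector_derivative_diff)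
      qed
      \<comment> \<open>The derivative of the first increment is itself an increment of
        \<open>partial_deriv i f\<close>, in direction \<open>j\<close>, so the increment bound is
        applied a second time.\<close>
      have 2: "norm (?\<phi>' s - h *\<^sub>R ?A) \<le> h * e" if s: "s \<in> closed_segment (x i) (x i + h)" for s
      proof -
        have "norm (partial_deriv i f ((x(i := s))(j := x j + h)) - partial_deriv i f ((x(i := s))(j := x j))
            - (x j + h - x j) *\<^sub>R ?A) \<le> \<bar>x j + h - x j\<bar> * e"
        proof (rule vector_increment_bound)
          fix t assume t: "t \<in> closed_segment (x j) (x j + h)"
          have "x(i := s, j := t) \<in> U" using pt(1)[of "s - x i" "t - x j"] seg[OF s] segj[OF t] by simp
          then show "((\<lambda>t. partial_deriv i f (x(i := s, j := t))) has_vector_derivative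
              partial_deriv j (partial_deriv i f) (x(i := s, j := t))) (at t)"
            by (rule der[OF ci j])
          show "norm (partial_deriv j (partial_deriv i f) (x(i := s, j := t)) - ?A) \<le> e"
            using pt(2)[of "s - x i" "t - x j"] seg[OF s] segj[OF t] by simp
        qed
        moreover have "(x(i := s))(j := x j) = x(i := s)" using ij by auto
        ultimately show ?thesis using h by simp
      qed
      have "norm (?\<phi> (x i + h) - ?\<phi> (x i) - (x i + h - x i) *\<^sub>R (h *\<^sub>R ?A)) \<le> \<bar>x i + h - x i\<bar> * (h * e)"
        by (rule vector_increment_bound[OF 1 2])
      then show "norm ((f (x(i := x i + h, j := x j + h)) - f (x(i := x i + h)) - f (x(j := x j + h)) + f x)
        - (h * h) *\<^sub>R ?A) \<le> h * h * e"
        using h by (simp add: algebra_simps)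
    qed
  qed
  let ?A = "partial_deriv j (partial_deriv i f) x" and ?B = "partial_deriv i (partial_deriv j f) x"
  have *: "norm (?A - ?B) \<le> 2 * e" if e: "e > 0" for e
  proof -
    obtain \<delta> where \<delta>: "\<delta> > 0" "\<And>h. 0 < h \<Longrightarrow> h < \<delta> \<Longrightarrow>
      norm ((f (x(i := x i + h, j := x j + h)) - f (x(i := x i + h)) - f (x(j := x j + h)) + f x) - (h * h) *\<^sub>R ?A) \<le> h * h * e"
      using bound[OF i j False e] by metis
    obtain \<delta>' where \<delta>': "\<delta>' > 0" "\<And>h. 0 < h \<Longrightarrow> h < \<delta>' \<Longrightarrow>
      norm ((f (x(j := x j + h, i := x i + h)) - f (x(j := x j + h)) - f (x(i := x i + h)) + f x) - (h * h) *\<^sub>R ?B) \<le> h * h * e"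
      using bound[OF j i False[symmetric] e] by metis
    define h where "h = min \<delta> \<delta>' / 2"
    have h: "0 < h" "h < \<delta>" "h < \<delta>'" using \<delta>(1) \<delta>'(1) by (auto simp: h_def min_def)
    let ?D = "f (x(i := x i + h, j := x j + h)) - f (x(i := x i + h)) - f (x(j := x j + h)) + f x"
    have 1: "norm (?D - (h * h) *\<^sub>R ?A) \<le> h * h * e" by (rule \<delta>(2)[OF h(1,2)])
    have "x(j := x j + h, i := x i + h) = x(i := x i + h, j := x j + h)" using False by (rule fun_upd_twist[symmetric])
    then have 2: "norm (?D - (h * h) *\<^sub>R ?B) \<le> h * h * e" using \<delta>'(2)[OF h(1,3)] by (simp add: algebra_simps)
    have "norm ((h * h) *\<^sub>R (?A - ?B)) = norm ((?D - (h * h) *\<^sub>R ?B) - (?D - (h * h) *\<^sub>R ?A))"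
      by (simp add: algebra_simps)
    also have "\<dots> \<le> h * h * e + h * h * e" by (rule order_trans[OF norm_triangle_ineq4 add_mono[OF 2 1]])
    finally have "norm ((h * h) *\<^sub>R (?A - ?B)) \<le> (h * h) * (2 * e)" by (simp add: mult_ac)
    then have "(h * h) * norm (?A - ?B) \<le> (h * h) * (2 * e)" unfolding norm_scaleR using h(1) by (simp add: mult_ac)
    then show ?thesis using h(1) by (simp add: mult_le_cancel_left)
  qed
  have "norm (?A - ?B) \<le> 0"
  proof (rule field_le_epsilon)
    show "norm (?A - ?B) \<le> 0 + e" if "e > 0" for e using *[of "e / 2"] that by simp
  qed
  then show ?thesis by simp
qed simp

end

section \<open>Chain rule and smooth auxiliary functions\<close>

context open_region begin

lemma C_k_scaleR:
  "C_k_on n k U a \<Longrightarrow> C_k_on n k U f \<Longrightarrow> C_k_on n k U (\<lambda>x. a x *\<^sub>R f x)"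
proof (induction k arbitrary: a f)
  case 0
  then show ?case by (simp add: C_0_iff continuous_on_scaleR)
next
  case (Suc k)
  show ?case
  proof (rule C_SucI[where g = "\<lambda>i x. a x *\<^sub>R partial_deriv i f x + partial_deriv i a x *\<^sub>R f x"])
    show "continuous_on U (\<lambda>x. a x *\<^sub>R f x)"
      using Suc.prems by (intro continuous_on_scaleR C_Suc_continuous)
    show "C_k_on n k U (\<lambda>x. a x *\<^sub>R partial_deriv i f x + partial_deriv i a x *\<^sub>R f x)" if "i < n" for i
      by (rule C_k_add[OF Suc.IH[OF C_Suc_mono[OF Suc.prems(1)] C_Suc_deriv[OF Suc.prems(2) that]]
            Suc.IH[OF C_Suc_deriv[OF Suc.prems(1) that] C_Suc_mono[OF Suc.prems(2)]]])
    show "has_partial i (\<lambda>x. a x *\<^sub>R f x) (a x *\<^sub>R partial_deriv i f x + partial_deriv i a x *\<^sub>R f x) x"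
      if "i < n" "x \<in> U" for i x
      using has_vector_derivative_scaleR[of "\<lambda>t. a (x(i := t))" "partial_deriv i a x" "x i" UNIV
          "\<lambda>t. f (x(i := t))" "partial_deriv i f x"]
        C_Suc_partial[OF Suc.prems(1) that] C_Suc_partial[OF Suc.prems(2) that]
      by (simp add: has_partial_def has_real_derivative_iff_has_vector_derivative)
  qed
qed

text \<open>Continuous partial derivatives give total differentiability: pass from \<open>y0\<close>
  to \<open>y\<close> through the points \<open>z k\<close>, changing one coordinate at a
  time.\<close>

lemma total_increment_bound:
  assumes g: "C_k_on n (Suc 0) U g" and y0: "y0 \<in> U" and e: "e > 0"
  shows "\<exists>\<delta>>0. \<forall>y. (\<forall>i\<ge>n. y i = 0) \<longrightarrow> (\<forall>i<n. \<bar>y i - y0 i\<bar> < \<delta>) \<longrightarrow>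
    norm (g y - g y0 - (\<Sum>j<n. (y j - y0 j) *\<^sub>R partial_deriv j g y0)) \<le> e * (\<Sum>j<n. \<bar>y j - y0 j\<bar>)"
proof -
  have "\<exists>\<delta>>0. \<forall>y. (\<forall>i\<ge>n. y i = 0) \<longrightarrow> (\<forall>i<n. \<bar>y i - y0 i\<bar> < \<delta>) \<longrightarrow>
      y \<in> U \<and> norm (partial_deriv j g y - partial_deriv j g y0) < e" if j: "j < n" for j
  proof -
    have "continuous_on U (partial_deriv j g)" using C_Suc_deriv[OF g j] by (simp add: C_0_iff)
    then show ?thesis using continuous_box[OF _ y0 e] by metis
  qed
  then obtain D where D: "\<And>j. j < n \<Longrightarrow> D j > 0" "\<And>j y. j < n \<Longrightarrow> (\<forall>i\<ge>n. y i = 0) \<Longrightarrow>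
      (\<forall>i<n. \<bar>y i - y0 i\<bar> < D j) \<Longrightarrow> y \<in> U \<and> norm (partial_deriv j g y - partial_deriv j g y0) < e"
    by metis
  define \<delta> where "\<delta> = Min (insert 1 (D ` {..<n}))"
  have \<delta>: "\<delta> > 0" "\<And>j. j < n \<Longrightarrow> \<delta> \<le> D j"
    unfolding \<delta>_def using D(1) by (auto simp: Min_gr_iff)
  show ?thesis
  proof (intro exI[of _ \<delta>] conjI allI impI \<delta>(1))
    fix y :: "nat \<Rightarrow> real"
    assume y': "\<forall>i\<ge>n. y i = 0" "\<forall>i<n. \<bar>y i - y0 i\<bar> < \<delta>"
    note y = y'[rule_format]
    define z where "z = (\<lambda>k i. if i < k then y i else y0 i)"
    have z0: "z 0 = y0" by (simp add: z_def)
    have zn: "z n = y" using y(1) U_zero[OF y0] by (auto simp: z_def)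
    have step: "norm (g (z (Suc k)) - g (z k) - (y k - y0 k) *\<^sub>R partial_deriv k g y0) \<le> \<bar>y k - y0 k\<bar> * e" if k: "k < n" for k
    proof -
      have "norm (g ((z k)(k := y k)) - g ((z k)(k := y0 k)) - (y k - y0 k) *\<^sub>R partial_deriv k g y0) \<le> \<bar>y k - y0 k\<bar> * e"
      proof (rule vector_increment_bound)
        fix t assume t: "t \<in> closed_segment (y0 k) (y k)"
        have "\<bar>t - y0 k\<bar> \<le> \<bar>y k - y0 k\<bar>"
          using t by (auto simp: closed_segment_eq_real_ivl split: if_splits)
        then have "\<bar>t - y0 k\<bar> < \<delta>" using y(2)[OF k] by linarith
        then have *: "(z k)(k := t) \<in> U \<and> norm (partial_deriv k g ((z k)(k := t)) - partial_deriv k g y0) < e"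
        proof (intro D(2)[OF k] allI impI)
          show "((z k)(k := t)) i = 0" if "i \<ge> n" for i using that k y(1) U_zero[OF y0] by (simp add: z_def)
          show "\<bar>((z k)(k := t)) i - y0 i\<bar> < D k" if "i < n" for i
            using that y(2)[OF that] \<open>\<bar>t - y0 k\<bar> < \<delta>\<close> \<delta>(2)[OF k] D(1)[OF k] by (auto simp: z_def)
        qed
        have "has_partial k g (partial_deriv k g ((z k)(k := t))) ((z k)(k := t))"
          by (rule C_Suc_partial[OF g k]) (use * in auto)
        then show "((\<lambda>t. g ((z k)(k := t))) has_vector_derivative partial_deriv k g ((z k)(k := t))) (at t)"
          by (simp add: has_partial_def)
        show "norm (partial_deriv k g ((z k)(k := t)) - partial_deriv k g y0) \<le> e" using * by simp
      qed
      moreover have "(z k)(k := y k) = z (Suc k)" "(z k)(k := y0 k) = z k" by (auto simp: z_def)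
      ultimately show ?thesis by simp
    qed
    have "g y - g y0 = (\<Sum>k<n. g (z (Suc k)) - g (z k))"
      using sum_lessThan_telescope[of "\<lambda>k. g (z k)" n] by (simp add: zn z0)
    then have "norm (g y - g y0 - (\<Sum>j<n. (y j - y0 j) *\<^sub>R partial_deriv j g y0)) =
        norm (\<Sum>k<n. g (z (Suc k)) - g (z k) - (y k - y0 k) *\<^sub>R partial_deriv k g y0)"
      by (simp add: sum_subtractf)
    also have "\<dots> \<le> (\<Sum>k<n. \<bar>y k - y0 k\<bar> * e)"
      by (rule sum_norm_le) (use step in auto)
    finally show "norm (g y - g y0 - (\<Sum>j<n. (y j - y0 j) *\<^sub>R partial_deriv j g y0)) \<le> e * (\<Sum>j<n. \<bar>y j - y0 j\<bar>)"
      by (simp add: sum_distrib_left mult.commute)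
  qed
qed

lemma curve_derivative:
  assumes g: "C_k_on n (Suc 0) U g" and y0: "c t0 \<in> U" and T: "open T" "t0 \<in> T"
    and zero: "\<And>t i. t \<in> T \<Longrightarrow> i \<ge> n \<Longrightarrow> c t i = 0"
    and c: "\<And>j. j < n \<Longrightarrow> ((\<lambda>t. c t j) has_vector_derivative c' j) (at t0)"
  shows "((\<lambda>t. g (c t)) has_vector_derivative (\<Sum>j<n. c' j *\<^sub>R partial_deriv j g (c t0))) (at t0)"
  unfolding has_vector_derivative_def has_derivative_at_alt
proof (intro conjI allI impI)
  let ?S = "\<Sum>j<n. c' j *\<^sub>R partial_deriv j g (c t0)"
  show "bounded_linear (\<lambda>h. h *\<^sub>R ?S)" by (rule bounded_linear_scaleR_left)
  fix e :: real assume e: "e > 0"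
  \<comment> \<open>Coordinate \<open>j\<close> contributes an error of at most
    \<open>\<epsilon> * (\<bar>c' j\<bar> + 1)\<close> from the increment bound and \<epsilon> times
    the norm of the partial derivative from linearizing the curve. The final \<open>+ 1\<close>
    keeps \<open>M\<close> positive for \<open>n = 0\<close>.\<close>
  define M where "M = (\<Sum>j<n. \<bar>c' j\<bar> + 1 + norm (partial_deriv j g (c t0))) + 1"
  have M: "M > 0" unfolding M_def by (intro add_nonneg_pos sum_nonneg) auto
  define \<epsilon> where "\<epsilon> = min 1 (e / M)"
  have \<epsilon>: "\<epsilon> > 0" "\<epsilon> \<le> 1" "\<epsilon> * M \<le> e" using e M by (auto simp: \<epsilon>_def min_def field_simps)
  obtain \<delta> where \<delta>: "\<delta> > 0" "\<forall>y. (\<forall>i\<ge>n. y i = 0) \<longrightarrow> (\<forall>i<n. \<bar>y i - c t0 i\<bar> < \<delta>) \<longrightarrow>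
    norm (g y - g (c t0) - (\<Sum>j<n. (y j - c t0 j) *\<^sub>R partial_deriv j g (c t0))) \<le> \<epsilon> * (\<Sum>j<n. \<bar>y j - c t0 j\<bar>)"
    using total_increment_bound[OF g y0 \<epsilon>(1)] by blast
  have "\<exists>r>0. \<forall>t. \<bar>t - t0\<bar> < r \<longrightarrow> \<bar>c t j - c t0 j - (t - t0) * c' j\<bar> \<le> \<epsilon> * \<bar>t - t0\<bar>" if "j < n" for j
    using c[OF that] \<epsilon>(1) unfolding has_vector_derivative_def has_derivative_at_alt by auto
  then obtain r where r: "\<And>j. j < n \<Longrightarrow> r j > 0"
    "\<And>j t. j < n \<Longrightarrow> \<bar>t - t0\<bar> < r j \<Longrightarrow> \<bar>c t j - c t0 j - (t - t0) * c' j\<bar> \<le> \<epsilon> * \<bar>t - t0\<bar>" by metis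
  obtain rT where rT: "rT > 0" "ball t0 rT \<subseteq> T" using T open_contains_ball by blast
  define R where "R = Min (insert rT (insert (\<delta> / M) (r ` {..<n})))"
  have R: "R > 0" "R \<le> rT" "R \<le> \<delta> / M" "\<And>j. j < n \<Longrightarrow> R \<le> r j"
  proof -
    have fin: "finite (insert rT (insert (\<delta> / M) (r ` {..<n})))" by simp
    show "R > 0" unfolding R_def using rT \<delta>(1) M r(1) by (subst Min_gr_iff) auto
    show "R \<le> rT" "R \<le> \<delta> / M" "\<And>j. j < n \<Longrightarrow> R \<le> r j"
      unfolding R_def by (rule Min_le[OF fin], simp)+
  qed
  show "\<exists>d>0. \<forall>t. norm (t - t0) < d \<longrightarrow> norm (g (c t) - g (c t0) - (t - t0) *\<^sub>R ?S) \<le> e * norm (t - t0)"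
  proof (intro exI[of _ R] conjI allI impI R(1))
    fix t assume t: "norm (t - t0) < R"
    then have tT: "t \<in> T" using R(2) rT(2) by (auto simp: dist_real_def abs_minus_commute)
    have inc: "\<bar>c t j - c t0 j - (t - t0) * c' j\<bar> \<le> \<epsilon> * \<bar>t - t0\<bar>" if "j < n" for j
      using r(2)[OF that, of t] t R(4)[OF that] by simp
    have lip: "\<bar>c t j - c t0 j\<bar> \<le> (\<bar>c' j\<bar> + 1) * \<bar>t - t0\<bar>" if "j < n" for j
    proof -
      have "\<bar>c t j - c t0 j\<bar> \<le> \<bar>c t j - c t0 j - (t - t0) * c' j\<bar> + \<bar>(t - t0) * c' j\<bar>" by linarith
      also have "\<dots> \<le> 1 * \<bar>t - t0\<bar> + \<bar>t - t0\<bar> * \<bar>c' j\<bar>"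
        using inc[OF that] mult_right_mono[OF \<epsilon>(2), of "\<bar>t - t0\<bar>"] by (simp add: abs_mult)
      finally show ?thesis by (simp add: algebra_simps)
    qed
    have "\<bar>c t j - c t0 j\<bar> < \<delta>" if "j < n" for j
    proof -
      have "\<bar>c' j\<bar> + 1 \<le> M"
      proof -
        have "\<bar>c' j\<bar> + 1 + norm (partial_deriv j g (c t0)) \<le> (\<Sum>j<n. \<bar>c' j\<bar> + 1 + norm (partial_deriv j g (c t0)))"
          using that by (intro member_le_sum) auto
        then show ?thesis unfolding M_def using norm_ge_zero[of "partial_deriv j g (c t0)"] by linarith
      qed
      then have "\<bar>c t j - c t0 j\<bar> \<le> M * \<bar>t - t0\<bar>"
        using lip[OF that] mult_right_mono[of "\<bar>c' j\<bar> + 1" M "\<bar>t - t0\<bar>"] by linarith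
      also have "\<dots> < M * (\<delta> / M)" using t R(3) M by (intro mult_strict_left_mono) auto
      finally show ?thesis using M by simp
    qed
    then have 1: "norm (g (c t) - g (c t0) - (\<Sum>j<n. (c t j - c t0 j) *\<^sub>R partial_deriv j g (c t0))) \<le>
        \<epsilon> * (\<Sum>j<n. \<bar>c t j - c t0 j\<bar>)"
      using zero[OF tT] \<delta>(2) by simp
    also have "\<dots> \<le> \<epsilon> * (\<Sum>j<n. (\<bar>c' j\<bar> + 1) * \<bar>t - t0\<bar>)"
      using \<epsilon>(1) lip by (intro mult_left_mono sum_mono) auto
    finally have 1: "norm (g (c t) - g (c t0) - (\<Sum>j<n. (c t j - c t0 j) *\<^sub>R partial_deriv j g (c t0))) \<le>
        (\<Sum>j<n. \<epsilon> * (\<bar>c' j\<bar> + 1) * \<bar>t - t0\<bar>)" by (simp add: sum_distrib_left mult.assoc)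
    have 2: "norm (\<Sum>j<n. (c t j - c t0 j - (t - t0) * c' j) *\<^sub>R partial_deriv j g (c t0)) \<le>
        (\<Sum>j<n. \<epsilon> * norm (partial_deriv j g (c t0)) * \<bar>t - t0\<bar>)"
    proof (rule sum_norm_le)
      fix j assume "j \<in> {..<n}"
      then show "norm ((c t j - c t0 j - (t - t0) * c' j) *\<^sub>R partial_deriv j g (c t0)) \<le>
          \<epsilon> * norm (partial_deriv j g (c t0)) * \<bar>t - t0\<bar>"
        using mult_right_mono[OF inc[of j] norm_ge_zero[of "partial_deriv j g (c t0)"]] by (simp add: mult_ac)
    qed
    have eq: "g (c t) - g (c t0) - (t - t0) *\<^sub>R ?S =
        (g (c t) - g (c t0) - (\<Sum>j<n. (c t j - c t0 j) *\<^sub>R partial_deriv j g (c t0))) +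
        (\<Sum>j<n. (c t j - c t0 j - (t - t0) * c' j) *\<^sub>R partial_deriv j g (c t0))"
      by (simp add: scaleR_diff_left sum_subtractf scaleR_sum_right)
    have "norm (g (c t) - g (c t0) - (t - t0) *\<^sub>R ?S) \<le>
        (\<Sum>j<n. \<epsilon> * (\<bar>c' j\<bar> + 1) * \<bar>t - t0\<bar>) + (\<Sum>j<n. \<epsilon> * norm (partial_deriv j g (c t0)) * \<bar>t - t0\<bar>)"
      unfolding eq by (rule order_trans[OF norm_triangle_ineq add_mono[OF 1 2]])
    also have "\<dots> = \<epsilon> * (M - 1) * \<bar>t - t0\<bar>"
      unfolding M_def by (simp add: sum.distrib sum_distrib_left sum_distrib_right algebra_simps)
    also have "\<dots> \<le> e * norm (t - t0)"
    proof -
      have "\<epsilon> * (M - 1) \<le> e" using \<epsilon> by (simp add: algebra_simps)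
      then show ?thesis by (simp add: mult_right_mono)
    qed
    finally show "norm (g (c t) - g (c t0) - (t - t0) *\<^sub>R ?S) \<le> e * norm (t - t0)" .
  qed
qed

text \<open>A family closed under differentiation takes the place of higher derivatives of one
  function: the induction on \<open>k\<close> moves from \<phi> to a derivative that lies again in
  \<open>Fam\<close>.\<close>

lemma C_k_compose_family:
  fixes w :: "(nat \<Rightarrow> real) \<Rightarrow> real"
  assumes Fam: "\<And>\<phi>. \<phi> \<in> Fam \<Longrightarrow> \<exists>\<phi>'\<in>Fam. \<forall>t\<in>S. (\<phi> has_real_derivative \<phi>' t) (at t)"
    and S: "\<And>x. x \<in> U \<Longrightarrow> w x \<in> S"
  shows "\<phi> \<in> Fam \<Longrightarrow> C_k_on n k U w \<Longrightarrow> C_k_on n k U (\<lambda>x. \<phi> (w x))"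
proof (induction k arbitrary: \<phi>)
  have cont: "continuous_on U (\<lambda>x. \<phi> (w x))" if \<phi>: "\<phi> \<in> Fam" and w: "continuous_on U w" for \<phi>
  proof -
    have "continuous_on S \<phi>" using Fam[OF \<phi>] by (meson DERIV_isCont continuous_at_imp_continuous_on)
    then show ?thesis using continuous_on_compose2[OF _ w] S by blast
  qed
  {
    case 0
    then show ?case using cont by (simp add: C_0_iff)
  next
    case (Suc k)
    obtain \<phi>' where \<phi>': "\<phi>' \<in> Fam" "\<forall>t\<in>S. (\<phi> has_real_derivative \<phi>' t) (at t)" using Fam[OF Suc.prems(1)] by blast
    show ?case
    proof (rule C_SucI[where g = "\<lambda>i x. \<phi>' (w x) * partial_deriv i w x"])
      show "continuous_on U (\<lambda>x. \<phi> (w x))" by (rule cont[OF Suc.prems(1) C_Suc_continuous[OF Suc.prems(2)]])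
      show "C_k_on n k U (\<lambda>x. \<phi>' (w x) * partial_deriv i w x)" if "i < n" for i
        by (rule C_k_mult[OF Suc.IH[OF \<phi>'(1) C_Suc_mono[OF Suc.prems(2)]] C_Suc_deriv[OF Suc.prems(2) that]])
      show "has_partial i (\<lambda>x. \<phi> (w x)) (\<phi>' (w x) * partial_deriv i w x) x" if "i < n" "x \<in> U" for i x
      proof -
        have "((\<lambda>t. w (x(i := t))) has_real_derivative partial_deriv i w x) (at (x i))"
          using C_Suc_partial[OF Suc.prems(2) that]
          by (simp add: has_partial_def has_real_derivative_iff_has_vector_derivative)
        moreover have "(\<phi> has_real_derivative \<phi>' (w x)) (at (w (x(i := x i))))" using \<phi>'(2) S[OF that(2)] by simp
        ultimately show ?thesis
          using DERIV_chain2[of \<phi> "\<phi>' (w x)" "\<lambda>t. w (x(i := t))"]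
          by (simp add: has_partial_def has_real_derivative_iff_has_vector_derivative)
      qed
    qed
  }
qed

lemma C_k_powr:
  assumes "C_k_on n k U w" "\<And>x. x \<in> U \<Longrightarrow> w x > (0 :: real)"
  shows "C_k_on n k U (\<lambda>x. w x powr a)"
proof -
  have "C_k_on n k U (\<lambda>x. 1 * w x powr a)"
  proof (rule C_k_compose_family[where Fam = "{(\<lambda>t. b * t powr a) | a b. True}" and S = "{0<..}"
        and \<phi> = "\<lambda>t. 1 * t powr a"])
    fix \<phi> assume "\<phi> \<in> {(\<lambda>t :: real. b * t powr a) | a b. True}"
    then obtain c b where \<phi>: "\<phi> = (\<lambda>t. b * t powr c)" by blast
    have "(\<phi> has_real_derivative (b * c) * t powr (c - 1)) (at t)" if "t > 0" for t
      unfolding \<phi> using that by (auto intro!: derivative_eq_intros simp: mult_ac)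
    then show "\<exists>\<phi>'\<in>{(\<lambda>t. b * t powr a) | a b. True}. \<forall>t\<in>{0<..}. (\<phi> has_real_derivative \<phi>' t) (at t)"
      by (intro bexI[of _ "\<lambda>t. (b * c) * t powr (c - 1)"]) auto
  next
    show "(\<lambda>t. 1 * t powr a) \<in> {(\<lambda>t :: real. b * t powr a) | a b. True}" by blast
  qed (use assms in auto)
  then show ?thesis by simp
qed

end

text \<open>The polynomial factor makes the family closed under differentiation, as
  \<open>C_k_compose_family\<close> demands; \<open>flat 1\<close> is the standard function that is
  flat at \<open>0\<close>.\<close>

definition flat :: "real poly \<Rightarrow> real \<Rightarrow> real" where
  "flat p t = (if t > 0 then poly p (1 / t) * exp (- (1 / t)) else 0)"

lemma flat_derivative:
  "(flat p has_real_derivative flat ([:0, 0, 1:] * (p - pderiv p)) t) (at t)"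
proof -
  let ?q = "[:0, 0, 1:] * (p - pderiv p)"
  consider "t > 0" | "t < 0" | "t = 0" by linarith
  then show ?thesis
  proof cases
    case 1
    have "((\<lambda>t. poly p (1 / t) * exp (- (1 / t))) has_real_derivative
        (poly (pderiv p) (1 / t) * (- (1 / t^2))) * exp (- (1 / t)) + poly p (1 / t) * (exp (- (1 / t)) * (1 / t^2))) (at t)"
      using 1 by (auto intro!: derivative_eq_intros DERIV_chain2[OF poly_DERIV] simp: power2_eq_square field_simps)
    moreover have "(poly (pderiv p) (1 / t) * (- (1 / t^2))) * exp (- (1 / t)) + poly p (1 / t) * (exp (- (1 / t)) * (1 / t^2)) = flat ?q t"
      using 1 by (simp add: flat_def power2_eq_square field_simps)
    ultimately have "((\<lambda>t. poly p (1 / t) * exp (- (1 / t))) has_real_derivative flat ?q t) (at t)" by simp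
    then show ?thesis
      by (rule has_field_derivative_transform_within_open[of _ _ _ "{0<..}"]) (use 1 in \<open>auto simp: flat_def\<close>)
  next
    case 2
    have "((\<lambda>t. 0) has_real_derivative flat ?q t) (at t)" using 2 by (simp add: flat_def)
    then show ?thesis
      by (rule has_field_derivative_transform_within_open[of _ _ _ "{..<0}"]) (use 2 in \<open>auto simp: flat_def\<close>)
  next
    \<comment> \<open>At \<open>0\<close> the right difference quotient is
      \<open>s * poly p s * exp (- s)\<close> with \<open>s = 1 / h\<close>, which tends to
      \<open>0\<close>; the left one is identically \<open>0\<close>.\<close>
    case 3
    have lim: "((\<lambda>s. poly r s * exp (- s)) \<longlongrightarrow> 0) at_top" for r :: "real poly"
    proof (induction r)
      case (pCons a r)
      have mono: "((\<lambda>s :: real. s ^ k * exp (- s)) \<longlongrightarrow> 0) at_top" for k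
        using tendsto_power_div_exp_0[of k] by (simp add: exp_minus divide_inverse)
      have "((\<lambda>s. \<Sum>i\<le>degree (pCons a r). coeff (pCons a r) i * (s ^ i * exp (- s))) \<longlongrightarrow> (\<Sum>i\<le>degree (pCons a r). coeff (pCons a r) i * 0)) at_top"
        by (intro tendsto_sum tendsto_mult tendsto_const mono)
      then show ?case by (simp add: poly_altdef sum_distrib_right mult.assoc del: coeff_pCons_0)
    qed simp
    have "((\<lambda>h. (poly ([:0, 1:] * p) (inverse h) * exp (- inverse h))) \<longlongrightarrow> 0) (at_right 0)"
      by (rule filterlim_compose[OF lim filterlim_inverse_at_top_right])
    then have "((\<lambda>h. (flat p (0 + h) - flat p 0) / h) \<longlongrightarrow> 0) (at_right 0)"
      by (rule Lim_transform_eventually)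
        (auto intro!: eventually_at_rightI[of 0 1] simp: flat_def field_simps)
    moreover have "((\<lambda>h. (flat p (0 + h) - flat p 0) / h) \<longlongrightarrow> 0) (at_left 0)"
      by (rule Lim_transform_eventually[OF tendsto_const])
        (auto intro!: eventually_at_leftI[of "-1" 0] simp: flat_def)
    ultimately have "((\<lambda>h. (flat p (0 + h) - flat p 0) / h) \<longlongrightarrow> 0) (at 0)"
      by (simp add: filterlim_split_at)
    then show ?thesis using 3 by (simp add: DERIV_def flat_def)
  qed
qed

lemma (in open_region) C_k_flat:
  assumes "C_k_on n k U w"
  shows "C_k_on n k U (\<lambda>x. flat p (w x))"
proof (rule C_k_compose_family[where Fam = "range flat" and S = UNIV and \<phi> = "flat p"])
  show "\<exists>\<phi>'\<in>range flat. \<forall>t\<in>UNIV. (\<phi> has_real_derivative \<phi>' t) (at t)" if "\<phi> \<in> range flat" for \<phi>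
    using that flat_derivative by blast
qed (use assms in auto)

definition bump :: "real \<Rightarrow> real" where
  "bump = flat 1"

lemma bump_pos: "bump t > 0 \<longleftrightarrow> t > 0" and bump_nonneg: "bump t \<ge> 0" and bump_zero: "t \<le> 0 \<Longrightarrow> bump t = 0"
  by (auto simp: bump_def flat_def)

text \<open>The partial derivatives of the composite are sums of products of derivatives of the
  coordinates of \<psi> with \<open>partial_deriv j g\<close> composed with \<psi>, so the induction
  on \<open>k\<close> must let \<open>g\<close> vary. Coordinates from \<open>m\<close> on vanish on
  \<open>V\<close>, which completes the continuity of \<psi>.\<close>

lemma C_k_chain:
  assumes U: "openin (Euclidean_space n) U" and V: "openin (Euclidean_space m) V"
    and \<psi>: "\<And>x. x \<in> U \<Longrightarrow> \<psi> x \<in> V" "\<And>j. j < m \<Longrightarrow> C_inf_on n U (\<lambda>x. \<psi> x j)"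
  shows "C_k_on m k V g \<Longrightarrow> C_k_on n k U (\<lambda>x. g (\<psi> x))"
proof -
  interpret U: open_region n U by unfold_locales (rule U)
  interpret V: open_region m V by unfold_locales (rule V)
  have \<psi>C: "C_k_on n k U (\<lambda>x. \<psi> x j)" if "j < m" for j k
    using \<psi>(2)[OF that] by (simp add: C_inf_on_def)
  have "continuous_on U \<psi>"
  proof (rule continuous_on_coordinatewise_then_product)
    fix j show "continuous_on U (\<lambda>x. \<psi> x j)"
    proof (cases "j < m")
      case True
      then show ?thesis using \<psi>C[of j 0] by (simp add: U.C_0_iff)
    next
      case False
      have "continuous_on U (\<lambda>x. 0 :: real)" by simp
      then show ?thesis by (rule continuous_on_eq) (use False V.U_zero[OF \<psi>(1)] in auto)
    qed
  qed
  then have cont: "continuous_on U (\<lambda>x. g (\<psi> x))" if "continuous_on V g" for g :: "(nat \<Rightarrow> real) \<Rightarrow> 'a"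
    by (rule continuous_on_compose2[OF that]) (use \<psi>(1) in auto)
  show "C_k_on m k V g \<Longrightarrow> C_k_on n k U (\<lambda>x. g (\<psi> x))"
  proof (induction k arbitrary: g)
    case 0
    then show ?case using cont by (simp add: U.C_0_iff V.C_0_iff)
  next
    case (Suc k)
    have g1: "C_k_on m (Suc 0) V g"
      using Suc.prems by (induction k) (auto dest: V.C_Suc_mono)
    show ?case
    proof (rule U.C_SucI[where g = "\<lambda>i x. \<Sum>j<m. partial_deriv i (\<lambda>x. \<psi> x j) x *\<^sub>R partial_deriv j g (\<psi> x)"])
      show "continuous_on U (\<lambda>x. g (\<psi> x))" by (rule cont[OF V.C_Suc_continuous[OF Suc.prems]])
      show "has_partial i (\<lambda>x. g (\<psi> x)) (\<Sum>j<m. partial_deriv i (\<lambda>x. \<psi> x j) x *\<^sub>R partial_deriv j g (\<psi> x)) x"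
        if i: "i < n" and x: "x \<in> U" for i x
      proof -
        obtain T where T: "open T" "x i \<in> T" "\<And>t. t \<in> T \<Longrightarrow> x(i := t) \<in> U" using U.line_in_U[OF x i] by metis
        have "((\<lambda>t. g (\<psi> (x(i := t)))) has_vector_derivative
            (\<Sum>j<m. partial_deriv i (\<lambda>x. \<psi> x j) x *\<^sub>R partial_deriv j g (\<psi> (x(i := x i))))) (at (x i))"
        proof (rule V.curve_derivative[OF g1 _ T(1,2)])
          show "\<psi> (x(i := x i)) \<in> V" using \<psi>(1) x by simp
          show "\<psi> (x(i := t)) l = 0" if "t \<in> T" "l \<ge> m" for t l using V.U_zero[OF \<psi>(1)[OF T(3)]] that by simp
          show "((\<lambda>t. \<psi> (x(i := t)) j) has_vector_derivative partial_deriv i (\<lambda>x. \<psi> x j) x) (at (x i))" if "j < m" for j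
            using U.C_Suc_partial[OF \<psi>C[OF that] i x] by (simp add: has_partial_def)
        qed
        then show ?thesis by (simp add: has_partial_def)
      qed
      show "C_k_on n k U (\<lambda>x. \<Sum>j<m. partial_deriv i (\<lambda>x. \<psi> x j) x *\<^sub>R partial_deriv j g (\<psi> x))" if i: "i < n" for i
      proof (rule U.C_k_sum)
        fix j assume "j \<in> {..<m}"
        then have j: "j < m" by simp
        show "C_k_on n k U (\<lambda>x. partial_deriv i (\<lambda>x. \<psi> x j) x *\<^sub>R partial_deriv j g (\<psi> x))"
          by (rule U.C_k_scaleR[OF U.C_Suc_deriv[OF \<psi>C[OF j] i] Suc.IH[OF V.C_Suc_deriv[OF Suc.prems j]]])
      qed
    qed
  qed
qed

text \<open>Functions on \<open>U\<close> are represented by functions on the whole type that take the same value at all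
  points outside \<open>U\<close> as at a fixed point of \<open>U\<close>. Thus algebraic identities on \<open>U\<close>, such as
  \<open>d i (x i) = 1\<close>, are identities of functions on the whole type.\<close>

locale nonempty_open_region = open_region +
  assumes nonempty: "U \<noteq> {}"
begin

definition ret :: "(nat \<Rightarrow> real) \<Rightarrow> nat \<Rightarrow> real" where
  "ret x = (if x \<in> U then x else (SOME x. x \<in> U))"

lemma ret_U [simp]: "ret x \<in> U" and ret_id [simp]: "x \<in> U \<Longrightarrow> ret x = x" and ret_ret [simp]: "ret (ret x) = ret x"
  using nonempty some_in_eq[of U] by (auto simp: ret_def)

definition smooth :: "((nat \<Rightarrow> real) \<Rightarrow> complex) set" where
  "smooth = {u. C_inf_on n U u \<and> (\<forall>x. u (ret x) = u x)}"

definition deriv_on :: "nat \<Rightarrow> ((nat \<Rightarrow> real) \<Rightarrow> complex) \<Rightarrow> (nat \<Rightarrow> real) \<Rightarrow> complex" where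
  "deriv_on i u = (\<lambda>x. partial_deriv i u (ret x))"

lemma smooth_C_k: "f \<in> smooth \<Longrightarrow> C_k_on n k U f"
  and smooth_ret: "f \<in> smooth \<Longrightarrow> f (ret x) = f x"
  by (simp_all add: smooth_def C_inf_on_def)

lemma smoothI: "(\<And>k. C_k_on n k U f) \<Longrightarrow> (\<And>x. f (ret x) = f x) \<Longrightarrow> f \<in> smooth"
  by (simp add: smooth_def C_inf_on_def)

lemma smooth_compose_ret: "(\<And>k. C_k_on n k U f) \<Longrightarrow> (\<lambda>x. f (ret x)) \<in> smooth"
  by (rule smoothI, rule C_k_cong_imp[of f]) auto

lemma smooth_eqI: "(\<And>x. x \<in> U \<Longrightarrow> f x = g x) \<Longrightarrow> f \<in> smooth \<Longrightarrow> g \<in> smooth \<Longrightarrow> f = g"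
  by (metis ext ret_U smooth_ret)

lemma smooth_partial: "f \<in> smooth \<Longrightarrow> i < n \<Longrightarrow> x \<in> U \<Longrightarrow> has_partial i f (deriv_on i f x) x"
  using C_Suc_partial[OF smooth_C_k] by (simp add: deriv_on_def)

lemma partial_unique: "i < n \<Longrightarrow> x \<in> U \<Longrightarrow> has_partial i f v x \<Longrightarrow> deriv_on i f x = v"
  by (simp add: deriv_on_def has_partial_partial_deriv)

lemma smooth_deriv:
  assumes "i < n" "f \<in> smooth"
  shows "deriv_on i f \<in> smooth"
  unfolding deriv_on_def by (rule smooth_compose_ret) (rule C_Suc_deriv[OF smooth_C_k[OF assms(2)] assms(1)])

lemma smooth_add: "f \<in> smooth \<Longrightarrow> g \<in> smooth \<Longrightarrow> f + g \<in> smooth"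
  unfolding plus_fun_def by (rule smoothI, rule C_k_add; (rule smooth_C_k)?) (auto simp: smooth_ret)

lemma smooth_mult: "f \<in> smooth \<Longrightarrow> g \<in> smooth \<Longrightarrow> f * g \<in> smooth"
  unfolding times_fun_def by (rule smoothI, rule C_k_mult; (rule smooth_C_k)?) (auto simp: smooth_ret)

lemma smooth_const: "(\<lambda>_. c) \<in> smooth"
  by (rule smoothI, rule C_k_const, rule refl)

lemma smooth_cnj: "f \<in> smooth \<Longrightarrow> (\<lambda>x. cnj (f x)) \<in> smooth"
  by (rule smoothI, rule C_k_linear[OF bounded_linear_cnj], rule smooth_C_k) (auto simp: smooth_ret)

lemma deriv_on_add: "i < n \<Longrightarrow> f \<in> smooth \<Longrightarrow> g \<in> smooth \<Longrightarrow> deriv_on i (f + g) = deriv_on i f + deriv_on i g"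
proof (rule smooth_eqI)
  fix x assume *: "i < n" "f \<in> smooth" "g \<in> smooth" and x: "x \<in> U"
  have "has_partial i (\<lambda>x. f x + g x) (deriv_on i f x + deriv_on i g x) x"
    by (intro has_partial_add smooth_partial * x)
  then show "deriv_on i (f + g) x = (deriv_on i f + deriv_on i g) x"
    using partial_unique[OF *(1) x] by (simp add: plus_fun_def)
qed (auto intro: smooth_add smooth_deriv)

lemma deriv_on_mult: "i < n \<Longrightarrow> f \<in> smooth \<Longrightarrow> g \<in> smooth \<Longrightarrow> deriv_on i (f * g) = deriv_on i f * g + f * deriv_on i g"
proof (rule smooth_eqI)
  fix x assume *: "i < n" "f \<in> smooth" "g \<in> smooth" and x: "x \<in> U"
  have "has_partial i (\<lambda>x. f x * g x) (f x * deriv_on i g x + deriv_on i f x * g x) x"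
    by (intro has_partial_mult smooth_partial * x)
  then show "deriv_on i (f * g) x = (deriv_on i f * g + f * deriv_on i g) x"
    using partial_unique[OF *(1) x] by (simp add: times_fun_def)
qed (auto intro: smooth_add smooth_mult smooth_deriv)

lemma partial_deriv_cong_on:
  assumes "i < n" "x \<in> U" "g \<in> smooth" "\<And>y. y \<in> U \<Longrightarrow> f y = g y"
  shows "partial_deriv i f x = deriv_on i g x"
  by (rule has_partial_partial_deriv, rule has_partial_cong[OF assms(2,1) assms(4)[symmetric] smooth_partial[OF assms(3,1,2)]])

sublocale alg: diff_algebra smooth "\<lambda>c _. c" "\<lambda>u x. cnj (u x)" n deriv_on "\<lambda>i x. complex_of_real (ret x i)"
proof unfold_locales
  fix i j a b assume i: "i < n"
  show x: "(\<lambda>x. complex_of_real (ret x j)) \<in> smooth" if "j < n" for j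
    by (rule smooth_compose_ret[of "\<lambda>x. complex_of_real (x j)"],
        rule C_k_linear[OF bounded_linear_of_real C_k_coordinate[OF that]])
  show "deriv_on i (\<lambda>_. c) = 0" for c
    by (rule smooth_eqI)
      (use i smooth_const[of 0] in \<open>auto intro: partial_unique has_partial_const smooth_deriv smooth_const simp: zero_fun_def\<close>)
  show "(\<lambda>x. cnj (deriv_on i a x)) = deriv_on i (\<lambda>x. cnj (a x))" if a: "a \<in> smooth"
    by (rule smooth_eqI)
      (use i a in \<open>auto intro!: smooth_cnj smooth_deriv partial_unique[symmetric]
        has_partial_linear[OF bounded_linear_cnj] smooth_partial\<close>)
  assume j: "j < n"
  show "deriv_on i (deriv_on j a) = deriv_on j (deriv_on i a)" if a: "a \<in> smooth"
  proof (rule smooth_eqI)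
    fix x assume x: "x \<in> U"
    have "deriv_on i (deriv_on j a) x = partial_deriv i (partial_deriv j a) x"
      using i j a x by (intro partial_deriv_cong_on[symmetric] smooth_deriv) (auto simp: deriv_on_def)
    also have "\<dots> = partial_deriv j (partial_deriv i a) x"
      by (rule partial_deriv_commute[OF smooth_C_k[OF a] i j x])
    also have "\<dots> = deriv_on j (deriv_on i a) x"
      using i j a x by (intro partial_deriv_cong_on smooth_deriv) (auto simp: deriv_on_def)
    finally show "deriv_on i (deriv_on j a) x = deriv_on j (deriv_on i a) x" .
  qed (use i j a in \<open>auto intro: smooth_deriv\<close>)
  show "deriv_on i (\<lambda>x. complex_of_real (ret x j)) = (if i = j then 1 else 0)"
  proof (rule smooth_eqI)
    fix y assume y: "y \<in> U"
    have "has_partial i (\<lambda>x. complex_of_real (x j)) (complex_of_real (if i = j then 1 else 0)) y"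
      by (rule has_partial_linear[OF bounded_linear_of_real, of i "\<lambda>x. x j"])
        (auto simp: has_partial_def has_vector_derivative_id)
    then have "has_partial i (\<lambda>x. complex_of_real (ret x j)) (complex_of_real (if i = j then 1 else 0)) y"
      by (rule has_partial_cong[OF y i, rotated]) simp
    then show "deriv_on i (\<lambda>x. complex_of_real (ret x j)) y = (if i = j then 1 else 0) y"
      using partial_unique[OF i y] by (cases "i = j") auto
  next
    show "(if i = j then 1 else 0) \<in> smooth"
      using smooth_const[of 0] smooth_const[of 1] by (auto simp: zero_fun_def one_fun_def)
  qed (use i j x in \<open>auto intro: smooth_deriv\<close>)
qed (auto simp: smooth_add smooth_mult smooth_const smooth_cnj smooth_deriv deriv_on_add deriv_on_mult fun_eq_iff)

definition multi_deriv_on :: "(nat \<Rightarrow> nat) \<Rightarrow> ((nat \<Rightarrow> real) \<Rightarrow> complex) \<Rightarrow> (nat \<Rightarrow> real) \<Rightarrow> complex" where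
  "multi_deriv_on \<alpha> f = foldr (\<lambda>i. deriv_on i ^^ \<alpha> i) [0..<n] f"

lemma iterate_deriv:
  assumes "i < n"
  shows "g \<in> smooth \<Longrightarrow> (\<And>y. y \<in> U \<Longrightarrow> f y = g y) \<Longrightarrow> (deriv_on i ^^ k) g \<in> smooth \<and>
    (\<forall>x\<in>U. (partial_deriv i ^^ k) f x = (deriv_on i ^^ k) g x)"
proof (induction k)
  case (Suc k)
  then show ?case using assms partial_deriv_cong_on[of i _ "(deriv_on i ^^ k) g" "(partial_deriv i ^^ k) f"]
    by (auto intro: smooth_deriv)
qed auto

lemma multi_deriv_on:
  assumes "g \<in> smooth" "\<And>y. y \<in> U \<Longrightarrow> f y = g y" "x \<in> U"
  shows "multi_deriv n \<alpha> f x = multi_deriv_on \<alpha> g x"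
proof -
  have "set I \<subseteq> {..<n} \<Longrightarrow> foldr (\<lambda>i. deriv_on i ^^ \<alpha> i) I g \<in> smooth \<and>
    (\<forall>x\<in>U. foldr (\<lambda>i. partial_deriv i ^^ \<alpha> i) I f x = foldr (\<lambda>i. deriv_on i ^^ \<alpha> i) I g x)" for I
  proof (induction I)
    case (Cons i I)
    then show ?case using iterate_deriv[of i "foldr (\<lambda>i. deriv_on i ^^ \<alpha> i) I g"
          "foldr (\<lambda>i. partial_deriv i ^^ \<alpha> i) I f" "\<alpha> i"] by auto
  qed (use assms in auto)
  from this[of "[0..<n]"] show ?thesis
    using assms(3) by (auto simp: multi_deriv_def multi_deriv_on_def atLeast0LessThan)
qed

lemma is_diffop_multi_deriv: "alg.is_diffop (multi_deriv_on \<alpha>)"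
proof -
  have 1: "alg.is_diffop (deriv_on i ^^ k)" if "i < n" for i k
  proof (induction k)
    case (Suc k)
    have "alg.is_diffop (\<lambda>f. (deriv_on i ^^ k) (deriv_on i f))" by (rule alg.is_diffop_d[OF that Suc])
    then show ?case by (simp add: funpow_swap1 o_def)
  qed (simp add: id_def)
  have "set I \<subseteq> {..<n} \<Longrightarrow> alg.is_diffop (foldr (\<lambda>i. deriv_on i ^^ \<alpha> i) I)" for I
  proof (induction I)
    case (Cons i I)
    then have "alg.is_diffop (\<lambda>f. (deriv_on i ^^ \<alpha> i) (foldr (\<lambda>i. deriv_on i ^^ \<alpha> i) I f))"
      using alg.is_diffop_comp[of "deriv_on i ^^ \<alpha> i" "foldr (\<lambda>i. deriv_on i ^^ \<alpha> i) I"] 1 by simp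
    then show ?case by (simp add: o_def)
  qed (simp add: id_def)
  from this[of "[0..<n]"] show ?thesis by (simp add: multi_deriv_on_def[abs_def] atLeast0LessThan)
qed

definition local_bidiff where
  "local_bidiff N c f g = (\<lambda>x. \<Sum>\<alpha>\<in>multi_indices n N. \<Sum>\<beta>\<in>multi_indices n N.
     c \<alpha> \<beta> (ret x) * multi_deriv n \<alpha> f (ret x) * multi_deriv n \<beta> g (ret x))"

lemma is_bidiffop_local_bidiff:
  assumes "\<And>\<alpha> \<beta>. \<alpha> \<in> multi_indices n N \<Longrightarrow> \<beta> \<in> multi_indices n N \<Longrightarrow> C_inf_on n U (c \<alpha> \<beta>)"
  shows "alg.is_bidiffop (local_bidiff N c)"
proof -
  let ?c = "\<lambda>\<alpha> \<beta> x. c \<alpha> \<beta> (ret x)"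
  have c: "?c \<alpha> \<beta> \<in> smooth" if "\<alpha> \<in> multi_indices n N" "\<beta> \<in> multi_indices n N" for \<alpha> \<beta>
    using assms[OF that] by (intro smooth_compose_ret) (auto simp: C_inf_on_def)
  have "alg.is_bidiffop (\<lambda>f g. \<Sum>\<alpha>\<in>multi_indices n N. \<Sum>\<beta>\<in>multi_indices n N.
      ?c \<alpha> \<beta> * (multi_deriv_on \<alpha> f * multi_deriv_on \<beta> g))"
    by ((rule alg.is_bidiffop_sum)+, rule alg.is_bidiffop_lmult[OF c],
        assumption, assumption,
        rule alg.is_bidiffop_sub[OF is_diffop_multi_deriv is_diffop_multi_deriv alg.is_bidiffop_times])
  moreover have "local_bidiff N c f g = (\<Sum>\<alpha>\<in>multi_indices n N. \<Sum>\<beta>\<in>multi_indices n N.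
      ?c \<alpha> \<beta> * (multi_deriv_on \<alpha> f * multi_deriv_on \<beta> g))" if "f \<in> smooth" "g \<in> smooth" for f g
  proof
    have sum_fun: "(\<Sum>a\<in>A. h a) x = (\<Sum>a\<in>A. h a x)" for A and h :: "(nat \<Rightarrow> nat) \<Rightarrow> (nat \<Rightarrow> real) \<Rightarrow> complex" and x
      by (induction A rule: infinite_finite_induct) auto
    have "multi_deriv n \<alpha> h (ret x) = multi_deriv_on \<alpha> h x" if "h \<in> smooth" for \<alpha> h x
      using multi_deriv_on[OF that refl ret_U] smooth_ret[OF alg.is_diffop_B[OF is_diffop_multi_deriv that]] by simp
    then show "local_bidiff N c f g x = (\<Sum>\<alpha>\<in>multi_indices n N. \<Sum>\<beta>\<in>multi_indices n N.
      ?c \<alpha> \<beta> * (multi_deriv_on \<alpha> f * multi_deriv_on \<beta> g)) x" for x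
      using that by (simp add: local_bidiff_def sum_fun mult.assoc)
  qed
  ultimately show ?thesis
    by (subst alg.is_bidiffop_cong[where Z' = "\<lambda>f g. \<Sum>\<alpha>\<in>multi_indices n N. \<Sum>\<beta>\<in>multi_indices n N.
      ?c \<alpha> \<beta> * (multi_deriv_on \<alpha> f * multi_deriv_on \<beta> g)"])
qed

text \<open>A bidifferential operator sees only germs. Smoothness is asked of \<open>f'\<close> and
  \<open>g'\<close> alone: the derivatives of \<open>f\<close> and \<open>g\<close> are taken inside
  \<open>W\<close>, where they agree with theirs.\<close>

lemma local_bidiff_cong:
  assumes W: "openin (Euclidean_space n) W" "W \<subseteq> U" and fg: "f' \<in> smooth" "g' \<in> smooth"
    and eq: "\<And>y. y \<in> W \<Longrightarrow> f y = f' y" "\<And>y. y \<in> W \<Longrightarrow> g y = g' y" and x: "x \<in> W"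
  shows "local_bidiff N c f g x = local_bidiff N c f' g' x"
proof -
  interpret W: nonempty_open_region n W by unfold_locales (use W x in auto)
  have md: "multi_deriv n \<alpha> h x = multi_deriv n \<alpha> h' x"
    if h': "h' \<in> smooth" and eq: "\<And>y. y \<in> W \<Longrightarrow> h y = h' y" for \<alpha> h h'
  proof -
    have "(\<lambda>x. h' (W.ret x)) \<in> W.smooth"
      by (rule W.smooth_compose_ret) (rule C_k_subset[OF W smooth_C_k[OF h']])
    from W.multi_deriv_on[OF this _ x, of h] W.multi_deriv_on[OF this _ x, of h'] show ?thesis using eq by simp
  qed
  have "multi_deriv n \<alpha> f x = multi_deriv n \<alpha> f' x" "multi_deriv n \<alpha> g x = multi_deriv n \<alpha> g' x" for \<alpha>
    by (rule md[OF fg(1) eq(1)], assumption, rule md[OF fg(2) eq(2)])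
  moreover have "ret x = x" using x W(2) by (intro ret_id) blast
  ultimately show ?thesis by (simp only: local_bidiff_def)
qed

end

section \<open>Cut-off functions around a point\<close>

context open_region begin

text \<open>The quotient of \<open>e1\<close> by \<open>e1 + e2\<close>, both functions of the
  squared distance \<open>s\<close>: \<open>e2\<close> vanishes for \<open>s \<le> \<delta>\<close>,
  where the quotient is \<open>1\<close>, and \<open>e1\<close> vanishes for
  \<open>s \<ge> 2 * \<delta>\<close>. These regions are disjoint, so the denominator is
  positive.\<close>

lemma cutoff_exists:
  assumes a: "a \<in> U"
  shows "\<exists>r K W. (\<forall>k. C_k_on n k U r) \<and> (\<forall>y. 0 \<le> r y \<and> r y \<le> (1 :: real)) \<and>
    compactin (Euclidean_space n) K \<and> K \<subseteq> U \<and> (\<forall>y\<in>U. r y \<noteq> 0 \<longrightarrow> y \<in> K) \<and>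
    openin (Euclidean_space n) W \<and> a \<in> W \<and> W \<subseteq> U \<and> (\<forall>y\<in>W. r y = 1)"
proof -
  obtain e where e: "e > 0" "\<And>y. (\<And>i. i \<ge> n \<Longrightarrow> y i = 0) \<Longrightarrow> (\<And>i. i < n \<Longrightarrow> \<bar>y i - a i\<bar> < e) \<Longrightarrow> y \<in> U"
    using box[OF a] by metis
  define K where "K = (\<Pi>\<^sub>E i\<in>UNIV. if i < n then {a i - e/2..a i + e/2} else {0})"
  have K_iff: "y \<in> K \<longleftrightarrow> (\<forall>i<n. \<bar>y i - a i\<bar> \<le> e/2) \<and> (\<forall>i\<ge>n. y i = 0)" for y
  proof -
    have "t \<in> {a i - e/2..a i + e/2} \<longleftrightarrow> \<bar>t - a i\<bar> \<le> e/2" for t i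
      unfolding atLeastAtMost_iff abs_le_iff by linarith
    then have "y \<in> K \<longleftrightarrow> (\<forall>i. if i < n then \<bar>y i - a i\<bar> \<le> e/2 else y i = 0)"
      unfolding K_def PiE_iff by (auto split: if_splits simp del: atLeastAtMost_iff)
    then show ?thesis by (metis not_less)
  qed
  have KU: "K \<subseteq> U" using e by (force simp: K_iff intro!: e(2))
  have "compactin (product_topology (\<lambda>i. euclidean) UNIV) K"
    unfolding K_def compactin_PiE by auto
  moreover have "K \<subseteq> {x. \<forall>i\<ge>n. x i = 0}" by (auto simp: K_iff)
  ultimately have cK: "compactin (Euclidean_space n) K"
    unfolding Euclidean_space_def by (simp add: compactin_subtopology)
  define s where "s = (\<lambda>y :: nat \<Rightarrow> real. \<Sum>i<n. (y i - a i)\<^sup>2)"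
  \<comment> \<open>Then \<open>2 * \<delta> = (e / 2)\<^sup>2\<close>, which keeps the support
    inside the box \<open>K\<close> of half-width \<open>e / 2\<close>.\<close>
  define \<delta> where "\<delta> = e\<^sup>2 / 8"
  have \<delta>: "\<delta> > 0" using e by (simp add: \<delta>_def)
  have sC: "C_k_on n k U s" for k
  proof -
    have "C_k_on n k U (\<lambda>y. (y i + - a i) * (y i + - a i))" if "i < n" for i
      by (intro C_k_mult C_k_add C_k_coordinate C_k_const that)
    then show ?thesis unfolding s_def power2_eq_square by (intro C_k_sum) auto
  qed
  have aff: "C_k_on n k U (\<lambda>y. b + c * s y)" for b c k
    by (intro C_k_add C_k_mult C_k_const sC)
  define e1 where "e1 = (\<lambda>y. bump (2 * \<delta> + (- 1) * s y))"
  define e2 where "e2 = (\<lambda>y. bump (- \<delta> + 1 * s y))"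
  have eC: "C_k_on n k U e1" "C_k_on n k U e2" for k
    unfolding e1_def e2_def bump_def by (intro C_k_flat aff)+
  have pos: "e1 y + e2 y > 0" for y
  proof (cases "s y < 2 * \<delta>")
    case True
    then have "e1 y > 0" by (simp add: e1_def bump_pos)
    then show ?thesis using bump_nonneg[of "- \<delta> + 1 * s y"] unfolding e2_def by linarith
  next
    case False
    then have "e2 y > 0" using \<delta> by (simp add: e2_def bump_pos)
    then show ?thesis using bump_nonneg[of "2 * \<delta> + (- 1) * s y"] unfolding e1_def by linarith
  qed
  define r where "r = (\<lambda>y. e1 y * (e1 y + e2 y) powr (- 1))"
  have r_eq: "r y = e1 y / (e1 y + e2 y)" for y
    using pos[of y] by (simp add: r_def powr_minus divide_inverse)
  define W where "W = {y \<in> U. s y < \<delta>}"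
  have "continuous_on U s" using sC[of 0] by (simp add: C_0_iff)
  then have "openin (top_of_set U) (U \<inter> s -` {..<\<delta>})" by (rule continuous_openin_preimage_gen) simp
  moreover have "U \<inter> s -` {..<\<delta>} = W" by (auto simp: W_def)
  ultimately have "openin (Euclidean_space n) W"
    using open_U unfolding Euclidean_space_top_of_set by (simp add: openin_trans)
  moreover have "a \<in> W" using a \<delta> by (simp add: W_def s_def)
  moreover have "r y = 1" if "y \<in> W" for y
  proof -
    have "e2 y = 0" using that by (simp add: W_def e2_def bump_zero)
    then show ?thesis using pos[of y] by (simp add: r_eq)
  qed
  moreover have "C_k_on n k U r" for k
    unfolding r_def by (intro C_k_mult C_k_powr C_k_add eC pos)
  moreover have "0 \<le> r y \<and> r y \<le> 1" for y
    using pos[of y] bump_nonneg by (simp add: r_eq e1_def e2_def)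
  moreover have "y \<in> K" if y: "y \<in> U" and r: "r y \<noteq> 0" for y
  proof -
    have "e1 y \<noteq> 0" using r by (simp add: r_eq)
    then have s: "s y < 2 * \<delta>" using bump_zero[of "2 * \<delta> + (- 1) * s y"] by (force simp: e1_def)
    have "\<bar>y i - a i\<bar> \<le> e/2" if "i < n" for i
    proof -
      have "(y i - a i)\<^sup>2 \<le> s y" unfolding s_def using that by (intro member_le_sum) auto
      then have "\<bar>y i - a i\<bar>\<^sup>2 \<le> (e/2)\<^sup>2" using s by (simp add: \<delta>_def power_divide)
      then show ?thesis by (rule power2_le_imp_le) (use e(1) in simp)
    qed
    then show ?thesis using U_zero[OF y] by (simp add: K_iff)
  qed
  ultimately show ?thesis using cK KU by (intro exI[of _ r] exI[of _ K] exI[of _ W]) (auto simp: W_def)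
qed

end

section \<open>Cut-off functions and partitions on manifolds\<close>

context smooth_manifold begin

text \<open>Polymorphic in the values, because cut-offs and partitions are real-valued while the
  algebra consists of complex-valued functions.\<close>

definition msmooth :: "('a \<Rightarrow> 'b::real_normed_vector) \<Rightarrow> bool" where
  "msmooth f \<longleftrightarrow> (\<forall>x. x \<notin> topspace (mtop M) \<longrightarrow> f x = 0) \<and>
     (\<forall>(U, \<phi>)\<in>matlas M. C_inf_on (mdim M) (\<phi> ` U) (f \<circ> inv_into U \<phi>))"

lemma smooth_functions_iff: "f \<in> smooth_functions M \<longleftrightarrow> msmooth f"
  by (simp add: smooth_functions_def msmooth_def)

lemma chart_open: "(U, \<phi>) \<in> matlas M \<Longrightarrow> openin (mtop M) U"
  and chart_image: "(U, \<phi>) \<in> matlas M \<Longrightarrow> openin (Euclidean_space (mdim M)) (\<phi> ` U)"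
  and chart_homeomorphic: "(U, \<phi>) \<in> matlas M \<Longrightarrow>
    homeomorphic_map (subtopology (mtop M) U) (subtopology (Euclidean_space (mdim M)) (\<phi> ` U)) \<phi>"
  using charts unfolding is_chart_def by blast+

lemma chart_region: "(U, \<phi>) \<in> matlas M \<Longrightarrow> open_region (mdim M) (\<phi> ` U)"
  by unfold_locales (rule chart_image)

lemma chart_subset: "(U, \<phi>) \<in> matlas M \<Longrightarrow> U \<subseteq> topspace (mtop M)"
  by (rule openin_subset[OF chart_open])

lemma chart_inj:
  assumes "(U, \<phi>) \<in> matlas M"
  shows "inj_on \<phi> U"
  using homeomorphic_imp_injective_map[OF chart_homeomorphic[OF assms]] chart_subset[OF assms]
  by (simp add: Int_absorb1)

lemma chart_inv: "(U, \<phi>) \<in> matlas M \<Longrightarrow> p \<in> U \<Longrightarrow> inv_into U \<phi> (\<phi> p) = p"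
  by (rule inv_into_f_f[OF chart_inj])

lemma chart_open_image:
  assumes c: "(U, \<phi>) \<in> matlas M" and S: "openin (mtop M) S" "S \<subseteq> U"
  shows "openin (Euclidean_space (mdim M)) (\<phi> ` S)"
proof -
  have "openin (subtopology (mtop M) U) S"
    using S by (auto simp: openin_subtopology intro!: exI[of _ S])
  then have "openin (subtopology (Euclidean_space (mdim M)) (\<phi> ` U)) (\<phi> ` S)"
    using homeomorphic_imp_open_map[OF chart_homeomorphic[OF c]] by (simp add: open_map_def)
  then show ?thesis using chart_image[OF c] openin_trans_full by blast
qed

lemma chart_open_preimage:
  assumes c: "(U, \<phi>) \<in> matlas M" and W: "openin (Euclidean_space (mdim M)) W"
  shows "openin (mtop M) {p \<in> U. \<phi> p \<in> W}"
proof -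
  have "continuous_map (subtopology (mtop M) U) (Euclidean_space (mdim M)) \<phi>"
    using homeomorphic_imp_continuous_map[OF chart_homeomorphic[OF c]]
    by (simp add: continuous_map_in_subtopology)
  from openin_continuous_map_preimage[OF this W] chart_subset[OF c]
  have "openin (subtopology (mtop M) U) {p \<in> U. \<phi> p \<in> W}" by (simp add: Int_absorb1)
  then show ?thesis using chart_open[OF c] openin_trans_full by blast
qed

text \<open>Compactness survives the transfer from the chart to \<open>M\<close>, and in a Hausdorff
  space it implies closedness. A support that is closed in all of \<open>M\<close> is what lets a
  function on a chart be extended by \<open>0\<close>.\<close>

lemma chart_compact_closed:
  assumes c: "(U, \<phi>) \<in> matlas M" and K: "compactin (Euclidean_space (mdim M)) K" "K \<subseteq> \<phi> ` U"
  shows "closedin (mtop M) {p \<in> U. \<phi> p \<in> K}"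
proof -
  obtain g where g: "homeomorphic_maps (subtopology (mtop M) U) (subtopology (Euclidean_space (mdim M)) (\<phi> ` U)) \<phi> g"
    using chart_homeomorphic[OF c] homeomorphic_map_maps by blast
  have "compactin (subtopology (Euclidean_space (mdim M)) (\<phi> ` U)) K"
    using K by (simp add: compactin_subtopology)
  then have "compactin (subtopology (mtop M) U) (g ` K)"
    using g image_compactin unfolding homeomorphic_maps_def by blast
  moreover have "g ` K = {p \<in> U. \<phi> p \<in> K}"
  proof -
    have gU: "g (\<phi> p) = p" if "p \<in> U" for p
      using g that chart_subset[OF c] unfolding homeomorphic_maps_def by auto
    then show ?thesis using K(2) by (force simp: image_iff)
  qed
  ultimately have "compactin (mtop M) {p \<in> U. \<phi> p \<in> K}"
    by (simp add: compactin_subtopology)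
  then show ?thesis by (rule compactin_imp_closedin[OF hausdorff])
qed

lemma msmooth_C_k: "msmooth f \<Longrightarrow> (U, \<phi>) \<in> matlas M \<Longrightarrow> C_k_on (mdim M) k (\<phi> ` U) (\<lambda>y. f (inv_into U \<phi> y))"
  by (auto simp: msmooth_def C_inf_on_def o_def)

lemma msmooth_outside: "msmooth f \<Longrightarrow> x \<notin> topspace (mtop M) \<Longrightarrow> f x = 0"
  by (simp add: msmooth_def)

lemma msmoothI:
  assumes "\<And>x. x \<notin> topspace (mtop M) \<Longrightarrow> f x = 0"
    "\<And>U \<phi> k. (U, \<phi>) \<in> matlas M \<Longrightarrow> C_k_on (mdim M) k (\<phi> ` U) (\<lambda>y. f (inv_into U \<phi> y))"
  shows "msmooth f"
  using assms by (auto simp: msmooth_def C_inf_on_def o_def)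

lemma msmooth_localI:
  fixes f :: "'a \<Rightarrow> 'b::real_normed_vector"
  assumes "\<And>x. x \<notin> topspace (mtop M) \<Longrightarrow> f x = 0"
    "\<And>V \<psi> p k. (V, \<psi>) \<in> matlas M \<Longrightarrow> p \<in> V \<Longrightarrow> \<exists>N h. openin (mtop M) N \<and> p \<in> N \<and> N \<subseteq> V \<and>
      C_k_on (mdim M) k (\<psi> ` N) h \<and> (\<forall>q\<in>N. f q = h (\<psi> q))"
  shows "msmooth f"
proof (rule msmoothI)
  fix V \<psi> k assume c: "(V, \<psi>) \<in> matlas M"
  interpret open_region "mdim M" "\<psi> ` V" by (rule chart_region[OF c])
  show "C_k_on (mdim M) k (\<psi> ` V) (\<lambda>y. f (inv_into V \<psi> y))"
  proof (rule C_k_local)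
    fix y assume "y \<in> \<psi> ` V"
    then obtain p where p: "p \<in> V" "y = \<psi> p" by blast
    obtain N h where N: "openin (mtop M) N" "p \<in> N" "N \<subseteq> V" "C_k_on (mdim M) k (\<psi> ` N) h" "\<forall>q\<in>N. f q = h (\<psi> q)"
      using assms(2)[OF c p(1), of k] by blast
    show "\<exists>W g. y \<in> W \<and> W \<subseteq> \<psi> ` V \<and> openin (Euclidean_space (mdim M)) W \<and> C_k_on (mdim M) k W g \<and>
        (\<forall>z\<in>W. f (inv_into V \<psi> z) = g z)"
      by (rule exI[of _ "\<psi> ` N"], rule exI[of _ h])
        (use N p chart_open_image[OF c N(1,3)] chart_inv[OF c] in auto)
  qed
qed (rule assms(1))

definition extend :: "'a set \<Rightarrow> ('a \<Rightarrow> nat \<Rightarrow> real) \<Rightarrow> ((nat \<Rightarrow> real) \<Rightarrow> 'b::zero) \<Rightarrow> 'a \<Rightarrow> 'b" where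
  "extend U \<phi> u p = (if p \<in> U then u (\<phi> p) else 0)"

text \<open>The chart domain and the complement of \<open>K\<close> form an open cover: on the first
  the extension is \<open>u\<close> in changed coordinates, on the second it is
  \<open>0\<close>.\<close>

lemma msmooth_extend:
  fixes u :: "(nat \<Rightarrow> real) \<Rightarrow> 'b::real_normed_vector"
  assumes c: "(U, \<phi>) \<in> matlas M" and u: "\<And>k. C_k_on (mdim M) k (\<phi> ` U) u"
    and K: "closedin (mtop M) K" "K \<subseteq> U" "\<And>p. p \<in> U \<Longrightarrow> u (\<phi> p) \<noteq> 0 \<Longrightarrow> p \<in> K"
  shows "msmooth (extend U \<phi> u)"
proof (rule msmooth_localI)
  fix x assume "x \<notin> topspace (mtop M)"
  then show "extend U \<phi> u x = 0" using chart_subset[OF c] by (auto simp: extend_def)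
next
  fix V \<psi> p k assume d: "(V, \<psi>) \<in> matlas M" and p: "p \<in> V"
  show "\<exists>N h. openin (mtop M) N \<and> p \<in> N \<and> N \<subseteq> V \<and> C_k_on (mdim M) k (\<psi> ` N) h \<and>
      (\<forall>q\<in>N. extend U \<phi> u q = h (\<psi> q))"
  proof (cases "p \<in> U")
    case True
    let ?N = "V \<inter> U"
    have N: "openin (mtop M) ?N" using chart_open c d by blast
    have "C_k_on (mdim M) k (\<psi> ` ?N) (\<lambda>y. u (\<phi> (inv_into V \<psi> y)))"
    proof (rule C_k_chain[OF chart_open_image[OF d N] chart_image[OF c] _ _ u])
      show "\<phi> (inv_into V \<psi> y) \<in> \<phi> ` U" if "y \<in> \<psi> ` ?N" for y
        using that chart_inv[OF d] by auto
      show "C_inf_on (mdim M) (\<psi> ` ?N) (\<lambda>y. \<phi> (inv_into V \<psi> y) j)" if "j < mdim M" for j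
        by (rule transition_smooth[OF d c that])
    qed auto
    then show ?thesis
      by (intro exI[of _ ?N] exI[of _ "\<lambda>y. u (\<phi> (inv_into V \<psi> y))"])
        (use N True p chart_inv[OF d] in \<open>auto simp: extend_def\<close>)
  next
    case False
    let ?N = "V - K"
    have N: "openin (mtop M) ?N" using chart_open[OF d] K(1) by (simp add: openin_diff)
    interpret open_region "mdim M" "\<psi> ` ?N" by unfold_locales (rule chart_open_image[OF d N], auto)
    show ?thesis
      by (intro exI[of _ ?N] exI[of _ "\<lambda>y. 0"])
        (use N False p K C_k_const in \<open>auto simp: extend_def\<close>)
  qed
qed

lemma msmooth_add: "msmooth f \<Longrightarrow> msmooth g \<Longrightarrow> msmooth (\<lambda>p. f p + g p)"
  by (rule msmoothI) (auto simp: msmooth_outside intro: open_region.C_k_add[OF chart_region] msmooth_C_k)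

lemma msmooth_mult:
  fixes f g :: "'a \<Rightarrow> 'b::real_normed_algebra"
  shows "msmooth f \<Longrightarrow> msmooth g \<Longrightarrow> msmooth (\<lambda>p. f p * g p)"
  by (rule msmoothI) (auto simp: msmooth_outside intro: open_region.C_k_mult[OF chart_region] msmooth_C_k)

lemma msmooth_linear:
  assumes L: "bounded_linear L"
  shows "msmooth f \<Longrightarrow> msmooth (\<lambda>p. L (f p))"
  by (rule msmoothI)
    (auto simp: msmooth_outside linear_0[OF bounded_linear.linear[OF L]] intro: open_region.C_k_linear[OF chart_region L] msmooth_C_k)

lemma msmooth_zero: "msmooth (\<lambda>p. 0)"
  by (rule msmoothI) (auto intro: open_region.C_k_const[OF chart_region])

lemma msmooth_sum: "(\<And>i. i \<in> I \<Longrightarrow> msmooth (f i)) \<Longrightarrow> msmooth (\<lambda>p. \<Sum>i\<in>I. f i p)"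
  by (induction I rule: infinite_finite_induct) (auto intro: msmooth_zero msmooth_add)

text \<open>The unit of the function algebra as a real function; it is cut off because smooth
  functions are represented with value \<open>0\<close> outside the carrier.\<close>

definition one_M :: "'a \<Rightarrow> real" where
  "one_M p = (if p \<in> topspace (mtop M) then 1 else 0)"

lemma C_k_restrict_chart:
  assumes c: "(U, \<phi>) \<in> matlas M" and f: "C_k_on (mdim M) k (\<phi> ` U) (\<lambda>y. f (inv_into U \<phi> y))"
  shows "C_k_on (mdim M) k (\<phi> ` U) (\<lambda>y. if inv_into U \<phi> y \<in> topspace (mtop M) then f (inv_into U \<phi> y) else 0)"
  by (rule open_region.C_k_cong_imp[OF chart_region[OF c] _ f])
    (use chart_inv[OF c] chart_subset[OF c] in auto)

lemma msmooth_one: "msmooth one_M"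
  unfolding one_M_def
  by (rule msmoothI) (auto intro: C_k_restrict_chart open_region.C_k_const[OF chart_region])

lemma msmooth_powr:
  fixes f :: "'a \<Rightarrow> real"
  assumes f: "msmooth f" and pos: "\<And>p. p \<in> topspace (mtop M) \<Longrightarrow> f p > 0"
  shows "msmooth (\<lambda>p. f p powr a)"
proof (rule msmoothI)
  fix U \<phi> k assume c: "(U, \<phi>) \<in> matlas M"
  show "C_k_on (mdim M) k (\<phi> ` U) (\<lambda>y. f (inv_into U \<phi> y) powr a)"
    by (rule open_region.C_k_powr[OF chart_region[OF c] msmooth_C_k[OF f c]])
      (use pos chart_inv[OF c] chart_subset[OF c] in auto)
qed (simp add: msmooth_outside[OF f])

lemma msmooth_bump:
  fixes f :: "'a \<Rightarrow> real"
  assumes f: "msmooth f"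
  shows "msmooth (\<lambda>p. if p \<in> topspace (mtop M) then bump (1 + c * f p) else 0)"
proof (rule msmoothI)
  fix U \<phi> k assume c: "(U, \<phi>) \<in> matlas M"
  interpret open_region "mdim M" "\<phi> ` U" by (rule chart_region[OF c])
  have "C_k_on (mdim M) k (\<phi> ` U) (\<lambda>y. bump (1 + c * f (inv_into U \<phi> y)))"
    unfolding bump_def by (intro C_k_flat C_k_add C_k_mult C_k_const msmooth_C_k[OF f c])
  then show "C_k_on (mdim M) k (\<phi> ` U) (\<lambda>y. if inv_into U \<phi> y \<in> topspace (mtop M)
      then bump (1 + c * f (inv_into U \<phi> y)) else 0)"
    by (rule C_k_restrict_chart[OF c])
qed simp

section \<open>Locally finite sums and quadratic partitions of unity\<close>

definition locally_finite :: "(nat \<Rightarrow> 'a \<Rightarrow> real) \<Rightarrow> bool" where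
  "locally_finite h \<longleftrightarrow> (\<forall>p\<in>topspace (mtop M). \<exists>N m. openin (mtop M) N \<and> p \<in> N \<and> (\<forall>i\<ge>m. \<forall>q\<in>N. h i q = 0))"

definition lfsum :: "(nat \<Rightarrow> 'a \<Rightarrow> real) \<Rightarrow> 'a \<Rightarrow> real" where
  "lfsum h p = (\<Sum>i | h i p \<noteq> 0. h i p)"

lemma lfsum_eq: "(\<And>i. i \<ge> m \<Longrightarrow> h i p = 0) \<Longrightarrow> lfsum h p = (\<Sum>i<m. h i p)"
  unfolding lfsum_def by (rule sum.mono_neutral_left) (auto simp: not_less[symmetric])

lemma msmooth_lfsum:
  assumes h: "\<And>i. msmooth (h i)" and lf: "locally_finite h"
  shows "msmooth (lfsum h)"
proof (rule msmooth_localI)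
  show "lfsum h x = 0" if "x \<notin> topspace (mtop M)" for x
    using msmooth_outside[OF h that] by (simp add: lfsum_def)
  fix V \<psi> p k assume c: "(V, \<psi>) \<in> matlas M" and p: "p \<in> V"
  obtain N m where N: "openin (mtop M) N" "p \<in> N" "\<And>i q. i \<ge> m \<Longrightarrow> q \<in> N \<Longrightarrow> h i q = 0"
  proof -
    have "p \<in> topspace (mtop M)" using p chart_subset[OF c] by blast
    from bspec[OF lf[unfolded locally_finite_def] this] that show ?thesis by blast
  qed
  have o: "openin (mtop M) (N \<inter> V)" using N(1) chart_open[OF c] by blast
  interpret open_region "mdim M" "\<psi> ` V" by (rule chart_region[OF c])
  have "C_k_on (mdim M) k (\<psi> ` (N \<inter> V)) (\<lambda>y. \<Sum>i<m. h i (inv_into V \<psi> y))"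
    by (rule C_k_subset[OF chart_open_image[OF c o]]) (auto intro: C_k_sum msmooth_C_k[OF h c])
  then show "\<exists>N h'. openin (mtop M) N \<and> p \<in> N \<and> N \<subseteq> V \<and> C_k_on (mdim M) k (\<psi> ` N) h' \<and>
      (\<forall>q\<in>N. lfsum h q = h' (\<psi> q))"
    by (intro exI[of _ "N \<inter> V"] exI[of _ "\<lambda>y. \<Sum>i<m. h i (inv_into V \<psi> y)"])
      (use o N p chart_inv[OF c] in \<open>auto intro: lfsum_eq\<close>)
qed

lemma locally_finite_mono:
  assumes h: "locally_finite h" and z: "\<And>i p. h i p = 0 \<Longrightarrow> h' i p = 0"
  shows "locally_finite h'"
  unfolding locally_finite_def
proof
  fix p assume "p \<in> topspace (mtop M)"
  from bspec[OF h[unfolded locally_finite_def] this]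
  obtain N m where N: "openin (mtop M) N" "p \<in> N" "\<forall>i\<ge>m. \<forall>q\<in>N. h i q = 0" by blast
  then show "\<exists>N m. openin (mtop M) N \<and> p \<in> N \<and> (\<forall>i\<ge>m. \<forall>q\<in>N. h' i q = 0)"
    by (intro exI[of _ N] exI[of _ m]) (simp add: z)
qed

lemma lfsum_pointwise:
  assumes "locally_finite h" "p \<in> topspace (mtop M)"
  obtains m where "\<And>i. i \<ge> m \<Longrightarrow> h i p = 0"
proof -
  from bspec[OF assms(1)[unfolded locally_finite_def] assms(2)]
  obtain N m where "p \<in> N" "\<forall>i\<ge>m. \<forall>q\<in>N. h i q = 0" by blast
  then show ?thesis using that by blast
qed

definition chart_supported :: "('a \<Rightarrow> real) \<Rightarrow> bool" where
  "chart_supported f \<longleftrightarrow> (\<exists>U \<phi> K. (U, \<phi>) \<in> matlas M \<and> closedin (mtop M) K \<and> K \<subseteq> U \<and> U \<noteq> {} \<and>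
     (\<forall>p. f p \<noteq> 0 \<longrightarrow> p \<in> K))"

lemma chart_cutoff:
  assumes c: "(U, \<phi>) \<in> matlas M" and p: "p \<in> U"
  obtains r K W where "\<And>k. C_k_on (mdim M) k (\<phi> ` U) r" "\<And>y. 0 \<le> r y \<and> r y \<le> (1 :: real)"
    "closedin (mtop M) K" "K \<subseteq> U" "\<And>q. q \<in> U \<Longrightarrow> r (\<phi> q) \<noteq> 0 \<Longrightarrow> q \<in> K"
    "openin (Euclidean_space (mdim M)) W" "\<phi> p \<in> W" "W \<subseteq> \<phi> ` U" "\<And>y. y \<in> W \<Longrightarrow> r y = 1"
proof -
  interpret open_region "mdim M" "\<phi> ` U" by (rule chart_region[OF c])
  obtain r K W where r: "\<forall>k. C_k_on (mdim M) k (\<phi> ` U) r" "\<forall>y. 0 \<le> r y \<and> r y \<le> (1 :: real)"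
    "compactin (Euclidean_space (mdim M)) K" "K \<subseteq> \<phi> ` U" "\<forall>y\<in>\<phi> ` U. r y \<noteq> 0 \<longrightarrow> y \<in> K"
    "openin (Euclidean_space (mdim M)) W" "\<phi> p \<in> W" "W \<subseteq> \<phi> ` U" "\<forall>y\<in>W. r y = 1"
    using cutoff_exists[of "\<phi> p"] p by blast
  show ?thesis
    by (rule that[of r "{q \<in> U. \<phi> q \<in> K}" W])
      (use r chart_compact_closed[OF c r(3,4)] in auto)
qed

text \<open>A second countable space is Lindelof, so countably many of the open sets on which a
  cut-off is positive cover \<open>M\<close>. Nonemptiness of \<open>M\<close> lets the family be
  indexed by all natural numbers.\<close>

lemma bump_family:
  assumes "topspace (mtop M) \<noteq> {}"
  shows "\<exists>b. (\<forall>i :: nat. msmooth (b i) \<and> (\<forall>p. b i p \<ge> 0) \<and> chart_supported (b i)) \<and>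
    (\<forall>p\<in>topspace (mtop M). \<exists>i. b i p > (0 :: real))"
proof -
  have "\<exists>b. msmooth b \<and> (\<forall>q. b q \<ge> (0 :: real)) \<and> chart_supported b \<and>
      (\<exists>N. openin (mtop M) N \<and> p \<in> N \<and> (\<forall>q\<in>N. b q > 0))" if p: "p \<in> topspace (mtop M)" for p
  proof -
    obtain U \<phi> where c: "(U, \<phi>) \<in> matlas M" "p \<in> U" using p charts_cover by blast
    obtain r K W where r: "\<And>k. C_k_on (mdim M) k (\<phi> ` U) r" "\<And>y. 0 \<le> r y \<and> r y \<le> (1 :: real)"
      "closedin (mtop M) K" "K \<subseteq> U" "\<And>q. q \<in> U \<Longrightarrow> r (\<phi> q) \<noteq> 0 \<Longrightarrow> q \<in> K"
      "openin (Euclidean_space (mdim M)) W" "\<phi> p \<in> W" "W \<subseteq> \<phi> ` U" "\<And>y. y \<in> W \<Longrightarrow> r y = 1"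
      using chart_cutoff[OF c] by blast
    have "msmooth (extend U \<phi> r)" by (rule msmooth_extend[OF c(1) r(1,3,4,5)])
    moreover have "chart_supported (extend U \<phi> r)"
      unfolding chart_supported_def
      by (rule exI[of _ U], rule exI[of _ \<phi>], rule exI[of _ K]) (use c r in \<open>auto simp: extend_def\<close>)
    moreover have "\<exists>N. openin (mtop M) N \<and> p \<in> N \<and> (\<forall>q\<in>N. extend U \<phi> r q > 0)"
      by (rule exI[of _ "{q \<in> U. \<phi> q \<in> W}"])
        (use c r chart_open_preimage[OF c(1) r(6)] in \<open>auto simp: extend_def\<close>)
    ultimately show ?thesis using r(2) by (intro exI[of _ "extend U \<phi> r"]) (auto simp: extend_def)
  qed
  then obtain b N where b: "\<And>p. p \<in> topspace (mtop M) \<Longrightarrow> msmooth (b p) \<and> (\<forall>q. b p q \<ge> (0 :: real)) \<and>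
      chart_supported (b p) \<and> openin (mtop M) (N p) \<and> p \<in> N p \<and> (\<forall>q\<in>N p. b p q > 0)" by metis
  have "Lindelof_space (mtop M)" by (rule second_countable_imp_Lindelof_space[OF second_countable])
  then obtain \<V> where V: "countable \<V>" "\<V> \<subseteq> N ` topspace (mtop M)" "\<Union>\<V> = topspace (mtop M)"
  proof -
    have "\<Union>(N ` topspace (mtop M)) = topspace (mtop M)"
      using b openin_subset by fast
    moreover have "\<forall>S\<in>N ` topspace (mtop M). openin (mtop M) S" using b by blast
    ultimately show ?thesis using that \<open>Lindelof_space (mtop M)\<close> unfolding Lindelof_space_def by meson
  qed
  have "\<exists>P. countable P \<and> P \<subseteq> topspace (mtop M) \<and> \<V> = N ` P"
    using iffD1[OF countable_subset_image conjI[OF V(1,2)]] .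
  then obtain P where P: "countable P" "P \<subseteq> topspace (mtop M)" "\<V> = N ` P"
    by (elim exE conjE)
  have "P \<noteq> {}"
  proof
    assume "P = {}"
    then have "topspace (mtop M) = {}" using V(3) P(3) by blast
    then show False using assms by contradiction
  qed
  then have rng: "range (from_nat_into P) = P" by (rule range_from_nat_into[OF _ P(1)])
  show ?thesis
  proof (intro exI[of _ "\<lambda>i. b (from_nat_into P i)"] conjI allI ballI)
    fix i
    have "from_nat_into P i \<in> topspace (mtop M)" using rng P(2) by blast
    then show "msmooth (b (from_nat_into P i))" "b (from_nat_into P i) q \<ge> 0"
      "chart_supported (b (from_nat_into P i))" for q using b by auto
  next
    fix p assume "p \<in> topspace (mtop M)"
    then obtain q where "q \<in> P" "p \<in> N q" using V(3) P(3) by blast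
    then show "\<exists>i. b (from_nat_into P i) p > 0" using rng b P(2) by (metis (no_types, lifting) rangeE subsetD)
  qed
qed

text \<open>Multiplying the \<open>i\<close>-th function by cut-offs that vanish where an earlier one is at least \<open>1 / i\<close>
  makes the family locally finite.\<close>

lemma partition_exists:
  assumes "topspace (mtop M) \<noteq> {}"
  shows "\<exists>\<kappa>. (\<forall>i. msmooth (\<kappa> i) \<and> chart_supported (\<kappa> i)) \<and> locally_finite \<kappa> \<and>
    (\<forall>p\<in>topspace (mtop M). lfsum (\<lambda>i p. (\<kappa> i p)\<^sup>2) p = 1)"
proof -
  obtain b :: "nat \<Rightarrow> 'a \<Rightarrow> real"
    where b: "\<And>i. msmooth (b i)" "\<And>i p. b i p \<ge> 0" "\<And>i. chart_supported (b i)"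
    and pos: "\<And>p. p \<in> topspace (mtop M) \<Longrightarrow> \<exists>i. b i p > 0"
    using bump_family[OF assms] by (elim exE conjE) (auto simp: Ball_def)
  \<comment> \<open>On the carrier \<open>\<theta> i j p\<close> is positive exactly where
    \<open>real i * b j p < 1\<close>.\<close>
  define \<theta> where "\<theta> = (\<lambda>i j p. if p \<in> topspace (mtop M) then bump (1 + (- real i) * b j p) else 0)"
  define \<xi> where "\<xi> = (\<lambda>i p. b i p * (\<Prod>j<i. \<theta> i j p))"
  have prod_smooth: "msmooth (\<lambda>p. g p * (\<Prod>j<m. \<theta> i j p))" if "msmooth g" for g :: "'a \<Rightarrow> real" and i m
  proof (induction m)
    case (Suc m)
    have "msmooth (\<lambda>p. (g p * (\<Prod>j<m. \<theta> i j p)) * \<theta> i m p)"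
      by (rule msmooth_mult[OF Suc]) (unfold \<theta>_def, rule msmooth_bump[OF b(1)])
    then show ?case by (simp add: mult.assoc)
  qed (use that in simp)
  have \<xi>_smooth: "msmooth (\<xi> i)" for i unfolding \<xi>_def by (rule prod_smooth[OF b(1)])
  have \<xi>_supp: "\<xi> i p \<noteq> 0 \<Longrightarrow> b i p \<noteq> 0" for i p by (simp add: \<xi>_def)
  have lf: "locally_finite \<xi>"
    unfolding locally_finite_def
  proof
    fix p assume p: "p \<in> topspace (mtop M)"
    obtain j where j: "b j p > 0" using pos[OF p] by blast
    obtain U \<phi> where c: "(U, \<phi>) \<in> matlas M" "p \<in> U" using p charts_cover by blast
    interpret open_region "mdim M" "\<phi> ` U" by (rule chart_region[OF c(1)])
    let ?f = "\<lambda>y. b j (inv_into U \<phi> y)"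
    have "continuous_on (\<phi> ` U) ?f" using msmooth_C_k[OF b(1) c(1), of 0 j] by (simp add: C_0_iff)
    then have "openin (top_of_set (\<phi> ` U)) (\<phi> ` U \<inter> ?f -` {b j p / 2<..})"
      by (rule continuous_openin_preimage_gen) simp
    then have W: "openin (Euclidean_space (mdim M)) (\<phi> ` U \<inter> ?f -` {b j p / 2<..})"
      using open_U unfolding Euclidean_space_top_of_set by (rule openin_trans)
    let ?N = "{q \<in> U. \<phi> q \<in> \<phi> ` U \<inter> ?f -` {b j p / 2<..}}"
    \<comment> \<open>Near \<open>p\<close> the function \<open>b j\<close> stays above
      \<open>b j p / 2\<close>. Once \<open>i\<close> is larger than both \<open>j\<close> and
      \<open>2 / b j p\<close>, the factor \<open>\<theta> i j\<close> of \<open>\<xi> i\<close> is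
      zero there.\<close>
    obtain m where m: "real m > 2 / b j p" using reals_Archimedean2 by blast
    have "\<xi> i q = 0" if i: "i \<ge> max m (Suc j)" and q: "q \<in> ?N" for i q
    proof -
      have "q \<in> U" using q by simp
      then have bq: "b j q > b j p / 2" using q chart_inv[OF c(1) \<open>q \<in> U\<close>] by simp
      have "real i * b j q \<ge> real m * b j q" using i b(2)[of j q] by (intro mult_right_mono) auto
      also have "real m * b j q \<ge> (2 / b j p) * (b j p / 2)"
        using m bq j by (intro mult_mono) auto
      finally have "1 + (- real i) * b j q \<le> 0" using j by simp
      then have "\<theta> i j q = 0" by (simp add: \<theta>_def bump_zero)
      then have "(\<Prod>j<i. \<theta> i j q) = 0" using i by (intro prod_zero) auto
      then show ?thesis by (simp add: \<xi>_def)
    qed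
    moreover have "p \<in> ?N" using c j by (simp add: chart_inv[OF c(1)])
    ultimately show "\<exists>N m. openin (mtop M) N \<and> p \<in> N \<and> (\<forall>i\<ge>m. \<forall>q\<in>N. \<xi> i q = 0)"
      using chart_open_preimage[OF c(1) W] by (intro exI[of _ ?N] exI[of _ "max m (Suc j)"]) blast
  qed
  let ?s = "lfsum (\<lambda>i p. \<xi> i p * \<xi> i p)"
  have lf2: "locally_finite (\<lambda>i p. \<xi> i p * \<xi> i p)"
    by (rule locally_finite_mono[OF lf]) simp
  have s_smooth: "msmooth ?s" by (rule msmooth_lfsum[OF msmooth_mult[OF \<xi>_smooth \<xi>_smooth] lf2])
  have s_pos: "?s p > 0" if p: "p \<in> topspace (mtop M)" for p
  proof -
    \<comment> \<open>At the first index with \<open>b i p > 0\<close> all earlier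
      \<open>b j\<close> vanish, so every factor of the product is \<open>bump 1\<close> and
      \<open>\<xi> i p\<close> is positive.\<close>
    define i where "i = (LEAST i. b i p > 0)"
    have i: "b i p > 0" unfolding i_def using pos[OF p] by (rule LeastI_ex)
    have "b j p = 0" if "j < i" for j
      using not_less_Least[of j "\<lambda>i. b i p > 0"] that b(2)[of j p] unfolding i_def by auto
    then have "(\<Prod>j<i. \<theta> i j p) > 0" using p by (intro prod_pos) (auto simp: \<theta>_def bump_pos)
    then have \<xi>i: "\<xi> i p > 0" using i by (simp add: \<xi>_def)
    obtain m where m: "\<And>i. i \<ge> m \<Longrightarrow> \<xi> i p = 0"
      using lfsum_pointwise[OF lf p] by blast
    have "?s p = (\<Sum>i<m. \<xi> i p * \<xi> i p)" by (rule lfsum_eq) (simp add: m)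
    also have "\<dots> \<ge> \<xi> i p * \<xi> i p"
      using m[of i] \<xi>i by (intro member_le_sum) (auto simp: not_le[symmetric])
    finally show ?thesis using \<xi>i by (smt (verit) mult_pos_pos)
  qed
  \<comment> \<open>Division by the square root of the total normalizes the sum of squares and does
    not enlarge supports.\<close>
  define \<kappa> where "\<kappa> = (\<lambda>i p. \<xi> i p * ?s p powr (- 1/2))"
  show ?thesis
  proof (intro exI[of _ \<kappa>] conjI allI ballI)
    show "msmooth (\<kappa> i)" for i
      unfolding \<kappa>_def by (rule msmooth_mult[OF \<xi>_smooth msmooth_powr[OF s_smooth s_pos]])
    show "chart_supported (\<kappa> i)" for i
    proof -
      obtain U \<phi> K where "(U, \<phi>) \<in> matlas M" "closedin (mtop M) K" "K \<subseteq> U" "U \<noteq> {}" "\<forall>p. b i p \<noteq> 0 \<longrightarrow> p \<in> K"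
        using b(3)[of i] unfolding chart_supported_def by blast
      then show ?thesis unfolding chart_supported_def
        by (intro exI[of _ U] exI[of _ \<phi>] exI[of _ K]) (auto simp: \<kappa>_def dest: \<xi>_supp)
    qed
    show "locally_finite \<kappa>"
      by (rule locally_finite_mono[OF lf]) (simp add: \<kappa>_def)
    fix p assume p: "p \<in> topspace (mtop M)"
    obtain m where m: "\<And>i. i \<ge> m \<Longrightarrow> \<xi> i p = 0"
      using lfsum_pointwise[OF lf p] by blast
    have "lfsum (\<lambda>i p. (\<kappa> i p)\<^sup>2) p = (\<Sum>i<m. (\<kappa> i p)\<^sup>2)" by (rule lfsum_eq) (simp add: m \<kappa>_def)
    also have "\<dots> = (\<Sum>i<m. \<xi> i p * \<xi> i p) * (?s p powr (- 1/2))\<^sup>2"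
      by (simp add: \<kappa>_def sum_distrib_right power2_eq_square mult_ac)
    also have "(\<Sum>i<m. \<xi> i p * \<xi> i p) = ?s p" by (rule lfsum_eq[symmetric]) (simp add: m)
    also have "(?s p powr (- 1/2))\<^sup>2 = inverse (?s p)"
      using s_pos[OF p] by (simp add: power2_eq_square powr_minus powr_half_sqrt flip: inverse_mult_distrib)
    finally show "lfsum (\<lambda>i p. (\<kappa> i p)\<^sup>2) p = 1" using s_pos[OF p] by simp
  qed
qed

end

section \<open>Matrix algebras and their deformations\<close>

lemma (in assoc_algebra) sum_closed: "(\<And>i. i \<in> I \<Longrightarrow> f i \<in> carr A) \<Longrightarrow> sum f I \<in> carr A"
  by (induction I rule: infinite_finite_induct) (auto intro: zero_closed add_closed)

lemma (in assoc_algebra) scal_zero: "scal A c 0 = 0"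
  using scal_add_right[OF zero_closed zero_closed, of c] by simp

lemma (in assoc_algebra) mul_zero_left: "a \<in> carr A \<Longrightarrow> mul A 0 a = 0"
  using mul_add_left[OF zero_closed zero_closed, of a] by simp

lemma (in assoc_algebra) mul_zero_right: "a \<in> carr A \<Longrightarrow> mul A a 0 = 0"
  using mul_add_right[OF _ zero_closed zero_closed, of a] by simp

lemma (in assoc_algebra) scal_sum: "(\<And>i. i \<in> I \<Longrightarrow> f i \<in> carr A) \<Longrightarrow> scal A c (sum f I) = (\<Sum>i\<in>I. scal A c (f i))"
  by (induction I rule: infinite_finite_induct) (auto simp: scal_zero scal_add_right sum_closed)

lemma (in assoc_algebra) mul_sum_left:
  "(\<And>i. i \<in> I \<Longrightarrow> f i \<in> carr A) \<Longrightarrow> a \<in> carr A \<Longrightarrow> mul A (sum f I) a = (\<Sum>i\<in>I. mul A (f i) a)"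
  by (induction I rule: infinite_finite_induct) (auto simp: mul_zero_left mul_add_left sum_closed)

lemma (in assoc_algebra) mul_sum_right:
  "(\<And>i. i \<in> I \<Longrightarrow> f i \<in> carr A) \<Longrightarrow> a \<in> carr A \<Longrightarrow> mul A a (sum f I) = (\<Sum>i\<in>I. mul A a (f i))"
  by (induction I rule: infinite_finite_induct) (auto simp: mul_zero_right mul_add_right sum_closed)

lemma (in star_algebra) adj_zero: "adj A 0 = 0"
  using adj_add[OF zero_closed zero_closed] by simp

lemma (in star_algebra) adj_sum: "(\<And>i. i \<in> I \<Longrightarrow> f i \<in> carr A) \<Longrightarrow> adj A (sum f I) = (\<Sum>i\<in>I. adj A (f i))"
  by (induction I rule: infinite_finite_induct) (auto simp: adj_zero adj_add sum_closed)

lemma matrix_algebra_simps: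
  "a \<in> carr (matrix_algebra n A) \<longleftrightarrow> (\<forall>i j. if i < n \<and> j < n then a i j \<in> carr A else a i j = 0)"
  "scal (matrix_algebra n A) c a = (\<lambda>i j. if i < n \<and> j < n then scal A c (a i j) else 0)"
  "mul (matrix_algebra n A) a b = (\<lambda>i j. if i < n \<and> j < n then (\<Sum>l<n. mul A (a i l) (b l j)) else 0)"
  "adj (matrix_algebra n A) a = (\<lambda>i j. if i < n \<and> j < n then adj A (a j i) else 0)"
  by (simp_all add: matrix_algebra_def)

lemma matrix_entry: "a \<in> carr (matrix_algebra n A) \<Longrightarrow> i < n \<Longrightarrow> j < n \<Longrightarrow> a i j \<in> carr A"
  and matrix_entry_outside: "a \<in> carr (matrix_algebra n A) \<Longrightarrow> \<not> (i < n \<and> j < n) \<Longrightarrow> a i j = 0"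
  by (auto simp: matrix_algebra_simps(1) split: if_splits dest: spec)

lemma assoc_algebra_matrix:
  assumes "assoc_algebra A"
  shows "assoc_algebra (matrix_algebra n A)"
proof -
  interpret assoc_algebra A by fact
  note simps = matrix_algebra_simps(2-4)
  have carrI: "b \<in> carr (matrix_algebra n A)"
    if "\<And>i j. i < n \<Longrightarrow> j < n \<Longrightarrow> b i j \<in> carr A" "\<And>i j. \<not> (i < n \<and> j < n) \<Longrightarrow> b i j = 0" for b
    using that by (simp add: matrix_algebra_simps(1))
  show ?thesis
  proof
    show "0 \<in> carr (matrix_algebra n A)" by (rule carrI) (auto simp: zero_closed)
    fix a b c k k'
    assume a: "a \<in> carr (matrix_algebra n A)"
    show "scal (matrix_algebra n A) k a \<in> carr (matrix_algebra n A)"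
      by (rule carrI) (auto simp: simps matrix_entry[OF a] scal_closed)
    show "scal (matrix_algebra n A) 1 a = a"
      by (intro ext) (auto simp: simps matrix_entry[OF a] matrix_entry_outside[OF a] scal_one)
    show "scal (matrix_algebra n A) k (scal (matrix_algebra n A) k' a) = scal (matrix_algebra n A) (k * k') a"
      by (intro ext) (auto simp: simps matrix_entry[OF a] scal_scal)
    show "scal (matrix_algebra n A) (k + k') a = scal (matrix_algebra n A) k a + scal (matrix_algebra n A) k' a"
      by (intro ext) (auto simp: simps matrix_entry[OF a] scal_add_left)
    assume b: "b \<in> carr (matrix_algebra n A)"
    note e = matrix_entry[OF a] matrix_entry[OF b]
    show "a + b \<in> carr (matrix_algebra n A)"
      by (rule carrI) (auto simp: e add_closed matrix_entry_outside[OF a] matrix_entry_outside[OF b])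
    show "mul (matrix_algebra n A) a b \<in> carr (matrix_algebra n A)"
      by (rule carrI) (auto simp: simps e intro!: sum_closed mul_closed)
    show "scal (matrix_algebra n A) k (a + b) = scal (matrix_algebra n A) k a + scal (matrix_algebra n A) k b"
      by (intro ext) (auto simp: simps e scal_add_right)
    show "mul (matrix_algebra n A) (scal (matrix_algebra n A) k a) b = scal (matrix_algebra n A) k (mul (matrix_algebra n A) a b)"
      by (intro ext) (auto simp: simps e mul_scal_left mul_closed intro!: scal_sum[symmetric])
    show "mul (matrix_algebra n A) a (scal (matrix_algebra n A) k b) = scal (matrix_algebra n A) k (mul (matrix_algebra n A) a b)"
      by (intro ext) (auto simp: simps e mul_scal_right mul_closed intro!: scal_sum[symmetric])
    assume c: "c \<in> carr (matrix_algebra n A)"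
    note e = e matrix_entry[OF c]
    show "mul (matrix_algebra n A) (a + b) c = mul (matrix_algebra n A) a c + mul (matrix_algebra n A) b c"
      by (intro ext) (auto simp: simps e mul_add_left sum.distrib)
    show "mul (matrix_algebra n A) a (b + c) = mul (matrix_algebra n A) a b + mul (matrix_algebra n A) a c"
      by (intro ext) (auto simp: simps e mul_add_right sum.distrib)
    show "mul (matrix_algebra n A) (mul (matrix_algebra n A) a b) c = mul (matrix_algebra n A) a (mul (matrix_algebra n A) b c)"
    proof (intro ext)
      fix i j
      have "(\<Sum>l<n. mul A (\<Sum>m<n. mul A (a i m) (b m l)) (c l j)) = (\<Sum>l<n. \<Sum>m<n. mul A (a i m) (mul A (b m l) (c l j)))"
        if "i < n" "j < n"
        by (rule sum.cong[OF refl]) (use that in \<open>auto simp: mul_closed e mul_assoc intro!: mul_sum_left[THEN trans] sum.cong\<close>)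
      also have "\<dots> = (\<Sum>m<n. \<Sum>l<n. mul A (a i m) (mul A (b m l) (c l j)))" by (rule sum.swap)
      also have "\<dots> = (\<Sum>m<n. mul A (a i m) (\<Sum>l<n. mul A (b m l) (c l j)))" if "i < n" "j < n"
        by (rule sum.cong[OF refl]) (use that in \<open>auto simp: mul_closed e intro!: mul_sum_right[symmetric]\<close>)
      finally show "mul (matrix_algebra n A) (mul (matrix_algebra n A) a b) c i j = mul (matrix_algebra n A) a (mul (matrix_algebra n A) b c) i j"
        by (simp add: simps)
    qed
  qed
qed

lemma star_algebra_matrix:
  assumes "star_algebra A cj"
  shows "star_algebra (matrix_algebra n A) cj"
proof -
  interpret star_algebra A cj by fact
  interpret m: assoc_algebra "matrix_algebra n A"
    by (rule assoc_algebra_matrix) (rule assoc_algebra_axioms)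
  note simps = matrix_algebra_simps(2-4)
  show ?thesis
  proof
    fix a b k
    assume a: "a \<in> carr (matrix_algebra n A)"
    show "adj (matrix_algebra n A) a \<in> carr (matrix_algebra n A)"
      by (auto simp: matrix_algebra_simps(1,4) matrix_entry[OF a] adj_closed)
    show "adj (matrix_algebra n A) (adj (matrix_algebra n A) a) = a"
      by (intro ext) (auto simp: simps matrix_entry[OF a] matrix_entry_outside[OF a] adj_adj)
    show "adj (matrix_algebra n A) (scal (matrix_algebra n A) k a) = scal (matrix_algebra n A) (cj k) (adj (matrix_algebra n A) a)"
      by (intro ext) (auto simp: simps matrix_entry[OF a] adj_scal)
    assume b: "b \<in> carr (matrix_algebra n A)"
    note e = matrix_entry[OF a] matrix_entry[OF b]
    show "adj (matrix_algebra n A) (a + b) = adj (matrix_algebra n A) a + adj (matrix_algebra n A) b"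
      by (intro ext) (auto simp: simps e adj_add)
    show "adj (matrix_algebra n A) (mul (matrix_algebra n A) a b) = mul (matrix_algebra n A) (adj (matrix_algebra n A) b) (adj (matrix_algebra n A) a)"
      by (intro ext) (auto simp: simps e mul_closed adj_mul intro!: adj_sum[THEN trans] sum.cong)
  qed
qed

text \<open>All axioms are equations or closure conditions, so they pull back along an injective
  homomorphism under which the carriers correspond. It is meant for the passage between series of
  matrices and matrices of series.\<close>

lemma star_algebra_transport:
  fixes D :: "('k::comm_ring_1, 'a::ab_group_add) algebra_data" and E :: "('k, 'b::ab_group_add) algebra_data"
  assumes E: "star_algebra E cj" and inj: "inj \<Phi>" and add: "\<And>F G. \<Phi> (F + G) = \<Phi> F + \<Phi> G"
    and carr: "\<And>F. F \<in> carr D \<longleftrightarrow> \<Phi> F \<in> carr E"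
    and scal: "\<And>c F. F \<in> carr D \<Longrightarrow> \<Phi> (scal D c F) = scal E c (\<Phi> F)"
    and mul: "\<And>F G. F \<in> carr D \<Longrightarrow> G \<in> carr D \<Longrightarrow> \<Phi> (mul D F G) = mul E (\<Phi> F) (\<Phi> G)"
    and adj: "\<And>F. F \<in> carr D \<Longrightarrow> \<Phi> (adj D F) = adj E (\<Phi> F)"
  shows "star_algebra D cj"
proof -
  interpret E: star_algebra E cj by fact
  have zero: "\<Phi> 0 = 0" using add[of 0 0] by simp
  have c0: "0 \<in> carr D" by (simp add: carr zero E.zero_closed)
  have cadd: "F + G \<in> carr D" if "F \<in> carr D" "G \<in> carr D" for F G
    using that by (simp add: carr add E.add_closed)
  have cscal: "scal D c F \<in> carr D" if "F \<in> carr D" for c F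
    using that scal[OF that] by (simp add: carr E.scal_closed)
  have cmul: "mul D F G \<in> carr D" if "F \<in> carr D" "G \<in> carr D" for F G
    using that mul[OF that] by (simp add: carr E.mul_closed)
  have cadj: "adj D F \<in> carr D" if "F \<in> carr D" for F
    using that adj[OF that] by (simp add: carr E.adj_closed)
  note cl = c0 cadd cscal cmul cadj
  have cE: "\<Phi> F \<in> carr E" if "F \<in> carr D" for F using that by (simp add: carr)
  note hom = add scal mul adj cl cE
  show ?thesis
  proof
    fix F assume F: "F \<in> carr D"
    show "scal D 1 F = F" by (rule injD[OF inj]) (simp add: hom F E.scal_one)
    show "scal D k (scal D k' F) = scal D (k * k') F" for k k'
      by (rule injD[OF inj]) (simp add: hom F E.scal_scal)
    show "scal D (k + k') F = scal D k F + scal D k' F" for k k'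
      by (rule injD[OF inj]) (simp add: hom F E.scal_add_left)
    show "adj D (adj D F) = F" by (rule injD[OF inj]) (simp add: hom F E.adj_adj)
    show "adj D (scal D k F) = scal D (cj k) (adj D F)" for k
      by (rule injD[OF inj]) (simp add: hom F E.adj_scal)
    fix G assume G: "G \<in> carr D"
    show "scal D k (F + G) = scal D k F + scal D k G" for k
      by (rule injD[OF inj]) (simp add: hom F G E.scal_add_right)
    show "mul D (scal D k F) G = scal D k (mul D F G)" for k
      by (rule injD[OF inj]) (simp add: hom F G E.mul_scal_left)
    show "mul D F (scal D k G) = scal D k (mul D F G)" for k
      by (rule injD[OF inj]) (simp add: hom F G E.mul_scal_right)
    show "adj D (F + G) = adj D F + adj D G"
      by (rule injD[OF inj]) (simp add: hom F G E.adj_add)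
    show "adj D (mul D F G) = mul D (adj D G) (adj D F)"
      by (rule injD[OF inj]) (simp add: hom F G E.adj_mul)
    fix H assume H: "H \<in> carr D"
    show "mul D (F + G) H = mul D F H + mul D G H"
      by (rule injD[OF inj]) (simp add: hom F G H E.mul_add_left)
    show "mul D F (G + H) = mul D F G + mul D F H"
      by (rule injD[OF inj]) (simp add: hom F G H E.mul_add_right)
    show "mul D (mul D F G) H = mul D F (mul D G H)"
      by (rule injD[OF inj]) (simp add: hom F G H E.mul_assoc)
  qed (simp_all add: cl)
qed

section \<open>Hermitian deformations and their matrix algebras\<close>

lemma deformed_algebra_simps:
  "F \<in> carr (deformed_algebra A star) \<longleftrightarrow> (\<forall>k. fps_nth F k \<in> carr A)"
  "fps_nth (scal (deformed_algebra A star) c F) k = (\<Sum>j\<le>k. scal A (fps_nth c j) (fps_nth F (k - j)))"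
  "mul (deformed_algebra A star) = star"
  "fps_nth (adj (deformed_algebra A star) F) k = adj A (fps_nth F k)"
  by (simp_all add: deformed_algebra_def)

text \<open>The involution acts coefficientwise, so its axioms come from those of \<open>A\<close>;
  only its compatibility with the deformed product is new, and that is
  \<open>hermitian_product\<close>.\<close>

lemma hermitian_deformationI:
  assumes A: "star_algebra A cnj" and d: "formal_deformation A star" and h: "hermitian_product A star"
  shows "hermitian_deformation A star"
proof -
  interpret star_algebra A cnj by fact
  interpret D: assoc_algebra "deformed_algebra A star" using d by (simp add: formal_deformation_def)
  note simps = deformed_algebra_simps
  have "star_algebra (deformed_algebra A star) fps_cnj"
  proof
    fix F G c
    assume F: "F \<in> carr (deformed_algebra A star)"
    note Fk = F[unfolded simps, rule_format]
    show "adj (deformed_algebra A star) F \<in> carr (deformed_algebra A star)"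
      using Fk by (simp add: simps adj_closed)
    show "adj (deformed_algebra A star) (adj (deformed_algebra A star) F) = F"
      by (rule fps_ext) (simp add: simps adj_adj[OF Fk])
    show "adj (deformed_algebra A star) (scal (deformed_algebra A star) c F)
        = scal (deformed_algebra A star) (fps_cnj c) (adj (deformed_algebra A star) F)"
      by (rule fps_ext) (simp add: simps adj_sum scal_closed adj_scal Fk fps_cnj_def)
    assume G: "G \<in> carr (deformed_algebra A star)"
    show "adj (deformed_algebra A star) (F + G) = adj (deformed_algebra A star) F + adj (deformed_algebra A star) G"
      by (rule fps_ext) (use G in \<open>simp add: simps adj_add Fk\<close>)
    show "adj (deformed_algebra A star) (mul (deformed_algebra A star) F G)
        = mul (deformed_algebra A star) (adj (deformed_algebra A star) G) (adj (deformed_algebra A star) F)"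
      using h F G by (simp add: hermitian_product_def Let_def simps(3))
  qed
  then show ?thesis using A d h by (simp add: hermitian_deformation_def)
qed

lemma matrix_of_series_nth [simp]: "fps_nth (matrix_of_series F i j) k = fps_nth F k i j"
  by (simp add: matrix_of_series_def)

lemma fun_sum_apply: "(\<Sum>a\<in>I. h a) x = (\<Sum>a\<in>I. h a x)"
  by (induction I rule: infinite_finite_induct) auto

lemma matrix_star_nth:
  "fps_nth (matrix_star n A star F G) k i j =
    (if i < n \<and> j < n then \<Sum>l<n. fps_nth (star (matrix_of_series F i l) (matrix_of_series G l j)) k else 0)"
  by (simp add: matrix_star_def series_of_matrix_def matrix_algebra_simps deformed_algebra_simps fps_sum_nth)

text \<open>The map \<open>matrix_of_series\<close> pulls the structure back from matrices with
  entries in the deformed algebra, to which \<open>star_algebra_matrix\<close> applies.\<close>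

lemma hermitian_deformation_matrix:
  fixes A :: "(complex, 'a::ab_group_add) algebra_data"
  assumes h: "hermitian_deformation A star"
  shows "hermitian_deformation (matrix_algebra n A) (matrix_star n A star)"
proof -
  let ?MA = "matrix_algebra n A" and ?D = "deformed_algebra A star"
  have A: "star_algebra A cnj" and D: "star_algebra ?D fps_cnj" and fd: "formal_deformation A star"
    using h by (simp_all add: hermitian_deformation_def)
  interpret A: star_algebra A cnj by fact
  interpret MA: star_algebra ?MA cnj by (rule star_algebra_matrix[OF A])
  let ?MD = "deformed_algebra ?MA (matrix_star n A star)"
  have MD: "star_algebra ?MD fps_cnj"
  proof (rule star_algebra_transport[OF star_algebra_matrix[OF D, of n], where \<Phi> = matrix_of_series])
    show "inj (matrix_of_series :: (nat \<Rightarrow> nat \<Rightarrow> 'a) fps \<Rightarrow> _)"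
    proof (rule injI, rule fps_ext, intro ext)
      fix F G :: "(nat \<Rightarrow> nat \<Rightarrow> 'a) fps" and k i j
      assume "matrix_of_series F = matrix_of_series G"
      then have "fps_nth (matrix_of_series F i j) k = fps_nth (matrix_of_series G i j) k" by simp
      then show "fps_nth F k i j = fps_nth G k i j" by simp
    qed
    show "matrix_of_series (F + G) = matrix_of_series F + matrix_of_series G" for F G :: "(nat \<Rightarrow> nat \<Rightarrow> 'a) fps"
      by (intro ext fps_ext) simp
    show carr: "F \<in> carr ?MD \<longleftrightarrow> matrix_of_series F \<in> carr (matrix_algebra n ?D)" for F
      unfolding deformed_algebra_simps(1) matrix_algebra_simps(1)
      by (auto simp: deformed_algebra_simps(1) fps_eq_iff split: if_splits)
    show "matrix_of_series (scal ?MD c F) = scal (matrix_algebra n ?D) c (matrix_of_series F)" for c F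
      by (intro ext fps_ext) (auto simp: deformed_algebra_simps matrix_algebra_simps fun_sum_apply)
    show "matrix_of_series (mul ?MD F G) = mul (matrix_algebra n ?D) (matrix_of_series F) (matrix_of_series G)" for F G
      by (intro ext fps_ext) (simp add: deformed_algebra_simps(3) matrix_algebra_simps matrix_star_nth fps_sum_nth)
    show "matrix_of_series (adj ?MD F) = adj (matrix_algebra n ?D) (matrix_of_series F)" for F
      by (intro ext fps_ext) (simp add: deformed_algebra_simps matrix_algebra_simps)
  qed
  interpret MD: star_algebra ?MD fps_cnj by (rule MD)
  have "formal_deformation ?MA (matrix_star n A star)"
    unfolding formal_deformation_def
  proof (intro conjI ballI)
    show "assoc_algebra ?MA" "assoc_algebra ?MD" by (rule MA.assoc_algebra_axioms, rule MD.assoc_algebra_axioms)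
    fix a b assume a: "a \<in> carr ?MA" and b: "b \<in> carr ?MA"
    have c: "matrix_of_series (fps_const a) i j = fps_const (a i j)" for a :: "nat \<Rightarrow> nat \<Rightarrow> 'a" and i j
      by (rule fps_ext) simp
    show "star_coeff (matrix_star n A star) 0 a b = mul ?MA a b"
      using fd matrix_entry[OF a] matrix_entry[OF b]
      by (intro ext) (simp add: star_coeff_def matrix_star_nth c matrix_algebra_simps formal_deformation_def)
  qed
  moreover have "hermitian_product ?MA (matrix_star n A star)"
    using MD.adj_mul by (simp add: hermitian_product_def Let_def deformed_algebra_simps(3))
  ultimately show ?thesis by (rule hermitian_deformationI[OF MA.star_algebra_axioms])
qed

section \<open>Star products in a chart\<close>

locale manifold_chart = smooth_manifold M for M :: "'a manifold" +
  fixes U and \<phi>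
  assumes chart: "(U, \<phi>) \<in> matlas M" and nonempty_chart: "U \<noteq> {}"
begin

sublocale loc: nonempty_open_region "mdim M" "\<phi> ` U"
  by unfold_locales (use chart_image[OF chart] nonempty_chart in auto)

definition localize :: "('a \<Rightarrow> complex) \<Rightarrow> (nat \<Rightarrow> real) \<Rightarrow> complex" where
  "localize f = (\<lambda>y. f (inv_into U \<phi> (loc.ret y)))"

lemma localize_smooth: "f \<in> smooth_functions M \<Longrightarrow> localize f \<in> loc.smooth"
  unfolding localize_def smooth_functions_iff
  by (rule loc.smooth_compose_ret[of "\<lambda>y. f (inv_into U \<phi> y)"]) (rule msmooth_C_k[OF _ chart])

lemma localize_at: "p \<in> U \<Longrightarrow> localize f (\<phi> p) = f p"
  by (simp add: localize_def chart_inv[OF chart])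

lemma localize_sum: "localize (\<Sum>i\<in>I. f i) = (\<Sum>i\<in>I. localize (f i))"
  by (rule ext) (simp add: localize_def fun_sum_apply)

text \<open>A smooth function on the chart need not extend to \<open>M\<close>, but its product with
  a cut-off does, and near \<open>y\<close> nothing changes. One neighbourhood \<open>W\<close>
  serves all functions, so that identities in several arguments can be transferred.\<close>

lemma germ_extension:
  assumes y: "y \<in> \<phi> ` U"
  obtains W e where "openin (Euclidean_space (mdim M)) W" "y \<in> W" "W \<subseteq> \<phi> ` U"
    "\<And>u. u \<in> loc.smooth \<Longrightarrow> e u \<in> smooth_functions M"
    "\<And>u z. u \<in> loc.smooth \<Longrightarrow> z \<in> W \<Longrightarrow> u z = localize (e u) z"
proof -
  obtain p where p: "p \<in> U" "y = \<phi> p" using y by blast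
  obtain r K W where r: "\<And>k. C_k_on (mdim M) k (\<phi> ` U) r" "\<And>y. 0 \<le> r y \<and> r y \<le> (1 :: real)"
    "closedin (mtop M) K" "K \<subseteq> U" "\<And>q. q \<in> U \<Longrightarrow> r (\<phi> q) \<noteq> 0 \<Longrightarrow> q \<in> K"
    "openin (Euclidean_space (mdim M)) W" "\<phi> p \<in> W" "W \<subseteq> \<phi> ` U" "\<And>y. y \<in> W \<Longrightarrow> r y = 1"
    using chart_cutoff[OF chart p(1)] by blast
  define e where "e = (\<lambda>u. extend U \<phi> (\<lambda>y. complex_of_real (r y) * u y))"
  show ?thesis
  proof (rule that[of W e])
    show "e u \<in> smooth_functions M" if u: "u \<in> loc.smooth" for u
      unfolding smooth_functions_iff e_def
    proof (rule msmooth_extend[OF chart _ r(3,4)])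
      show "C_k_on (mdim M) k (\<phi> ` U) (\<lambda>y. complex_of_real (r y) * u y)" for k
        by (rule loc.C_k_mult[OF loc.C_k_linear[OF bounded_linear_of_real r(1)] loc.smooth_C_k[OF u]])
      show "q \<in> K" if "q \<in> U" "complex_of_real (r (\<phi> q)) * u (\<phi> q) \<noteq> 0" for q
        by (rule r(5)) (use that in auto)
    qed
    show "u z = localize (e u) z" if z: "z \<in> W" for u z
    proof -
      obtain q where q: "q \<in> U" "z = \<phi> q" using z r(8) by blast
      then show ?thesis using r(9)[OF z] by (simp add: localize_at e_def extend_def)
    qed
  qed (use r p in auto)
qed

end

section \<open>Coefficients of a Hermitian star product\<close>

locale hermitian_star = smooth_manifold M for M :: "'a manifold" +
  fixes star :: "('a \<Rightarrow> complex) fps \<Rightarrow> ('a \<Rightarrow> complex) fps \<Rightarrow> ('a \<Rightarrow> complex) fps"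
  assumes deformation: "formal_deformation (function_algebra M) star"
    and bidifferential: "\<And>r. r \<ge> 1 \<Longrightarrow> bidifferential_operator M (star_coeff star r)"
    and hermitian: "hermitian_product (function_algebra M) star"
begin

abbreviation C where "C \<equiv> star_coeff star"

sublocale D: assoc_algebra "deformed_algebra (function_algebra M) star"
  using deformation by (simp add: formal_deformation_def)

sublocale fn: additive_set "smooth_functions M"
  by unfold_locales (auto simp: smooth_functions_iff zero_fun_def plus_fun_def msmooth_zero msmooth_add)

lemma function_algebra_simps:
  "carr (function_algebra M) = smooth_functions M"
  "scal (function_algebra M) c f = (\<lambda>x. c * f x)"
  "mul (function_algebra M) f g = f * g"
  "adj (function_algebra M) f = (\<lambda>x. cnj (f x))"
  by (simp_all add: function_algebra_def times_fun_def)

lemma deformed_carr: "carr (deformed_algebra (function_algebra M) star) = series (smooth_functions M)"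
  by (auto simp: series_def deformed_algebra_simps function_algebra_simps)

lemma scal_X: "scal (deformed_algebra (function_algebra M) star) fps_X F = fps_X * F"
proof (rule fps_ext, rule ext)
  fix k p
  have "(\<Sum>j\<le>k. fps_nth fps_X j * fps_nth F (k - j) p) = (\<Sum>j\<le>k. if j = 1 then fps_nth F (k - 1) p else 0)"
    by (rule sum.cong) auto
  then show "fps_nth (scal (deformed_algebra (function_algebra M) star) fps_X F) k p = fps_nth (fps_X * F) k p"
    by (cases k) (simp_all add: deformed_algebra_simps function_algebra_simps fun_sum_apply)
qed

lemma star_linear2: "F \<in> series (smooth_functions M) \<Longrightarrow> series_linear (smooth_functions M) (star F)"
  and star_linear1: "F \<in> series (smooth_functions M) \<Longrightarrow> series_linear (smooth_functions M) (\<lambda>G. star G F)"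
  using D.mul_closed D.mul_add_left D.mul_add_right D.mul_scal_left[where k = fps_X] D.mul_scal_right[where k = fps_X]
  by (simp_all add: series_linear_def deformed_carr deformed_algebra_simps(3) scal_X)

lemma C_closed: "f \<in> smooth_functions M \<Longrightarrow> g \<in> smooth_functions M \<Longrightarrow> C r f g \<in> smooth_functions M"
  unfolding star_coeff_def
  by (rule series_nth) (use star_linear2 fn.series_const in \<open>auto simp: series_linear_def\<close>)

lemma biadditive_C: "fn.biadditive C"
proof -
  have "star F (fps_const (f + g)) = star F (fps_const f) + star F (fps_const g)"
    "star (fps_const (f + g)) F = star (fps_const f) F + star (fps_const g) F"
    if "f \<in> smooth_functions M" "g \<in> smooth_functions M" "F \<in> series (smooth_functions M)" for f g F
    using star_linear1[OF that(3)] star_linear2[OF that(3)] that(1,2) fn.series_const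
    unfolding series_linear_def by (simp_all flip: fps_const_add)
  then show ?thesis
    unfolding fn.biadditive_def using C_closed by (simp add: star_coeff_def)
qed

text \<open>Compatibility with the formal variable in both arguments determines the product by its
  values on constant series, and these are given by the coefficients \<open>C\<close>.\<close>

lemma star_eq:
  assumes "F \<in> series (smooth_functions M)" "G \<in> series (smooth_functions M)"
  shows "star F G = star_of C F G"
proof (rule fn.bilinear_eqI[OF star_linear2 star_linear1 fn.series_linear_star2[OF biadditive_C]
      fn.series_linear_star1[OF biadditive_C] _ assms])
  show "star (fps_const f) (fps_const g) = star_of C (fps_const f) (fps_const g)"
    if "f \<in> smooth_functions M" "g \<in> smooth_functions M" for f g
    by (rule fps_ext) (simp add: fn.star_of_const[OF biadditive_C that] star_coeff_def)
qed

lemma C_0: "f \<in> smooth_functions M \<Longrightarrow> g \<in> smooth_functions M \<Longrightarrow> C 0 f g = f * g"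
  using deformation by (simp add: formal_deformation_def function_algebra_simps)

lemma C_assoc:
  assumes "f \<in> smooth_functions M" "g \<in> smooth_functions M" "h \<in> smooth_functions M"
  shows "(\<Sum>i\<le>r. C i (C (r - i) f g) h) = (\<Sum>i\<le>r. C i f (C (r - i) g h))"
proof -
  have "\<forall>F\<in>series (smooth_functions M). \<forall>G\<in>series (smooth_functions M). \<forall>H\<in>series (smooth_functions M).
      star_of C (star_of C F G) H = star_of C F (star_of C G H)"
  proof (intro ballI)
    fix F G H assume F: "F \<in> series (smooth_functions M)" "G \<in> series (smooth_functions M)"
      and H: "H \<in> series (smooth_functions M)"
    have "star (star F G) H = star F (star G H)"
      using D.mul_assoc[of F G H] F H by (simp add: deformed_carr deformed_algebra_simps(3))
    then show "star_of C (star_of C F G) H = star_of C F (star_of C G H)"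
      using F H fn.star_of_series[OF biadditive_C] by (simp add: star_eq)
  qed
  then show ?thesis using fn.star_of_assoc_iff[OF biadditive_C] assms by simp
qed

lemma C_cnj:
  assumes f: "f \<in> smooth_functions M" and g: "g \<in> smooth_functions M"
  shows "(\<lambda>p. cnj (C r f g p)) = C r (\<lambda>p. cnj (g p)) (\<lambda>p. cnj (f p))"
proof -
  let ?D = "deformed_algebra (function_algebra M) star"
  have a: "adj ?D (fps_const f) = fps_const (\<lambda>p. cnj (f p))" for f
    by (rule fps_ext) (auto simp: deformed_algebra_simps function_algebra_simps fun_eq_iff)
  have "adj ?D (star (fps_const f) (fps_const g)) = star (adj ?D (fps_const g)) (adj ?D (fps_const f))"
    using hermitian f g by (simp add: hermitian_product_def Let_def deformed_carr)
  then have "fps_nth (adj ?D (star (fps_const f) (fps_const g))) r = C r (\<lambda>p. cnj (g p)) (\<lambda>p. cnj (f p))"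
    by (simp add: a star_coeff_def)
  then show ?thesis by (simp add: deformed_algebra_simps function_algebra_simps star_coeff_def)
qed

lemma smooth_cnj: "f \<in> smooth_functions M \<Longrightarrow> (\<lambda>p. cnj (f p)) \<in> smooth_functions M"
  unfolding smooth_functions_iff by (rule msmooth_linear[OF bounded_linear_cnj])

lemma star_function_algebra: "star_algebra (function_algebra M) cnj"
proof -
  interpret fa: assoc_algebra "function_algebra M" using deformation by (simp add: formal_deformation_def)
  show ?thesis by unfold_locales (auto simp: function_algebra_simps smooth_cnj fun_eq_iff)
qed

end

section \<open>The star product in one chart\<close>

locale star_chart = hermitian_star M star + manifold_chart M U \<phi> for M :: "'a manifold" and star U \<phi>
begin

lemma chart_coefficients:
  assumes r: "r \<ge> 1"
  shows "\<exists>N c. (\<forall>\<alpha>\<in>multi_indices (mdim M) N. \<forall>\<beta>\<in>multi_indices (mdim M) N.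
            C_inf_on (mdim M) (\<phi> ` U) (c \<alpha> \<beta> :: (nat \<Rightarrow> real) \<Rightarrow> complex)) \<and>
        (\<forall>f\<in>smooth_functions M. \<forall>g\<in>smooth_functions M. \<forall>x\<in>U.
            C r f g x =
              (\<Sum>\<alpha>\<in>multi_indices (mdim M) N. \<Sum>\<beta>\<in>multi_indices (mdim M) N.
                 c \<alpha> \<beta> (\<phi> x) * multi_deriv (mdim M) \<alpha> (f \<circ> inv_into U \<phi>) (\<phi> x)
                             * multi_deriv (mdim M) \<beta> (g \<circ> inv_into U \<phi>) (\<phi> x)))"
  using bidifferential[OF r] unfolding bidifferential_operator_def Ball_def split_paired_All prod.case
  by - (elim conjE, elim exE, drule spec[of _ U], drule spec[of _ \<phi>], drule mp[OF _ chart], elim exE,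
    intro exI, assumption)

lemma multi_deriv_localize:
  assumes "f \<in> smooth_functions M" "y \<in> \<phi> ` U"
  shows "multi_deriv (mdim M) \<alpha> (f \<circ> inv_into U \<phi>) y = multi_deriv (mdim M) \<alpha> (localize f) y"
proof -
  have "multi_deriv (mdim M) \<alpha> (f \<circ> inv_into U \<phi>) y = loc.multi_deriv_on \<alpha> (localize f) y"
    by (rule loc.multi_deriv_on[OF localize_smooth[OF assms(1)] _ assms(2)]) (simp add: localize_def)
  also have "\<dots> = multi_deriv (mdim M) \<alpha> (localize f) y"
    by (rule loc.multi_deriv_on[OF localize_smooth[OF assms(1)] refl assms(2), symmetric])
  finally show ?thesis .
qed

text \<open>The coefficient functions of the chart define operators on all smooth functions of the
  chart, not only on restrictions from \<open>M\<close>. Their identities are checked point by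
  point, after replacing the arguments by global functions with the same germ.\<close>

lemma local_star_exists:
  "\<exists>L. loc.alg.star_coeffs L \<and> (\<forall>r. \<forall>f\<in>smooth_functions M. \<forall>g\<in>smooth_functions M.
     localize (C r f g) = L r (localize f) (localize g))"
proof -
  define Q where "Q = (\<lambda>r N c. (\<forall>\<alpha>\<in>multi_indices (mdim M) N. \<forall>\<beta>\<in>multi_indices (mdim M) N.
            C_inf_on (mdim M) (\<phi> ` U) (c \<alpha> \<beta> :: (nat \<Rightarrow> real) \<Rightarrow> complex)) \<and>
        (\<forall>f\<in>smooth_functions M. \<forall>g\<in>smooth_functions M. \<forall>x\<in>U.
            C r f g x =
              (\<Sum>\<alpha>\<in>multi_indices (mdim M) N. \<Sum>\<beta>\<in>multi_indices (mdim M) N.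
                 c \<alpha> \<beta> (\<phi> x) * multi_deriv (mdim M) \<alpha> (f \<circ> inv_into U \<phi>) (\<phi> x)
                             * multi_deriv (mdim M) \<beta> (g \<circ> inv_into U \<phi>) (\<phi> x))))"
  have "\<exists>N c. Q r N c" if "r \<ge> 1" for r unfolding Q_def by (rule chart_coefficients[OF that])
  then obtain N c where Nc: "\<And>r. r \<ge> 1 \<Longrightarrow> Q r (N r) (c r)" by metis
  \<comment> \<open>\<open>bidifferential\<close> speaks about orders from one on; the coefficient
    of order \<open>0\<close> is the pointwise product.\<close>
  define L where "L = (\<lambda>r. if r = 0 then (\<lambda>f g. f * g) else loc.local_bidiff (N r) (c r))"
  have L_bidiff: "loc.alg.is_bidiffop (L r)" for r
  proof (cases "r = 0")
    case True
    then show ?thesis unfolding L_def using loc.alg.is_bidiffop_times by simp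
  next
    case False
    then have "Q r (N r) (c r)" by (intro Nc) simp
    then show ?thesis using False unfolding L_def Q_def by (simp add: loc.is_bidiffop_local_bidiff)
  qed
  note L_B = loc.alg.is_bidiffop_B[OF L_bidiff]
  have germ: "L r f g z = L r f' g' z"
    if "openin (Euclidean_space (mdim M)) W" "W \<subseteq> \<phi> ` U" "f' \<in> loc.smooth" "g' \<in> loc.smooth"
      "\<And>y. y \<in> W \<Longrightarrow> f y = f' y" "\<And>y. y \<in> W \<Longrightarrow> g y = g' y" "z \<in> W" for r f g f' g' W z
    using loc.local_bidiff_cong[OF that(1-4) that(5) that(6) that(7), of "N r" "c r"] that(5)[OF that(7)] that(6)[OF that(7)]
    by (simp add: L_def)
  have L_localize: "localize (C r f g) = L r (localize f) (localize g)"
    if f: "f \<in> smooth_functions M" and g: "g \<in> smooth_functions M" for r f g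
  proof (rule loc.smooth_eqI[OF _ localize_smooth[OF C_closed[OF f g]] L_B[OF localize_smooth[OF f] localize_smooth[OF g]]])
    fix y assume y: "y \<in> \<phi> ` U"
    then obtain p where p: "p \<in> U" "y = \<phi> p" by blast
    show "localize (C r f g) y = L r (localize f) (localize g) y"
    proof (cases "r = 0")
      case True
      then show ?thesis using p C_0[OF f g] by (simp add: L_def localize_at)
    next
      case False
      then have "Q r (N r) (c r)" by (intro Nc) simp
      then have "C r f g p = (\<Sum>\<alpha>\<in>multi_indices (mdim M) (N r). \<Sum>\<beta>\<in>multi_indices (mdim M) (N r).
                 c r \<alpha> \<beta> y * multi_deriv (mdim M) \<alpha> (f \<circ> inv_into U \<phi>) y
                             * multi_deriv (mdim M) \<beta> (g \<circ> inv_into U \<phi>) y)"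
        using f g p unfolding Q_def by blast
      then show ?thesis
        using False y p(1) by (simp add: L_def loc.local_bidiff_def multi_deriv_localize[OF f y] multi_deriv_localize[OF g y]
          p(2)[symmetric] localize_at[OF p(1), of "C r f g", folded p(2)])
    qed
  qed
  have "loc.alg.star_coeffs L"
    unfolding loc.alg.star_coeffs_def
  proof (intro conjI allI ballI)
    show "L 0 f g = f * g" for f g by (simp add: L_def)
    show "loc.alg.is_bidiffop (L r)" for r by (rule L_bidiff)
    fix r f g assume f: "f \<in> loc.smooth" and g: "g \<in> loc.smooth"
    show "(\<lambda>x. cnj (L r f g x)) = L r (\<lambda>x. cnj (g x)) (\<lambda>x. cnj (f x))"
    proof (rule loc.smooth_eqI)
      fix y assume y: "y \<in> \<phi> ` U"
      then obtain p where p: "p \<in> U" "y = \<phi> p" by blast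
      obtain W e where W: "openin (Euclidean_space (mdim M)) W" "y \<in> W" "W \<subseteq> \<phi> ` U"
        and e: "\<And>u. u \<in> loc.smooth \<Longrightarrow> e u \<in> smooth_functions M"
          "\<And>u z. u \<in> loc.smooth \<Longrightarrow> z \<in> W \<Longrightarrow> u z = localize (e u) z"
        by (rule germ_extension[OF y]) (rule that)
      have "L r f g y = L r (localize (e f)) (localize (e g)) y"
        by (rule germ[OF W(1,3) _ _ _ _ W(2)]) (use e f g in \<open>auto intro: localize_smooth\<close>)
      also have "\<dots> = C r (e f) (e g) p"
        using e(1) f g p by (simp add: L_localize[symmetric] localize_at)
      finally have "cnj (L r f g y) = C r (\<lambda>q. cnj (e g q)) (\<lambda>q. cnj (e f q)) p"
        using C_cnj[OF e(1)[OF f] e(1)[OF g]] by (metis (no_types, lifting))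
      also have "\<dots> = L r (localize (\<lambda>q. cnj (e g q))) (localize (\<lambda>q. cnj (e f q))) y"
        using e(1) f g p by (simp add: L_localize[symmetric] localize_at smooth_cnj)
      also have "\<dots> = L r (\<lambda>x. cnj (g x)) (\<lambda>x. cnj (f x)) y"
      proof (rule germ[OF W(1,3) _ _ _ _ W(2), symmetric])
        show "cnj (g z) = localize (\<lambda>q. cnj (e g q)) z" "cnj (f z) = localize (\<lambda>q. cnj (e f q)) z" if "z \<in> W" for z
          using e(2)[OF g that] e(2)[OF f that] by (simp_all add: localize_def)
      qed (use e f g in \<open>auto intro: localize_smooth smooth_cnj\<close>)
      finally show "cnj (L r f g y) = L r (\<lambda>x. cnj (g x)) (\<lambda>x. cnj (f x)) y" .
    qed (use f g in \<open>auto intro: L_B loc.smooth_cnj\<close>)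
    fix h assume h: "h \<in> loc.smooth"
    show "(\<Sum>i\<le>r. L i (L (r - i) f g) h) = (\<Sum>i\<le>r. L i f (L (r - i) g h))"
    proof (rule loc.smooth_eqI)
      fix y assume y: "y \<in> \<phi> ` U"
      then obtain p where p: "p \<in> U" "y = \<phi> p" by blast
      obtain W e where W: "openin (Euclidean_space (mdim M)) W" "y \<in> W" "W \<subseteq> \<phi> ` U"
        and e: "\<And>u. u \<in> loc.smooth \<Longrightarrow> e u \<in> smooth_functions M"
          "\<And>u z. u \<in> loc.smooth \<Longrightarrow> z \<in> W \<Longrightarrow> u z = localize (e u) z"
        by (rule germ_extension[OF y]) (rule that)
      \<comment> \<open>The inner product has to agree with its global counterpart on all of
        \<open>W\<close> and not just at \<open>y\<close>, since the outer operator differentiates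
        it.\<close>
      have inner: "L j u v z = localize (C j (e u) (e v)) z"
        if "u \<in> loc.smooth" "v \<in> loc.smooth" "z \<in> W" for j u v z
        unfolding L_localize[OF e(1)[OF that(1)] e(1)[OF that(2)]]
        by (rule germ[OF W(1,3) _ _ _ _ that(3)]) (use e that in \<open>auto intro: localize_smooth\<close>)
      have outer: "L i u v y = C i u' v' p" if "u' \<in> smooth_functions M" "v' \<in> smooth_functions M"
        "\<And>z. z \<in> W \<Longrightarrow> u z = localize u' z" "\<And>z. z \<in> W \<Longrightarrow> v z = localize v' z" for i u v u' v'
      proof -
        have "L i u v y = L i (localize u') (localize v') y"
          by (rule germ[OF W(1,3) _ _ that(3,4) W(2)]) (use that(1,2) in \<open>auto intro: localize_smooth\<close>)
        then show ?thesis using that(1,2) p by (simp add: L_localize[symmetric] localize_at)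
      qed
      have "L i (L j f g) h y = C i (C j (e f) (e g)) (e h) p" for i j
        by (rule outer) (use e f g h inner C_closed in auto)
      moreover have "L i f (L j g h) y = C i (e f) (C j (e g) (e h)) p" for i j
        by (rule outer) (use e f g h inner C_closed in auto)
      ultimately show "(\<Sum>i\<le>r. L i (L (r - i) f g) h) y = (\<Sum>i\<le>r. L i f (L (r - i) g h)) y"
        using arg_cong[OF C_assoc[OF e(1)[OF f] e(1)[OF g] e(1)[OF h]], of "\<lambda>F. F p" r]
        by (simp add: fun_sum_apply)
    qed (use f g h in \<open>auto intro!: loc.alg.sum_B L_B\<close>)
  qed
  then show ?thesis using L_localize by blast
qed

lemma localize_star:
  assumes L: "\<And>r f g. f \<in> smooth_functions M \<Longrightarrow> g \<in> smooth_functions M \<Longrightarrow> localize (C r f g) = L r (localize f) (localize g)"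
    and F: "F \<in> series (smooth_functions M)" and G: "G \<in> series (smooth_functions M)"
  shows "localize (fps_nth (star F G) k) =
    fps_nth (star_of L (Abs_fps (\<lambda>k. localize (fps_nth F k))) (Abs_fps (\<lambda>k. localize (fps_nth G k)))) k"
  by (simp add: star_eq[OF F G] star_of_def localize_sum L series_nth[OF F] series_nth[OF G])

end

section \<open>Localization of positive functionals\<close>

text \<open>The degenerate Cauchy-Schwarz inequality, from positivity on \<open>c x + y\<close> for
  all complex \<open>c\<close>: as \<open>x\<close> is null, the value depends on \<open>c\<close>
  in an affine way, so its linear part vanishes. The two mixed terms are treated as independent
  numbers, which spares a separate proof that the functional is Hermitian.\<close>

lemma positive_functional_null:
  assumes A: "star_algebra A cnj" and pos: "positive_functional complex_nonneg A \<omega>"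
    and x: "x \<in> carr A" and y: "y \<in> carr A" and null: "\<omega> (mul A (adj A x) x) = 0"
  shows "\<omega> (mul A (adj A x) y) = 0"
proof -
  interpret star_algebra A cnj by fact
  have add: "\<omega> (a + b) = \<omega> a + \<omega> b" if "a \<in> carr A" "b \<in> carr A" for a b
    using pos that by (simp add: positive_functional_def linear_functional_def)
  have sc: "\<omega> (scal A c a) = c * \<omega> a" if "a \<in> carr A" for a c
    using pos that by (simp add: positive_functional_def linear_functional_def)
  let ?z = "\<omega> (mul A (adj A x) y)" and ?w = "\<omega> (mul A (adj A y) x)" and ?r = "\<omega> (mul A (adj A y) y)"
  have nn: "complex_nonneg (cnj c * ?z + c * ?w + ?r)" for c
  proof -
    let ?a = "scal A c x + y"
    have a: "?a \<in> carr A" using x y by (simp add: add_closed scal_closed)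
    have "mul A (adj A ?a) ?a = scal A (cnj c * c) (mul A (adj A x) x) + scal A (cnj c) (mul A (adj A x) y)
        + (scal A c (mul A (adj A y) x) + mul A (adj A y) y)"
      using x y by (simp add: adj_add adj_scal mul_add_left mul_add_right mul_scal_left mul_scal_right
        scal_closed adj_closed mul_closed add_closed scal_scal scal_add_right mult.commute)
    then have "\<omega> (mul A (adj A ?a) ?a) = cnj c * ?z + c * ?w + ?r"
      using x y by (simp add: add sc scal_closed adj_closed mul_closed add_closed null)
    then show ?thesis using pos a by (auto simp: positive_functional_def)
  qed
  have lin: "b = 0" if "\<And>t. t * b + c \<ge> 0" for b c :: real
  proof (rule ccontr)
    assume "b \<noteq> 0"
    then show False using that[of "(- c - 1) / b"] by simp
  qed
  have re: "t * (Re ?z + Re ?w) + Re ?r \<ge> 0" and im: "t * (Im ?z + Im ?w) + Im ?r = 0"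
    and re': "t * (Im ?z - Im ?w) + Re ?r \<ge> 0" and im': "t * (Re ?w - Re ?z) + Im ?r = 0" for t
    using nn[of "complex_of_real t"] nn[of "\<i> * complex_of_real t"]
    by (simp_all add: complex_nonneg_iff algebra_simps)
  have "Re ?z + Re ?w = 0" "Im ?z - Im ?w = 0" using lin re re' by blast+
  moreover have "Im ?z + Im ?w = 0" "Re ?w - Re ?z = 0" using im[of 0] im[of 1] im'[of 1] by simp_all
  ultimately show ?thesis by (simp add: complex_eq_iff)
qed

context smooth_manifold begin

lemma msmooth_scale: "msmooth f \<Longrightarrow> msmooth (\<lambda>p. c * f p :: real)"
  by (rule msmooth_linear[OF bounded_linear_mult_right])

lemma msmooth_diff: "msmooth f \<Longrightarrow> msmooth g \<Longrightarrow> msmooth (\<lambda>p. f p - g p :: real)"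
  using msmooth_add[of f "\<lambda>p. (- 1) * g p"] msmooth_scale[of g "- 1"] by simp

lemma sum_le_lfsum:
  assumes "\<And>i. msmooth (h i)" "locally_finite h" "\<And>i p. h i p \<ge> 0"
  shows "(\<Sum>i<m. h i p) \<le> lfsum h p"
proof -
  have "\<exists>k. \<forall>i\<ge>k. h i p = 0"
  proof (cases "p \<in> topspace (mtop M)")
    case True
    then show ?thesis by (rule lfsum_pointwise[OF assms(2)]) blast
  qed (simp add: msmooth_outside[OF assms(1)])
  then obtain k where k: "\<And>i. i \<ge> k \<Longrightarrow> h i p = 0" by blast
  have "(\<Sum>i<m. h i p) \<le> (\<Sum>i<max m k. h i p)" by (rule sum_mono2) (auto simp: assms(3))
  also have "\<dots> = lfsum h p" by (rule lfsum_eq[symmetric]) (simp add: k)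
  finally show ?thesis .
qed

end

section \<open>Positive functionals on matrices over the smooth functions\<close>

locale star_functional = hermitian_star M star for M :: "'a manifold" and star +
  fixes N :: nat and \<omega>\<^sub>0
  assumes N_pos: "N \<ge> 1"
    and positive: "positive_functional complex_nonneg (matrix_algebra N (function_algebra M)) \<omega>\<^sub>0"
begin

abbreviation MA where "MA \<equiv> matrix_algebra N (function_algebra M)"

sublocale MA: star_algebra MA cnj
  by (rule star_algebra_matrix[OF star_function_algebra])

lemma MA_iff: "a \<in> carr MA \<longleftrightarrow> (\<forall>i j. if i < N \<and> j < N then msmooth (a i j) else a i j = 0)"
  by (simp add: matrix_algebra_simps function_algebra_simps smooth_functions_iff)

lemma MA_smooth: "a \<in> carr MA \<Longrightarrow> i < N \<Longrightarrow> j < N \<Longrightarrow> a i j \<in> smooth_functions M"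
  using matrix_entry[of a N "function_algebra M"] by (simp add: function_algebra_simps)

lemma MA_outside:
  assumes a: "a \<in> carr MA" and p: "p \<notin> topspace (mtop M)"
  shows "a i j p = 0"
proof (cases "i < N \<and> j < N")
  case True
  then show ?thesis using MA_smooth[OF a] msmooth_outside[of "a i j", OF _ p] by (simp add: smooth_functions_iff)
next
  case False
  then show ?thesis using matrix_entry_outside[OF a] by simp
qed

lemma \<omega>\<^sub>0_add: "a \<in> carr MA \<Longrightarrow> b \<in> carr MA \<Longrightarrow> \<omega>\<^sub>0 (a + b) = \<omega>\<^sub>0 a + \<omega>\<^sub>0 b"
  and \<omega>\<^sub>0_scal: "a \<in> carr MA \<Longrightarrow> \<omega>\<^sub>0 (scal MA c a) = c * \<omega>\<^sub>0 a"
  and \<omega>\<^sub>0_pos: "a \<in> carr MA \<Longrightarrow> complex_nonneg (\<omega>\<^sub>0 (mul MA (adj MA a) a))"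
  using positive by (simp_all add: positive_functional_def linear_functional_def)

lemma \<omega>\<^sub>0_zero: "\<omega>\<^sub>0 0 = 0"
  using \<omega>\<^sub>0_add[OF MA.zero_closed MA.zero_closed] by simp

lemma \<omega>\<^sub>0_sum: "(\<And>i. i \<in> I \<Longrightarrow> f i \<in> carr MA) \<Longrightarrow> \<omega>\<^sub>0 (sum f I) = (\<Sum>i\<in>I. \<omega>\<^sub>0 (f i))"
  by (induction I rule: infinite_finite_induct) (auto simp: \<omega>\<^sub>0_zero \<omega>\<^sub>0_add MA.sum_closed)

lemma matrix_scal: "a \<in> carr MA \<Longrightarrow> scal MA c a = (\<lambda>i j p. c * a i j p)"
  by (intro ext) (auto simp: matrix_algebra_simps function_algebra_simps MA_iff split: if_splits)

definition smult :: "('a \<Rightarrow> real) \<Rightarrow> (nat \<Rightarrow> nat \<Rightarrow> 'a \<Rightarrow> complex) \<Rightarrow> nat \<Rightarrow> nat \<Rightarrow> 'a \<Rightarrow> complex" where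
  "smult f a = (\<lambda>i j p. complex_of_real (f p) * a i j p)"

lemma smult_closed:
  assumes "msmooth f" "a \<in> carr MA"
  shows "smult f a \<in> carr MA"
  using assms(2) msmooth_mult[OF msmooth_linear[OF bounded_linear_of_real assms(1)]]
  by (auto simp: MA_iff smult_def fun_eq_iff split: if_splits)

lemma smult_add: "smult (\<lambda>p. f p + g p) a = smult f a + smult g a"
  by (intro ext) (simp add: smult_def algebra_simps)

definition idm :: "nat \<Rightarrow> nat \<Rightarrow> 'a \<Rightarrow> complex" where
  "idm = (\<lambda>i j p. if i < N \<and> i = j then complex_of_real (one_M p) else 0)"

lemma idm_closed: "idm \<in> carr MA"
  unfolding MA_iff
proof (intro allI)
  fix i j
  show "if i < N \<and> j < N then msmooth (idm i j) else idm i j = 0"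
    using msmooth_linear[OF bounded_linear_of_real msmooth_one]
    by (cases "i = j") (auto simp: idm_def msmooth_zero zero_fun_def)
qed

text \<open>The functional restricted to scalar matrices; taking the real part gives a real-valued
  functional that can be compared by inequalities.\<close>

definition trf :: "('a \<Rightarrow> real) \<Rightarrow> real" where
  "trf f = Re (\<omega>\<^sub>0 (smult f idm))"

lemma trf_add: "msmooth f \<Longrightarrow> msmooth g \<Longrightarrow> trf (\<lambda>p. f p + g p) = trf f + trf g"
  by (simp add: trf_def smult_add \<omega>\<^sub>0_add smult_closed idm_closed)

lemma trf_scale:
  assumes "msmooth f"
  shows "trf (\<lambda>p. c * f p) = c * trf f"
proof -
  have "smult (\<lambda>p. c * f p) idm = scal MA (complex_of_real c) (smult f idm)"
    unfolding matrix_scal[OF smult_closed[OF assms idm_closed]] by (simp add: smult_def mult.assoc)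
  then show ?thesis by (simp add: trf_def \<omega>\<^sub>0_scal smult_closed assms idm_closed)
qed

lemma trf_sum: "(\<And>i. i \<in> I \<Longrightarrow> msmooth (f i)) \<Longrightarrow> trf (\<lambda>p. \<Sum>i\<in>I. f i p) = (\<Sum>i\<in>I. trf (f i))"
proof (induction I rule: infinite_finite_induct)
  case (insert i I)
  then show ?case using trf_add[of "f i" "\<lambda>p. \<Sum>i\<in>I. f i p"] msmooth_sum[of I f] by simp
qed (use trf_scale[OF msmooth_zero, of 0] in auto)

lemma adj_smult_idm_mult:
  assumes "a \<in> carr MA"
  shows "mul MA (adj MA (smult f idm)) a = smult f a"
proof (intro ext)
  fix i j p
  have "(\<Sum>l<N. cnj (complex_of_real (f p) * idm l i p) * a l j p) = (\<Sum>l<N. if l = i then complex_of_real (f p) * a i j p else 0)"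
    if "i < N" "j < N"
  proof (rule sum.cong[OF refl])
    have "p \<notin> topspace (mtop M) \<Longrightarrow> a i j p = 0"
      using MA_outside[OF assms] by simp
    then show "cnj (complex_of_real (f p) * idm l i p) * a l j p = (if l = i then complex_of_real (f p) * a i j p else 0)" for l
      using that by (auto simp: idm_def one_M_def)
  qed
  moreover have "a i j = 0" if "\<not> (i < N \<and> j < N)" using matrix_entry_outside[OF assms that] .
  ultimately show "mul MA (adj MA (smult f idm)) a i j p = smult f a i j p"
    by (auto simp: matrix_algebra_simps function_algebra_simps fun_sum_apply smult_def)
qed

lemma trf_square:
  assumes "msmooth g"
  shows "complex_nonneg (\<omega>\<^sub>0 (smult (\<lambda>p. g p * g p) idm))" "trf (\<lambda>p. g p * g p) \<ge> 0"
proof -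
  have "smult g (smult g idm) = smult (\<lambda>p. g p * g p) idm" by (simp add: smult_def mult.assoc)
  then show nn: "complex_nonneg (\<omega>\<^sub>0 (smult (\<lambda>p. g p * g p) idm))"
    using \<omega>\<^sub>0_pos[OF smult_closed[OF assms idm_closed]]
    by (simp add: adj_smult_idm_mult[OF smult_closed[OF assms idm_closed]])
  then show "trf (\<lambda>p. g p * g p) \<ge> 0" by (simp add: trf_def complex_nonneg_iff)
qed

text \<open>A nonnegative smooth function becomes a square after adding a positive constant.\<close>

lemma trf_nonneg:
  assumes f: "msmooth f" and nn: "\<And>p. f p \<ge> 0"
  shows "trf f \<ge> 0"
proof (rule ccontr)
  assume neg: "\<not> trf f \<ge> 0"
  have "(\<lambda>p. one_M p * one_M p) = one_M" by (rule ext) (simp add: one_M_def)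
  then have one: "trf one_M \<ge> 0" using trf_square(2)[OF msmooth_one] by simp
  \<comment> \<open>With this \<open>e\<close> the value on \<open>f + e * one_M\<close> is
    \<open>trf f / (trf one_M + 1)\<close>, still negative, whereas that function is a square; the
    \<open>+ 1\<close> excludes division by zero.\<close>
  define e where "e = - trf f / (trf one_M + 1)"
  have e: "e > 0" unfolding e_def by (rule divide_pos_pos) (use one neg in auto)
  have fe: "msmooth (\<lambda>p. f p + e * one_M p)" by (rule msmooth_add[OF f msmooth_scale[OF msmooth_one]])
  have pos: "f p + e * one_M p > 0" if "p \<in> topspace (mtop M)" for p
    using nn[of p] e that by (simp add: one_M_def add_nonneg_pos)
  have "msmooth (\<lambda>p. (f p + e * one_M p) powr (1/2))" by (rule msmooth_powr[OF fe pos])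
  moreover have "(f p + e * one_M p) powr (1/2) * (f p + e * one_M p) powr (1/2) = f p + e * one_M p" for p
    using nn[of p] e by (simp add: powr_half_sqrt one_M_def)
  ultimately have "trf (\<lambda>p. f p + e * one_M p) \<ge> 0"
    using trf_square(2)[of "\<lambda>p. (f p + e * one_M p) powr (1/2)"] by simp
  then have "trf f + e * trf one_M \<ge> 0"
    by (simp add: trf_add f msmooth_scale msmooth_one trf_scale)
  moreover have "trf f + e * trf one_M = trf f / (trf one_M + 1)"
    using one by (simp add: e_def field_simps)
  moreover have "trf f / (trf one_M + 1) < 0" by (rule divide_neg_pos) (use one neg in auto)
  ultimately show False by simp
qed

lemma trf_mono: "msmooth f \<Longrightarrow> msmooth g \<Longrightarrow> (\<And>p. f p \<le> g p) \<Longrightarrow> trf f \<le> trf g"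
  using trf_add[of f "\<lambda>p. g p - f p"] trf_nonneg[of "\<lambda>p. g p - f p"] msmooth_diff[of g f] by simp

text \<open>Otherwise \<open>\<Sum>i. e i / trf (e i)\<close> would be a smooth function whose value under \<open>trf\<close> exceeds every
  natural number.\<close>

lemma trf_locally_finite:
  assumes e: "\<And>i. msmooth (e i)" "locally_finite e" "\<And>i p. e i p \<ge> 0"
  shows "\<exists>i. trf (e i) = 0"
proof (rule ccontr)
  assume "\<not> (\<exists>i. trf (e i) = 0)"
  then have pos: "trf (e i) > 0" for i using trf_nonneg[OF e(1,3), of i] by (simp add: less_le)
  define h where "h = (\<lambda>i p. inverse (trf (e i)) * e i p)"
  have h: "msmooth (h i)" for i unfolding h_def by (rule msmooth_scale[OF e(1)])
  have lf: "locally_finite h" by (rule locally_finite_mono[OF e(2)]) (simp add: h_def)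
  have h0: "h i p \<ge> 0" for i p using pos[of i] e(3) by (simp add: h_def)
  have "real m \<le> trf (lfsum h)" for m
  proof -
    have "trf (h i) = 1" for i unfolding h_def using trf_scale[OF e(1)] pos[of i] by simp
    then have "real m = trf (\<lambda>p. \<Sum>i<m. h i p)" using trf_sum[of "{..<m}" h] h by simp
    also have "\<dots> \<le> trf (lfsum h)"
      by (rule trf_mono[OF msmooth_sum msmooth_lfsum[OF h lf] sum_le_lfsum[OF h lf h0]]) (rule h)
    finally show ?thesis .
  qed
  then show False using reals_Archimedean2[of "trf (lfsum h)"] by (meson not_less)
qed

text \<open>From \<open>0 \<le> e \<le> 1\<close> one gets \<open>e * e \<le> e\<close>, so
  \<open>e\<close> times the unit matrix is a null vector, and Cauchy-Schwarz carries the vanishing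
  over to all matrices.\<close>

lemma smult_null:
  assumes e: "msmooth e" "\<And>p. e p \<ge> 0" "\<And>p. e p \<le> 1" "trf e = 0" and a: "a \<in> carr MA"
  shows "\<omega>\<^sub>0 (smult e a) = 0"
proof -
  let ?x = "smult e idm"
  have x: "?x \<in> carr MA" by (rule smult_closed[OF e(1) idm_closed])
  have sq: "mul MA (adj MA ?x) ?x = smult (\<lambda>p. e p * e p) idm"
    unfolding adj_smult_idm_mult[OF x] by (simp add: smult_def mult.assoc)
  have "trf (\<lambda>p. e p * e p) \<le> trf e"
    using e by (intro trf_mono msmooth_mult) (auto simp: mult_left_le)
  then have "\<omega>\<^sub>0 (mul MA (adj MA ?x) ?x) = 0"
    using trf_square[OF e(1)] e(4) unfolding sq by (simp add: trf_def complex_nonneg_iff complex_eq_iff)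
  from positive_functional_null[OF MA.star_algebra_axioms positive, OF x a this]
  show ?thesis unfolding adj_smult_idm_mult[OF a] .
qed

text \<open>The remainders after subtracting the first \<open>n\<close> squares from the unit form a
  locally finite family themselves, since near each point they vanish for large \<open>n\<close>. By
  \<open>trf_locally_finite\<close> the functional kills one of them, and the squares before it then
  account for everything.\<close>

lemma finite_decomposition:
  "\<exists>\<kappa> n. (\<forall>i<n. msmooth (\<kappa> i) \<and> chart_supported (\<kappa> i)) \<and>
    (\<forall>a\<in>carr MA. \<omega>\<^sub>0 a = (\<Sum>i<(n :: nat). \<omega>\<^sub>0 (smult (\<lambda>p. (\<kappa> i p)\<^sup>2) a)))"
proof (cases "topspace (mtop M) = {}")
  case True
  have "a = 0" if "a \<in> carr MA" for a
  proof (intro ext)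
    fix i j p
    show "a i j p = 0 i j p"
      using MA_outside[OF that] True by simp
  qed
  then have "\<omega>\<^sub>0 a = 0" if "a \<in> carr MA" for a using that \<omega>\<^sub>0_zero by metis
  then show ?thesis by (intro exI[of _ "\<lambda>_ _. 0"] exI[of _ 0]) simp
next
  case False
  obtain \<kappa> where \<kappa>: "\<And>i. msmooth (\<kappa> i)" "\<And>i. chart_supported (\<kappa> i)" "locally_finite \<kappa>"
    and one: "\<And>p. p \<in> topspace (mtop M) \<Longrightarrow> lfsum (\<lambda>i p. (\<kappa> i p)\<^sup>2) p = 1"
    using partition_exists[OF False] by (elim exE conjE) (auto simp: Ball_def)
  have sq: "msmooth (\<lambda>p. (\<kappa> i p)\<^sup>2)" for i unfolding power2_eq_square by (rule msmooth_mult[OF \<kappa>(1) \<kappa>(1)])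
  have lf: "locally_finite (\<lambda>i p. (\<kappa> i p)\<^sup>2)" by (rule locally_finite_mono[OF \<kappa>(3)]) simp
  define e where "e = (\<lambda>n p. one_M p - (\<Sum>i<n. (\<kappa> i p)\<^sup>2))"
  have e_smooth: "msmooth (e n)" for n
    unfolding e_def by (rule msmooth_diff[OF msmooth_one msmooth_sum]) (rule sq)
  have le: "(\<Sum>i<n. (\<kappa> i p)\<^sup>2) \<le> one_M p" for n p
    using sum_le_lfsum[OF sq lf, where m = n and p = p] one[of p] msmooth_outside[OF \<kappa>(1), of p]
    by (cases "p \<in> topspace (mtop M)") (simp_all add: one_M_def)
  have e0: "e n p \<ge> 0" and e1: "e n p \<le> 1" for n p
    using le[of p n] sum_nonneg[of "{..<n}" "\<lambda>i. (\<kappa> i p)\<^sup>2"] by (auto simp: e_def one_M_def)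
  have "locally_finite e"
    unfolding locally_finite_def
  proof
    fix p assume p: "p \<in> topspace (mtop M)"
    from bspec[OF lf[unfolded locally_finite_def] p]
    obtain S m where S: "openin (mtop M) S" "p \<in> S" "\<And>i q. i \<ge> m \<Longrightarrow> q \<in> S \<Longrightarrow> (\<kappa> i q)\<^sup>2 = 0" by blast
    have "e n q = 0" if "n \<ge> m" "q \<in> S" for n q
    proof -
      have q: "q \<in> topspace (mtop M)" using openin_subset[OF S(1)] that(2) by blast
      have "lfsum (\<lambda>i p. (\<kappa> i p)\<^sup>2) q = (\<Sum>i<n. (\<kappa> i q)\<^sup>2)"
        by (rule lfsum_eq) (rule S(3), use that in auto)
      then show ?thesis using one[OF q] q by (simp add: e_def one_M_def)
    qed
    then show "\<exists>S m. openin (mtop M) S \<and> p \<in> S \<and> (\<forall>i\<ge>m. \<forall>q\<in>S. e i q = 0)"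
      by (intro exI[of _ S] exI[of _ m]) (simp add: S(1,2))
  qed
  from trf_locally_finite[OF e_smooth this e0] obtain n where n: "trf (e n) = 0" by blast
  have "\<omega>\<^sub>0 a = (\<Sum>i<n. \<omega>\<^sub>0 (smult (\<lambda>p. (\<kappa> i p)\<^sup>2) a))" if a: "a \<in> carr MA" for a
  proof -
    have "a = smult (e n) a + (\<Sum>i<n. smult (\<lambda>p. (\<kappa> i p)\<^sup>2) a)"
    proof (intro ext)
      fix i j p
      have "a i j p = complex_of_real (one_M p) * a i j p"
        using MA_outside[OF a] by (auto simp: one_M_def)
      also have "one_M p = e n p + (\<Sum>i<n. (\<kappa> i p)\<^sup>2)" by (simp add: e_def)
      finally show "a i j p = (smult (e n) a + (\<Sum>i<n. smult (\<lambda>p. (\<kappa> i p)\<^sup>2) a)) i j p"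
        by (simp add: smult_def fun_sum_apply distrib_right sum_distrib_right)
    qed
    then have "\<omega>\<^sub>0 a = \<omega>\<^sub>0 (smult (e n) a + (\<Sum>i<n. smult (\<lambda>p. (\<kappa> i p)\<^sup>2) a))" by simp
    also have "\<dots> = \<omega>\<^sub>0 (smult (e n) a) + (\<Sum>i<n. \<omega>\<^sub>0 (smult (\<lambda>p. (\<kappa> i p)\<^sup>2) a))"
      by (subst \<omega>\<^sub>0_add) (auto intro!: smult_closed e_smooth sq a MA.sum_closed \<omega>\<^sub>0_sum)
    also have "\<omega>\<^sub>0 (smult (e n) a) = 0" by (rule smult_null[OF e_smooth e0 e1 n a])
    finally show ?thesis by simp
  qed
  then show ?thesis using \<kappa>(1,2) by blast
qed

end

section \<open>The functional localized to one chart\<close>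

locale star_functional_chart = star_functional M star N \<omega>\<^sub>0 + star_chart M star U \<phi>
  for M :: "'a manifold" and star N \<omega>\<^sub>0 U \<phi> +
  fixes \<kappa> :: "'a \<Rightarrow> real" and K
  assumes \<kappa>_smooth: "msmooth \<kappa>" and K_closed: "closedin (mtop M) K" and K_chart: "K \<subseteq> U"
    and \<kappa>_support: "\<And>p. \<kappa> p \<noteq> 0 \<Longrightarrow> p \<in> K"
begin

definition push :: "('a \<Rightarrow> real) \<Rightarrow> ((nat \<Rightarrow> real) \<Rightarrow> complex) \<Rightarrow> 'a \<Rightarrow> complex" where
  "push f u p = (if p \<in> U then complex_of_real (f p) * u (\<phi> p) else 0)"

definition unit_at :: "nat \<Rightarrow> nat \<Rightarrow> ('a \<Rightarrow> complex) \<Rightarrow> nat \<Rightarrow> nat \<Rightarrow> 'a \<Rightarrow> complex" where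
  "unit_at i j f = (\<lambda>i' j'. if i' = i \<and> j' = j then f else 0)"

lemma \<kappa>2_smooth: "msmooth (\<lambda>p. (\<kappa> p)\<^sup>2)"
  unfolding power2_eq_square by (rule msmooth_mult[OF \<kappa>_smooth \<kappa>_smooth])

lemma push_smooth:
  assumes f: "msmooth f" "\<And>p. f p \<noteq> 0 \<Longrightarrow> p \<in> K" and u: "u \<in> loc.smooth"
  shows "push f u \<in> smooth_functions M"
proof -
  have "push f u = extend U \<phi> (\<lambda>y. complex_of_real (f (inv_into U \<phi> y)) * u y)"
    by (rule ext) (simp add: push_def extend_def chart_inv[OF chart])
  moreover have "msmooth (extend U \<phi> (\<lambda>y. complex_of_real (f (inv_into U \<phi> y)) * u y))"
  proof (rule msmooth_extend[OF chart _ K_closed K_chart])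
    show "C_k_on (mdim M) k (\<phi> ` U) (\<lambda>y. complex_of_real (f (inv_into U \<phi> y)) * u y)" for k
      by (rule loc.C_k_mult[OF loc.C_k_linear[OF bounded_linear_of_real msmooth_C_k[OF f(1) chart]] loc.smooth_C_k[OF u]])
    show "q \<in> K" if "q \<in> U" "complex_of_real (f (inv_into U \<phi> (\<phi> q))) * u (\<phi> q) \<noteq> 0" for q
      by (rule f(2)) (use that chart_inv[OF chart that(1)] in auto)
  qed
  ultimately show ?thesis by (simp add: smooth_functions_iff)
qed

lemma push_\<kappa>2: "u \<in> loc.smooth \<Longrightarrow> push (\<lambda>p. (\<kappa> p)\<^sup>2) u \<in> smooth_functions M"
  by (rule push_smooth[OF \<kappa>2_smooth]) (auto intro: \<kappa>_support)

lemma unit_at_closed: "i < N \<Longrightarrow> j < N \<Longrightarrow> f \<in> smooth_functions M \<Longrightarrow> unit_at i j f \<in> carr MA"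
  by (auto simp: MA_iff unit_at_def smooth_functions_iff msmooth_zero zero_fun_def)

lemma unit_at_sum:
  "(\<Sum>i<N. \<Sum>j<N. unit_at i j (f i j)) i' j' = (if i' < N \<and> j' < N then f i' j' else 0)"
proof
  fix p
  have "(\<Sum>i<N. \<Sum>j<N. unit_at i j (f i j)) i' j' p =
      (\<Sum>i<N. \<Sum>j<N. if j = j' then if i = i' then f i j' p else 0 else 0)"
    unfolding fun_sum_apply by (intro sum.cong) (auto simp: unit_at_def)
  also have "\<dots> = (\<Sum>i<N. if i = i' then if j' < N then f i' j' p else 0 else 0)"
    by (intro sum.cong) auto
  finally show "(\<Sum>i<N. \<Sum>j<N. unit_at i j (f i j)) i' j' p = (if i' < N \<and> j' < N then f i' j' else 0) p"
    by auto
qed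

definition local_functional :: "nat \<Rightarrow> nat \<Rightarrow> ((nat \<Rightarrow> real) \<Rightarrow> complex) \<Rightarrow> complex" where
  "local_functional i j u = \<omega>\<^sub>0 (unit_at i j (push (\<lambda>p. (\<kappa> p)\<^sup>2) u))"

lemma sum_local_functional:
  assumes "\<And>i j. i < N \<Longrightarrow> j < N \<Longrightarrow> u i j \<in> loc.smooth"
  shows "(\<Sum>i<N. \<Sum>j<N. local_functional i j (u i j)) =
    \<omega>\<^sub>0 (\<Sum>i<N. \<Sum>j<N. unit_at i j (push (\<lambda>p. (\<kappa> p)\<^sup>2) (u i j)))"
proof -
  have c: "unit_at i j (push (\<lambda>p. (\<kappa> p)\<^sup>2) (u i j)) \<in> carr MA" if "i < N" "j < N" for i j
    using that by (intro unit_at_closed push_\<kappa>2 assms)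
  have "\<omega>\<^sub>0 (\<Sum>i<N. \<Sum>j<N. unit_at i j (push (\<lambda>p. (\<kappa> p)\<^sup>2) (u i j))) =
      (\<Sum>i<N. \<omega>\<^sub>0 (\<Sum>j<N. unit_at i j (push (\<lambda>p. (\<kappa> p)\<^sup>2) (u i j))))"
    by (rule \<omega>\<^sub>0_sum, rule MA.sum_closed) (auto intro: c)
  also have "\<dots> = (\<Sum>i<N. \<Sum>j<N. local_functional i j (u i j))"
    unfolding local_functional_def by (rule sum.cong[OF refl], rule \<omega>\<^sub>0_sum) (auto intro: c)
  finally show ?thesis ..
qed

lemma local_functional_positive: "loc.alg.positive_matrix_functional N local_functional"
  unfolding loc.alg.positive_matrix_functional_def
proof (intro conjI allI impI ballI)
  fix i j u assume ij: "i < N" "j < N" and u: "u \<in> loc.smooth"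
  note cl = unit_at_closed[OF ij push_\<kappa>2]
  show "local_functional i j (u + v) = local_functional i j u + local_functional i j v" if v: "v \<in> loc.smooth" for v
  proof -
    have "unit_at i j (push (\<lambda>p. (\<kappa> p)\<^sup>2) (u + v)) = unit_at i j (push (\<lambda>p. (\<kappa> p)\<^sup>2) u) + unit_at i j (push (\<lambda>p. (\<kappa> p)\<^sup>2) v)"
      by (intro ext) (simp add: unit_at_def push_def distrib_left)
    then show ?thesis by (simp add: local_functional_def \<omega>\<^sub>0_add cl u v)
  qed
  show "local_functional i j ((\<lambda>_. c) * u) = c * local_functional i j u" for c
  proof -
    have "unit_at i j (push (\<lambda>p. (\<kappa> p)\<^sup>2) ((\<lambda>_. c) * u)) = scal MA c (unit_at i j (push (\<lambda>p. (\<kappa> p)\<^sup>2) u))"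
      unfolding matrix_scal[OF cl[OF u]] by (intro ext) (simp add: unit_at_def push_def)
    then show ?thesis by (simp add: local_functional_def \<omega>\<^sub>0_scal cl u)
  qed
next
  fix u :: "nat \<Rightarrow> (nat \<Rightarrow> real) \<Rightarrow> complex" assume "range u \<subseteq> loc.smooth"
  then have u: "u i \<in> loc.smooth" for i by blast
  \<comment> \<open>Only row \<open>0\<close> is nonzero, and it exists because
    \<open>N \<ge> 1\<close>. Each factor of \<open>b\<^sup>* b\<close> takes one
    \<open>\<kappa>\<close>; this is why squares of the partition functions are used.\<close>
  define b where "b = (\<lambda>(i :: nat) j. if i = 0 \<and> j < N then push \<kappa> (u j) else 0)"
  have b: "b \<in> carr MA"
    using push_smooth[OF \<kappa>_smooth \<kappa>_support u] N_pos
    by (auto simp: MA_iff b_def smooth_functions_iff[symmetric] fn.zero_mem)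
  have "(\<Sum>i<N. \<Sum>j<N. local_functional i j ((\<lambda>x. cnj (u i x)) * u j)) =
      \<omega>\<^sub>0 (\<Sum>i<N. \<Sum>j<N. unit_at i j (push (\<lambda>p. (\<kappa> p)\<^sup>2) ((\<lambda>x. cnj (u i x)) * u j)))"
    by (rule sum_local_functional) (rule loc.alg.mult_B[OF loc.alg.st_B[OF u] u])
  also have "(\<Sum>i<N. \<Sum>j<N. unit_at i j (push (\<lambda>p. (\<kappa> p)\<^sup>2) ((\<lambda>x. cnj (u i x)) * u j))) = mul MA (adj MA b) b"
  proof (intro ext)
    fix i j p
    have "(\<Sum>l<N. cnj (b l i p) * b l j p) = (\<Sum>l<N. if l = 0 then cnj (push \<kappa> (u i) p) * push \<kappa> (u j) p else 0)"
      if "i < N" "j < N" by (rule sum.cong) (use that in \<open>auto simp: b_def\<close>)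
    then have "(\<Sum>l<N. cnj (b l i p) * b l j p) = cnj (push \<kappa> (u i) p) * push \<kappa> (u j) p" if "i < N" "j < N"
      using that by simp
    then show "(\<Sum>i<N. \<Sum>j<N. unit_at i j (push (\<lambda>p. (\<kappa> p)\<^sup>2) ((\<lambda>x. cnj (u i x)) * u j))) i j p = mul MA (adj MA b) b i j p"
      unfolding unit_at_sum
      by (simp add: matrix_algebra_simps function_algebra_simps fun_sum_apply) (simp add: push_def power2_eq_square)
  qed
  finally show "complex_nonneg (\<Sum>i<N. \<Sum>j<N. local_functional i j ((\<lambda>x. cnj (u i x)) * u j))"
    by (simp only: \<omega>\<^sub>0_pos[OF b])
qed

lemma \<omega>\<^sub>0_localize:
  assumes a: "a \<in> carr MA"
  shows "\<omega>\<^sub>0 (smult (\<lambda>p. (\<kappa> p)\<^sup>2) a) = (\<Sum>i<N. \<Sum>j<N. local_functional i j (localize (a i j)))"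
proof -
  have "smult (\<lambda>p. (\<kappa> p)\<^sup>2) a = (\<Sum>i<N. \<Sum>j<N. unit_at i j (push (\<lambda>p. (\<kappa> p)\<^sup>2) (localize (a i j))))"
  proof (intro ext)
    fix i j p
    have "p \<notin> U \<Longrightarrow> \<kappa> p = 0" using \<kappa>_support K_chart by blast
    moreover have "\<not> (i < N \<and> j < N) \<Longrightarrow> a i j = 0" using matrix_entry_outside[OF a] .
    ultimately show "smult (\<lambda>p. (\<kappa> p)\<^sup>2) a i j p =
        (\<Sum>i<N. \<Sum>j<N. unit_at i j (push (\<lambda>p. (\<kappa> p)\<^sup>2) (localize (a i j)))) i j p"
      unfolding unit_at_sum by (cases "p \<in> U") (auto simp: smult_def push_def localize_at)
  qed
  then show ?thesis
    using sum_local_functional[of "\<lambda>i j. localize (a i j)"] localize_smooth MA_smooth[OF a] by simp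
qed

end

text \<open>Lowest coefficients are positive and cannot cancel, so the sum starts at the smaller of
  the two orders.\<close>

lemma complex_fps_nonneg_add:
  assumes "complex_fps_nonneg z" "complex_fps_nonneg w"
  shows "complex_fps_nonneg (z + w)"
proof -
  have *: "(\<forall>k. Im (fps_nth z k) = 0) \<and> (z = 0 \<or> (\<exists>m. (\<forall>k<m. fps_nth z k = 0) \<and> Re (fps_nth z m) > 0))"
    if z: "complex_fps_nonneg z" for z
  proof -
    obtain a where a: "z = Abs_fps (\<lambda>k. complex_of_real (fps_nth a k))" "a = 0 \<or> real_fps_pos a"
      using z unfolding complex_fps_nonneg_def by blast
    have nth: "fps_nth z k = complex_of_real (fps_nth a k)" for k by (subst a(1)) simp
    have "z = 0 \<or> (\<exists>m. (\<forall>k<m. fps_nth z k = 0) \<and> Re (fps_nth z m) > 0)"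
    proof (rule disjE[OF a(2)])
      assume "a = 0"
      then have "z = 0" by (intro fps_ext) (simp add: nth)
      then show ?thesis ..
    next
      assume pos: "real_fps_pos a"
      have "\<forall>k<subdegree a. fps_nth z k = 0"
        by (intro allI impI) (simp only: nth nth_less_subdegree_zero of_real_0)
      moreover have "Re (fps_nth z (subdegree a)) > 0"
        using pos unfolding real_fps_pos_def nth by (simp only: Re_complex_of_real)
      ultimately show ?thesis by (intro disjI2 exI[of _ "subdegree a"] conjI)
    qed
    moreover have "Im (fps_nth z k) = 0" for k unfolding nth by (rule Im_complex_of_real)
    ultimately show ?thesis by (intro conjI allI)
  qed
  have im: "Im (fps_nth (z + w) k) = 0" for k using *[OF assms(1)] *[OF assms(2)] by simp
  have "z + w = 0 \<or> (\<exists>m. (\<forall>k<m. fps_nth (z + w) k = 0) \<and> Re (fps_nth (z + w) m) > 0)"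
  proof (cases "z = 0 \<or> w = 0")
    case True
    then show ?thesis
    proof
      assume "z = 0"
      then show ?thesis using conjunct2[OF *[OF assms(2)]] by (simp only: add_0_left)
    next
      assume "w = 0"
      then show ?thesis using conjunct2[OF *[OF assms(1)]] by (simp only: add_0_right)
    qed
  next
    case False
    then obtain m m' where m: "\<forall>k<m. fps_nth z k = 0" "Re (fps_nth z m) > 0"
      and m': "\<forall>k<m'. fps_nth w k = 0" "Re (fps_nth w m') > 0"
      using *[OF assms(1)] *[OF assms(2)] by blast
    have "Re (fps_nth (z + w) (min m m')) > 0"
      using m m' by (cases m m' rule: linorder_cases) (auto simp: min_def)
    moreover have "\<forall>k<min m m'. fps_nth (z + w) k = 0" using m(1) m'(1) by simp
    ultimately show ?thesis by (intro disjI2 exI[of _ "min m m'"] conjI)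
  qed
  then show ?thesis by (intro complex_fps_nonnegI im)
qed

lemma complex_fps_nonneg_zero: "complex_fps_nonneg 0"
  by (rule complex_fps_nonnegI) simp_all

lemma complex_fps_nonneg_sum:
  "(\<And>i. i \<in> I \<Longrightarrow> complex_fps_nonneg (f i)) \<Longrightarrow> complex_fps_nonneg (sum f I)"
proof (induction I rule: infinite_finite_induct)
  case (insert i I)
  then show ?case by (simp add: complex_fps_nonneg_add)
qed (simp_all add: complex_fps_nonneg_zero)

section \<open>Deforming the localized functional\<close>

context star_functional_chart begin

text \<open>The deformed functional is the localized one composed with the gauge transformation of
  the chart, applied entrywise. An entry of \<open>F\<^sup>* \<star> F\<close> is a sum over the
  rows of \<open>F\<close>, so \<open>star_positive\<close> is used once per row and the results are
  added.\<close>

lemma chart_deformation: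
  "\<exists>\<omega>. (\<forall>a\<in>carr MA. \<omega> 0 a = \<omega>\<^sub>0 (smult (\<lambda>p. (\<kappa> p)\<^sup>2) a)) \<and> (\<forall>r. linear_functional MA (\<omega> r)) \<and>
    (\<forall>F\<in>carr (deformed_algebra MA (matrix_star N (function_algebra M) star)).
      complex_fps_nonneg (formal_functional \<omega> (matrix_star N (function_algebra M) star
        (adj (deformed_algebra MA (matrix_star N (function_algebra M) star)) F) F)))"
proof -
  obtain L where L: "loc.alg.star_coeffs L"
    and loc_L': "\<forall>r. \<forall>f\<in>smooth_functions M. \<forall>g\<in>smooth_functions M. localize (C r f g) = L r (localize f) (localize g)"
    using local_star_exists by (elim exE conjE) (rule that)
  note loc_L = loc_L'[rule_format]
  obtain \<tau> where gt: "loc.alg.gauge_transformation \<tau>"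
    and pos': "\<forall>N \<Lambda> F. loc.alg.positive_matrix_functional N \<Lambda> \<longrightarrow> (\<forall>i<N. F i \<in> series loc.smooth) \<longrightarrow>
      complex_fps_nonneg (Abs_fps (\<lambda>m. \<Sum>i<N. \<Sum>j<N. \<Lambda> i j (fps_nth (app \<tau> (star_of L (loc.alg.st_series (F i)) (F j))) m)))"
    using loc.alg.star_positive[OF L] by (elim exE conjE) (rule that)
  note pos = pos'[rule_format]
  let ?\<Lambda> = local_functional
  note P = local_functional_positive
  have \<tau>: "\<exists>m. loc.alg.diffop m (\<tau> r)" for r
    using loc.alg.gt_diffop[OF gt] by (simp add: loc.alg.is_diffop_def)
  have \<tau>_add: "\<tau> r (u + v) = \<tau> r u + \<tau> r v" if "u \<in> loc.smooth" "v \<in> loc.smooth" for r u v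
    by (rule exE[OF \<tau>]) (rule loc.alg.diffop_additive[OF _ that])
  have \<tau>_sc: "\<tau> r ((\<lambda>_. c) * u) = (\<lambda>_. c) * \<tau> r u" if "u \<in> loc.smooth" for r u c
    by (rule exE[OF \<tau>]) (rule loc.alg.diffop_sc[OF _ that])
  have \<tau>_sum: "\<tau> r (\<Sum>l<N. u l) = (\<Sum>l<N. \<tau> r (u l))" if "\<And>l. l < N \<Longrightarrow> u l \<in> loc.smooth" for r and u :: "nat \<Rightarrow> _"
    by (rule exE[OF \<tau>], rule loc.alg.diffop_sum_arg) (use that in auto)
  note \<tau>_B = loc.alg.is_diffop_B[OF loc.alg.gt_diffop[OF gt]]
  define \<omega> where "\<omega> = (\<lambda>r a. \<Sum>i<N. \<Sum>j<N. ?\<Lambda> i j (\<tau> r (localize (a i j))))"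
  have loc_B: "localize (a i j) \<in> loc.smooth" if "a \<in> carr MA" "i < N" "j < N" for a i j
    by (rule localize_smooth[OF MA_smooth[OF that]])
  have "\<omega> 0 a = \<omega>\<^sub>0 (smult (\<lambda>p. (\<kappa> p)\<^sup>2) a)" if "a \<in> carr MA" for a
    unfolding \<omega>\<^sub>0_localize[OF that] \<omega>_def by (simp add: loc.alg.gt_0[OF gt])
  moreover have "linear_functional MA (\<omega> r)" for r
    unfolding linear_functional_def
  proof (intro conjI ballI allI)
    fix a assume a: "a \<in> carr MA"
    show "\<omega> r (scal MA c a) = c * \<omega> r a" for c
    proof -
      have "?\<Lambda> i j (\<tau> r (localize (scal MA c a i j))) = c * ?\<Lambda> i j (\<tau> r (localize (a i j)))" if "i < N" "j < N" for i j
      proof -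
        have "localize (scal MA c a i j) = (\<lambda>_. c) * localize (a i j)"
          unfolding matrix_scal[OF a] by (rule ext) (simp add: localize_def)
        then show ?thesis using that by (simp add: \<tau>_sc loc_B a loc.alg.\<Lambda>_sc[OF P] \<tau>_B)
      qed
      then show ?thesis by (simp add: \<omega>_def sum_distrib_left)
    qed
    fix b assume b: "b \<in> carr MA"
    have "?\<Lambda> i j (\<tau> r (localize ((a + b) i j))) = ?\<Lambda> i j (\<tau> r (localize (a i j))) + ?\<Lambda> i j (\<tau> r (localize (b i j)))"
      if "i < N" "j < N" for i j
    proof -
      have "localize ((a + b) i j) = localize (a i j) + localize (b i j)"
        by (rule ext) (simp add: localize_def)
      then show ?thesis using that by (simp add: \<tau>_add loc_B a b loc.alg.\<Lambda>_add[OF P] \<tau>_B)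
    qed
    then show "\<omega> r (a + b) = \<omega> r a + \<omega> r b" by (simp add: \<omega>_def sum.distrib)
  qed
  moreover have "complex_fps_nonneg (formal_functional \<omega> (matrix_star N (function_algebra M) star
        (adj (deformed_algebra MA (matrix_star N (function_algebra M) star)) F) F))"
    if F: "F \<in> carr (deformed_algebra MA (matrix_star N (function_algebra M) star))" for F
  proof -
    let ?D = "deformed_algebra MA (matrix_star N (function_algebra M) star)"
    let ?A = "smooth_functions M"
    \<comment> \<open>Entry \<open>(l, i)\<close> of \<open>F\<close> seen in the chart; for fixed
      \<open>l\<close> the series \<open>X l\<close> form one row.\<close>
    define X where "X = (\<lambda>l i. Abs_fps (\<lambda>k. localize (fps_nth F k l i)))"
    have Fk: "fps_nth F k \<in> carr MA" for k using F by (simp add: deformed_algebra_simps)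
    have X: "X l i \<in> series loc.smooth" if "l < N" "i < N" for l i
      using loc_B[OF Fk that] by (simp add: X_def series_def)
    have stX: "loc.alg.st_series (X l i) \<in> series loc.smooth" if "l < N" "i < N" for l i
      using X[OF that] by (auto simp: series_def loc.alg.st_series_def intro: loc.smooth_cnj)
    have XX: "star_of L (loc.alg.st_series (X l i)) (X l j) \<in> series loc.smooth" if "l < N" "i < N" "j < N" for l i j
      by (rule loc.alg.star_of_series[OF loc.alg.star_biadditive[OF L] stX[OF that(1,2)] X[OF that(1,3)]])
    have entry: "localize (fps_nth (matrix_star N (function_algebra M) star (adj ?D F) F) k i j) =
        (\<Sum>l<N. fps_nth (star_of L (loc.alg.st_series (X l i)) (X l j)) k)" if ij: "i < N" "j < N" for i j k
    proof -
      have "localize (fps_nth (star (matrix_of_series (adj ?D F) i l) (matrix_of_series F l j)) k) =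
          fps_nth (star_of L (loc.alg.st_series (X l i)) (X l j)) k" if l: "l < N" for l
      proof -
        have s: "matrix_of_series F l j \<in> series ?A" "matrix_of_series (adj ?D F) i l \<in> series ?A"
          using MA_smooth[OF Fk] MA_smooth[OF MA.adj_closed[OF Fk]] ij l by (auto simp: series_def deformed_algebra_simps)
        have "Abs_fps (\<lambda>k. localize (fps_nth (matrix_of_series (adj ?D F) i l) k)) = loc.alg.st_series (X l i)"
          by (rule fps_ext) (use ij l in \<open>simp add: deformed_algebra_simps matrix_algebra_simps
            function_algebra_simps loc.alg.st_series_def X_def localize_def\<close>)
        moreover have "Abs_fps (\<lambda>k. localize (fps_nth (matrix_of_series F l j) k)) = X l j"
          by (rule fps_ext) (simp add: X_def)
        ultimately show ?thesis by (simp only: localize_star[OF loc_L s(2,1)])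
      qed
      note term_eq = this
      have "localize (fps_nth (matrix_star N (function_algebra M) star (adj ?D F) F) k i j) =
          (\<Sum>l<N. localize (fps_nth (star (matrix_of_series (adj ?D F) i l) (matrix_of_series F l j)) k))"
        using ij by (simp only: matrix_star_nth simp_thms if_True localize_sum)
      also have "\<dots> = (\<Sum>l<N. fps_nth (star_of L (loc.alg.st_series (X l i)) (X l j)) k)"
        by (rule sum.cong[OF refl], rule term_eq) (simp only: lessThan_iff)
      finally show ?thesis .
    qed
    have nth: "fps_nth (formal_functional \<omega> (matrix_star N (function_algebra M) star (adj ?D F) F)) k =
        (\<Sum>l<N. \<Sum>i<N. \<Sum>j<N. ?\<Lambda> i j (fps_nth (app \<tau> (star_of L (loc.alg.st_series (X l i)) (X l j))) k))" for k
    proof -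
      let ?Y = "\<lambda>l i j r. \<tau> r (fps_nth (star_of L (loc.alg.st_series (X l i)) (X l j)) (k - r))"
      have Y: "?Y l i j r \<in> loc.smooth" if "l < N" "i < N" "j < N" for l i j r
        by (rule \<tau>_B[OF series_nth[OF XX[OF that]]])
      have "?\<Lambda> i j (\<tau> r (localize (fps_nth (matrix_star N (function_algebra M) star (adj ?D F) F) (k - r) i j))) =
          (\<Sum>l<N. ?\<Lambda> i j (?Y l i j r))" if ij: "i < N" "j < N" for i j r
      proof -
        have "\<tau> r (\<Sum>l<N. fps_nth (star_of L (loc.alg.st_series (X l i)) (X l j)) (k - r)) = (\<Sum>l<N. ?Y l i j r)"
          by (rule \<tau>_sum) (rule series_nth[OF XX[OF _ ij]])
        then show ?thesis unfolding entry[OF ij]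
          using loc.alg.\<Lambda>_sum[OF P ij, of "{..<N}" "\<lambda>l. ?Y l i j r"] Y ij by simp
      qed
      then have "fps_nth (formal_functional \<omega> (matrix_star N (function_algebra M) star (adj ?D F) F)) k =
          (\<Sum>r\<le>k. \<Sum>i<N. \<Sum>j<N. \<Sum>l<N. ?\<Lambda> i j (?Y l i j r))"
        by (simp add: formal_functional_def \<omega>_def)
      also have "\<dots> = (\<Sum>r\<le>k. \<Sum>l<N. \<Sum>i<N. \<Sum>j<N. ?\<Lambda> i j (?Y l i j r))"
      proof (rule sum.cong[OF refl])
        fix r
        have "(\<Sum>i<N. \<Sum>j<N. \<Sum>l<N. ?\<Lambda> i j (?Y l i j r)) = (\<Sum>i<N. \<Sum>l<N. \<Sum>j<N. ?\<Lambda> i j (?Y l i j r))"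
          by (rule sum.cong[OF refl], rule sum.swap)
        also have "\<dots> = (\<Sum>l<N. \<Sum>i<N. \<Sum>j<N. ?\<Lambda> i j (?Y l i j r))" by (rule sum.swap)
        finally show "(\<Sum>i<N. \<Sum>j<N. \<Sum>l<N. ?\<Lambda> i j (?Y l i j r)) = (\<Sum>l<N. \<Sum>i<N. \<Sum>j<N. ?\<Lambda> i j (?Y l i j r))" .
      qed
      also have "\<dots> = (\<Sum>l<N. \<Sum>r\<le>k. \<Sum>i<N. \<Sum>j<N. ?\<Lambda> i j (?Y l i j r))" by (rule sum.swap)
      also have "\<dots> = (\<Sum>l<N. \<Sum>i<N. \<Sum>r\<le>k. \<Sum>j<N. ?\<Lambda> i j (?Y l i j r))"
        by (rule sum.cong[OF refl], rule sum.swap)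
      also have "\<dots> = (\<Sum>l<N. \<Sum>i<N. \<Sum>j<N. \<Sum>r\<le>k. ?\<Lambda> i j (?Y l i j r))"
        by (rule sum.cong[OF refl], rule sum.cong[OF refl], rule sum.swap)
      also have "\<dots> = (\<Sum>l<N. \<Sum>i<N. \<Sum>j<N. ?\<Lambda> i j (fps_nth (app \<tau> (star_of L (loc.alg.st_series (X l i)) (X l j))) k))"
      proof (rule sum.cong[OF refl], rule sum.cong[OF refl], rule sum.cong[OF refl])
        fix l i j assume *: "l \<in> {..<N}" "i \<in> {..<N}" "j \<in> {..<N}"
        show "(\<Sum>r\<le>k. ?\<Lambda> i j (?Y l i j r)) = ?\<Lambda> i j (fps_nth (app \<tau> (star_of L (loc.alg.st_series (X l i)) (X l j))) k)"
          unfolding app_def fps_nth_Abs_fps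
          by (rule loc.alg.\<Lambda>_sum[OF P, symmetric]) (use * Y in auto)
      qed
      finally show ?thesis .
    qed
    have "formal_functional \<omega> (matrix_star N (function_algebra M) star (adj ?D F) F) =
        (\<Sum>l<N. Abs_fps (\<lambda>k. \<Sum>i<N. \<Sum>j<N. ?\<Lambda> i j (fps_nth (app \<tau> (star_of L (loc.alg.st_series (X l i)) (X l j))) k)))"
      by (rule fps_ext) (simp add: nth fps_sum_nth)
    also have "complex_fps_nonneg \<dots>"
      by (rule complex_fps_nonneg_sum) (use pos[OF P X] in auto)
    finally show ?thesis .
  qed
  ultimately show ?thesis by blast
qed

end

lemma formal_functional_linear:
  assumes A: "assoc_algebra A" and \<omega>: "\<And>r. linear_functional A (\<omega> r)"
  shows "linear_functional (deformed_algebra A star) (formal_functional \<omega>)"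
proof -
  interpret assoc_algebra A by fact
  have add: "\<omega> r (a + b) = \<omega> r a + \<omega> r b" if "a \<in> carr A" "b \<in> carr A" for a b r
    using \<omega>[of r] that by (simp add: linear_functional_def)
  have sc: "\<omega> r (scal A c a) = c * \<omega> r a" if "a \<in> carr A" for a c r
    using \<omega>[of r] that by (simp add: linear_functional_def)
  have "\<omega> r 0 = 0" for r using add[OF zero_closed zero_closed, of r] by simp
  then have sum: "(\<And>i. i \<in> I \<Longrightarrow> f i \<in> carr A) \<Longrightarrow> \<omega> r (sum f I) = (\<Sum>i\<in>I. \<omega> r (f i))" for I and f :: "nat \<Rightarrow> _" and r
    by (induction I rule: infinite_finite_induct) (auto simp: add sum_closed)
  show ?thesis
    unfolding linear_functional_def
  proof (intro conjI ballI allI)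
    fix F assume F: "F \<in> carr (deformed_algebra A star)"
    note Fk = F[unfolded deformed_algebra_simps, rule_format]
    show "formal_functional \<omega> (F + G) = formal_functional \<omega> F + formal_functional \<omega> G"
      if G: "G \<in> carr (deformed_algebra A star)" for G
      by (rule fps_ext)
        (use G in \<open>simp add: formal_functional_def add Fk deformed_algebra_simps sum.distrib\<close>)
    fix c
    show "formal_functional \<omega> (scal (deformed_algebra A star) c F) = c * formal_functional \<omega> F"
    proof (rule fps_ext)
      fix k
      have "fps_nth (formal_functional \<omega> (scal (deformed_algebra A star) c F)) k =
          (\<Sum>r\<le>k. \<Sum>j\<le>k - r. fps_nth c j * \<omega> r (fps_nth F (k - r - j)))"
        by (simp add: formal_functional_def deformed_algebra_simps sum scal_closed sc Fk)
      also have "\<dots> = (\<Sum>(r, j)\<in>(SIGMA r:{..k}. {..k - r}). fps_nth c j * \<omega> r (fps_nth F (k - r - j)))"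
        by (subst sum.Sigma) auto
      also have "\<dots> = (\<Sum>(j, r)\<in>(SIGMA j:{..k}. {..k - j}). fps_nth c j * \<omega> r (fps_nth F (k - j - r)))"
        by (rule sum.reindex_bij_witness[of _ prod.swap prod.swap]) (auto simp: add.commute)
      also have "\<dots> = (\<Sum>j\<le>k. fps_nth c j * (\<Sum>r\<le>k - j. \<omega> r (fps_nth F (k - j - r))))"
        by (subst sum.Sigma[symmetric]) (auto simp: sum_distrib_left)
      finally show "fps_nth (formal_functional \<omega> (scal (deformed_algebra A star) c F)) k = fps_nth (c * formal_functional \<omega> F) k"
        by (simp add: fps_mult_nth formal_functional_def atLeast0AtMost)
    qed
  qed
qed

section \<open>Assembling the extension from the charts\<close>

context star_functional begin

lemma positive_extension:
  "\<exists>\<omega>. \<omega> 0 = \<omega>\<^sub>0 \<and> (\<forall>r\<ge>1. linear_functional MA (\<omega> r)) \<and>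
     positive_functional complex_fps_nonneg (deformed_algebra MA (matrix_star N (function_algebra M) star))
       (formal_functional \<omega>)"
proof -
  let ?star = "matrix_star N (function_algebra M) star"
  let ?D = "deformed_algebra MA ?star"
  obtain \<kappa> n where \<kappa>: "\<And>i. i < n \<Longrightarrow> msmooth (\<kappa> i)" "\<And>i. i < n \<Longrightarrow> chart_supported (\<kappa> i)"
    and dec: "\<And>a. a \<in> carr MA \<Longrightarrow> \<omega>\<^sub>0 a = (\<Sum>i<(n :: nat). \<omega>\<^sub>0 (smult (\<lambda>p. (\<kappa> i p)\<^sup>2) a))"
    using finite_decomposition by (elim exE conjE) auto
  define Q where "Q = (\<lambda>i \<omega>. (\<forall>a\<in>carr MA. \<omega> (0 :: nat) a = \<omega>\<^sub>0 (smult (\<lambda>p. (\<kappa> i p)\<^sup>2) a)) \<and>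
    (\<forall>r. linear_functional MA (\<omega> r)) \<and> (\<forall>F\<in>carr ?D. complex_fps_nonneg (formal_functional \<omega> (?star (adj ?D F) F))))"
  have "\<exists>\<omega>. Q i \<omega>" if i: "i < n" for i
  proof -
    obtain U \<phi> K where "(U, \<phi>) \<in> matlas M" "closedin (mtop M) K" "K \<subseteq> U" "U \<noteq> {}" "\<forall>p. \<kappa> i p \<noteq> 0 \<longrightarrow> p \<in> K"
      using \<kappa>(2)[OF i] unfolding chart_supported_def by blast
    then interpret star_functional_chart M star N \<omega>\<^sub>0 U \<phi> "\<kappa> i" K
      by unfold_locales (use \<kappa>(1)[OF i] in auto)
    show ?thesis unfolding Q_def by (rule chart_deformation)
  qed
  then obtain w where w: "\<And>i. i < n \<Longrightarrow> Q i (w i)" by metis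
  \<comment> \<open>In order \<open>0\<close> the result must equal \<open>\<omega>\<^sub>0\<close>
    on the whole type, while the decomposition holds only on the carrier; hence the case
    distinction.\<close>
  define \<omega> where "\<omega> = (\<lambda>r. if r = 0 then \<omega>\<^sub>0 else (\<lambda>a. \<Sum>i<n. w i r a))"
  have \<omega>: "\<omega> r a = (\<Sum>i<n. w i r a)" if "a \<in> carr MA" for r a
    using w dec[OF that] that by (simp add: \<omega>_def Q_def)
  have lin: "linear_functional MA (\<omega> r)" for r
    unfolding linear_functional_def
    using w by (simp add: \<omega> MA.add_closed MA.scal_closed Q_def linear_functional_def sum.distrib sum_distrib_left)
  have "hermitian_deformation MA ?star"
    by (rule hermitian_deformation_matrix) (rule hermitian_deformationI[OF star_function_algebra deformation hermitian])
  then interpret D: star_algebra ?D fps_cnj by (simp add: hermitian_deformation_def)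
  have "complex_fps_nonneg (formal_functional \<omega> (?star (adj ?D F) F))" if F: "F \<in> carr ?D" for F
  proof -
    have "?star (adj ?D F) F \<in> carr ?D"
      using D.mul_closed[OF D.adj_closed[OF F] F] by (simp add: deformed_algebra_simps(3))
    then have k: "fps_nth (?star (adj ?D F) F) k \<in> carr MA" for k by (simp add: deformed_algebra_simps(1))
    have "formal_functional \<omega> (?star (adj ?D F) F) = (\<Sum>i<n. formal_functional (w i) (?star (adj ?D F) F))"
    proof (rule fps_ext)
      fix k
      show "fps_nth (formal_functional \<omega> (?star (adj ?D F) F)) k =
          fps_nth (\<Sum>i<n. formal_functional (w i) (?star (adj ?D F) F)) k"
        by (simp add: formal_functional_def fps_sum_nth \<omega>[OF k]) (rule sum.swap)
    qed
    also have "complex_fps_nonneg \<dots>"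
      by (rule complex_fps_nonneg_sum) (use w F in \<open>auto simp: Q_def\<close>)
    finally show ?thesis .
  qed
  then have "positive_functional complex_fps_nonneg ?D (formal_functional \<omega>)"
    using formal_functional_linear[OF MA.assoc_algebra_axioms lin]
    by (simp add: positive_functional_def deformed_algebra_simps(3))
  then show ?thesis by (intro exI[of _ \<omega>] conjI allI impI lin) (simp add: \<omega>_def)
qed

end

theorem theorem2p1:
  fixes M :: "'a manifold"
    and bracket :: "('a \<Rightarrow> complex) \<Rightarrow> ('a \<Rightarrow> complex) \<Rightarrow> ('a \<Rightarrow> complex)"
    and star :: "('a \<Rightarrow> complex) fps \<Rightarrow> ('a \<Rightarrow> complex) fps \<Rightarrow> ('a \<Rightarrow> complex) fps"
  assumes "poisson_manifold M bracket"
    and "star_product M bracket star"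
    and "hermitian_product (function_algebra M) star"
  shows "completely_positive_deformation (function_algebra M) star"
proof -
  interpret sp: star_product M bracket star by (rule assms(2))
  interpret hermitian_star M star
    by unfold_locales (rule sp.star_deformation, erule sp.star_bidifferential, rule assms(3))
  have herm: "hermitian_deformation (function_algebra M) star"
    by (rule hermitian_deformationI[OF star_function_algebra deformation hermitian])
  show ?thesis
    unfolding completely_positive_deformation_def positive_deformation_def
  proof (intro conjI allI impI herm hermitian_deformation_matrix)
    fix n :: nat and \<omega>\<^sub>0 assume "n \<ge> 1"
      and "positive_functional complex_nonneg (matrix_algebra n (function_algebra M)) \<omega>\<^sub>0"
    then interpret star_functional M star n \<omega>\<^sub>0 by unfold_locales
    show "\<exists>\<omega>. \<omega> 0 = \<omega>\<^sub>0 \<and> (\<forall>r\<ge>1. linear_functional MA (\<omega> r)) \<and>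
      positive_functional complex_fps_nonneg (deformed_algebra MA (matrix_star n (function_algebra M) star))
        (formal_functional \<omega>)"
      by (rule positive_extension)
  qed
qed

end
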